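(* Let $M$ be a closed manifold of dimension greater than two and let $r\ge 1$. Then there exist an element $f_0$ of $\mathrm{Diff}^r(M)$ with an affine blender-horseshoe $\Lambda_{f_0}$ and a $C^r$-neighborhood $\mathcal{U}_0$ of $f_0$ in $\mathrm{Diff}^r(M)$ such that every $f\in\mathcal{U}_0$ is not strongly pluripotent for $\Lambda_f$, where $\Lambda_f$ denotes the continuation for $f$ of the whole horseshoe $\Lambda_{f_0}$.
   Context: $M$ is a closed Riemannian manifold, $\mathrm{dist}$ is its distance, and $\mathrm{Diff}^r(M)$ is the space of $C^r$-diffeomorphisms of $M$ with the $C^r$-topology. **Continuation.** If $\Lambda_f$ is a uniformly hyperbolic compact (locally maximal) invariant set of $f$, then for every $g$ sufficiently close to $f$ there is a hyperbolic set $\Lambda_g$ of $g$ and a homeomorphism $h_g:\Lambda_f\to\Lambda_g$ close to the inclusion with $h_g\circ f=g\circ h_g$. $\Lambda_g$ is the continuation of $\Lambda_f$, and $x_g=h_g(x)$ is the continuation of $x\in\Lambda_f$. The neighborhood $\mathcal{U}_0$ is understood to be small enough for the continuation $\Lambda_f$ of $\Lambda_{f_0}$ to be defined for all $f\in\mathcal{U}_0$. **Strong pluripotency.** Let $\Lambda_f$ be a uniformly hyperbolic compact invariant set of $f\in\mathrm{Diff}^r(M)$ and $\Lambda_f'\subset\Lambda_f$. Then $f$ is strongly pluripotent for $\Lambda_f'$ if for every $x\in\Lambda_f'$ there exist $g\in\mathrm{Diff}^r(M)$ arbitrarily $C^r$-close to $f$ (i.e. in every $C^r$-neighborhood of $f$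 there is such a $g$) and a subset $D_g\subset M$ of positive Lebesgue measure such that $$\lim_{n\to\infty}\frac1n\sum_{i=0}^{n-1}\sup_{y\in D_g}\mathrm{dist}\bigl(g^i(y),g^i(x_g)\bigr)=0,$$ where $x_g\in\Lambda_g$ is the continuation of $x$. **Affine blender-horseshoe.** Let $n=\dim M\ge 3$. Take positive constants with $$\lambda_{\rm ss}<\tfrac12,\quad \lambda_{\rm ss}<\lambda_{\rm cs0}\le\lambda_{\rm cs1}<1<\lambda_{\rm cs0}+\lambda_{\rm cs1},\quad 2<\lambda_{\rm u},$$ and a sufficiently small $\varepsilon_0>0$ (in particular $\tfrac12-\lambda_{\rm ss}(1+\varepsilon_0)>0$ and $\lambda_{\rm u}^{-1}+\varepsilon_0<\tfrac12$). Put $I_{\varepsilon_0}=[-\varepsilon_0,1+\varepsilon_0]$ and let the cube $\mathbb{B}=I_{\varepsilon_0}\times I_{\varepsilon_0}^{n-2}\times I_{\varepsilon_0}$, with coordinates $(x,y,z)$, be embedded in $M$. Set $$\mathbb{V}_0=[-\varepsilon_0,\lambda_{\rm u}^{-1}+\varepsilon_0]\times I_{\varepsilon_0}^{n-1},\qquad \mathbb{V}_1=[1-\lambda_{\rm u}^{-1}-\varepsilon_0,1+\varepsilon_0]\times I_{\varepsilon_0}^{n-1}.$$ A diffeomorphism $f_0$ has an affine blender-horseshoe $\Lambda_{f_0}$ if, for such data, $$f_0(x,y,z)=\begin{cases}(\lambda_{\rm u}x,\;Y_0(y),\;\lambda_{\rm cs0}z)&\text{if }(x,y,z)\in\mathbb{V}_0,\\(\lambda_{\rm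 u}(1-x),\;Y_1(y),\;\lambda_{\rm cs1}z+1-\lambda_{\rm cs1})&\text{if }(x,y,z)\in\mathbb{V}_1,\end{cases}$$ and $\Lambda_{f_0}=\bigcap_{k\in\mathbb{Z}}f_0^k(\mathbb{V}_0\cup\mathbb{V}_1)$. Here, for $n=3$, $Y_0(y)=\lambda_{\rm ss}y$ and $Y_1(y)=1-\lambda_{\rm ss}y$; for $n>3$, $Y_0,Y_1$ are invertible affine contractions of $\mathbb{R}^{n-2}$ whose linear parts have norm at most $\lambda_{\rm ss}$ and which map $I_{\varepsilon_0}^{n-2}$ into its interior with disjoint images. (Then $\Lambda_{f_0}$ is a uniformly hyperbolic horseshoe on which $f_0$ is conjugate to the full two-shift.) *)

theory Defs
  imports "HOL-Analysis.Analysis"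
begin

section \<open>Maps of class \<open>C\<^sup>k\<close> between Euclidean spaces\<close>

primrec iter_deriv ::
  "('e::euclidean_space \<Rightarrow> 'f::euclidean_space) \<Rightarrow> 'e list \<Rightarrow> 'e \<Rightarrow> 'f"
where
  "iter_deriv f [] = f"
| "iter_deriv f (v # vs) = (\<lambda>x. frechet_derivative (iter_deriv f vs) (at x) v)"

text \<open>Meant for open \<open>S\<close>: all partial derivatives of order at most \<open>k\<close> exist and are
  continuous on \<open>S\<close>.\<close>

definition Ck_on ::
  "nat \<Rightarrow> 'e::euclidean_space set \<Rightarrow> ('e \<Rightarrow> 'f::euclidean_space) \<Rightarrow> bool"
where
  "Ck_on k S f \<longleftrightarrow>
     (\<forall>vs. set vs \<subseteq> Basis \<longrightarrow>
        (length vs < k \<longrightarrow> iter_deriv f vs differentiable_on S) \<and>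
        (length vs \<le> k \<longrightarrow> continuous_on S (iter_deriv f vs)))"

definition smooth_on :: "'e::euclidean_space set \<Rightarrow> ('e \<Rightarrow> 'f::euclidean_space) \<Rightarrow> bool"
where
  "smooth_on S f \<longleftrightarrow> (\<forall>k. Ck_on k S f)"


section \<open>Closed Riemannian manifolds\<close>

text \<open>The manifold is a whole type \<open>'a\<close>, whose type class instance provides its topology;
  the smooth structure is given by an atlas, a set of charts with values in the model space
  \<open>'e\<close>. A chart is a pair of its domain and its coordinate map.\<close>

type_synonym ('a, 'e) chart = "'a set \<times> ('a \<Rightarrow> 'e)"

definition is_chart :: "('a::topological_space, 'e::euclidean_space) chart \<Rightarrow> bool" where
  "is_chart c \<longleftrightarrow> open (fst c) \<and> open (snd c ` fst c) \<and>
     (\<exists>\<psi>. homeomorphism (fst c) (snd c ` fst c) (snd c) \<psi>)"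

definition chart_inv :: "('a, 'e) chart \<Rightarrow> 'e \<Rightarrow> 'a" where
  "chart_inv c = inv_into (fst c) (snd c)"

definition smoothly_compatible ::
  "('a, 'e::euclidean_space) chart \<Rightarrow> ('a, 'f::euclidean_space) chart \<Rightarrow> bool"
where
  "smoothly_compatible c d \<longleftrightarrow>
     smooth_on (snd c ` (fst c \<inter> fst d)) (snd d \<circ> chart_inv c) \<and>
     smooth_on (snd d ` (fst c \<inter> fst d)) (snd c \<circ> chart_inv d)"

definition smooth_atlas ::
  "('a::topological_space, 'e::euclidean_space) chart set \<Rightarrow> bool"
where
  "smooth_atlas A \<longleftrightarrow>
     (\<forall>c\<in>A. is_chart c) \<and> \<Union> (fst ` A) = UNIV \<and>
     (\<forall>c\<in>A. \<forall>d\<in>A. smoothly_compatible c d)"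

text \<open>A chart is selected around every point \<open>p\<close>, and the tangent space at \<open>p\<close> is the model
  space \<open>'e\<close>, a tangent vector being represented by its coordinates in that chart.\<close>

definition chart_at :: "('a, 'e) chart set \<Rightarrow> 'a \<Rightarrow> ('a, 'e) chart" where
  "chart_at A p = (SOME c. c \<in> A \<and> p \<in> fst c)"

text \<open>The tangent vector at \<open>p\<close> whose coordinates in the chart \<open>c\<close> are \<open>v\<close>.\<close>

definition from_chart ::
  "('a, 'e::euclidean_space) chart set \<Rightarrow> ('a, 'e) chart \<Rightarrow> 'a \<Rightarrow> 'e \<Rightarrow> 'e"
where
  "from_chart A c p v =
     frechet_derivative (snd (chart_at A p) \<circ> chart_inv c) (at (snd c p)) v"

definition tangent_map ::
  "('a, 'e::euclidean_space) chart set \<Rightarrow> ('a \<Rightarrow> 'a) \<Rightarrow> 'a \<Rightarrow> 'e \<Rightarrow> 'e"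
where
  "tangent_map A f p v =
     frechet_derivative (snd (chart_at A (f p)) \<circ> f \<circ> chart_inv (chart_at A p))
       (at (snd (chart_at A p) p)) v"

definition riemannian_metric ::
  "('a, 'e::euclidean_space) chart set \<Rightarrow> ('a \<Rightarrow> 'e \<Rightarrow> 'e \<Rightarrow> real) \<Rightarrow> bool"
where
  "riemannian_metric A G \<longleftrightarrow>
     (\<forall>p. bilinear (G p) \<and> (\<forall>u v. G p u v = G p v u) \<and> (\<forall>v. v \<noteq> 0 \<longrightarrow> G p v v > 0)) \<and>
     (\<forall>c\<in>A. \<forall>u v.
        smooth_on (snd c ` fst c)
          (\<lambda>x. let p = chart_inv c x in G p (from_chart A c p u) (from_chart A c p v)))"

definition closed_riemannian_manifold ::
  "('a::{t2_space,second_countable_topology}, 'e::euclidean_space) chart set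
     \<Rightarrow> ('a \<Rightarrow> 'e \<Rightarrow> 'e \<Rightarrow> real) \<Rightarrow> bool"
where
  "closed_riemannian_manifold A G \<longleftrightarrow>
     compact (UNIV :: 'a set) \<and> smooth_atlas A \<and> riemannian_metric A G"

definition tangent_norm :: "('a \<Rightarrow> 'e \<Rightarrow> 'e \<Rightarrow> real) \<Rightarrow> 'a \<Rightarrow> 'e \<Rightarrow> real" where
  "tangent_norm G p v = sqrt (G p v v)"

definition piecewise_C1_curves ::
  "('a::topological_space, 'e::euclidean_space) chart set \<Rightarrow> 'a \<Rightarrow> 'a \<Rightarrow> (real \<Rightarrow> 'a) set"
where
  "piecewise_C1_curves A p q =
     {\<gamma>. continuous_on {0..1} \<gamma> \<and> \<gamma> 0 = p \<and> \<gamma> 1 = q \<and>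
        (\<forall>c\<in>A. \<forall>a b. 0 \<le> a \<and> a \<le> b \<and> b \<le> 1 \<and> \<gamma> ` {a..b} \<subseteq> fst c \<longrightarrow>
            (snd c \<circ> \<gamma>) piecewise_C1_differentiable_on {a..b})}"

definition curve_length ::
  "('a, 'e::euclidean_space) chart set \<Rightarrow> ('a \<Rightarrow> 'e \<Rightarrow> 'e \<Rightarrow> real) \<Rightarrow> (real \<Rightarrow> 'a) \<Rightarrow> ennreal"
where
  "curve_length A G \<gamma> =
     (\<integral>\<^sup>+ t \<in> {0..1}.
        ennreal (tangent_norm G (\<gamma> t) (vector_derivative (snd (chart_at A (\<gamma> t)) \<circ> \<gamma>) (at t)))
      \<partial>lborel)"

text \<open>The manifold need not be connected: points in different components have distance
  \<open>\<infinity>\<close>.\<close>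

definition rdist ::
  "('a::topological_space, 'e::euclidean_space) chart set \<Rightarrow> ('a \<Rightarrow> 'e \<Rightarrow> 'e \<Rightarrow> real)
     \<Rightarrow> 'a \<Rightarrow> 'a \<Rightarrow> ennreal"
where
  "rdist A G p q = (INF \<gamma>\<in>piecewise_C1_curves A p q. curve_length A G \<gamma>)"

text \<open>The Lebesgue measure of a manifold is determined up to a positive smooth density, so
  that measurability and positivity of the measure are read off in charts.\<close>

definition lebesgue_positive :: "('a, 'e::euclidean_space) chart set \<Rightarrow> 'a set \<Rightarrow> bool" where
  "lebesgue_positive A D \<longleftrightarrow>
     (\<forall>c\<in>A. snd c ` (D \<inter> fst c) \<in> sets lebesgue) \<and>
     (\<exists>c\<in>A. emeasure lebesgue (snd c ` (D \<inter> fst c)) > 0)"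


section \<open>The space of \<open>C\<^sup>r\<close>-diffeomorphisms\<close>

definition in_charts ::
  "('a, 'e) chart \<Rightarrow> ('a, 'e) chart \<Rightarrow> ('a \<Rightarrow> 'a) \<Rightarrow> 'e \<Rightarrow> 'e"
where
  "in_charts c d f = snd d \<circ> f \<circ> chart_inv c"

definition Ck_map ::
  "('a::topological_space, 'e::euclidean_space) chart set \<Rightarrow> nat \<Rightarrow> ('a \<Rightarrow> 'a) \<Rightarrow> bool"
where
  "Ck_map A k f \<longleftrightarrow> continuous_on UNIV f \<and>
     (\<forall>c\<in>A. \<forall>d\<in>A. Ck_on k (snd c ` (fst c \<inter> f -` fst d)) (in_charts c d f))"

definition Diff ::
  "('a::topological_space, 'e::euclidean_space) chart set \<Rightarrow> nat \<Rightarrow> ('a \<Rightarrow> 'a) set"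
where
  "Diff A r = {f. bij f \<and> Ck_map A r f \<and> Ck_map A r (inv f)}"

definition Cr_basic_nbhd ::
  "('a::topological_space, 'e::euclidean_space) chart set \<Rightarrow> nat \<Rightarrow> ('a \<Rightarrow> 'a)
     \<Rightarrow> ('a, 'e) chart \<Rightarrow> ('a, 'e) chart \<Rightarrow> 'a set \<Rightarrow> real \<Rightarrow> ('a \<Rightarrow> 'a) set"
where
  "Cr_basic_nbhd A r f c d K \<epsilon> =
     {g \<in> Diff A r. g ` K \<subseteq> fst d \<and>
        (\<forall>x \<in> snd c ` K. \<forall>vs. set vs \<subseteq> Basis \<and> length vs \<le> r \<longrightarrow>
           norm (iter_deriv (in_charts c d f) vs x - iter_deriv (in_charts c d g) vs x) < \<epsilon>)}"

text \<open>The weak (compact-open) \<open>C\<^sup>r\<close>-topology, which is the usual one on a compact manifold.\<close>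

definition Cr_topology ::
  "('a::topological_space, 'e::euclidean_space) chart set \<Rightarrow> nat \<Rightarrow> ('a \<Rightarrow> 'a) topology"
where
  "Cr_topology A r = topology_generated_by
     {Cr_basic_nbhd A r f c d K \<epsilon> | f c d K \<epsilon>.
        f \<in> Diff A r \<and> c \<in> A \<and> d \<in> A \<and> compact K \<and> K \<subseteq> fst c \<and> f ` K \<subseteq> fst d \<and> \<epsilon> > 0}"


section \<open>Hyperbolic sets and their continuations\<close>

definition hyperbolic_set ::
  "('a::topological_space, 'e::euclidean_space) chart set \<Rightarrow> ('a \<Rightarrow> 'e \<Rightarrow> 'e \<Rightarrow> real)
     \<Rightarrow> ('a \<Rightarrow> 'a) \<Rightarrow> 'a set \<Rightarrow> bool"
where
  "hyperbolic_set A G f \<Lambda> \<longleftrightarrow> compact \<Lambda> \<and> f ` \<Lambda> = \<Lambda> \<and>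
     (\<exists>Es Eu C \<mu>. C > 0 \<and> 0 < \<mu> \<and> \<mu> < 1 \<and>
       (\<forall>x\<in>\<Lambda>.
          subspace (Es x) \<and> subspace (Eu x) \<and>
          Es x \<inter> Eu x = {0} \<and> {u + v | u v. u \<in> Es x \<and> v \<in> Eu x} = UNIV \<and>
          tangent_map A f x ` Es x = Es (f x) \<and> tangent_map A f x ` Eu x = Eu (f x) \<and>
          (\<forall>n. \<forall>v\<in>Es x.
             tangent_norm G ((f ^^ n) x) (tangent_map A (f ^^ n) x v)
               \<le> C * \<mu> ^ n * tangent_norm G x v) \<and>
          (\<forall>n. \<forall>v\<in>Eu x.
             tangent_norm G ((inv f ^^ n) x) (tangent_map A (inv f ^^ n) x v)
               \<le> C * \<mu> ^ n * tangent_norm G x v)))"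

text \<open>\<open>h g\<close> is the conjugacy from \<open>\<Lambda>\<close> to its continuation \<open>h g ` \<Lambda>\<close> for \<open>g\<close> in the
  \<open>C\<^sup>r\<close>-neighbourhood \<open>V\<close> of \<open>f\<close>. That \<open>h g\<close> is close to the inclusion is expressed by
  \<open>h f\<close> being the inclusion and \<open>h g\<close> depending continuously on \<open>g\<close>, uniformly on \<open>\<Lambda>\<close>. As
  hyperbolic sets are expansive, uniformly for nearby diffeomorphisms, this determines
  \<open>h g\<close> on \<open>\<Lambda>\<close> for all \<open>g\<close> close to \<open>f\<close>.\<close>

definition hyperbolic_continuation ::
  "('a::topological_space, 'e::euclidean_space) chart set \<Rightarrow> ('a \<Rightarrow> 'e \<Rightarrow> 'e \<Rightarrow> real) \<Rightarrow> nat
     \<Rightarrow> ('a \<Rightarrow> 'a) \<Rightarrow> 'a set \<Rightarrow> ('a \<Rightarrow> 'a) set \<Rightarrow> (('a \<Rightarrow> 'a) \<Rightarrow> 'a \<Rightarrow> 'a) \<Rightarrow> bool"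
where
  "hyperbolic_continuation A G r f \<Lambda> V h \<longleftrightarrow>
     openin (Cr_topology A r) V \<and> f \<in> V \<and>
     (\<forall>x\<in>\<Lambda>. h f x = x) \<and>
     (\<forall>g\<in>V. hyperbolic_set A G g (h g ` \<Lambda>) \<and>
            (\<exists>k. homeomorphism \<Lambda> (h g ` \<Lambda>) (h g) k) \<and>
            (\<forall>x\<in>\<Lambda>. h g (f x) = g (h g x))) \<and>
     (\<forall>g\<in>V. \<forall>\<epsilon>>0. \<exists>W. openin (Cr_topology A r) W \<and> g \<in> W \<and>
        (\<forall>g'\<in>W \<inter> V. \<forall>x\<in>\<Lambda>. rdist A G (h g' x) (h g x) < ennreal \<epsilon>))"

text \<open>To be used for a hyperbolic set \<open>\<Lambda>\<close> of \<open>f \<in> Diff A r\<close> and \<open>\<Lambda>' \<subseteq> \<Lambda>\<close>. Only the values of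
  \<open>h\<close> near \<open>f\<close> matter, so the choice of the continuation is irrelevant.\<close>

definition strongly_pluripotent ::
  "('a::topological_space, 'e::euclidean_space) chart set \<Rightarrow> ('a \<Rightarrow> 'e \<Rightarrow> 'e \<Rightarrow> real) \<Rightarrow> nat
     \<Rightarrow> ('a \<Rightarrow> 'a) \<Rightarrow> 'a set \<Rightarrow> 'a set \<Rightarrow> bool"
where
  "strongly_pluripotent A G r f \<Lambda> \<Lambda>' \<longleftrightarrow>
     (\<exists>V h. hyperbolic_continuation A G r f \<Lambda> V h \<and>
       (\<forall>x\<in>\<Lambda>'. \<forall>W. openin (Cr_topology A r) W \<and> f \<in> W \<longrightarrow>
          (\<exists>g\<in>W \<inter> V. \<exists>D. lebesgue_positive A D \<and>
             (\<lambda>n. (\<Sum>i<n. SUP y\<in>D. rdist A G ((g ^^ i) y) ((g ^^ i) (h g x))) / of_nat n)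
               \<longlonglongrightarrow> 0)))"


section \<open>Affine blender-horseshoes\<close>

text \<open>The coordinates \<open>(x, y, z)\<close> live in \<open>real \<times> (real ^ 'm) \<times> real\<close>, where \<open>CARD('m)\<close> is the
  dimension of the manifold minus two.\<close>

definition I_eps :: "real \<Rightarrow> real set" where
  "I_eps \<epsilon> = {-\<epsilon>..1 + \<epsilon>}"

definition I_eps_cube :: "real \<Rightarrow> (real ^ 'm) set" where
  "I_eps_cube \<epsilon> = {y. \<forall>i. y $ i \<in> I_eps \<epsilon>}"

definition blender_cube :: "real \<Rightarrow> (real \<times> (real ^ 'm) \<times> real) set" where
  "blender_cube \<epsilon> = I_eps \<epsilon> \<times> I_eps_cube \<epsilon> \<times> I_eps \<epsilon>"

definition blender_V0 :: "real \<Rightarrow> real \<Rightarrow> (real \<times> (real ^ 'm) \<times> real) set" where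
  "blender_V0 lam_u \<epsilon> = {-\<epsilon>..1 / lam_u + \<epsilon>} \<times> I_eps_cube \<epsilon> \<times> I_eps \<epsilon>"

definition blender_V1 :: "real \<Rightarrow> real \<Rightarrow> (real \<times> (real ^ 'm) \<times> real) set" where
  "blender_V1 lam_u \<epsilon> = {1 - 1 / lam_u - \<epsilon>..1 + \<epsilon>} \<times> I_eps_cube \<epsilon> \<times> I_eps \<epsilon>"

definition affine_contraction :: "real \<Rightarrow> (real ^ 'm \<Rightarrow> real ^ 'm) \<Rightarrow> bool" where
  "affine_contraction \<rho> Y \<longleftrightarrow>
     (\<exists>L c. linear L \<and> bij L \<and> onorm L \<le> \<rho> \<and> Y = (\<lambda>y. L y + c))"

definition blender_fibre_maps ::
  "real \<Rightarrow> real \<Rightarrow> (real ^ 'm \<Rightarrow> real ^ 'm) \<Rightarrow> (real ^ 'm \<Rightarrow> real ^ 'm) \<Rightarrow> bool"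
where
  "blender_fibre_maps lam_ss \<epsilon> Y0 Y1 \<longleftrightarrow>
     (if CARD('m) = 1 then
        Y0 = (\<lambda>y. lam_ss *\<^sub>R y) \<and> Y1 = (\<lambda>y. \<chi> i. 1 - lam_ss * y $ i)
      else
        affine_contraction lam_ss Y0 \<and> affine_contraction lam_ss Y1 \<and>
        Y0 ` I_eps_cube \<epsilon> \<subseteq> interior (I_eps_cube \<epsilon>) \<and>
        Y1 ` I_eps_cube \<epsilon> \<subseteq> interior (I_eps_cube \<epsilon>) \<and>
        Y0 ` I_eps_cube \<epsilon> \<inter> Y1 ` I_eps_cube \<epsilon> = {})"

text \<open>The coordinates are a smooth chart \<open>\<kappa>\<close> of the manifold. As the images of \<open>blender_V0\<close>
  and \<open>blender_V1\<close> under the affine formulas stick out of the cube in the \<open>x\<close>-direction, the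
  range of the chart has to contain these images as well as the cube. The two inequalities
  bounding \<open>\<epsilon>\<close> from above are what smallness of \<open>\<epsilon>\<close> amounts to: they make \<open>blender_V0\<close> and
  \<open>blender_V1\<close> disjoint and \<open>\<Lambda>\<close> a hyperbolic set in the interior of their union.\<close>

definition affine_blender_horseshoe ::
  "'m::finite itself \<Rightarrow> ('a::topological_space, 'e::euclidean_space) chart set
     \<Rightarrow> ('a \<Rightarrow> 'a) \<Rightarrow> 'a set \<Rightarrow> bool"
where
  "affine_blender_horseshoe _ A f \<Lambda> \<longleftrightarrow>
     (\<exists>lam_ss lam_cs0 lam_cs1 lam_u \<epsilon> Y0 Y1. \<exists>\<kappa> :: ('a, real \<times> (real ^ 'm) \<times> real) chart.
        0 < lam_ss \<and> lam_ss < 1 / 2 \<and> lam_ss < lam_cs0 \<and> lam_cs0 \<le> lam_cs1 \<and> lam_cs1 < 1 \<and>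
        1 < lam_cs0 + lam_cs1 \<and> 2 < lam_u \<and> 0 < \<epsilon> \<and> 1 / 2 - lam_ss * (1 + \<epsilon>) > 0 \<and> 1 / lam_u + \<epsilon> < 1 / 2 \<and>
        blender_fibre_maps lam_ss \<epsilon> Y0 Y1 \<and>
        is_chart \<kappa> \<and> (\<forall>c\<in>A. smoothly_compatible \<kappa> c) \<and>
        (let F0 = (\<lambda>(x, y, z). (lam_u * x, Y0 y, lam_cs0 * z));
             F1 = (\<lambda>(x, y, z). (lam_u * (1 - x), Y1 y, lam_cs1 * z + 1 - lam_cs1));
             V = chart_inv \<kappa> ` (blender_V0 lam_u \<epsilon> \<union> blender_V1 lam_u \<epsilon>)
         in blender_cube \<epsilon> \<union> F0 ` blender_V0 lam_u \<epsilon> \<union> F1 ` blender_V1 lam_u \<epsilon> \<subseteq> snd \<kappa> ` fst \<kappa> \<and>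
            (\<forall>w\<in>blender_V0 lam_u \<epsilon>. f (chart_inv \<kappa> w) = chart_inv \<kappa> (F0 w)) \<and>
            (\<forall>w\<in>blender_V1 lam_u \<epsilon>. f (chart_inv \<kappa> w) = chart_inv \<kappa> (F1 w)) \<and>
            \<Lambda> = (\<Inter>n. (f ^^ n) ` V) \<inter> (\<Inter>n. (inv f ^^ n) ` V)))"

end

theory Submission
  imports Defs
begin

text \<open>
  Strong pluripotency at \<open>x\<close> fails as soon as \<open>x\<close> is a fixed point at which the map expands
  volume. If the orbits of a set \<open>D\<close> of positive measure shadow a fixed point on average, then for
  all times outside a set of density zero the images of \<open>D\<close> lie in a small neighbourhood of it,
  where each step multiplies the volume by at least two. At the exceptional times the volume drops
  at most by a constant factor, so it would grow without bound on a compact manifold. The conditions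
  on a blender-horseshoe put no upper bound on \<open>\<lambda>\<^sub>u\<close>, hence the Jacobian at the fixed point in
  \<open>\<V>\<^sub>0\<close> can be made as large as desired, and volume expansion at the continuation of this point
  persists for all \<open>C\<^sup>1\<close>-close diffeomorphisms.

  The affine model is realised on any closed manifold by a compactly supported diffeomorphism of
  Euclidean space, a composition of cut-off shears and dilations. Its continuation is obtained by
  solving for the orbit with a given itinerary by a contraction on sequences, and the invariant
  splitting consists of the vectors with bounded forward or backward derivative orbit.
\<close>

subsection \<open>Calculus of \<open>C\<^sup>k\<close> maps\<close>

text \<open>The definition of strong pluripotency contains an existential choice of the
  continuation, so its negation has to handle every continuation \<open>h'\<close>. A fixed point
  makes this possible: \<open>h' g\<close> sends it to a fixed point of \<open>g\<close> close to
  the old one, and \<open>orbit_close\<close> confines all such points to a small ball in the leg.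
  Volume growth is obtained from a Lipschitz estimate. Once the linear part of the model is undone,
  a nearby map is a translation plus a small Lipschitz term; its inverse is 2-Lipschitz, and a
  Vitali covering bounds the volume of Lipschitz images. This gives away a factor
  \<open>2 ^ (m + 2)\<close>, with \<open>m\<close> the number of \<open>y\<close>-coordinates,
  which explains the size of \<open>lam\<close>. Every set whose volume is followed is compact, so
  that all its images are compact and measurable. A single number \<eta> measures closeness, in
  values and first derivatives on the two legs. The unperturbed rates are 2/3 in the fibre and at
  most 1/100 for the inverse of the base map; this leaves room to keep every perturbed rate at 7/10
  or below.\<close>

lemma iter_deriv_append: "iter_deriv f (vs @ ws) = iter_deriv (iter_deriv f ws) vs"
  by (induction vs) auto

text \<open>No differentiability is assumed: the derivative is a choice among all candidates, and at
  \<open>x\<close> both functions have the same candidates.\<close>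

lemma frechet_derivative_cong_open:
  assumes "open S" "x \<in> S" "\<And>y. y \<in> S \<Longrightarrow> f y = g y"
  shows "frechet_derivative f (at x) = frechet_derivative g (at x)"
proof -
  have "(f has_derivative D) (at x) \<longleftrightarrow> (g has_derivative D) (at x)" for D
    using has_derivative_transform_within_open[of f D x UNIV S g]
      has_derivative_transform_within_open[of g D x UNIV S f] assms by auto
  then show ?thesis by (simp add: frechet_derivative_def)
qed

lemma iter_deriv_cong:
  assumes "open S" "\<And>y. y \<in> S \<Longrightarrow> f y = g y" "x \<in> S"
  shows "iter_deriv f vs x = iter_deriv g vs x"
  using assms(3)
proof (induction vs arbitrary: x)
  case (Cons v vs)
  then show ?case
    using frechet_derivative_cong_open[OF assms(1) Cons.prems Cons.IH] by simp
qed (use assms in auto)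

lemma differentiable_on_cong_open:
  assumes "open S" "\<And>y. y \<in> S \<Longrightarrow> f y = g y"
  shows "f differentiable_on S \<longleftrightarrow> g differentiable_on S"
proof -
  have "(f has_derivative D) (at x) \<longleftrightarrow> (g has_derivative D) (at x)" if "x \<in> S" for D x
    using has_derivative_transform_within_open[of f D x UNIV S g]
      has_derivative_transform_within_open[of g D x UNIV S f] assms that by auto
  then show ?thesis
    using assms(1) by (auto simp: differentiable_on_eq_differentiable_at differentiable_def)
qed

lemma Ck_on_cong:
  assumes "open S" "\<And>y. y \<in> S \<Longrightarrow> f y = g y"
  shows "Ck_on k S f \<longleftrightarrow> Ck_on k S g"
proof -
  have "iter_deriv f vs differentiable_on S \<longleftrightarrow> iter_deriv g vs differentiable_on S" for vs
    by (rule differentiable_on_cong_open[OF assms(1) iter_deriv_cong[OF assms]])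
  moreover have "continuous_on S (iter_deriv f vs) \<longleftrightarrow> continuous_on S (iter_deriv g vs)" for vs
    by (rule continuous_on_cong[OF refl iter_deriv_cong[OF assms]])
  ultimately show ?thesis unfolding Ck_on_def by simp
qed

lemma Ck_on_eq:
  assumes "Ck_on k S f" "open S" "\<And>y. y \<in> S \<Longrightarrow> f y = g y"
  shows "Ck_on k S g"
  using Ck_on_cong[OF assms(2,3)] assms(1) by simp

lemma Ck_on_0 [simp]: "Ck_on 0 S f \<longleftrightarrow> continuous_on S f"
  by (auto simp: Ck_on_def)

text \<open>The direction applied first stands last in the list, so the derivative of
  \<open>f\<close> itself is split off at the end (\<open>rev_cases\<close>). This recursion carries
  the later inductions on the order.\<close>

lemma Ck_on_Suc:
  assumes "open S"
  shows "Ck_on (Suc k) S f \<longleftrightarrow> f differentiable_on S \<and>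
           (\<forall>b\<in>Basis. Ck_on k S (\<lambda>x. frechet_derivative f (at x) b))"
    (is "?L \<longleftrightarrow> ?R")
proof
  assume L: ?L
  have "Ck_on k S (\<lambda>x. frechet_derivative f (at x) b)" if b: "b \<in> Basis" for b
    unfolding Ck_on_def
  proof (intro allI impI)
    fix vs :: "'a list" assume "set vs \<subseteq> Basis"
    then show "(length vs < k \<longrightarrow>
            iter_deriv (\<lambda>x. frechet_derivative f (at x) b) vs differentiable_on S) \<and>
           (length vs \<le> k \<longrightarrow>
            continuous_on S (iter_deriv (\<lambda>x. frechet_derivative f (at x) b) vs))"
      using L[unfolded Ck_on_def, rule_format, of "vs @ [b]"] b
      by (simp add: iter_deriv_append)
  qed
  moreover have "f differentiable_on S"
    using L[unfolded Ck_on_def, rule_format, of "[]"] by simp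
  ultimately show ?R by blast
next
  assume R: ?R
  show ?L
    unfolding Ck_on_def
  proof (intro allI impI)
    fix vs :: "'a list" assume vs: "set vs \<subseteq> Basis"
    show "(length vs < Suc k \<longrightarrow> iter_deriv f vs differentiable_on S) \<and>
           (length vs \<le> Suc k \<longrightarrow> continuous_on S (iter_deriv f vs))"
    proof (cases vs rule: rev_cases)
      case Nil
      then show ?thesis using R differentiable_imp_continuous_on by auto
    next
      case (snoc ws b)
      then have "Ck_on k S (\<lambda>x. frechet_derivative f (at x) b)" using R vs by auto
      from this[unfolded Ck_on_def, rule_format, of ws] show ?thesis
        using snoc vs by (simp add: iter_deriv_append)
    qed
  qed
qed

text \<open>The form used in practice: a formula for the derivative is guessed, and its values on
  basis vectors need one order less.\<close>

lemma Ck_on_SucI: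
  assumes "open S" "\<And>x. x \<in> S \<Longrightarrow> (f has_derivative f' x) (at x)"
    and "\<And>b. b \<in> Basis \<Longrightarrow> Ck_on k S (\<lambda>x. f' x b)"
  shows "Ck_on (Suc k) S f"
proof -
  have "frechet_derivative f (at x) = f' x" if "x \<in> S" for x
    using assms(2)[OF that] frechet_derivative_at by metis
  then have "Ck_on k S (\<lambda>x. frechet_derivative f (at x) b)" if "b \<in> Basis" for b
    using Ck_on_cong[OF assms(1), of "\<lambda>x. frechet_derivative f (at x) b" "\<lambda>x. f' x b"]
      assms(3)[OF that] by simp
  moreover have "f differentiable_on S"
    using assms(1,2) by (auto simp: differentiable_on_eq_differentiable_at differentiable_def)
  ultimately show ?thesis using Ck_on_Suc[OF assms(1)] by blast
qed

lemma Ck_on_SucD: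
  assumes "Ck_on (Suc k) S f" "open S"
  shows "\<And>x. x \<in> S \<Longrightarrow> (f has_derivative frechet_derivative f (at x)) (at x)"
    and "\<And>b. b \<in> Basis \<Longrightarrow> Ck_on k S (\<lambda>x. frechet_derivative f (at x) b)"
  using assms Ck_on_Suc[OF assms(2)]
  by (auto simp: differentiable_on_eq_differentiable_at frechet_derivative_works)

lemma Ck_on_mono: "Ck_on k S f \<Longrightarrow> l \<le> k \<Longrightarrow> Ck_on l S f"
  unfolding Ck_on_def by fastforce

lemma Ck_on_Suc_imp: "Ck_on (Suc k) S f \<Longrightarrow> Ck_on k S f"
  using Ck_on_mono by (metis le_SucI le_refl)

lemma Ck_on_continuous: "Ck_on k S f \<Longrightarrow> continuous_on S f"
  using Ck_on_mono[of k S f 0] by simp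

lemma Ck_on_subset: "Ck_on k S f \<Longrightarrow> T \<subseteq> S \<Longrightarrow> Ck_on k T f"
  unfolding Ck_on_def using continuous_on_subset differentiable_on_subset by blast

text \<open>Being \<open>C^k\<close> is local. This glues the two descriptions of a lifted map, in
  the chart domain and off the support.\<close>

lemma Ck_on_open_UN:
  assumes "\<And>i. i \<in> I \<Longrightarrow> open (S i)" "\<And>i. i \<in> I \<Longrightarrow> Ck_on k (S i) f"
  shows "Ck_on k (\<Union>i\<in>I. S i) f"
proof -
  have o: "open (\<Union>i\<in>I. S i)" using assms(1) by blast
  have "iter_deriv f vs differentiable_on (\<Union>i\<in>I. S i)"
    if "set vs \<subseteq> Basis" "length vs < k" for vs
    using that assms o unfolding Ck_on_def
    by (auto simp: differentiable_on_eq_differentiable_at)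
  moreover have "continuous_on (\<Union>i\<in>I. S i) (iter_deriv f vs)"
    if "set vs \<subseteq> Basis" "length vs \<le> k" for vs
    using that assms unfolding Ck_on_def
    by (intro continuous_on_open_UN) auto
  ultimately show ?thesis unfolding Ck_on_def by blast
qed

section \<open>Closure of \<open>C^k\<close> maps under algebra and composition\<close>

lemma Ck_on_const [simp]: "Ck_on k S (\<lambda>x. c)"
proof -
  have "Ck_on k UNIV (\<lambda>x. c)"
  proof (induction k arbitrary: c)
    case (Suc k)
    show ?case by (rule Ck_on_SucI[where f' = "\<lambda>x v. 0"]) (auto intro: Suc)
  qed simp
  then show ?thesis using Ck_on_subset by blast
qed

lemma Ck_on_linear:
  assumes "linear L" shows "Ck_on k S L"
proof -
  have b: "bounded_linear L" using assms linear_conv_bounded_linear by blast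
  have "Ck_on k UNIV L"
  proof (cases k)
    case 0 then show ?thesis using b by (simp add: linear_continuous_on)
  next
    case (Suc n)
    show ?thesis unfolding Suc
      by (rule Ck_on_SucI[where f' = "\<lambda>x. L"]) (auto intro: bounded_linear_imp_has_derivative b)
  qed
  then show ?thesis using Ck_on_subset by blast
qed

lemma Ck_on_id [simp]: "Ck_on k S (\<lambda>x. x)"
  by (rule Ck_on_linear) (simp add: linear_id[unfolded id_def])

lemma Ck_on_compose_linear:
  assumes "linear L" "open S" "Ck_on k S f"
  shows "Ck_on k S (\<lambda>x. L (f x))"
  using assms(3)
proof (induction k arbitrary: f)
  case 0
  have "bounded_linear L" using assms linear_conv_bounded_linear by blast
  then show ?case using 0 bounded_linear.continuous_on by fastforce
next
  case (Suc k)
  have b: "bounded_linear L" using assms linear_conv_bounded_linear by blast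
  note f = Ck_on_SucD[OF Suc.prems assms(2)]
  show ?case
    by (rule Ck_on_SucI[where f' = "\<lambda>x v. L (frechet_derivative f (at x) v)"])
      (rule assms(2) bounded_linear.has_derivative[OF b f(1)] Suc.IH f(2) | assumption)+
qed

lemma Ck_on_add:
  assumes "open S" "Ck_on k S f" "Ck_on k S g"
  shows "Ck_on k S (\<lambda>x. f x + g x)"
  using assms(2,3)
proof (induction k arbitrary: f g)
  case 0 then show ?case by (auto intro: continuous_intros)
next
  case (Suc k)
  show ?case
    by (rule Ck_on_SucI[where f' = "\<lambda>x v. frechet_derivative f (at x) v
             + frechet_derivative g (at x) v"])
      (use assms(1) Ck_on_SucD[OF Suc.prems(1) assms(1)] Ck_on_SucD[OF Suc.prems(2) assms(1)]
        Suc.IH in \<open>auto intro: has_derivative_add\<close>)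
qed

lemma Ck_on_minus: "open S \<Longrightarrow> Ck_on k S f \<Longrightarrow> Ck_on k S (\<lambda>x. - f x)"
  using Ck_on_compose_linear[of uminus] linear_uminus by auto

lemma Ck_on_diff: "open S \<Longrightarrow> Ck_on k S f \<Longrightarrow> Ck_on k S g \<Longrightarrow> Ck_on k S (\<lambda>x. f x - g x)"
  using Ck_on_add[of S k f "\<lambda>x. - g x"] Ck_on_minus[of S k g] by simp

lemma Ck_on_sum:
  assumes "open S" "\<And>i. i \<in> I \<Longrightarrow> Ck_on k S (f i)"
  shows "Ck_on k S (\<lambda>x. \<Sum>i\<in>I. f i x)"
  using assms(2)
  by (induction I rule: infinite_finite_induct) (auto intro: Ck_on_add assms(1))

lemma Ck_on_scaleR:
  fixes f :: "'a::euclidean_space \<Rightarrow> real" and g :: "'a \<Rightarrow> 'b::euclidean_space"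
  assumes "open S" "Ck_on k S f" "Ck_on k S g"
  shows "Ck_on k S (\<lambda>x. f x *\<^sub>R g x)"
  using assms(2,3)
proof (induction k arbitrary: f g)
  case 0 then show ?case by (auto intro: continuous_intros)
next
  case (Suc k)
  note f = Ck_on_SucD[OF Suc.prems(1) assms(1)] and g = Ck_on_SucD[OF Suc.prems(2) assms(1)]
  show ?case
  proof (rule Ck_on_SucI[where f' = "\<lambda>x v. f x *\<^sub>R frechet_derivative g (at x) v
             + frechet_derivative f (at x) v *\<^sub>R g x"])
    fix b :: 'a assume "b \<in> Basis"
    then show "Ck_on k S (\<lambda>x. f x *\<^sub>R frechet_derivative g (at x) b
             + frechet_derivative f (at x) b *\<^sub>R g x)"
      by (intro Ck_on_add Suc.IH f g assms(1) Suc.prems[THEN Ck_on_Suc_imp])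
  qed (use assms(1) f g in \<open>auto intro: has_derivative_scaleR\<close>)
qed

lemma Ck_on_mult:
  fixes f g :: "'a::euclidean_space \<Rightarrow> real"
  assumes "open S" "Ck_on k S f" "Ck_on k S g"
  shows "Ck_on k S (\<lambda>x. f x * g x)"
  using Ck_on_scaleR[OF assms] by simp

lemma Ck_on_prod:
  fixes f :: "'i \<Rightarrow> 'a::euclidean_space \<Rightarrow> real"
  assumes "open S" "\<And>i. i \<in> I \<Longrightarrow> Ck_on k S (f i)"
  shows "Ck_on k S (\<lambda>x. \<Prod>i\<in>I. f i x)"
  using assms(2)
  by (induction I rule: infinite_finite_induct) (auto intro: Ck_on_mult assms(1))

lemma Ck_on_inner_const:
  "open S \<Longrightarrow> Ck_on k S f \<Longrightarrow> Ck_on k S (\<lambda>x. f x \<bullet> c)"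
  using Ck_on_compose_linear[of "\<lambda>v. v \<bullet> c" S k f] bounded_linear_inner_left
  by (auto simp: linear_conv_bounded_linear)

lemma linear_expand_Basis:
  fixes L :: "'a::euclidean_space \<Rightarrow> 'b::real_vector"
  assumes "linear L"
  shows "L v = (\<Sum>d\<in>Basis. (v \<bullet> d) *\<^sub>R L d)"
proof -
  have "L v = L (\<Sum>d\<in>Basis. (v \<bullet> d) *\<^sub>R d)" by (simp add: euclidean_representation)
  then show ?thesis using assms by (simp add: linear_sum linear_cmul)
qed

text \<open>The chain rule is expanded over the basis into scalar coefficients times partial
  derivatives of \<open>g\<close> at \<open>f x\<close>. Each of these is again a map composed with
  \<open>f\<close>, hence the induction with \<open>g\<close> arbitrary.\<close>

lemma Ck_on_compose:
  fixes f :: "'a::euclidean_space \<Rightarrow> 'b::euclidean_space"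
    and g :: "'b \<Rightarrow> 'c::euclidean_space"
  assumes "open S" "open T" "Ck_on k S f" "Ck_on k T g" "f ` S \<subseteq> T"
  shows "Ck_on k S (\<lambda>x. g (f x))"
  using assms(3,4)
proof (induction k arbitrary: g)
  case 0 then show ?case using assms(5) continuous_on_compose2 by (metis Ck_on_0)
next
  case (Suc k)
  note f = Ck_on_SucD[OF Suc.prems(1) assms(1)] and g = Ck_on_SucD[OF Suc.prems(2) assms(2)]
  have S: "f x \<in> T" if "x \<in> S" for x using assms(5) that by blast
  show ?case
  proof (rule Ck_on_SucI[where f' = "\<lambda>x v. \<Sum>d\<in>Basis. (frechet_derivative f (at x) v \<bullet> d)
           *\<^sub>R frechet_derivative g (at (f x)) d"])
    fix b :: 'a assume "b \<in> Basis"
    then show "Ck_on k S (\<lambda>x. \<Sum>d\<in>Basis. (frechet_derivative f (at x) b \<bullet> d)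
           *\<^sub>R frechet_derivative g (at (f x)) d)"
      by (intro Ck_on_sum Ck_on_scaleR Ck_on_inner_const f assms(1)
          Suc.IH[of "\<lambda>y. frechet_derivative g (at y) d" for d] g Ck_on_Suc_imp[OF Suc.prems(1)])
  next
    fix x assume x: "x \<in> S"
    have "linear (frechet_derivative g (at (f x)))"
      using g(1)[OF S[OF x]] has_derivative_linear by blast
    then have "(\<lambda>v. \<Sum>d\<in>Basis. (frechet_derivative f (at x) v \<bullet> d)
           *\<^sub>R frechet_derivative g (at (f x)) d)
       = (\<lambda>v. frechet_derivative g (at (f x)) (frechet_derivative f (at x) v))"
      using linear_expand_Basis by metis
    then show "((\<lambda>x. g (f x)) has_derivative (\<lambda>v. \<Sum>d\<in>Basis. (frechet_derivative f (at x) v \<bullet> d)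
           *\<^sub>R frechet_derivative g (at (f x)) d)) (at x)"
      using has_derivative_compose[OF f(1)[OF x] g(1)[OF S[OF x]]] by simp
  qed (rule assms(1))
qed

lemma Ck_on_real_SucI:
  fixes f :: "real \<Rightarrow> real"
  assumes "open S" "\<And>x. x \<in> S \<Longrightarrow> (f has_real_derivative f' x) (at x)" "Ck_on k S f'"
  shows "Ck_on (Suc k) S f"
  by (rule Ck_on_SucI[where f' = "\<lambda>x v. f' x * v"])
    (use assms in \<open>auto simp: has_field_derivative_def\<close>)

text \<open>The derivative is a polynomial in the function itself, so each order of smoothness
  yields the next.\<close>

lemma Ck_on_inverse_real: "Ck_on k (- {0}) (inverse :: real \<Rightarrow> real)"
proof (induction k)
  case 0 show ?case by (auto intro!: continuous_intros)
next
  case (Suc k)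
  show ?case
    by (rule Ck_on_real_SucI[where f' = "\<lambda>x. - (inverse x * inverse x)"])
      (use Suc in \<open>auto intro!: Ck_on_minus Ck_on_mult derivative_eq_intros\<close>)
qed

lemma Ck_on_divide:
  fixes f g :: "'a::euclidean_space \<Rightarrow> real"
  assumes "open S" "Ck_on k S f" "Ck_on k S g" "\<And>x. x \<in> S \<Longrightarrow> g x \<noteq> 0"
  shows "Ck_on k S (\<lambda>x. f x / g x)"
proof -
  have "Ck_on k S (\<lambda>x. inverse (g x))"
    by (rule Ck_on_compose[OF assms(1) _ assms(3) Ck_on_inverse_real]) (use assms(4) in auto)
  from Ck_on_mult[OF assms(1,2) this] show ?thesis by (simp add: divide_inverse)
qed

lemma Ck_on_ln: "Ck_on k {0<..} (ln :: real \<Rightarrow> real)"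
proof (cases k)
  case 0 then show ?thesis by (auto intro!: continuous_intros)
next
  case (Suc n)
  show ?thesis unfolding Suc
    by (rule Ck_on_real_SucI[where f' = inverse])
      (auto intro!: Ck_on_subset[OF Ck_on_inverse_real] DERIV_ln)
qed

lemma Ck_on_power:
  fixes f :: "'a::euclidean_space \<Rightarrow> real"
  shows "open S \<Longrightarrow> Ck_on k S f \<Longrightarrow> Ck_on k S (\<lambda>x. f x ^ n)"
  by (induction n) (auto intro: Ck_on_mult)

section \<open>Cutoff functions of finite smoothness\<close>

lemma has_derivative_max0_power:
  "((\<lambda>t::real. max 0 t ^ (Suc (Suc k))) has_real_derivative
      of_nat (Suc (Suc k)) * max 0 t ^ (Suc k)) (at t)"
proof -
  consider "t > 0" | "t < 0" | "t = 0" by linarith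
  then show ?thesis
  proof cases
    case 1
    have d: "((\<lambda>t::real. t ^ (Suc (Suc k))) has_real_derivative of_nat (Suc (Suc k)) * t ^ (Suc k)) (at t)"
      using DERIV_pow[of "Suc (Suc k)" t UNIV] by (simp only: diff_Suc_Suc diff_zero)
    have m: "max 0 t = t" using 1 by simp
    show ?thesis unfolding m
      by (rule has_field_derivative_transform_within_open[OF d, of "{0<..}"]) (use 1 in auto)
  next
    case 2
    have d: "((\<lambda>t::real. 0) has_real_derivative 0) (at t)" by simp
    have m: "real (Suc (Suc k)) * max 0 t ^ Suc k = 0" using 2 by simp
    show ?thesis unfolding m
      by (rule has_field_derivative_transform_within_open[OF d, of "{..<0}"]) (use 2 in auto)
  next
    case 3
    have "((\<lambda>h::real. max 0 h ^ Suc k) \<longlongrightarrow> max 0 0 ^ Suc k) (at 0)"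
      by (intro tendsto_intros)
    then have l: "((\<lambda>h::real. max 0 h ^ Suc k) \<longlongrightarrow> 0) (at 0)" by simp
    have "max 0 h ^ Suc (Suc k) / h = max 0 h ^ Suc k" if "h \<noteq> 0" for h :: real
      using that by (cases "h > 0") auto
    then have "((\<lambda>h::real. max 0 h ^ Suc (Suc k) / h) \<longlongrightarrow> 0) (at 0)"
      using l by (subst tendsto_cong[where g = "\<lambda>h. max 0 h ^ Suc k"])
        (auto simp: eventually_at_filter)
    then show ?thesis using 3 by (simp add: has_field_derivative_iff)
  qed
qed

lemma Ck_on_max0_power: "Ck_on k UNIV (\<lambda>t::real. max 0 t ^ Suc k)"
proof (induction k)
  case 0 show ?case by (auto intro!: continuous_intros)
next
  case (Suc k)
  show ?case
    by (rule Ck_on_real_SucI[OF open_UNIV has_derivative_max0_power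
          Ck_on_mult[OF open_UNIV Ck_on_const Suc]])
qed

subsection \<open>Compactly supported diffeomorphisms of Euclidean space\<close>

lemma Ck_on_deriv:
  fixes f :: "real \<Rightarrow> real"
  assumes "Ck_on (Suc k) S f" "open S"
  shows "\<And>x. x \<in> S \<Longrightarrow> (f has_real_derivative deriv f x) (at x)"
    and "Ck_on k S (deriv f)"
proof -
  have *: "(f has_real_derivative frechet_derivative f (at x) 1) (at x)" if "x \<in> S" for x
  proof -
    have l: "linear (frechet_derivative f (at x))"
      using Ck_on_SucD(1)[OF assms that] has_derivative_linear by blast
    have "frechet_derivative f (at x) = (*) (frechet_derivative f (at x) 1)"
    proof
      fix v
      have "frechet_derivative f (at x) (v *\<^sub>R 1) = v *\<^sub>R frechet_derivative f (at x) 1"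
        using l by (rule linear_cmul)
      then show "frechet_derivative f (at x) v = frechet_derivative f (at x) 1 * v"
        by (simp add: mult.commute)
    qed
    then show ?thesis using Ck_on_SucD(1)[OF assms that] by (simp add: has_field_derivative_def)
  qed
  then have eq: "deriv f x = frechet_derivative f (at x) 1" if "x \<in> S" for x
    using that DERIV_imp_deriv by blast
  then show "\<And>x. x \<in> S \<Longrightarrow> (f has_real_derivative deriv f x) (at x)" using * by simp
  show "Ck_on k S (deriv f)"
    using Ck_on_cong[OF assms(2), of "deriv f", OF eq] Ck_on_SucD(2)[OF assms, of 1] by simp
qed

text \<open>A quotient built from powers of the positive part. Its denominator is positive because
  \<open>2 - u\<close> and \<open>u - 1\<close> are never both nonpositive.\<close>

lemma Ck_step_exists:
  "\<exists>\<sigma>::real \<Rightarrow> real. Ck_on k UNIV \<sigma> \<and> (\<forall>u. 0 \<le> \<sigma> u \<and> \<sigma> u \<le> 1) \<and>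
     (\<forall>u\<le>1. \<sigma> u = 1) \<and> (\<forall>u\<ge>2. \<sigma> u = 0)"
proof -
  define p where "p = (\<lambda>t::real. max 0 t ^ Suc k)"
  have p: "Ck_on k UNIV p" unfolding p_def by (rule Ck_on_max0_power)
  have p0: "p t \<ge> 0" for t by (simp add: p_def)
  have pp: "t > 0 \<Longrightarrow> p t > 0" for t unfolding p_def by (rule zero_less_power) simp
  have pz: "t \<le> 0 \<Longrightarrow> p t = 0" for t unfolding p_def by (simp add: max_def)
  define \<sigma> where "\<sigma> = (\<lambda>u. p (2 - u) / (p (2 - u) + p (u - 1)))"
  have pos: "p (2 - u) + p (u - 1) > 0" for u
  proof (cases "u < 2")
    case True then show ?thesis using pp[of "2 - u"] p0[of "u - 1"] by simp
  next
    case False then show ?thesis using pp[of "u - 1"] p0[of "2 - u"] by simp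
  qed
  have c: "Ck_on k UNIV (\<lambda>u. p (2 - u))" "Ck_on k UNIV (\<lambda>u. p (u - 1))"
    by (auto intro!: Ck_on_compose[OF _ _ _ p] Ck_on_diff)
  have "Ck_on k UNIV \<sigma>"
    unfolding \<sigma>_def
    by (intro Ck_on_divide Ck_on_add c open_UNIV) (use pos in \<open>metis less_irrefl\<close>)
  moreover have "0 \<le> \<sigma> u \<and> \<sigma> u \<le> 1" for u
    using pos[of u] p0 by (simp add: \<sigma>_def)
  moreover have "\<sigma> u = 1" if "u \<le> 1" for u
    using that pp[of "2 - u"] by (simp add: \<sigma>_def pz)
  moreover have "\<sigma> u = 0" if "u \<ge> 2" for u
    using that by (simp add: \<sigma>_def pz)
  ultimately show ?thesis by blast
qed

text \<open>The logarithm makes the cutoff so slow that even \<open>t \<theta>'(t)\<close> is small; this is what keeps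
  cut-off dilations invertible.\<close>

lemma slow_cutoff_exists:
  assumes "\<eta> > 0"
  shows "\<exists>\<theta> b. Ck_on (Suc k) UNIV \<theta> \<and> (\<forall>t. 0 \<le> \<theta> t \<and> \<theta> t \<le> 1) \<and>
     (\<forall>t. \<bar>t\<bar> \<le> a \<longrightarrow> \<theta> t = 1) \<and> (\<forall>t. \<bar>t\<bar> \<ge> b \<longrightarrow> \<theta> t = 0) \<and>
     (\<forall>t::real. \<bar>deriv \<theta> t\<bar> * (1 + \<bar>t\<bar>) \<le> (\<eta>::real))"
proof -
  obtain \<sigma> :: "real \<Rightarrow> real" where \<sigma>: "Ck_on (Suc k) UNIV \<sigma>" "\<And>u. 0 \<le> \<sigma> u \<and> \<sigma> u \<le> 1"
    "\<And>u. u \<le> 1 \<Longrightarrow> \<sigma> u = 1" "\<And>u. u \<ge> 2 \<Longrightarrow> \<sigma> u = 0"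
    using Ck_step_exists[of "Suc k"] by blast
  have d: "(\<sigma> has_real_derivative deriv \<sigma> u) (at u)" for u
    using Ck_on_deriv(1)[OF \<sigma>(1)] by simp
  have "continuous_on UNIV (deriv \<sigma>)"
    using Ck_on_deriv(2)[OF \<sigma>(1)] Ck_on_continuous by blast
  then have "compact (deriv \<sigma> ` {1..2})"
    by (intro compact_continuous_image) (auto intro: continuous_on_subset)
  then obtain C0 where C0: "\<And>u. u \<in> {1..2} \<Longrightarrow> \<bar>deriv \<sigma> u\<bar> \<le> C0"
    using bounded_iff compact_imp_bounded by (metis imageI real_norm_def)
  define C where "C = max 1 C0"
  have "deriv \<sigma> u = 0" if "u < 1" for u
  proof -
    have "(\<sigma> has_real_derivative 0) (at u)"
      by (rule has_field_derivative_transform_within_open[of "\<lambda>_. 1" _ _ "{..<1}"])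
        (use that \<sigma>(3) in auto)
    then show ?thesis by (rule DERIV_imp_deriv)
  qed
  moreover have "deriv \<sigma> u = 0" if "u > 2" for u
  proof -
    have "(\<sigma> has_real_derivative 0) (at u)"
      by (rule has_field_derivative_transform_within_open[of "\<lambda>_. 0" _ _ "{2<..}"])
        (use that \<sigma>(4) in auto)
    then show ?thesis by (rule DERIV_imp_deriv)
  qed
  ultimately have C: "\<bar>deriv \<sigma> u\<bar> \<le> C" for u
    using C0[of u] unfolding C_def by (cases "u < 1"; cases "u > 2") fastforce+
  have "C > 0" unfolding C_def by simp
  \<comment> \<open>The first bound makes \<open>t * deriv \<theta> t\<close> small, the second
    keeps the argument of \<open>\<sigma>\<close> at most 1 for \<open>|t| \<le> a\<close>.\<close>
  define \<delta> where "\<delta> = min (\<eta> / (3 * C)) (1 / (1 + ln (1 + a\<^sup>2)))"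
  have la: "ln (1 + a\<^sup>2) \<ge> 0" by simp
  have \<delta>: "\<delta> > 0" "\<delta> * (3 * C) \<le> \<eta>" "\<delta> * (1 + ln (1 + a\<^sup>2)) \<le> 1"
  proof -
    show "\<delta> > 0" using \<open>C > 0\<close> assms la unfolding \<delta>_def by (simp add: add_pos_nonneg)
    have "\<delta> \<le> \<eta> / (3 * C)" "\<delta> \<le> 1 / (1 + ln (1 + a\<^sup>2))" by (auto simp: \<delta>_def)
    then show "\<delta> * (3 * C) \<le> \<eta>" "\<delta> * (1 + ln (1 + a\<^sup>2)) \<le> 1"
      using \<open>C > 0\<close> la by (simp_all add: pos_le_divide_eq)
  qed
  define \<theta> where "\<theta> = (\<lambda>t. \<sigma> (\<delta> * ln (1 + t\<^sup>2)))"
  have pos: "1 + t\<^sup>2 > 0" for t :: real by (simp add: add_pos_nonneg)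
  have "Ck_on (Suc k) UNIV (\<lambda>t::real. ln (1 + t\<^sup>2))"
    by (rule Ck_on_compose[OF _ _ Ck_on_add[OF _ Ck_on_const Ck_on_power[OF _ Ck_on_id]] Ck_on_ln])
      (use pos in auto)
  then have ck: "Ck_on (Suc k) UNIV \<theta>"
    unfolding \<theta>_def by (intro Ck_on_compose[OF _ _ _ \<sigma>(1)] Ck_on_mult) auto
  have dth: "deriv \<theta> t = deriv \<sigma> (\<delta> * ln (1 + t\<^sup>2)) * (\<delta> * (2 * t / (1 + t\<^sup>2)))" for t
  proof -
    have "((\<lambda>t. \<delta> * ln (1 + t\<^sup>2)) has_real_derivative \<delta> * (2 * t / (1 + t\<^sup>2))) (at t)"
      using pos by (auto intro!: derivative_eq_intros)
    from DERIV_chain2[OF d this] show ?thesis unfolding \<theta>_def by (rule DERIV_imp_deriv)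
  qed
  have "\<bar>deriv \<theta> t\<bar> * (1 + \<bar>t\<bar>) \<le> \<eta>" for t
  proof -
    \<comment> \<open>The difference of the two sides is \<open>(|t| - 1)^2 + 2\<close>.\<close>
    have "2 * \<bar>t\<bar> * (1 + \<bar>t\<bar>) \<le> 3 * (1 + t\<^sup>2)"
      using zero_le_power2[of "\<bar>t\<bar> - 1"] by (simp add: power2_eq_square algebra_simps)
    then have q: "2 * \<bar>t\<bar> * (1 + \<bar>t\<bar>) / (1 + t\<^sup>2) \<le> 3" using pos by (simp add: divide_le_eq)
    have "\<bar>deriv \<theta> t\<bar> * (1 + \<bar>t\<bar>)
        = \<bar>deriv \<sigma> (\<delta> * ln (1 + t\<^sup>2))\<bar> * (\<delta> * (2 * \<bar>t\<bar> * (1 + \<bar>t\<bar>) / (1 + t\<^sup>2)))"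
      using \<delta>(1) pos[of t] unfolding dth by (simp add: abs_mult)
    also have "\<dots> \<le> C * (\<delta> * 3)"
      by (intro mult_mono C mult_left_mono q) (use \<delta>(1) \<open>C > 0\<close> pos[of t] in auto)
    finally show ?thesis using \<delta>(2) by (simp add: mult_ac)
  qed
  moreover have "\<theta> t = 1" if "\<bar>t\<bar> \<le> a" for t
  proof -
    have "t\<^sup>2 \<le> a\<^sup>2" using that by (simp add: abs_le_square_iff[symmetric])
    then have "\<delta> * ln (1 + t\<^sup>2) \<le> \<delta> * (1 + ln (1 + a\<^sup>2))"
      using \<delta>(1) pos[of t] pos[of a] by (intro mult_left_mono) (auto intro: add_increasing)
    then show ?thesis using \<delta>(3) \<sigma>(3) unfolding \<theta>_def by simp
  qed
  \<comment> \<open>The cutoff only ends at an exponentially large radius, the price for its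
    slowness.\<close>
  moreover have "\<theta> t = 0" if "\<bar>t\<bar> \<ge> exp (2 / \<delta>)" for t
  proof -
    have "1 \<le> exp (2 / \<delta>)" using \<delta>(1) by simp
    then have "1 \<le> \<bar>t\<bar>" using that by linarith
    then have "\<bar>t\<bar> \<le> t\<^sup>2" by (metis abs_mult_self_eq mult_le_cancel_left1 power2_eq_square abs_ge_zero abs_of_nonneg dual_order.trans zero_less_one not_le)
    then have "exp (2 / \<delta>) \<le> 1 + t\<^sup>2" using that by linarith
    then have "2 / \<delta> \<le> ln (1 + t\<^sup>2)" using pos[of t] by (simp add: ln_ge_iff)
    then have "2 \<le> \<delta> * ln (1 + t\<^sup>2)" using \<delta>(1) by (simp add: divide_le_eq mult.commute)
    then show ?thesis using \<sigma>(4) unfolding \<theta>_def by simp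
  qed
  moreover have "0 \<le> \<theta> t \<and> \<theta> t \<le> 1" for t using \<sigma>(2) unfolding \<theta>_def by blast
  ultimately show ?thesis using ck by blast
qed

section \<open>Compactly supported diffeomorphisms moving points along one coordinate\<close>

text \<open>Being the identity outside a ball is what allows an extension by the identity from a
  chart to the manifold.\<close>

definition cdiff :: "nat \<Rightarrow> ('a::euclidean_space \<Rightarrow> 'a) \<Rightarrow> bool" where
  "cdiff k T \<longleftrightarrow> bij T \<and> Ck_on k UNIV T \<and> Ck_on k UNIV (inv T) \<and>
     (\<exists>R. \<forall>w. R < norm w \<longrightarrow> T w = w)"

lemma cdiff_compose:
  assumes "cdiff k T" "cdiff k S"
  shows "cdiff k (\<lambda>w. T (S w))"
proof -
  have b: "bij T" "bij S" using assms by (auto simp: cdiff_def)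
  have i: "inv (\<lambda>w. T (S w)) = (\<lambda>w. inv S (inv T w))"
    using o_inv_distrib[OF b] by (simp add: o_def)
  obtain R1 R2 where "\<forall>w. R1 < norm w \<longrightarrow> T w = w" "\<forall>w. R2 < norm w \<longrightarrow> S w = w"
    using assms by (auto simp: cdiff_def)
  then have "\<forall>w. max R1 R2 < norm w \<longrightarrow> T (S w) = w" by simp
  moreover have "bij (\<lambda>w. T (S w))" using bij_comp[OF b(2,1)] by (simp add: o_def)
  moreover have "Ck_on k UNIV (\<lambda>w. T (S w))" "Ck_on k UNIV (\<lambda>w. inv S (inv T w))"
    using assms by (auto simp: cdiff_def intro: Ck_on_compose[where T = UNIV])
  ultimately show ?thesis unfolding cdiff_def i by blast
qed

lemma cdiff_id: "cdiff k (\<lambda>w. w)"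
  by (auto simp: cdiff_def bij_id[unfolded id_def] inv_id[unfolded id_def])

text \<open>On each line in direction \<open>e\<close> the map is \<open>t + c * \<beta> t\<close>
  with constant \<open>c\<close>, because \<open>b\<close> does not depend on that coordinate. A
  positive derivative makes it increasing, and it is the identity far out, hence onto. The total
  derivative is the identity plus a rank-one map and is inverted explicitly.\<close>

lemma block_cdiff:
  fixes b :: "'a::euclidean_space \<Rightarrow> real" and \<beta> :: "real \<Rightarrow> real"
  assumes e: "e \<in> Basis"
    and b: "Ck_on (Suc k) UNIV b" and \<beta>: "Ck_on (Suc k) UNIV \<beta>"
    and inv_e: "\<And>w s. b (w + s *\<^sub>R e) = b w"
    and pos: "\<And>w t. 1 + b w * deriv \<beta> t > 0"
    and supp1: "\<And>t. R \<le> \<bar>t\<bar> \<Longrightarrow> \<beta> t = 0"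
    and supp2: "\<And>w. b w * \<beta> (w \<bullet> e) \<noteq> 0 \<Longrightarrow> norm w \<le> R'"
  shows "cdiff (Suc k) (\<lambda>w. w + (b w * \<beta> (w \<bullet> e)) *\<^sub>R e)"
proof -
  define T where "T = (\<lambda>w. w + (b w * \<beta> (w \<bullet> e)) *\<^sub>R e)"
  define A where "A = (\<lambda>w v. frechet_derivative b (at w) v * \<beta> (w \<bullet> e)
                        + b w * deriv \<beta> (w \<bullet> e) * (v \<bullet> e))"
  \<comment> \<open>The inverse of the rank-one perturbation of the identity (Sherman-Morrison); the
    denominator is \<open>1 + A w e\<close>, computed in \<open>Ae\<close>.\<close>
  define G where "G = (\<lambda>v w. v - (A w v / (1 + b w * deriv \<beta> (w \<bullet> e))) *\<^sub>R e)"
  have ee: "e \<bullet> e = 1" using e by simp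
  have db: "(b has_derivative frechet_derivative b (at w)) (at w)" for w
    using Ck_on_SucD(1)[OF b] by simp
  have d\<beta>: "(\<beta> has_real_derivative deriv \<beta> t) (at t)" for t
    using Ck_on_deriv(1)[OF \<beta>] by simp
  have dT: "(T has_derivative (\<lambda>v. v + A w v *\<^sub>R e)) (at w)" for w
  proof -
    have "((\<lambda>w. \<beta> (w \<bullet> e)) has_derivative (\<lambda>v. deriv \<beta> (w \<bullet> e) * (v \<bullet> e))) (at w)"
      by (rule has_derivative_compose[of "\<lambda>w. w \<bullet> e"])
        (use d\<beta> in \<open>auto intro!: derivative_eq_intros simp: has_field_derivative_def\<close>)
    from has_derivative_mult[OF db this]
    have "((\<lambda>w. b w * \<beta> (w \<bullet> e)) has_derivative A w) (at w)"
      by (rule has_derivative_eq_rhs) (auto simp: A_def)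
    then show ?thesis unfolding T_def
      by (intro has_derivative_add has_derivative_ident has_derivative_scaleR_left)
  qed
  have linA: "linear (A w)" for w
    unfolding A_def using has_derivative_linear[OF db[of w]]
    by (auto intro!: linearI simp: linear_add linear_cmul algebra_simps)
  have dbe: "frechet_derivative b (at w) e = 0" for w
  proof -
    have "((\<lambda>s::real. b (w + s *\<^sub>R e)) has_derivative (\<lambda>s. frechet_derivative b (at w) (s *\<^sub>R e))) (at 0)"
      by (rule has_derivative_compose[of "\<lambda>s. w + s *\<^sub>R e"])
        (use db[of w] in \<open>auto intro!: derivative_eq_intros\<close>)
    moreover have "((\<lambda>s::real. b (w + s *\<^sub>R e)) has_derivative (\<lambda>s. 0)) (at 0)"
      unfolding inv_e by simp
    ultimately have "(\<lambda>s. frechet_derivative b (at w) (s *\<^sub>R e)) = (\<lambda>s. 0)"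
      by (rule has_derivative_unique)
    from fun_cong[OF this, of 1] show ?thesis by simp
  qed
  have Ae: "A w e = b w * deriv \<beta> (w \<bullet> e)" for w unfolding A_def by (simp add: dbe ee)
  define h where "h = (\<lambda>c t. t + c * \<beta> t)"
  have dh: "(h (b w) has_real_derivative 1 + b w * deriv \<beta> t) (at t)" for w t
    unfolding h_def by (auto intro!: derivative_eq_intros d\<beta>)
  have hmono: "h (b w) s < h (b w) t" if "s < t" for w s t
    by (rule DERIV_pos_imp_increasing[OF that]) (use dh pos in blast)
  have inj: "inj T"
  proof (rule injI)
    fix w w' assume eq: "T w = T w'"
    define s where "s = b w' * \<beta> (w' \<bullet> e) - b w * \<beta> (w \<bullet> e)"
    have w: "w = w' + s *\<^sub>R e" using eq unfolding T_def s_def by (simp add: algebra_simps)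
    have bw: "b w = b w'" unfolding w by (rule inv_e)
    have "T w \<bullet> e = T w' \<bullet> e" using eq by simp
    then have "h (b w) (w \<bullet> e) = h (b w) (w' \<bullet> e)"
      unfolding T_def h_def by (simp add: inner_add_left ee bw)
    then have "w \<bullet> e = w' \<bullet> e"
      using hmono[of "w \<bullet> e" "w' \<bullet> e" w] hmono[of "w' \<bullet> e" "w \<bullet> e" w] by linarith
    then have "s = 0" using w by (simp add: inner_add_left ee)
    then show "w = w'" using w by simp
  qed
  have "surj T"
  proof -
    have "\<exists>w. T w = v" for v
    proof -
      define M where "M = \<bar>v \<bullet> e\<bar> + \<bar>R\<bar>"
      have M: "h (b v) (-M) = -M" "h (b v) M = M" by (auto simp: h_def supp1 M_def)
      have "continuous_on {-M..M} (h (b v))"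
        using dh[of v] by (intro DERIV_continuous_on) (auto intro: DERIV_subset)
      moreover have "-M \<le> v \<bullet> e" "v \<bullet> e \<le> M" "-M \<le> M" unfolding M_def by linarith+
      ultimately obtain t where t: "h (b v) t = v \<bullet> e"
        using IVT'[of "h (b v)" "-M" "v \<bullet> e" M] M by metis
      have "T (v + (t - v \<bullet> e) *\<^sub>R e) = v"
        using t unfolding T_def inv_e h_def
        by (simp add: inner_add_left ee algebra_simps flip: scaleR_add_left)
      then show ?thesis by blast
    qed
    then show ?thesis by (metis surjI surj_def)
  qed
  then have bij: "bij T" using inj by (simp add: bij_def)
  have "continuous_on UNIV T" using dT by (meson continuous_at_imp_continuous_on has_derivative_continuous)
  have dinv: "(inv T has_derivative (\<lambda>v. G v (inv T y))) (at y)" for y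
  proof -
    define w where "w = inv T y"
    have y: "y = T w" using bij unfolding w_def by (simp add: bij_is_surj surj_f_inv_f)
    have "(\<lambda>v. v + A w v *\<^sub>R e) \<circ> (\<lambda>v. G v w) = id"
    proof
      fix v
      define m where "m = b w * deriv \<beta> (w \<bullet> e)"
      have m: "1 + m > 0" using pos unfolding m_def by blast
      have "A w (G v w) = A w v - A w v / (1 + m) * m"
        unfolding G_def using linA[of w] by (simp add: linear_diff linear_cmul Ae m_def)
      moreover have "A w v - A w v / (1 + m) * m = A w v / (1 + m)"
        using m by (simp add: field_simps)
      ultimately show "((\<lambda>v. v + A w v *\<^sub>R e) \<circ> (\<lambda>v. G v w)) v = id v"
        by (simp add: G_def m_def)
    qed
    from has_derivative_inverse_strong[OF open_UNIV UNIV_I \<open>continuous_on UNIV T\<close> _ dT this, of "inv T"]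
    show ?thesis unfolding y using bij by (simp add: bij_is_inj)
  qed
  have AC: "Ck_on k UNIV (\<lambda>w. A w v)" if "v \<in> Basis" for v
    unfolding A_def
    by (intro Ck_on_add Ck_on_mult Ck_on_compose[OF _ _ _ Ck_on_deriv(2)[OF \<beta>]] Ck_on_inner_const
        Ck_on_compose[OF _ _ _ Ck_on_Suc_imp[OF \<beta>]] Ck_on_SucD(2)[OF b] Ck_on_Suc_imp[OF b] that) auto
  have GC: "Ck_on k UNIV (G v)" if "v \<in> Basis" for v
    unfolding G_def
    by (intro Ck_on_diff Ck_on_scaleR Ck_on_divide Ck_on_add AC that Ck_on_mult
        Ck_on_compose[OF _ _ _ Ck_on_deriv(2)[OF \<beta>]] Ck_on_inner_const Ck_on_Suc_imp[OF b])
      (use pos in \<open>auto simp: less_imp_neq[symmetric]\<close>)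
  have "Ck_on (Suc k) UNIV T"
  proof (rule Ck_on_SucI[OF _ dT])
    show "Ck_on k UNIV (\<lambda>w. v + A w v *\<^sub>R e)" if "v \<in> Basis" for v
      by (intro Ck_on_add Ck_on_scaleR AC that) auto
  qed auto
  \<comment> \<open>Bootstrapping: the derivative of \<open>inv T\<close> is \<open>G\<close>
    evaluated at \<open>inv T\<close>, so each order known for \<open>inv T\<close> gives one
    more.\<close>
  moreover have "Ck_on j UNIV (inv T)" if "j \<le> Suc k" for j
    using that
  proof (induction j)
    case 0
    show ?case using dinv
      by (simp, meson continuous_at_imp_continuous_on has_derivative_continuous)
  next
    case (Suc j)
    show ?case
    proof (rule Ck_on_SucI[OF _ dinv])
      show "Ck_on j UNIV (\<lambda>y. G v (inv T y))" if "v \<in> Basis" for v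
        by (rule Ck_on_compose[OF _ _ _ Ck_on_mono[OF GC[OF that]]]) (use Suc in auto)
    qed auto
  qed
  moreover have "T w = w" if "norm w > R'" for w
  proof -
    have "b w * \<beta> (w \<bullet> e) = 0" using supp2[of w] that by linarith
    then show ?thesis unfolding T_def by simp
  qed
  ultimately show ?thesis using bij unfolding cdiff_def T_def[symmetric] by blast
qed

text \<open>A product of one-dimensional cutoffs in all coordinates other than \<open>e\<close>; the
  remaining coordinate is left to the factor \<beta> of a block.\<close>

lemma Ck_cutoff_transversal:
  fixes e :: "'a::euclidean_space"
  assumes e: "e \<in> Basis"
  shows "\<exists>p R. Ck_on (Suc k) UNIV p \<and> (\<forall>w. 0 \<le> p w \<and> p w \<le> (1::real)) \<and>
     (\<forall>w s. p (w + s *\<^sub>R e) = p w) \<and> (\<forall>w. norm w \<le> a \<longrightarrow> p w = 1) \<and>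
     (\<forall>w. p w \<noteq> 0 \<longrightarrow> (\<forall>d\<in>Basis - {e}. \<bar>w \<bullet> d\<bar> \<le> R))"
proof -
  obtain \<theta> R where \<theta>: "Ck_on (Suc k) UNIV \<theta>" "\<And>t. 0 \<le> \<theta> t \<and> \<theta> t \<le> (1::real)"
    "\<And>t::real. \<bar>t\<bar> \<le> a \<Longrightarrow> \<theta> t = 1" "\<And>t. \<bar>t\<bar> \<ge> R \<Longrightarrow> \<theta> t = 0"
    using slow_cutoff_exists[of 1 k a] by (metis zero_less_one)
  define p where "p = (\<lambda>w::'a. \<Prod>d\<in>Basis - {e}. \<theta> (w \<bullet> d))"
  have "Ck_on (Suc k) UNIV p"
    unfolding p_def by (intro Ck_on_prod Ck_on_compose[OF _ _ _ \<theta>(1)] Ck_on_inner_const) auto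
  moreover have "0 \<le> p w \<and> p w \<le> 1" for w
    unfolding p_def using \<theta>(2) by (auto intro!: prod_nonneg prod_le_1)
  moreover have "p (w + s *\<^sub>R e) = p w" for w s
    unfolding p_def
    by (intro prod.cong refl) (use e inner_not_same_Basis[of e] in \<open>auto simp: inner_add_left\<close>)
  moreover have "p w = 1" if "norm w \<le> a" for w
    unfolding p_def by (intro prod.neutral ballI \<theta>(3)) (auto intro: order_trans[OF Basis_le_norm that])
  moreover have "\<bar>w \<bullet> d\<bar> \<le> R" if "p w \<noteq> 0" "d \<in> Basis - {e}" for w d
  proof (rule ccontr)
    assume "\<not> \<bar>w \<bullet> d\<bar> \<le> R"
    then have "p w = 0" unfolding p_def using that(2) \<theta>(4)[of "w \<bullet> d"] by (intro prod_zero) auto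
    then show False using that by simp
  qed
  ultimately show ?thesis by blast
qed

lemma norm_le_Basis_bound:
  fixes w :: "'a::euclidean_space" and R :: real
  assumes "\<And>d. d \<in> Basis \<Longrightarrow> \<bar>w \<bullet> d\<bar> \<le> R"
  shows "norm w \<le> DIM('a) * R"
proof -
  have "norm w \<le> (\<Sum>d\<in>Basis. \<bar>w \<bullet> d\<bar>)" by (rule norm_le_l1)
  also have "\<dots> \<le> (\<Sum>d\<in>(Basis::'a set). R)" using assms by (intro sum_mono)
  finally show ?thesis by simp
qed

text \<open>The transversal cutoff bounds the displacement by some \<open>B\<close>; a cutoff along
  \<open>e\<close> with slope at most \<open>1 / (2 * (B + 1))\<close> then keeps the map increasing
  on lines.\<close>

lemma shear_block:
  fixes e :: "'a::euclidean_space"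
  assumes e: "e \<in> Basis" and b0: "Ck_on (Suc k) UNIV b0"
    and inv_e: "\<And>w s. b0 (w + s *\<^sub>R e) = (b0 w :: real)"
  shows "\<exists>T. cdiff (Suc k) T \<and> (\<forall>w. norm w \<le> a \<longrightarrow> T w = w + b0 w *\<^sub>R e)"
proof -
  obtain p R where p: "Ck_on (Suc k) UNIV p" "\<And>w. 0 \<le> p w \<and> p w \<le> (1::real)"
     "\<And>w s. p (w + s *\<^sub>R e) = p w" "\<And>w. norm w \<le> a \<Longrightarrow> p w = 1"
     "\<And>w d. p w \<noteq> 0 \<Longrightarrow> d\<in>Basis - {e} \<Longrightarrow> \<bar>w \<bullet> d\<bar> \<le> R"
    using Ck_cutoff_transversal[OF e, of k a] by metis
  have "compact (b0 ` cball 0 (DIM('a) * \<bar>R\<bar>))"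
    using Ck_on_continuous[OF b0] by (intro compact_continuous_image) (auto intro: continuous_on_subset)
  then obtain B where B: "\<And>w. norm w \<le> DIM('a) * \<bar>R\<bar> \<Longrightarrow> \<bar>b0 w\<bar> \<le> B"
    using compact_imp_bounded bounded_iff by (metis imageI mem_cball_0 real_norm_def)
  then have B0: "B \<ge> 0" by (metis abs_ge_zero abs_le_zero_iff norm_zero mult_nonneg_nonneg of_nat_0_le_iff order_trans)
  define b where "b = (\<lambda>w. b0 w * p w)"
  have bB: "\<bar>b w\<bar> \<le> B" for w
  proof (cases "p w = 0")
    case True then show ?thesis using B0 by (simp add: b_def)
  next
    case False
    \<comment> \<open>\<open>b0\<close> does not see the coordinate \<open>e\<close>; erasing it
      moves the point from an unbounded cylinder into a compact ball.\<close>
    define w' where "w' = w + (- (w \<bullet> e)) *\<^sub>R e"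
    have "\<bar>w' \<bullet> d\<bar> \<le> \<bar>R\<bar>" if "d \<in> Basis" for d
      using p(5)[OF False, of d] that e inner_not_same_Basis[OF e that]
      by (cases "d = e") (auto simp: w'_def inner_add_left inner_diff_left)
    then have "norm w' \<le> DIM('a) * \<bar>R\<bar>" by (rule norm_le_Basis_bound)
    from B[OF this] have "\<bar>b0 w\<bar> \<le> B" unfolding w'_def inv_e .
    then have "\<bar>b0 w\<bar> * \<bar>p w\<bar> \<le> B * 1" using p(2)[of w] B0 by (intro mult_mono) auto
    then show ?thesis by (simp add: b_def abs_mult)
  qed
  obtain \<beta> R2 where \<beta>: "Ck_on (Suc k) UNIV \<beta>" "\<And>t::real. \<bar>t\<bar> \<le> a \<Longrightarrow> \<beta> t = 1"
    "\<And>t. \<bar>t\<bar> \<ge> R2 \<Longrightarrow> \<beta> t = 0" "\<And>t. \<bar>deriv \<beta> t\<bar> * (1 + \<bar>t\<bar>) \<le> 1 / (2 * (B + 1))"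
    using slow_cutoff_exists[of "1 / (2 * (B + 1))" k a] B0
    by (metis (no_types, opaque_lifting) add_nonneg_pos mult_pos_pos zero_less_divide_1_iff zero_less_numeral zero_less_one)
  have "cdiff (Suc k) (\<lambda>w. w + (b w * \<beta> (w \<bullet> e)) *\<^sub>R e)"
  proof (rule block_cdiff[OF e _ \<beta>(1)])
    show "Ck_on (Suc k) UNIV b" unfolding b_def by (intro Ck_on_mult b0 p(1)) auto
    show "b (w + s *\<^sub>R e) = b w" for w s by (simp add: b_def inv_e p(3))
    show "1 + b w * deriv \<beta> t > 0" for w t
    proof -
      have "\<bar>deriv \<beta> t\<bar> * 1 \<le> \<bar>deriv \<beta> t\<bar> * (1 + \<bar>t\<bar>)" by (intro mult_left_mono) auto
      then have "\<bar>b w\<bar> * \<bar>deriv \<beta> t\<bar> \<le> B * (1 / (2 * (B + 1)))"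
        using \<beta>(4)[of t] by (intro mult_mono bB) (auto simp: B0)
      also have "\<dots> < 1" using B0 by (simp add: divide_simps)
      finally show ?thesis by (simp add: abs_mult[symmetric])
    qed
    show "R2 \<le> \<bar>t\<bar> \<Longrightarrow> \<beta> t = 0" for t by (rule \<beta>(3))
    show "norm w \<le> DIM('a) * max R R2" if nz: "b w * \<beta> (w \<bullet> e) \<noteq> 0" for w
    proof (rule norm_le_Basis_bound)
      fix d :: 'a assume d: "d \<in> Basis"
      have "p w \<noteq> 0" "\<bar>w \<bullet> e\<bar> < R2" using nz \<beta>(3)[of "w \<bullet> e"] by (auto simp: b_def not_le[symmetric])
      then show "\<bar>w \<bullet> d\<bar> \<le> max R R2" using p(5)[of w d] d by (cases "d = e") auto
    qed
  qed
  moreover have "w + (b w * \<beta> (w \<bullet> e)) *\<^sub>R e = w + b0 w *\<^sub>R e" if "norm w \<le> a" for w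
    using that p(4)[OF that] \<beta>(2)[of "w \<bullet> e"] Basis_le_norm[OF e, of w] by (simp add: b_def)
  ultimately show ?thesis by blast
qed

text \<open>Along \<open>e\<close> the displacement is
  \<open>(\<alpha> - 1) * t * \<theta> t\<close>. Its derivative contains
  \<open>t * deriv \<theta> t\<close>, which does not become small for a cutoff that is merely
  stretched to a larger scale; the slow cutoff makes it so small that the derivative stays above
  -1.\<close>

lemma scale_block:
  fixes e :: "'a::euclidean_space"
  assumes e: "e \<in> Basis" and \<alpha>: "\<alpha> > 0"
  shows "\<exists>T. cdiff (Suc k) T \<and> (\<forall>w. norm w \<le> a \<longrightarrow> T w = w + ((\<alpha> - 1) * (w \<bullet> e)) *\<^sub>R e)"
proof -
  obtain p R where p: "Ck_on (Suc k) UNIV p" "\<And>w. 0 \<le> p w \<and> p w \<le> (1::real)"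
     "\<And>w s. p (w + s *\<^sub>R e) = p w" "\<And>w. norm w \<le> a \<Longrightarrow> p w = 1"
     "\<And>w d. p w \<noteq> 0 \<Longrightarrow> d\<in>Basis - {e} \<Longrightarrow> \<bar>w \<bullet> d\<bar> \<le> R"
    using Ck_cutoff_transversal[OF e, of k a] by metis
  \<comment> \<open>Chosen so that \<open>|\<alpha> - 1| * \<eta> < min 1 \<alpha>\<close>, the
    least distance of the main term from -1.\<close>
  define \<eta> where "\<eta> = min 1 \<alpha> / (2 * (\<bar>\<alpha> - 1\<bar> + 1))"
  have "min 1 \<alpha> > 0" using \<alpha> by simp
  moreover have "2 * (\<bar>\<alpha> - 1\<bar> + 1) > 0" by (intro mult_pos_pos add_nonneg_pos) auto
  ultimately have "\<eta> > 0" unfolding \<eta>_def by (rule divide_pos_pos)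
  then obtain \<theta> R2 where \<theta>: "Ck_on (Suc k) UNIV \<theta>" "\<And>t. 0 \<le> \<theta> t \<and> \<theta> t \<le> 1" "\<And>t::real. \<bar>t\<bar> \<le> a \<Longrightarrow> \<theta> t = 1"
    "\<And>t. \<bar>t\<bar> \<ge> R2 \<Longrightarrow> \<theta> t = 0" "\<And>t. \<bar>deriv \<theta> t\<bar> * (1 + \<bar>t\<bar>) \<le> \<eta>"
    using slow_cutoff_exists[of \<eta> k a] by metis
  define \<beta> where "\<beta> = (\<lambda>t. (\<alpha> - 1) * t * \<theta> t)"
  have C\<beta>: "Ck_on (Suc k) UNIV \<beta>" unfolding \<beta>_def by (intro Ck_on_mult \<theta>(1)) auto
  have d\<beta>: "deriv \<beta> t = (\<alpha> - 1) * \<theta> t + (\<alpha> - 1) * (t * deriv \<theta> t)" for t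
    by (rule DERIV_imp_deriv, unfold \<beta>_def)
      (auto intro!: derivative_eq_intros Ck_on_deriv(1)[OF \<theta>(1)] simp: algebra_simps)
  have "cdiff (Suc k) (\<lambda>w. w + (p w * \<beta> (w \<bullet> e)) *\<^sub>R e)"
  proof (rule block_cdiff[OF e p(1) C\<beta> p(3)])
    show "1 + p w * deriv \<beta> t > 0" for w t
    proof -
      have "\<bar>t * deriv \<theta> t\<bar> \<le> \<bar>deriv \<theta> t\<bar> * (1 + \<bar>t\<bar>)" by (simp add: abs_mult algebra_simps)
      then have "\<bar>(\<alpha> - 1) * (t * deriv \<theta> t)\<bar> \<le> \<bar>\<alpha> - 1\<bar> * \<eta>"
        using \<theta>(5)[of t] unfolding abs_mult by (intro mult_left_mono) auto
      also have "\<dots> < min 1 \<alpha>"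
      proof -
        have "t * (m / (2 * (t + 1))) < m" if "t \<ge> 0" "m > 0" for t m :: real
        proof -
          have "t * m < m * (2 * (t + 1))"
            using that mult_nonneg_nonneg[of t m] by (simp add: algebra_simps add_nonneg_pos)
          then show ?thesis using that by (simp add: pos_divide_less_eq)
        qed
        from this[of "\<bar>\<alpha> - 1\<bar>" "min 1 \<alpha>"] show ?thesis
          unfolding \<eta>_def using \<open>min 1 \<alpha> > 0\<close> abs_ge_zero by blast
      qed
      finally have s: "\<bar>(\<alpha> - 1) * (t * deriv \<theta> t)\<bar> < min 1 \<alpha>" .
      have "(\<alpha> - 1) * \<theta> t \<ge> min 1 \<alpha> - 1"
      proof (cases "\<alpha> \<ge> 1")
        case True then show ?thesis using \<theta>(2)[of t] by simp
      next
        case False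
        then have "(1 - \<alpha>) * \<theta> t \<le> (1 - \<alpha>) * 1" using \<theta>(2)[of t] by (intro mult_left_mono) auto
        then show ?thesis using False by (simp add: algebra_simps)
      qed
      then have "deriv \<beta> t > -1" using s unfolding d\<beta> by linarith
      then show ?thesis
      proof (cases "deriv \<beta> t \<ge> 0")
        case True then show ?thesis using p(2)[of w] by (simp add: add_pos_nonneg)
      next
        case False
        then have "p w * (- deriv \<beta> t) \<le> 1 * (- deriv \<beta> t)" using p(2)[of w] by (intro mult_right_mono) auto
        then show ?thesis using \<open>deriv \<beta> t > -1\<close> by simp
      qed
    qed
    show "R2 \<le> \<bar>t\<bar> \<Longrightarrow> \<beta> t = 0" for t using \<theta>(4) by (simp add: \<beta>_def)
    show "norm w \<le> DIM('a) * max R R2" if nz: "p w * \<beta> (w \<bullet> e) \<noteq> 0" for w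
    proof (rule norm_le_Basis_bound)
      fix d :: 'a assume d: "d \<in> Basis"
      have "p w \<noteq> 0" "\<bar>w \<bullet> e\<bar> < R2" using nz \<theta>(4)[of "w \<bullet> e"] by (auto simp: \<beta>_def not_le[symmetric])
      then show "\<bar>w \<bullet> d\<bar> \<le> max R R2" using p(5)[of w d] d by (cases "d = e") auto
    qed
  qed
  moreover have "w + (p w * \<beta> (w \<bullet> e)) *\<^sub>R e = w + ((\<alpha> - 1) * (w \<bullet> e)) *\<^sub>R e" if "norm w \<le> a" for w
    using that p(4)[OF that] \<theta>(3)[of "w \<bullet> e"] Basis_le_norm[OF e, of w] by (simp add: \<beta>_def)
  ultimately show ?thesis by blast
qed

text \<open>With \<alpha> at most 1 no factor increases the norm inside the ball, so the formulas of
  all factors apply one after the other.\<close>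

lemma contraction_block:
  fixes B :: "'a::euclidean_space set"
  assumes "B \<subseteq> Basis" and \<alpha>: "0 < \<alpha>" "\<alpha> \<le> 1"
  shows "\<exists>T. cdiff (Suc k) T \<and>
    (\<forall>w. norm w \<le> a \<longrightarrow> T w = w + (\<Sum>d\<in>B. ((\<alpha> - 1) * (w \<bullet> d)) *\<^sub>R d))"
proof -
  have "finite B" using assms(1) finite_Basis by (rule finite_subset)
  then show ?thesis using assms(1)
  proof (induction B)
    case empty show ?case using cdiff_id by (intro exI[of _ "\<lambda>w. w"]) auto
  next
    case (insert e B)
    then obtain T where T: "cdiff (Suc k) T"
      "\<And>w. norm w \<le> a \<Longrightarrow> T w = w + (\<Sum>d\<in>B. ((\<alpha> - 1) * (w \<bullet> d)) *\<^sub>R d)" by auto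
    obtain S where S: "cdiff (Suc k) S" "\<And>w. norm w \<le> a \<Longrightarrow> S w = w + ((\<alpha> - 1) * (w \<bullet> e)) *\<^sub>R e"
      using scale_block[of e \<alpha> k a] insert.prems \<alpha> by auto
    have "T (S w) = w + (\<Sum>d\<in>insert e B. ((\<alpha> - 1) * (w \<bullet> d)) *\<^sub>R d)" if "norm w \<le> a" for w
    proof -
      have "\<bar>S w \<bullet> d\<bar> \<le> \<bar>w \<bullet> d\<bar>" if "d \<in> Basis" for d
      proof (cases "d = e")
        case True
        have "S w \<bullet> d = w \<bullet> d + ((\<alpha> - 1) * (w \<bullet> e)) * (e \<bullet> d)"
          unfolding S(2)[OF \<open>norm w \<le> a\<close>] by (simp only: inner_add_left inner_scaleR_left)
        then have "S w \<bullet> d = \<alpha> * (w \<bullet> d)" using True that by (simp add: algebra_simps)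
        then show ?thesis using \<alpha> by (simp add: abs_mult mult_left_le_one_le)
      next
        case False
        then show ?thesis using S(2)[OF \<open>norm w \<le> a\<close>] that insert.prems
          by (simp add: inner_add_left inner_not_same_Basis)
      qed
      then have "norm (S w) \<le> norm w" by (rule norm_le_componentwise)
      then have "T (S w) = S w + (\<Sum>d\<in>B. ((\<alpha> - 1) * (S w \<bullet> d)) *\<^sub>R d)"
        using that T(2) by simp
      also have "(\<Sum>d\<in>B. ((\<alpha> - 1) * (S w \<bullet> d)) *\<^sub>R d) = (\<Sum>d\<in>B. ((\<alpha> - 1) * (w \<bullet> d)) *\<^sub>R d)"
      proof (rule sum.cong[OF refl])
        fix d assume "d \<in> B"
        then have "e \<bullet> d = 0" using insert.hyps insert.prems by (intro inner_not_same_Basis) auto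
        then have "S w \<bullet> d = w \<bullet> d" using S(2)[OF that] by (simp add: inner_add_left)
        then show "((\<alpha> - 1) * (S w \<bullet> d)) *\<^sub>R d = ((\<alpha> - 1) * (w \<bullet> d)) *\<^sub>R d" by simp
      qed
      finally show ?thesis using S(2)[OF that] insert by simp
    qed
    then show ?case using cdiff_compose[OF T(1) S(1)] by blast
  qed
qed


text \<open>The half-turn of \<open>\<V>\<^sub>1\<close> in the plane of \<open>x\<close> and one \<open>y\<close>-coordinate must not move \<open>\<V>\<^sub>0\<close>.
  The third dimension gives room for it: \<open>\<V>\<^sub>1\<close> is first lifted in the \<open>z\<close>-direction, there the
  half-turn is a product of six linear shears cut off in \<open>z\<close>, and finally \<open>\<V>\<^sub>1\<close> is lowered again.\<close>

lemma blender_diffeo_exists: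
  fixes lam :: real and i0 :: "'m::finite"
  assumes lam: "lam > 0"
  shows "\<exists>\<Phi> :: real \<times> (real ^ 'm) \<times> real \<Rightarrow> _. cdiff (Suc k) \<Phi> \<and>
    (\<forall>x y z. x \<in> {-1/10..2/5} \<and> (\<forall>i. y $ i \<in> {-1/10..11/10}) \<and> z \<in> {-1/10..11/10} \<longrightarrow>
       \<Phi> (x, y, z) = (lam * x, (1/4) *\<^sub>R y, 2/3 * z)) \<and>
    (\<forall>x y z. x \<in> {3/5..11/10} \<and> (\<forall>i. y $ i \<in> {-1/10..11/10}) \<and> z \<in> {-1/10..11/10} \<longrightarrow>
       \<Phi> (x, y, z) = (lam * (1 - x), \<chi> i. if i = i0 then 1 - 1/4 * y $ i else 1/4 * y $ i,
         2/3 * z + 1/3))"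
proof -
  \<comment> \<open>The ball of this radius contains the box \<open>?ok\<close>, where all
    intermediate positions of both legs lie and the cut-off maps have their exact formulas.\<close>
  define a where "a = 40 + 2 * real CARD('m)"
  let ?ok = "\<lambda>(x::real) (y::real^'m) z. \<bar>x\<bar> \<le> 20 \<and> (\<forall>i. \<bar>y $ i\<bar> \<le> 2) \<and> \<bar>z\<bar> \<le> (20::real)"
  have ok: "norm (x, y, z) \<le> a" if "?ok x y z" for x z :: real and y
  proof -
    have "norm y \<le> (\<Sum>i\<in>UNIV. \<bar>y $ i\<bar>)" by (rule norm_le_l1_cart)
    also have "\<dots> \<le> (\<Sum>i\<in>(UNIV::'m set). 2)" using that by (intro sum_mono) auto
    finally have "norm y \<le> 2 * real CARD('m)" by simp
    moreover have "norm (x, y, z) \<le> \<bar>x\<bar> + (norm y + \<bar>z\<bar>)"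
      using norm_Pair_le[of x "(y, z)"] norm_Pair_le[of y z] by simp
    ultimately show ?thesis using that unfolding a_def by linarith
  qed
  define ex ey ez :: "real \<times> (real ^ 'm) \<times> real"
    where "ex = (1, 0, 0)" and "ey = (0, axis i0 1, 0)" and "ez = (0, 0, 1)"
  note edefs = ex_def ey_def ez_def
  have eB: "ex \<in> Basis" "ey \<in> Basis" "ez \<in> Basis"
    by (auto simp: edefs Basis_prod_def axis_in_Basis_iff zero_prod_def)
  obtain \<sigma> :: "real \<Rightarrow> real" where \<sigma>: "Ck_on (Suc k) UNIV \<sigma>"
    "\<And>u. u \<le> 1 \<Longrightarrow> \<sigma> u = 1" "\<And>u. u \<ge> 2 \<Longrightarrow> \<sigma> u = 0"
    using Ck_step_exists[of "Suc k"] by blast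
  have cfst: "Ck_on (Suc k) UNIV (\<lambda>w::real \<times> (real ^ 'm) \<times> real. fst w)"
    by (rule Ck_on_linear) (simp add: bounded_linear.linear bounded_linear_fst)
  have cy: "Ck_on (Suc k) UNIV (\<lambda>w::real \<times> (real ^ 'm) \<times> real. fst (snd w) $ i0)"
    by (rule Ck_on_linear) (auto intro!: linearI)
  have csnd: "Ck_on (Suc k) UNIV (\<lambda>w::real \<times> (real ^ 'm) \<times> real. snd (snd w))"
    by (rule Ck_on_linear) (auto intro!: linearI)
  \<comment> \<open>\<open>\<chi>1\<close> separates the legs: it is 0 up to 2/5 and 1 from 3/5 on.
    \<open>\<chi>2\<close> switches between the heights 4 and 5, below the lifted leg and above the
    other one.\<close>
  define \<chi>1 where "\<chi>1 = (\<lambda>t. \<sigma> (4 - 5 * t))"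
  define \<chi>2 where "\<chi>2 = (\<lambda>t. \<sigma> (6 - t))"
  have c\<chi>: "Ck_on (Suc k) UNIV \<chi>1" "Ck_on (Suc k) UNIV \<chi>2"
    unfolding \<chi>1_def \<chi>2_def by (intro Ck_on_compose[OF _ _ _ \<sigma>(1)] Ck_on_diff Ck_on_mult; simp)+
  have \<chi>1: "t \<le> 2/5 \<Longrightarrow> \<chi>1 t = 0" "t \<ge> 3/5 \<Longrightarrow> \<chi>1 t = 1" for t
    by (auto simp: \<chi>1_def \<sigma>)
  have \<chi>2: "t \<le> 4 \<Longrightarrow> \<chi>2 t = 0" "t \<ge> 5 \<Longrightarrow> \<chi>2 t = 1" for t
    by (auto simp: \<chi>2_def \<sigma>)
  obtain C where C: "cdiff (Suc k) C" "\<And>x y z. ?ok x y z \<Longrightarrow> C (x, y, z) = (x, (1/4) *\<^sub>R y, z)"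
  proof -
    define B where "B = range (\<lambda>i::'m. (0::real, axis i (1::real), 0::real))"
    have "B \<subseteq> Basis" by (auto simp: B_def Basis_prod_def axis_in_Basis_iff)
    then obtain C where C: "cdiff (Suc k) C"
      "\<And>w. norm w \<le> a \<Longrightarrow> C w = w + (\<Sum>d\<in>B. ((1/4 - 1) * (w \<bullet> d)) *\<^sub>R d)"
      using contraction_block[of B "1/4" k a] by auto
    have inj: "inj (\<lambda>i::'m. (0::real, axis i (1::real), 0::real))"
      by (auto intro!: injI simp: axis_eq_axis)
    have "C (x, y, z) = (x, (1/4) *\<^sub>R y, z)" if "?ok x y z" for x y z
    proof -
      have "(\<Sum>d\<in>B. ((1/4 - 1) * ((x, y, z) \<bullet> d)) *\<^sub>R d)
          = (\<Sum>i\<in>UNIV. (0, (- (3/4) * y $ i) *\<^sub>R axis i 1, 0))"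
        unfolding B_def by (subst sum.reindex[OF inj]) (simp add: inner_axis)
      also have "\<dots> = (0, (\<Sum>i\<in>UNIV. (- (3/4) * y $ i) *\<^sub>R axis i 1), 0)"
        by (simp add: sum_prod[symmetric] prod_eq_iff fst_sum snd_sum)
      also have "(\<Sum>i\<in>UNIV. (- (3/4) * y $ i) *\<^sub>R axis i 1) = (- (3/4)) *\<^sub>R y"
        by (simp add: vec_eq_iff axis_def if_distrib sum.delta cong: if_cong)
      finally show ?thesis unfolding C(2)[OF ok[OF that]]
        by (simp add: vec_eq_iff)
    qed
    then show ?thesis using that C(1) by blast
  qed
  obtain Z where Z: "cdiff (Suc k) Z" "\<And>x y z. ?ok x y z \<Longrightarrow> Z (x, y, z) = (x, y, 2/3 * z)"
  proof -
    obtain Z where "cdiff (Suc k) Z" "\<And>w. norm w \<le> a \<Longrightarrow> Z w = w + ((2/3 - 1) * (w \<bullet> ez)) *\<^sub>R ez"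
      using scale_block[OF eB(3), of "2/3" k a] by auto
    then show ?thesis by (intro that[of Z]) (auto simp: ok ez_def algebra_simps)
  qed
  obtain L where L: "cdiff (Suc k) L" "\<And>x y z. ?ok x y z \<Longrightarrow> L (x, y, z) = (lam * x, y, z)"
  proof -
    obtain L where "cdiff (Suc k) L" "\<And>w. norm w \<le> a \<Longrightarrow> L w = w + ((lam - 1) * (w \<bullet> ex)) *\<^sub>R ex"
      using scale_block[OF eB(1), of lam k a] lam by auto
    then show ?thesis by (intro that[of L]) (auto simp: ok ex_def algebra_simps)
  qed
  \<comment> \<open>31/3 is 10 plus the translation 1/3 wanted at the end; \<open>H2\<close> takes
    back only the 10.\<close>
  obtain H1 where H1: "cdiff (Suc k) H1"
    "\<And>x y z. ?ok x y z \<Longrightarrow> H1 (x, y, z) = (x, y, z + 31/3 * \<chi>1 x)"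
  proof -
    have "Ck_on (Suc k) UNIV (\<lambda>w::real \<times> (real ^ 'm) \<times> real. 31/3 * \<chi>1 (fst w))"
      by (intro Ck_on_mult Ck_on_compose[OF _ _ cfst c\<chi>(1)]) auto
    from shear_block[OF eB(3) this, of a]
    obtain H where "cdiff (Suc k) H"
      "\<And>w. norm w \<le> a \<Longrightarrow> H w = w + (31/3 * \<chi>1 (fst w)) *\<^sub>R ez"
      by (auto simp: ez_def)
    then show ?thesis by (intro that[of H]) (auto simp: ok ez_def)
  qed
  \<comment> \<open>After the half-turn the legs are told apart by \<open>y $ i0\<close>: at most
    11/40 on the leg left in place, at least 29/40 on the turned one.\<close>
  obtain H2 where H2: "cdiff (Suc k) H2"
    "\<And>x y z. ?ok x y z \<Longrightarrow> H2 (x, y, z) = (x, y, z - 10 * \<chi>1 (y $ i0))"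
  proof -
    have "Ck_on (Suc k) UNIV (\<lambda>w::real \<times> (real ^ 'm) \<times> real. - 10 * \<chi>1 (fst (snd w) $ i0))"
      by (intro Ck_on_mult Ck_on_compose[OF _ _ cy c\<chi>(1)]) auto
    from shear_block[OF eB(3) this, of a]
    obtain H where "cdiff (Suc k) H"
      "\<And>w. norm w \<le> a \<Longrightarrow> H w = w + (- 10 * \<chi>1 (fst (snd w) $ i0)) *\<^sub>R ez"
      by (auto simp: ez_def)
    then show ?thesis by (intro that[of H]) (auto simp: ok ez_def)
  qed
  obtain R1 where R1: "cdiff (Suc k) R1"
    "\<And>x y z. ?ok x y z \<Longrightarrow> R1 (x, y, z) = (x - \<chi>2 z * (y $ i0 - 1/2), y, z)"
  proof -
    have "Ck_on (Suc k) UNIV (\<lambda>w::real \<times> (real ^ 'm) \<times> real.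
        - (\<chi>2 (snd (snd w)) * (fst (snd w) $ i0 - 1/2)))"
      by (intro Ck_on_minus Ck_on_mult Ck_on_diff cy Ck_on_compose[OF _ _ csnd c\<chi>(2)]) auto
    from shear_block[OF eB(1) this, of a]
    obtain H where "cdiff (Suc k) H" "\<And>w. norm w \<le> a \<Longrightarrow>
        H w = w + (- (\<chi>2 (snd (snd w)) * (fst (snd w) $ i0 - 1/2))) *\<^sub>R ex"
      by (auto simp: ex_def)
    then show ?thesis by (intro that[of H]) (auto simp: ok ex_def)
  qed
  obtain R2 where R2: "cdiff (Suc k) R2"
    "\<And>x y z. ?ok x y z \<Longrightarrow> R2 (x, y, z) = (x, y + (\<chi>2 z * (x - 1/2)) *\<^sub>R axis i0 1, z)"
  proof -
    have "Ck_on (Suc k) UNIV (\<lambda>w::real \<times> (real ^ 'm) \<times> real.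
        \<chi>2 (snd (snd w)) * (fst w - 1/2))"
      by (intro Ck_on_mult Ck_on_diff cfst Ck_on_compose[OF _ _ csnd c\<chi>(2)]) auto
    from shear_block[OF eB(2) this, of a]
    obtain H where "cdiff (Suc k) H" "\<And>w. norm w \<le> a \<Longrightarrow>
        H w = w + (\<chi>2 (snd (snd w)) * (fst w - 1/2)) *\<^sub>R ey"
      by (auto simp: ey_def)
    then show ?thesis by (intro that[of H]) (auto simp: ok ey_def)
  qed
  \<comment> \<open>With X and Y the signed offsets of \<open>x\<close> and \<open>y $ i0\<close>
    from 1/2, the product of \<open>R1\<close>, \<open>R2\<close>, \<open>R1\<close> at full height
    sends (X, Y) to (-Y, X). This quarter turn applied twice is the half-turn about (1/2,
    1/2).\<close>
  define \<Phi> where "\<Phi> = (\<lambda>w. L (H2 (R1 (R2 (R1 (R1 (R2 (R1 (H1 (Z (C w)))))))))))"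
  have "cdiff (Suc k) \<Phi>"
    unfolding \<Phi>_def
    by (rule cdiff_compose[OF L(1) cdiff_compose[OF H2(1) cdiff_compose[OF R1(1)
          cdiff_compose[OF R2(1) cdiff_compose[OF R1(1) cdiff_compose[OF R1(1)
          cdiff_compose[OF R2(1) cdiff_compose[OF R1(1) cdiff_compose[OF H1(1)
          cdiff_compose[OF Z(1) C(1)]]]]]]]]]])
  moreover have "\<Phi> (x, y, z) = (lam * x, (1/4) *\<^sub>R y, 2/3 * z)"
    if "x \<in> {-1/10..2/5}" "\<forall>i. y $ i \<in> {-1/10..11/10}" "z \<in> {-1/10..11/10}" for x y z
  proof -
    have y: "\<bar>y $ i\<bar> \<le> 2" "\<bar>y $ i\<bar> / 4 \<le> 2" "y $ i / 4 \<le> 2/5" for i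
      using that(2)[rule_format, of i] by (auto simp: abs_le_iff)
    have C': "C (x, y, z) = (x, (1/4) *\<^sub>R y, z)" by (rule C(2)) (use that y in auto)
    have Z': "Z (x, (1/4) *\<^sub>R y, z) = (x, (1/4) *\<^sub>R y, 2/3 * z)" by (rule Z(2)) (use that y in auto)
    have ok': "?ok x ((1/4) *\<^sub>R y) (2/3 * z)" using that y by auto
    have \<chi>': "\<chi>1 x = 0" "\<chi>1 (((1/4) *\<^sub>R y) $ i0) = 0" "\<chi>2 (2/3 * z) = 0"
      using that y(3)[of i0] by (auto intro!: \<chi>1 \<chi>2)
    show ?thesis
      unfolding \<Phi>_def C' Z' H1(2)[OF ok'] \<chi>' using R1(2)[OF ok'] R2(2)[OF ok'] H2(2)[OF ok'] L(2)[OF ok']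
      unfolding \<chi>' by simp
  qed
  moreover have "\<Phi> (x, y, z) = (lam * (1 - x), \<chi> i. if i = i0 then 1 - 1/4 * y $ i else 1/4 * y $ i,
         2/3 * z + 1/3)"
    if "x \<in> {3/5..11/10}" "\<forall>i. y $ i \<in> {-1/10..11/10}" "z \<in> {-1/10..11/10}" for x y z
  proof -
    define v where "v = (1/4) *\<^sub>R y"
    define \<zeta> where "\<zeta> = 2/3 * z + 31/3"
    define h where "h = v $ i0"
    have v: "v $ i \<in> {-1/40..11/40}" for i
      using that(2)[rule_format, of i] by (auto simp: v_def)
    have y: "\<bar>y $ i\<bar> \<le> 2" "\<bar>v $ i\<bar> \<le> 1" "\<bar>v $ i\<bar> \<le> 2" for i
      using that(2)[rule_format, of i] v[of i] by (auto simp: abs_le_iff)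
    have h: "h \<in> {-1/40..11/40}" using v unfolding h_def .
    have z: "\<bar>\<zeta>\<bar> \<le> 20" "\<chi>2 \<zeta> = 1" using that unfolding \<zeta>_def by (auto intro!: \<chi>2)
    have vs: "\<bar>(v + s *\<^sub>R axis i0 1) $ i\<bar> \<le> 2" if "h + s \<in> {-2..2}" for s i
      using that y(2)[of i] by (cases "i = i0") (auto simp: axis_def h_def)
    have hs: "(v + s *\<^sub>R axis i0 1) $ i0 = h + s" for s by (simp add: h_def axis_def)
    have C': "C (x, y, z) = (x, v, z)" unfolding v_def by (rule C(2)) (use that y in auto)
    have Z': "Z (x, v, z) = (x, v, 2/3 * z)" by (rule Z(2)) (use that y in \<open>auto intro: order_trans\<close>)
    have H1': "H1 (x, v, 2/3 * z) = (x, v, \<zeta>)"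
    proof -
      have "?ok x v (2/3 * z)" using that y(2) by (auto intro: order_trans[OF y(2)])
      from H1(2)[OF this] show ?thesis using that by (simp add: \<chi>1 \<zeta>_def)
    qed
    have S1: "R1 (t, v + s *\<^sub>R axis i0 1, \<zeta>) = (t - (h + s - 1/2), v + s *\<^sub>R axis i0 1, \<zeta>)"
      if "\<bar>t\<bar> \<le> 20" "h + s \<in> {-2..2}" for t s
      using R1(2)[of t "v + s *\<^sub>R axis i0 1" \<zeta>] that z vs[OF that(2)] unfolding hs by simp
    have S2: "R2 (t, v + s *\<^sub>R axis i0 1, \<zeta>) = (t, v + (s + (t - 1/2)) *\<^sub>R axis i0 1, \<zeta>)"
      if "\<bar>t\<bar> \<le> 20" "h + s \<in> {-2..2}" for t s
      using R2(2)[of t "v + s *\<^sub>R axis i0 1" \<zeta>] that z vs[OF that(2)]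
      by (simp add: scaleR_add_left add.assoc)
    have r0: "(x, v, \<zeta>) = (x, v + 0 *\<^sub>R axis i0 1, \<zeta>)" by simp
    have r1: "R1 (x, v, \<zeta>) = (x - (h - 1/2), v + 0 *\<^sub>R axis i0 1, \<zeta>)"
      unfolding r0 by (subst S1) (use that h in auto)
    have r2: "R2 (x - (h - 1/2), v + 0 *\<^sub>R axis i0 1, \<zeta>)
        = (x - (h - 1/2), v + (x - h) *\<^sub>R axis i0 1, \<zeta>)"
      by (subst S2) (use that h in auto)
    have r3: "R1 (x - (h - 1/2), v + (x - h) *\<^sub>R axis i0 1, \<zeta>)
        = (1 - h, v + (x - h) *\<^sub>R axis i0 1, \<zeta>)"
      by (subst S1) (use that h in auto)
    have r4: "R1 (1 - h, v + (x - h) *\<^sub>R axis i0 1, \<zeta>)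
        = (3/2 - h - x, v + (x - h) *\<^sub>R axis i0 1, \<zeta>)"
      by (subst S1) (use that h in auto)
    have r5: "R2 (3/2 - h - x, v + (x - h) *\<^sub>R axis i0 1, \<zeta>)
        = (3/2 - h - x, v + (1 - 2 * h) *\<^sub>R axis i0 1, \<zeta>)"
      by (subst S2) (use that h in auto)
    have r6: "R1 (3/2 - h - x, v + (1 - 2 * h) *\<^sub>R axis i0 1, \<zeta>)
        = (1 - x, v + (1 - 2 * h) *\<^sub>R axis i0 1, \<zeta>)"
      by (subst S1) (use that h in auto)
    define v' where "v' = v + (1 - 2 * h) *\<^sub>R axis i0 1"
    have v'0: "v' $ i0 = 1 - h" unfolding v'_def hs by simp
    have v'b: "\<bar>v' $ i\<bar> \<le> 2" for i unfolding v'_def by (rule vs) (use h in auto)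
    have h2: "H2 (1 - x, v', \<zeta>) = (1 - x, v', 2/3 * z + 1/3)"
    proof -
      have "?ok (1 - x) v' \<zeta>" using that(1) z v'b by (auto simp: abs_le_iff)
      from H2(2)[OF this] show ?thesis using h by (simp add: v'0 \<chi>1 \<zeta>_def)
    qed
    have l: "L (1 - x, v', 2/3 * z + 1/3) = (lam * (1 - x), v', 2/3 * z + 1/3)"
      by (rule L(2)) (use that v'b in auto)
    have "v' = (\<chi> i. if i = i0 then 1 - 1/4 * y $ i else 1/4 * y $ i)"
      using v'0 by (auto simp: vec_eq_iff v'_def h_def v_def axis_def)
    then show ?thesis
      unfolding \<Phi>_def C' Z' H1' r1 r2 r3 r4 r5 r6 unfolding v'_def[symmetric] h2 l by simp
  qed
  ultimately show ?thesis by blast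
qed

subsection \<open>Orbits with prescribed itinerary near an affine horseshoe\<close>

text \<open>The contraction principle for the uniform distance, which may be infinite between two
  sequences. It suffices that the start is moved by a bounded amount: the iterates are then Cauchy
  at each index, with geometric rates that do not depend on the index.\<close>

lemma sequence_fixpoint:
  fixes T :: "('i \<Rightarrow> 'b::complete_space) \<Rightarrow> 'i \<Rightarrow> 'b"
  assumes closed: "\<And>k. closed (X k)"
    and inX: "\<And>y k. (\<And>j. y j \<in> X j) \<Longrightarrow> T y k \<in> X k"
    and contr: "\<And>y y' B k. (\<And>j. y j \<in> X j) \<Longrightarrow> (\<And>j. y' j \<in> X j) \<Longrightarrow>
       (\<And>j. dist (y j) (y' j) \<le> B) \<Longrightarrow> dist (T y k) (T y' k) \<le> c * B"
    and c: "0 \<le> c" "c < 1"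
    and y0: "\<And>k. y0 k \<in> X k" "\<And>k. dist (y0 k) (T y0 k) \<le> B0"
  shows "\<exists>y. (\<forall>k. y k \<in> X k \<and> dist (y0 k) (y k) \<le> B0 / (1 - c)) \<and> T y = y"
proof -
  define Y where "Y n = (T ^^ n) y0" for n
  have Y_Suc: "Y (Suc n) = T (Y n)" for n by (simp add: Y_def)
  have YX: "Y n k \<in> X k" for n k
  proof (induction n arbitrary: k)
    case 0 show ?case using y0 by (simp add: Y_def)
  next
    case (Suc n) then show ?case unfolding Y_Suc by (intro inX)
  qed
  have step: "dist (Y n k) (Y (Suc n) k) \<le> B0 * c ^ n" for n k
  proof (induction n arbitrary: k)
    case 0 show ?case using y0 by (simp add: Y_def)
  next
    case (Suc n)
    have "dist (T (Y n) k) (T (Y (Suc n)) k) \<le> c * (B0 * c ^ n)"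
      by (rule contr) (use YX Suc in auto)
    then show ?case by (simp add: Y_Suc mult_ac)
  qed
  have B0: "B0 \<ge> 0" using y0(2) zero_le_dist order_trans by blast
  have far: "dist (Y n k) (Y (n + m) k) \<le> B0 * c ^ n / (1 - c) * (1 - c ^ m)" for n m k
  proof (induction m)
    case (Suc m)
    have "dist (Y n k) (Y (n + Suc m) k) \<le> dist (Y n k) (Y (n + m) k) + dist (Y (n + m) k) (Y (Suc (n + m)) k)"
      by (simp add: dist_triangle)
    also have "\<dots> \<le> B0 * c ^ n / (1 - c) * (1 - c ^ m) + B0 * c ^ (n + m)"
      by (intro add_mono Suc step)
    also have "\<dots> = B0 * c ^ n / (1 - c) * (1 - c ^ Suc m)"
      using c by (simp add: field_simps power_add)
    finally show ?case .
  qed simp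
  have far': "dist (Y n k) (Y m k) \<le> B0 * c ^ n / (1 - c)" if "n \<le> m" for n m k
  proof -
    have "dist (Y n k) (Y m k) \<le> B0 * c ^ n / (1 - c) * (1 - c ^ (m - n))"
      using far[of n k "m - n"] that by simp
    also have "\<dots> \<le> B0 * c ^ n / (1 - c) * 1"
      using c B0 by (intro mult_left_mono) auto
    finally show ?thesis by simp
  qed
  have lim0: "(\<lambda>n. B0 * c ^ n / (1 - c)) \<longlonglongrightarrow> 0"
    using c by (auto intro!: tendsto_eq_intros LIMSEQ_power_zero)
  have "Cauchy (\<lambda>n. Y n k)" for k
  proof (rule metric_CauchyI)
    fix e :: real assume "0 < e"
    then obtain N where N: "B0 * c ^ N / (1 - c) < e / 2"
      using order_tendstoD(2)[OF lim0, of "e / 2"] by (auto simp: eventually_sequentially)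
    have "dist (Y m k) (Y n k) < e" if "m \<ge> N" "n \<ge> N" for m n
      using dist_triangle3[of "Y m k" "Y n k" "Y N k"] far'[OF that(1), of k] far'[OF that(2), of k] N by linarith
    then show "\<exists>M. \<forall>m\<ge>M. \<forall>n\<ge>M. dist (Y m k) (Y n k) < e" by blast
  qed
  then have "\<exists>l. (\<lambda>n. Y n k) \<longlonglongrightarrow> l" for k
    using Cauchy_convergent_iff convergent_def by blast
  then obtain y where y: "\<And>k. (\<lambda>n. Y n k) \<longlonglongrightarrow> y k" by metis
  have yX: "y k \<in> X k" for k
    by (rule closed_sequentially[OF closed _ y]) (rule YX)
  have dY: "dist (Y n k) (y k) \<le> B0 * c ^ n / (1 - c)" for n k
  proof (rule LIMSEQ_le_const2[OF tendsto_dist[OF tendsto_const y]])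
    show "\<exists>N. \<forall>m\<ge>N. dist (Y n k) (Y m k) \<le> B0 * c ^ n / (1 - c)" using far' by blast
  qed
  have "T y k = y k" for k
  proof -
    have b: "dist (Y (Suc n) k) (T y k) \<le> c * (B0 * c ^ n / (1 - c))" for n
      unfolding Y_Suc by (rule contr) (use YX yX dY in auto)
    have "(\<lambda>n. c * (B0 * c ^ n / (1 - c))) \<longlonglongrightarrow> c * 0" by (intro tendsto_intros lim0)
    then have "(\<lambda>n. c * (B0 * c ^ n / (1 - c))) \<longlonglongrightarrow> 0" by simp
    then have "(\<lambda>n. dist (Y (Suc n) k) (T y k)) \<longlonglongrightarrow> 0"
      by (rule Lim_null_comparison[rotated]) (use b in simp)
    then have "(\<lambda>n. Y (Suc n) k) \<longlonglongrightarrow> T y k"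
      unfolding tendsto_dist_iff[of "\<lambda>n. Y (Suc n) k"] .
    moreover have "(\<lambda>n. Y (Suc n) k) \<longlonglongrightarrow> y k" using y by (rule LIMSEQ_Suc)
    ultimately show ?thesis using LIMSEQ_unique by blast
  qed
  then show ?thesis using yX dY[of 0] by (intro exI[of _ y]) (auto simp: Y_def)
qed

text \<open>The first coordinate is expanded with slope \<open>\<beta> i\<close>, the factor
  \<open>'s\<close> is contracted with linear part \<open>A' i\<close>; the Boolean names the leg.
  By \<open>I_inv\<close> the inverse branch of leg \<open>i\<close> brings either interval into
  \<open>I i\<close>, by \<open>Q_inv\<close> the fibre maps send \<open>Q\<close> into itself, both
  with a margin \<eta> for perturbations. The thresholds 100, 2/3 and 1/100 keep the perturbed rate
  at most 7/10.\<close>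

locale affine_horseshoe =
  fixes \<beta> \<alpha> :: "bool \<Rightarrow> real" and A A' :: "bool \<Rightarrow> 's::euclidean_space \<Rightarrow> 's"
    and I :: "bool \<Rightarrow> real set" and Q :: "'s set" and \<eta> :: real
  assumes \<eta>: "0 < \<eta>" "\<eta> \<le> 1/100"
    and \<beta>: "\<And>i. \<bar>\<beta> i\<bar> \<ge> 100"
    and A': "\<And>i. linear (A' i)" "\<And>i s. norm (A' i s) \<le> 2/3 * norm s"
    and A: "\<And>i s t. A i s - A i t = A' i (s - t)"
    and I: "\<And>i. compact (I i)" "\<And>i. convex (I i)" "\<And>i. I i \<noteq> {}" "I True \<inter> I False = {}"
    and Q: "compact Q" "convex Q" "Q \<noteq> {}"
    and I_inv: "\<And>u i j e. u \<in> I j \<Longrightarrow> \<bar>e\<bar> \<le> \<eta> \<Longrightarrow> (u - \<alpha> i - e) / \<beta> i \<in> I i"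
    and Q_inv: "\<And>s e i. s \<in> Q \<Longrightarrow> norm e \<le> \<eta> \<Longrightarrow> A i s + e \<in> Q"
begin

definition F :: "bool \<Rightarrow> real \<times> 's \<Rightarrow> real \<times> 's" where
  "F i w = (\<alpha> i + \<beta> i * fst w, A i (snd w))"

definition F' :: "bool \<Rightarrow> real \<times> 's \<Rightarrow> real \<times> 's" where
  "F' i v = (\<beta> i * fst v, A' i (snd v))"

definition V :: "bool \<Rightarrow> (real \<times> 's) set" where
  "V i = I i \<times> Q"

definition near :: "(real \<times> 's \<Rightarrow> real \<times> 's) \<Rightarrow> bool" where
  "near g \<longleftrightarrow> (\<forall>i. \<forall>w\<in>V i. g differentiable (at w) \<and> norm (g w - F i w) \<le> \<eta> \<and>
     (\<forall>v. norm (frechet_derivative g (at w) v - F' i v) \<le> \<eta> * norm v))"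

lemma V_disjoint: "w \<in> V i \<Longrightarrow> w \<in> V j \<Longrightarrow> i = j"
  using I(4) unfolding V_def by (cases i; cases j) auto

lemma compact_V: "compact (V i)" and convex_V: "convex (V i)"
  unfolding V_def using I Q by (auto intro: compact_Times convex_Times)

lemma F_diff: "F i w - F i w' = F' i (w - w')"
  unfolding F_def F'_def by (simp add: A right_diff_distrib)

lemma linear_F': "linear (F' i)"
  unfolding F'_def using A'(1)[of i]
  by (auto intro!: linearI simp: linear_add linear_cmul algebra_simps)

lemma has_derivative_F: "(F i has_derivative F' i) (at w within S)"
proof -
  have b: "bounded_linear (F' i)" using linear_F' linear_conv_bounded_linear by blast
  have "F i = (\<lambda>w. F i 0 + F' i w)"
  proof
    show "F i w = F i 0 + F' i w" for w using F_diff[of i w 0] by (metis add.commute diff_add_cancel diff_zero)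
  qed
  then show ?thesis
    using has_derivative_add[OF has_derivative_const bounded_linear_imp_has_derivative[OF b], of "F i 0"]
    by (metis (no_types, lifting) add_0 ext)
qed

text \<open>Mean value inequality on the convex leg: the deviation from the affine model has
  derivative at most \<eta>.\<close>

lemma near_lipschitz:
  assumes "near g" "w \<in> V i" "w' \<in> V i"
  shows "norm ((g w - F i w) - (g w' - F i w')) \<le> \<eta> * norm (w - w')"
proof (rule differentiable_bound[OF convex_V _ _ assms(2,3)])
  fix x assume x: "x \<in> V i"
  then have "(g has_derivative frechet_derivative g (at x)) (at x)"
    using assms(1) frechet_derivative_works unfolding near_def by blast
  then show "((\<lambda>w. g w - F i w) has_derivative
      (\<lambda>v. frechet_derivative g (at x) v - F' i v)) (at x within V i)"
    by (rule has_derivative_diff[OF has_derivative_at_withinI has_derivative_F])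
  show "onorm (\<lambda>v. frechet_derivative g (at x) v - F' i v) \<le> \<eta>"
    by (rule onorm_le) (use assms(1) x in \<open>auto simp: near_def\<close>)
qed

lemma fst_le_norm: "\<bar>fst (w :: real \<times> 's)\<bar> \<le> norm w" and snd_le_norm: "norm (snd w) \<le> norm w"
  using norm_fst_le[of "fst w" "snd w"] norm_snd_le[of "snd w" "fst w"] by auto

lemma norm_le_fst_snd: "norm (w :: real \<times> 's) \<le> \<bar>fst w\<bar> + norm (snd w)"
  using norm_Pair_le[of "fst w" "snd w"] by simp

text \<open>The recursion is solved for the unstable coordinate from the future, dividing by
  \<beta>, and for the stable one from the past. This is a fixed point equation with rate (1 +
  \<eta>) / 100 + 2/3 + \<eta>, at most 7/10. It has two uses: orbits of nonlinear maps confined to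
  the legs, and bounded solutions of the linear cocycle with an impulse.\<close>

lemma sequence_solution:
  fixes C :: "int \<Rightarrow> 's \<Rightarrow> 's" and e :: "int \<Rightarrow> real \<times> 's \<Rightarrow> real \<times> 's" and shift :: "int \<Rightarrow> real"
    and a :: "int \<Rightarrow> bool"
  defines "T y k \<equiv> ((fst (y (k + 1)) - shift k - fst (e k (y k))) / \<beta> (a k),
      C (k - 1) (snd (y (k - 1))) + snd (e (k - 1) (y (k - 1))))"
  assumes X: "\<And>k. closed (X k)" and C: "\<And>k s t. C k s - C k t = A' (a k) (s - t)"
    and e: "\<And>k w w'. w \<in> X k \<Longrightarrow> w' \<in> X k \<Longrightarrow> norm (e k w - e k w') \<le> \<eta> * norm (w - w')"
    and inX: "\<And>y k. (\<And>j. y j \<in> X j) \<Longrightarrow> T y k \<in> X k"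
    and start: "\<And>k. start k \<in> X k" "\<And>k. dist (start k) (T start k) \<le> D"
  shows "\<exists>y. (\<forall>k. y k \<in> X k) \<and> (\<forall>k. dist (start k) (y k) \<le> D / (1 - 7/10)) \<and>
    (\<forall>k. y (k + 1) = (shift k + \<beta> (a k) * fst (y k), C k (snd (y k))) + e k (y k))"
proof -
  have \<beta>0: "\<beta> i \<noteq> 0" for i using \<beta>[of i] by auto
  have "\<exists>y. (\<forall>k. y k \<in> X k \<and> dist (start k) (y k) \<le> D / (1 - 7/10)) \<and> T y = y"
  proof (rule sequence_fixpoint[OF X inX])
    fix y y' B k
    assume y: "\<And>j. y j \<in> X j" and y': "\<And>j. y' j \<in> X j" and B: "\<And>j. dist (y j) (y' j) \<le> B"
    have B0: "B \<ge> 0" using B[of 0] zero_le_dist order_trans by blast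
    have dB: "norm (y j - y' j) \<le> B" for j using B by (simp add: dist_norm)
    have ed: "norm (e j (y j) - e j (y' j)) \<le> \<eta> * B" for j
      by (rule order_trans[OF e[OF y y'] mult_left_mono[OF dB less_imp_le[OF \<eta>(1)]]])
    have "T y k - T y' k = (((fst (y (k+1)) - fst (y' (k+1))) - (fst (e k (y k)) - fst (e k (y' k)))) / \<beta> (a k),
        A' (a (k-1)) (snd (y (k-1)) - snd (y' (k-1))) + (snd (e (k-1) (y (k-1))) - snd (e (k-1) (y' (k-1)))))"
      unfolding T_def by (simp add: diff_divide_distrib add_divide_distrib C[symmetric])
    then have "norm (T y k - T y' k) \<le>
        \<bar>((fst (y (k+1)) - fst (y' (k+1))) - (fst (e k (y k)) - fst (e k (y' k)))) / \<beta> (a k)\<bar> +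
        norm (A' (a (k-1)) (snd (y (k-1)) - snd (y' (k-1))) + (snd (e (k-1) (y (k-1))) - snd (e (k-1) (y' (k-1)))))"
      using norm_le_fst_snd by (metis fst_conv snd_conv)
    also have "\<dots> \<le> (B + \<eta> * B) / 100 + (2/3 * B + \<eta> * B)"
    proof (rule add_mono)
      have "\<bar>(fst (y (k+1)) - fst (y' (k+1))) - (fst (e k (y k)) - fst (e k (y' k)))\<bar> \<le> B + \<eta> * B"
        using fst_le_norm[of "y (k+1) - y' (k+1)"] dB[of "k+1"] fst_le_norm[of "e k (y k) - e k (y' k)"] ed[of k]
        unfolding fst_diff by linarith
      then show "\<bar>((fst (y (k+1)) - fst (y' (k+1))) - (fst (e k (y k)) - fst (e k (y' k)))) / \<beta> (a k)\<bar> \<le> (B + \<eta> * B) / 100"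
        unfolding abs_divide by (intro frac_le \<beta>) auto
      have "norm (A' (a (k-1)) (snd (y (k-1)) - snd (y' (k-1)))) \<le> 2/3 * B"
        using A'(2)[of "a (k-1)" "snd (y (k-1)) - snd (y' (k-1))"] snd_le_norm[of "y (k-1) - y' (k-1)"] dB[of "k-1"]
        unfolding snd_diff by linarith
      moreover have "norm (snd (e (k-1) (y (k-1))) - snd (e (k-1) (y' (k-1)))) \<le> \<eta> * B"
        using snd_le_norm[of "e (k-1) (y (k-1)) - e (k-1) (y' (k-1))"] ed[of "k-1"] unfolding snd_diff by linarith
      ultimately show "norm (A' (a (k-1)) (snd (y (k-1)) - snd (y' (k-1)))
           + (snd (e (k-1) (y (k-1))) - snd (e (k-1) (y' (k-1))))) \<le> 2/3 * B + \<eta> * B"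
        by (intro norm_triangle_le) linarith
    qed
    also have "\<dots> \<le> 7/10 * B"
      using mult_right_mono[OF \<eta>(2) B0] B0 by argo
    finally show "dist (T y k) (T y' k) \<le> 7/10 * B" by (simp add: dist_norm)
  qed (use start in auto)
  then obtain y where y: "\<And>k. y k \<in> X k" "\<And>k. dist (start k) (y k) \<le> D / (1 - 7/10)" "T y = y" by blast
  have "y (k + 1) = (shift k + \<beta> (a k) * fst (y k), C k (snd (y k))) + e k (y k)" for k
  proof (rule prod_eqI)
    have "fst (y k) = (fst (y (k + 1)) - shift k - fst (e k (y k))) / \<beta> (a k)"
      using fun_cong[OF y(3), of k] unfolding T_def by (metis fst_conv)
    then have "\<beta> (a k) * fst (y k) = fst (y (k + 1)) - shift k - fst (e k (y k))"
      using \<beta>0 by (simp add: field_simps)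
    then show "fst (y (k + 1)) = fst ((shift k + \<beta> (a k) * fst (y k), C k (snd (y k))) + e k (y k))" by simp
    show "snd (y (k + 1)) = snd ((shift k + \<beta> (a k) * fst (y k), C k (snd (y k))) + e k (y k))"
      using arg_cong[where f = snd, OF fun_cong[OF y(3), of "k + 1"]] unfolding T_def by simp
  qed
  with y(1,2) show ?thesis by (intro exI[of _ y] conjI allI)
qed

text \<open>Sequences visiting the prescribed legs are preserved by the fixed point operator, by
  \<open>I_inv\<close> in the first coordinate and \<open>Q_inv\<close> in the fibre, so every
  two-sided itinerary is realised.\<close>

lemma orbit_exists:
  assumes g: "near g"
  shows "\<exists>y::int \<Rightarrow> _. \<forall>k. y k \<in> V (a k) \<and> g (y k) = y (k + 1)"
proof -
  define e where "e k w = g w - F (a k) w" for k w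
  have eb: "norm (e k w) \<le> \<eta>" if "w \<in> V (a k)" for k w
    using g that by (auto simp: near_def e_def)
  have inX: "((fst (y (k + 1)) - \<alpha> (a k) - fst (e k (y k))) / \<beta> (a k),
      A (a (k - 1)) (snd (y (k - 1))) + snd (e (k - 1) (y (k - 1)))) \<in> V (a k)"
    if y: "\<And>j. y j \<in> V (a j)" for y k
  proof -
    have "\<bar>fst (e k (y k))\<bar> \<le> \<eta>" "norm (snd (e (k - 1) (y (k - 1)))) \<le> \<eta>"
      using eb[OF y] fst_le_norm snd_le_norm order_trans by blast+
    then show ?thesis
      using y[of "k + 1"] y[of "k - 1"] I_inv Q_inv unfolding V_def by (auto simp: mem_Times_iff)
  qed
  \<comment> \<open>Any sequence in the legs can serve as start, since the legs are bounded.\<close>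
  define y0 where "y0 k = (SOME w. w \<in> V (a k))" for k :: int
  have y0: "y0 k \<in> V (a k)" for k
    unfolding y0_def some_in_eq V_def using I(3) Q(3) by simp
  have "bounded (V True \<union> V False)" using compact_V compact_imp_bounded by blast
  then obtain D where D': "\<And>w w'. w \<in> V True \<union> V False \<Longrightarrow> w' \<in> V True \<union> V False \<Longrightarrow> dist w w' \<le> D"
    unfolding bounded_two_points by blast
  have "w \<in> V i \<Longrightarrow> w \<in> V True \<union> V False" for w i by (cases i) auto
  then have D: "dist w w' \<le> D" if "w \<in> V i" "w' \<in> V j" for w w' i j using D' that by blast
  obtain y where y: "\<And>k. y k \<in> V (a k)"
    "\<And>k. y (k + 1) = (\<alpha> (a k) + \<beta> (a k) * fst (y k), A (a k) (snd (y k))) + e k (y k)"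
    using sequence_solution[where X = "\<lambda>k. V (a k)" and C = "\<lambda>k. A (a k)" and e = e and a = a
        and shift = "\<lambda>k. \<alpha> (a k)", OF compact_imp_closed[OF compact_V] A _ inX y0 D[OF y0 inX[OF y0]]]
      near_lipschitz[OF g] unfolding e_def by blast
  have "g (y k) = y (k + 1)" for k unfolding y(2)[of k] by (simp add: e_def F_def)
  then show ?thesis using y(1) by blast
qed

text \<open>One estimate with three uses: \<delta> = 0 with N tending to infinity gives uniqueness,
  \<delta> = 0 with a finite window gives continuity of the coding, and positive \<delta> with N
  tending to infinity gives dependence on the map. The difference at time \<open>k\<close> is at
  most 7/10 of the largest difference at the times \<open>k - 1\<close>, \<open>k\<close>,
  \<open>k + 1\<close>, plus 2\<delta>; the constant 7 exceeds the geometric sum 2 / (1 -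
  7/10).\<close>

lemma orbit_close:
  assumes g: "near g"
    and y: "\<And>k. \<bar>k\<bar> \<le> int N \<Longrightarrow> y k \<in> V (a k)" "\<And>k. \<bar>k\<bar> \<le> int N \<Longrightarrow> g (y k) = y (k + 1)"
    and y': "\<And>k. \<bar>k\<bar> \<le> int N \<Longrightarrow> y' k \<in> V (a k)" "\<And>k. \<bar>k\<bar> \<le> int N \<Longrightarrow> g' (y' k) = y' (k + 1)"
    and \<delta>: "\<And>i w. w \<in> V i \<Longrightarrow> norm (g w - g' w) \<le> \<delta>"
    and B: "\<And>k. \<bar>k\<bar> \<le> int N \<Longrightarrow> norm (y k - y' k) \<le> B"
  shows "norm (y 0 - y' 0) \<le> (7/10) ^ N * B + 7 * \<delta>"
proof -
  define d where "d k = norm (y k - y' k)" for k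
  have \<delta>0: "\<delta> \<ge> 0" using order_trans[OF norm_ge_zero \<delta>[OF y(1)[of 0]]] by simp
  have ed: "norm ((y (k+1) - y' (k+1)) - F' (a k) (y k - y' k)) \<le> \<eta> * d k + \<delta>" if k: "\<bar>k\<bar> \<le> int N" for k
  proof -
    have "(y (k+1) - y' (k+1)) - F' (a k) (y k - y' k)
        = ((g (y k) - F (a k) (y k)) - (g (y' k) - F (a k) (y' k))) + (g (y' k) - g' (y' k))"
      using y(2)[OF k] y'(2)[OF k] by (simp add: F_diff[symmetric])
    then have "norm ((y (k+1) - y' (k+1)) - F' (a k) (y k - y' k))
        \<le> norm ((g (y k) - F (a k) (y k)) - (g (y' k) - F (a k) (y' k))) + norm (g (y' k) - g' (y' k))"
      by (simp only: norm_triangle_ineq)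
    also have "\<dots> \<le> \<eta> * d k + \<delta>"
      using near_lipschitz[OF g y(1)[OF k] y'(1)[OF k]] \<delta>[OF y'(1)[OF k]] by (simp add: d_def)
    finally show ?thesis .
  qed
  have main: "d k \<le> 7/10 * M + 2 * \<delta>"
    if k: "\<bar>k\<bar> + 1 \<le> int N" and M: "d (k-1) \<le> M" "d k \<le> M" "d (k+1) \<le> M" for k M
  proof -
    have M0: "M \<ge> 0" using M(1) unfolding d_def using norm_ge_zero order_trans by blast
    have k': "\<bar>k\<bar> \<le> int N" "\<bar>k - 1\<bar> \<le> int N" using k by linarith+
    have e1: "norm ((y (k+1) - y' (k+1)) - F' (a k) (y k - y' k)) \<le> \<eta> * M + \<delta>"
      using ed[OF k'(1)] mult_left_mono[OF M(2), of \<eta>] \<eta> by linarith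
    have e2: "norm ((y k - y' k) - F' (a (k-1)) (y (k-1) - y' (k-1))) \<le> \<eta> * M + \<delta>"
    proof -
      have "norm ((y k - y' k) - F' (a (k-1)) (y (k-1) - y' (k-1))) \<le> \<eta> * d (k - 1) + \<delta>"
        using ed[OF k'(2)] by simp
      moreover have "\<eta> * d (k - 1) \<le> \<eta> * M" using mult_left_mono[OF M(1)] \<eta> by simp
      ultimately show ?thesis by linarith
    qed
    have "\<bar>\<beta> (a k) * fst (y k - y' k)\<bar> \<le> M + (\<eta> * M + \<delta>)"
      using fst_le_norm[of "y (k+1) - y' (k+1)"] M(3) e1
        fst_le_norm[of "(y (k+1) - y' (k+1)) - F' (a k) (y k - y' k)"]
      unfolding d_def F'_def by simp
    moreover have "100 * \<bar>fst (y k - y' k)\<bar> \<le> \<bar>\<beta> (a k) * fst (y k - y' k)\<bar>"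
      unfolding abs_mult by (intro mult_right_mono \<beta>) auto
    ultimately have u: "100 * \<bar>fst (y k - y' k)\<bar> \<le> M + (\<eta> * M + \<delta>)" by linarith
    have "norm (A' (a (k-1)) (snd (y (k-1) - y' (k-1)))) \<le> 2/3 * M"
      using A'(2)[of "a (k-1)" "snd (y (k-1) - y' (k-1))"] snd_le_norm[of "y (k-1) - y' (k-1)"] M(1)
      unfolding d_def by linarith
    moreover have "norm (snd (y k - y' k) - A' (a (k-1)) (snd (y (k-1) - y' (k-1)))) \<le> \<eta> * M + \<delta>"
      using snd_le_norm[of "(y k - y' k) - F' (a (k-1)) (y (k-1) - y' (k-1))"] e2
      unfolding F'_def by simp
    ultimately have "norm (snd (y k - y' k)) \<le> 2/3 * M + (\<eta> * M + \<delta>)"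
      using norm_triangle_sub[of "snd (y k - y' k)" "A' (a (k-1)) (snd (y (k-1) - y' (k-1)))"] by linarith
    then show ?thesis
      using norm_le_fst_snd[of "y k - y' k"] u mult_right_mono[OF \<eta>(2) M0] M0 \<delta>0 unfolding d_def by linarith
  qed
  have B0: "B \<ge> 0" using order_trans[OF norm_ge_zero B[of 0]] by simp
  \<comment> \<open>Each round of improvement costs one time at either end of the window.\<close>
  have "d k \<le> (7/10) ^ m * B + 7 * \<delta>" if "\<bar>k\<bar> + int m \<le> int N" for k m
    using that
  proof (induction m arbitrary: k)
    case 0
    then show ?case using B[of k] \<delta>0 by (simp add: d_def)
  next
    case (Suc m)
    have "d k \<le> 7/10 * ((7/10) ^ m * B + 7 * \<delta>) + 2 * \<delta>"
      by (rule main) (use Suc.prems in \<open>auto intro!: Suc.IH\<close>)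
    moreover have "(7/10) ^ Suc m * B = 7/10 * ((7/10) ^ m * B)" by simp
    ultimately show ?case using \<delta>0 by argo
  qed
  from this[of 0 N] show ?thesis by (simp add: d_def)
qed

subsection \<open>Exponential dichotomy of the derivative cocycle\<close>

text \<open>In the unstable cone the error is at most a fiftieth of \<open>|fst v|\<close>, so the
  first coordinate grows by 98 and the image lies deep inside the cone again.\<close>

lemma expanding_step:
  assumes st: "norm (v' - F' i v) \<le> \<eta> * norm v" and cone: "norm (snd v) \<le> \<bar>fst v\<bar>"
  shows "98 * \<bar>fst v\<bar> \<le> \<bar>fst v'\<bar>" "norm (snd v') \<le> \<bar>fst v\<bar>"
proof -
  have "norm v \<le> 2 * \<bar>fst v\<bar>" using norm_le_fst_snd[of v] cone by linarith
  then have "\<eta> * norm v \<le> 1/100 * (2 * \<bar>fst v\<bar>)" using \<eta> by (intro mult_mono) auto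
  then have e: "norm (v' - F' i v) \<le> 1/50 * \<bar>fst v\<bar>" using st by linarith
  have "100 * \<bar>fst v\<bar> \<le> \<bar>\<beta> i * fst v\<bar>" unfolding abs_mult by (intro mult_right_mono \<beta>) auto
  moreover have "\<bar>fst v' - \<beta> i * fst v\<bar> \<le> 1/50 * \<bar>fst v\<bar>"
    using fst_le_norm[of "v' - F' i v"] e by (simp add: F'_def)
  ultimately show "98 * \<bar>fst v\<bar> \<le> \<bar>fst v'\<bar>" by linarith
  have "norm (snd v' - A' i (snd v)) \<le> 1/50 * \<bar>fst v\<bar>"
    using snd_le_norm[of "v' - F' i v"] e by (simp add: F'_def)
  moreover have "norm (A' i (snd v)) \<le> 2/3 * \<bar>fst v\<bar>" using A'(2)[of i "snd v"] cone by linarith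
  ultimately show "norm (snd v') \<le> \<bar>fst v\<bar>"
    using norm_triangle_sub[of "snd v'" "A' i (snd v)"] by linarith
qed

text \<open>In the complementary cone the fibre component contracts. That cone is not forward
  invariant; boundedness of the orbit has to keep a vector in it.\<close>

lemma contracting_step:
  assumes st: "norm (v' - F' i v) \<le> \<eta> * norm v" and cone: "\<bar>fst v\<bar> \<le> norm (snd v)"
  shows "norm (snd v') \<le> 7/10 * norm (snd v)"
proof -
  have "norm v \<le> 2 * norm (snd v)" using norm_le_fst_snd[of v] cone by linarith
  then have "\<eta> * norm v \<le> 1/100 * (2 * norm (snd v))" using \<eta> by (intro mult_mono) auto
  then have e: "norm (v' - F' i v) \<le> 1/50 * norm (snd v)" using st by linarith
  have "norm (snd v' - A' i (snd v)) \<le> 1/50 * norm (snd v)"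
    using snd_le_norm[of "v' - F' i v"] e by (simp add: F'_def)
  then show ?thesis
    using norm_triangle_sub[of "snd v'" "A' i (snd v)"] A'(2)[of i "snd v"] norm_ge_zero[of "snd v"] by linarith
qed

lemma unbounded_growth:
  fixes x :: "nat \<Rightarrow> real"
  assumes "\<And>n. c * x n \<le> x (Suc n)" "c > 1" "x 0 > 0" "\<And>n. x n \<le> B"
  shows False
proof -
  have "c ^ n * x 0 \<le> x n" for n
  proof (induction n)
    case (Suc n)
    have "c ^ Suc n * x 0 \<le> c * x n" using Suc assms(2) by (simp add: mult.assoc)
    then show ?case using assms(1) order_trans by blast
  qed simp
  moreover obtain n where "B / x 0 < c ^ n" using real_arch_pow[OF assms(2)] by blast
  ultimately show False using assms(3) assms(4)[of n]
    by (metis divide_less_eq not_le order.strict_trans2)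
qed

text \<open>A vector that enters the unstable cone stays there and grows by 98 per step. A bounded
  forward orbit therefore remains in the complementary cone, where the fibre component dominates and
  contracts.\<close>

lemma forward_bounded_decay:
  assumes st: "\<And>n. \<exists>i. norm (w (Suc n) - F' i (w n)) \<le> \<eta> * norm (w n)"
    and bd: "\<And>n. norm (w n) \<le> B"
  shows "norm (w n) \<le> 2 * (7/10) ^ n * norm (w 0)"
proof -
  have cone: "\<bar>fst (w n)\<bar> \<le> norm (snd (w n))" for n
  proof (rule ccontr)
    assume c: "\<not> ?thesis"
    have *: "norm (snd (w (n + m))) \<le> \<bar>fst (w (n + m))\<bar> \<and> \<bar>fst (w (n + m))\<bar> > 0" for m
    proof (induction m)
      case 0 then show ?case using c norm_ge_zero[of "snd (w n)"] by (simp del: norm_ge_zero)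
    next
      case (Suc m)
      obtain i where i: "norm (w (Suc (n + m)) - F' i (w (n + m))) \<le> \<eta> * norm (w (n + m))" using st by blast
      show ?case using expanding_step[OF i] Suc by auto
    qed
    have "98 * \<bar>fst (w (n + m))\<bar> \<le> \<bar>fst (w (n + Suc m))\<bar>" for m
    proof -
      obtain i where i: "norm (w (Suc (n + m)) - F' i (w (n + m))) \<le> \<eta> * norm (w (n + m))" using st by blast
      show ?thesis using expanding_step(1)[OF i] *[of m] by simp
    qed
    then show False
      using unbounded_growth[of 98 "\<lambda>m. \<bar>fst (w (n + m))\<bar>" B] *[of 0] order_trans[OF fst_le_norm bd]
      by auto
  qed
  have "norm (snd (w n)) \<le> (7/10) ^ n * norm (snd (w 0))" for n
  proof (induction n)
    case (Suc n)
    obtain i where i: "norm (w (Suc n) - F' i (w n)) \<le> \<eta> * norm (w n)" using st by blast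
    from contracting_step[OF i cone] Suc show ?case by simp
  qed simp
  moreover have "(7/10) ^ n * norm (snd (w 0)) \<le> (7/10) ^ n * norm (w 0)"
    by (intro mult_left_mono snd_le_norm) auto
  ultimately have "norm (snd (w n)) \<le> (7/10) ^ n * norm (w 0)" using order_trans by blast
  then show ?thesis using norm_le_fst_snd[of "w n"] cone[of n] by linarith
qed

text \<open>The index runs backwards in time. By invariance of the unstable cone, a vector outside
  it has its whole past outside, and its fibre component then grows by 10/7 per backward step. A
  bounded backward orbit thus stays in the unstable cone.\<close>

lemma backward_bounded_decay:
  assumes st: "\<And>n. \<exists>i. norm (w n - F' i (w (Suc n))) \<le> \<eta> * norm (w (Suc n))"
    and bd: "\<And>n. norm (w n) \<le> B"
  shows "norm (w n) \<le> 2 * (7/10) ^ n * norm (w 0)"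
proof -
  have cone: "norm (snd (w n)) \<le> \<bar>fst (w n)\<bar>" for n
  proof (rule ccontr)
    assume c: "\<not> ?thesis"
    have *: "\<bar>fst (w (n + m))\<bar> < norm (snd (w (n + m)))" for m
    proof (induction m)
      case 0 then show ?case using c by simp
    next
      case (Suc m)
      obtain i where i: "norm (w (n + m) - F' i (w (Suc (n + m)))) \<le> \<eta> * norm (w (Suc (n + m)))" using st by blast
      show ?case
      proof (rule ccontr)
        assume "\<not> ?case"
        then have "norm (snd (w (Suc (n + m)))) \<le> \<bar>fst (w (Suc (n + m)))\<bar>" by simp
        from expanding_step[OF i this] Suc show False by simp
      qed
    qed
    have "10/7 * norm (snd (w (n + m))) \<le> norm (snd (w (n + Suc m)))" for m
    proof -
      obtain i where i: "norm (w (n + m) - F' i (w (Suc (n + m)))) \<le> \<eta> * norm (w (Suc (n + m)))" using st by blast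
      show ?thesis using contracting_step[OF i] *[of "Suc m"] by simp
    qed
    then show False
      using unbounded_growth[of "10/7" "\<lambda>m. norm (snd (w (n + m)))" B]
        le_less_trans[OF abs_ge_zero *[of 0]] order_trans[OF snd_le_norm bd]
      by auto
  qed
  have "\<bar>fst (w n)\<bar> \<le> (7/10) ^ n * \<bar>fst (w 0)\<bar>" for n
  proof (induction n)
    case (Suc n)
    obtain i where i: "norm (w n - F' i (w (Suc n))) \<le> \<eta> * norm (w (Suc n))" using st by blast
    from expanding_step(1)[OF i cone] Suc have "\<bar>fst (w (Suc n))\<bar> \<le> 7/10 * ((7/10) ^ n * \<bar>fst (w 0)\<bar>)" by linarith
    then show ?case by simp
  qed simp
  moreover have "(7/10) ^ n * \<bar>fst (w 0)\<bar> \<le> (7/10) ^ n * norm (w 0)"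
    by (intro mult_left_mono fst_le_norm) auto
  ultimately have "\<bar>fst (w n)\<bar> \<le> (7/10) ^ n * norm (w 0)" using order_trans by blast
  then show ?thesis using norm_le_fst_snd[of "w n"] cone[of n] by linarith
qed

text \<open>Starting the forward decay at time \<open>-n\<close> bounds the vector at time 0 by
  \<open>2 * (7/10) ^ n * B\<close>, for every \<open>n\<close>.\<close>

lemma bounded_orbit_zero:
  fixes w :: "int \<Rightarrow> real \<times> 's"
  assumes st: "\<And>k. \<exists>i. norm (w (k + 1) - F' i (w k)) \<le> \<eta> * norm (w k)"
    and bd: "\<And>k. norm (w k) \<le> B"
  shows "w 0 = 0"
proof -
  have B0: "B \<ge> 0" using bd norm_ge_zero order_trans by blast
  have b: "norm (w 0) \<le> 2 * (7/10) ^ n * B" for n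
  proof -
    have "norm (w (int n - int n)) \<le> 2 * (7/10) ^ n * norm (w (int 0 - int n))"
    proof (rule forward_bounded_decay[of "\<lambda>m. w (int m - int n)"])
      show "\<exists>i. norm (w (int (Suc m) - int n) - F' i (w (int m - int n))) \<le> \<eta> * norm (w (int m - int n))" for m
        using st[of "int m - int n"] by (simp add: algebra_simps)
    qed (rule bd)
    also have "\<dots> \<le> 2 * (7/10) ^ n * B" by (intro mult_left_mono bd) auto
    finally show ?thesis by simp
  qed
  have "(\<lambda>n. 2 * (7/10) ^ n * B) \<longlonglongrightarrow> 2 * 0 * B"
    by (intro tendsto_intros LIMSEQ_power_zero) auto
  then have "norm (w 0) \<le> 0" using b by (intro LIMSEQ_le_const) auto
  then show ?thesis by simp
qed

text \<open>A bounded solution of the cocycle with an impulse \<open>v\<close> at time \<open>0\<close> splits \<open>v\<close> into a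
  forward bounded and a backward bounded part.\<close>

lemma dichotomy_split:
  fixes L :: "int \<Rightarrow> real \<times> 's \<Rightarrow> real \<times> 's"
  assumes lin: "\<And>k. linear (L k)" and st: "\<And>k v. norm (L k v - F' (a k) v) \<le> \<eta> * norm v"
  shows "\<exists>w B. (\<forall>k. norm (w k) \<le> B) \<and> (\<forall>k. w (k + 1) = L k (w k) + (if k = -1 then v else 0))"
proof -
  define q where "q k = (if k = -1 then v else 0)" for k :: int
  \<comment> \<open>The impulse is put into the error term, where it cancels in differences and
    leaves the Lipschitz constant unchanged.\<close>
  define e where "e k w = L k w - F' (a k) w + q k" for k w
  have e0: "e k 0 = q k" for k
    unfolding e_def by (simp add: linear_0[OF lin] linear_0[OF linear_F'])
  have ed: "norm (e k w - e k w') \<le> \<eta> * norm (w - w')" for k w w'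
  proof -
    have "e k w - e k w' = L k (w - w') - F' (a k) (w - w')"
      by (simp add: e_def linear_diff[OF lin] linear_diff[OF linear_F'])
    then show ?thesis using st by simp
  qed
  have A0: "A' (a k) 0 = 0" for k by (rule linear_0[OF A'(1)])
  have b: "dist 0 ((fst (0 :: real \<times> 's) - 0 - fst (e k 0)) / \<beta> (a k),
      A' (a (k - 1)) (snd (0 :: real \<times> 's)) + snd (e (k - 1) 0)) \<le> 2 * norm v" for k
  proof -
    have qv: "norm (q j) \<le> norm v" for j by (simp add: q_def)
    have "\<bar>- fst (q k) / \<beta> (a k)\<bar> \<le> norm v / 100"
      unfolding abs_divide abs_minus_cancel
      by (intro frac_le \<beta> order_trans[OF fst_le_norm qv]) auto
    moreover have "norm (snd (q (k - 1))) \<le> norm v" by (rule order_trans[OF snd_le_norm qv])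
    ultimately have "norm (- fst (q k) / \<beta> (a k), snd (q (k - 1))) \<le> 2 * norm v"
      using norm_le_fst_snd[of "(- fst (q k) / \<beta> (a k), snd (q (k - 1)))"] norm_ge_zero[of v]
      unfolding fst_conv snd_conv by argo
    then show ?thesis by (simp add: e0 A0)
  qed
  obtain y where y: "\<And>k. norm (y k) \<le> 2 * norm v / (1 - 7/10)"
    "\<And>k. y (k + 1) = (0 + \<beta> (a k) * fst (y k), A' (a k) (snd (y k))) + e k (y k)"
    using sequence_solution[where X = "\<lambda>k. UNIV" and C = "\<lambda>k. A' (a k)" and e = e and a = a
        and shift = "\<lambda>k. 0" and start = "\<lambda>k. 0", OF closed_UNIV linear_diff[OF A'(1), symmetric] ed UNIV_I UNIV_I b]
    by (auto simp del: dist_0_norm simp: dist_0_norm)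
  have "y (k + 1) = L k (y k) + q k" for k unfolding y(2)[of k] by (simp add: e_def F'_def)
  then show ?thesis using y(1) unfolding q_def by blast
qed

end

subsection \<open>Charts and lifts of Euclidean diffeomorphisms\<close>

lemma chart_facts:
  assumes "is_chart \<kappa>"
  shows chart_open_dom: "open (fst \<kappa>)" and chart_open_range: "open (snd \<kappa> ` fst \<kappa>)"
    and chart_inv_left: "\<And>p. p \<in> fst \<kappa> \<Longrightarrow> chart_inv \<kappa> (snd \<kappa> p) = p"
    and chart_inv_mem: "\<And>y. y \<in> snd \<kappa> ` fst \<kappa> \<Longrightarrow> chart_inv \<kappa> y \<in> fst \<kappa>"
    and chart_inv_right: "\<And>y. y \<in> snd \<kappa> ` fst \<kappa> \<Longrightarrow> snd \<kappa> (chart_inv \<kappa> y) = y"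
    and chart_continuous: "continuous_on (fst \<kappa>) (snd \<kappa>)"
    and chart_inv_continuous: "continuous_on (snd \<kappa> ` fst \<kappa>) (chart_inv \<kappa>)"
    and chart_open_image: "\<And>U. open U \<Longrightarrow> open (snd \<kappa> ` (fst \<kappa> \<inter> U))"
    and chart_inv_open_image: "\<And>W. open W \<Longrightarrow> W \<subseteq> snd \<kappa> ` fst \<kappa> \<Longrightarrow> open (chart_inv \<kappa> ` W)"
proof -
  obtain \<psi> where h: "homeomorphism (fst \<kappa>) (snd \<kappa> ` fst \<kappa>) (snd \<kappa>) \<psi>"
    and o: "open (fst \<kappa>)" "open (snd \<kappa> ` fst \<kappa>)"
    using assms unfolding is_chart_def by blast
  have inj: "inj_on (snd \<kappa>) (fst \<kappa>)"
    using homeomorphism_apply1[OF h] by (rule inj_on_inverseI)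
  show "open (fst \<kappa>)" "open (snd \<kappa> ` fst \<kappa>)" using o by auto
  show 1: "\<And>p. p \<in> fst \<kappa> \<Longrightarrow> chart_inv \<kappa> (snd \<kappa> p) = p"
    unfolding chart_inv_def using inj by (rule inv_into_f_f)
  show 2: "\<And>y. y \<in> snd \<kappa> ` fst \<kappa> \<Longrightarrow> chart_inv \<kappa> y \<in> fst \<kappa>"
    unfolding chart_inv_def by (rule inv_into_into)
  show 3: "\<And>y. y \<in> snd \<kappa> ` fst \<kappa> \<Longrightarrow> snd \<kappa> (chart_inv \<kappa> y) = y"
    unfolding chart_inv_def by (rule f_inv_into_f)
  show c: "continuous_on (fst \<kappa>) (snd \<kappa>)" using h homeomorphism_cont1 by blast
  have "chart_inv \<kappa> y = \<psi> y" if "y \<in> snd \<kappa> ` fst \<kappa>" for y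
    using that 1 homeomorphism_apply1[OF h] by auto
  then show c': "continuous_on (snd \<kappa> ` fst \<kappa>) (chart_inv \<kappa>)"
    using homeomorphism_cont2[OF h] by (metis (no_types, lifting) continuous_on_cong)
  show "open (snd \<kappa> ` (fst \<kappa> \<inter> U))" if "open U" for U
  proof -
    have "snd \<kappa> ` (fst \<kappa> \<inter> U) = (snd \<kappa> ` fst \<kappa>) \<inter> chart_inv \<kappa> -` U"
      using 1 2 3 by (auto simp: image_iff)
    then show ?thesis using continuous_open_preimage[OF c' o(2) that] by simp
  qed
  show "open (chart_inv \<kappa> ` W)" if "open W" "W \<subseteq> snd \<kappa> ` fst \<kappa>" for W
  proof -
    have "chart_inv \<kappa> ` W = fst \<kappa> \<inter> snd \<kappa> -` W"
    proof (intro set_eqI iffI)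
      fix p assume "p \<in> chart_inv \<kappa> ` W"
      then show "p \<in> fst \<kappa> \<inter> snd \<kappa> -` W" using that(2) 2 3 by auto
    next
      fix p assume "p \<in> fst \<kappa> \<inter> snd \<kappa> -` W"
      then show "p \<in> chart_inv \<kappa> ` W" using 1 by (metis IntD1 IntD2 imageI vimageD)
    qed
    then show ?thesis using continuous_open_preimage[OF c o(1) that(1)] by simp
  qed
qed

definition chart_lift :: "('a, 'f) chart \<Rightarrow> ('f \<Rightarrow> 'f) \<Rightarrow> 'a \<Rightarrow> 'a" where
  "chart_lift \<kappa> \<Phi> p = (if p \<in> fst \<kappa> then chart_inv \<kappa> (\<Phi> (snd \<kappa> p)) else p)"

text \<open>Two open sets cover the manifold: the chart domain, where the map is conjugate to
  \<Phi>, and the complement of the compact set \<open>P\<close>, where it is the identity. The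
  complement is open because compact sets are closed in a Hausdorff space.\<close>

lemma chart_lift_Ck_map:
  fixes A :: "('a::t2_space, 'e::euclidean_space) chart set" and \<kappa> :: "('a, 'f::euclidean_space) chart"
  assumes A: "smooth_atlas A" and \<kappa>: "is_chart \<kappa>" "\<And>d. d \<in> A \<Longrightarrow> smoothly_compatible \<kappa> d"
    and \<Phi>: "Ck_on k UNIV \<Phi>" "\<Phi> ` (snd \<kappa> ` fst \<kappa>) \<subseteq> snd \<kappa> ` fst \<kappa>"
    and K: "compact K" "K \<subseteq> snd \<kappa> ` fst \<kappa>" "\<And>w. w \<notin> K \<Longrightarrow> \<Phi> w = w"
  shows "Ck_map A k (chart_lift \<kappa> \<Phi>)"
proof -
  let ?f = "chart_lift \<kappa> \<Phi>"
  note k = chart_facts[OF \<kappa>(1)]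
  define P where "P = chart_inv \<kappa> ` K"
  have "compact P" unfolding P_def
    by (intro compact_continuous_image K continuous_on_subset[OF chart_inv_continuous[OF \<kappa>(1)]])
  then have oP: "open (- P)" using compact_imp_closed by blast
  have f1: "?f p = chart_inv \<kappa> (\<Phi> (snd \<kappa> p))" if "p \<in> fst \<kappa>" for p using that by (simp add: chart_lift_def)
  have f2: "?f p = p" if "p \<notin> P" for p
  proof (cases "p \<in> fst \<kappa>")
    case True
    then have "snd \<kappa> p \<notin> K" using that k(3)[OF True] unfolding P_def by force
    then show ?thesis using True K(3) k(3) by (simp add: f1)
  qed (simp add: chart_lift_def)
  have P: "P \<subseteq> fst \<kappa>" unfolding P_def using K(2) k(4) by blast
  have cov: "fst \<kappa> \<union> - P = UNIV" using P by blast
  have "continuous_on (fst \<kappa>) (\<lambda>p. chart_inv \<kappa> (\<Phi> (snd \<kappa> p)))"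
    by (rule continuous_on_compose2[OF k(7)], rule continuous_on_compose2[OF Ck_on_continuous[OF \<Phi>(1)] k(6)])
      (use \<Phi>(2) in auto)
  then have "continuous_on (fst \<kappa>) ?f" by (rule continuous_on_eq) (simp add: f1)
  moreover have "continuous_on (- P) ?f" by (rule continuous_on_eq[OF continuous_on_id]) (simp add: f2)
  ultimately have cont: "continuous_on UNIV ?f"
    using continuous_on_open_Un[OF k(1) oP] cov by metis
  have "Ck_on k (snd c ` (fst c \<inter> ?f -` fst d)) (in_charts c d ?f)" if cA: "c \<in> A" and dA: "d \<in> A" for c d
  proof -
    have ch: "is_chart c" "is_chart d" using A cA dA by (auto simp: smooth_atlas_def)
    note cc = chart_facts[OF ch(1)] and dd = chart_facts[OF ch(2)]
    define U where "U = ?f -` fst d"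
    have oU: "open U" unfolding U_def using cont dd(1) by (simp add: open_vimage)
    define S where "S b = snd c ` (fst c \<inter> (U \<inter> (if b then fst \<kappa> else - P)))" for b
    have oS: "open (S b)" for b unfolding S_def by (intro cc(8)) (use oU k(1) oP in auto)
    have SU: "snd c ` (fst c \<inter> U) = (\<Union>b\<in>UNIV. S b)"
      unfolding S_def UNIV_bool using cov by auto
    have "Ck_on k (S True) (\<lambda>x. snd d (chart_inv \<kappa> (\<Phi> (snd \<kappa> (chart_inv c x)))))"
    proof (rule Ck_on_compose[where T = "snd \<kappa> ` (fst \<kappa> \<inter> fst d)" and g = "\<lambda>w. snd d (chart_inv \<kappa> w)"])
      show "Ck_on k (snd \<kappa> ` (fst \<kappa> \<inter> fst d)) (\<lambda>w. snd d (chart_inv \<kappa> w))"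
        using \<kappa>(2)[OF dA] by (auto simp: smoothly_compatible_def smooth_on_def o_def)
      have "Ck_on k (snd c ` (fst \<kappa> \<inter> fst c)) (\<lambda>x. snd \<kappa> (chart_inv c x))"
        using \<kappa>(2)[OF cA] by (auto simp: smoothly_compatible_def smooth_on_def o_def)
      then have "Ck_on k (S True) (\<lambda>x. snd \<kappa> (chart_inv c x))"
        by (rule Ck_on_subset) (auto simp: S_def)
      then show "Ck_on k (S True) (\<lambda>x. \<Phi> (snd \<kappa> (chart_inv c x)))"
        by (intro Ck_on_compose[OF oS open_UNIV _ \<Phi>(1)]) auto
      show "(\<lambda>x. \<Phi> (snd \<kappa> (chart_inv c x))) ` S True \<subseteq> snd \<kappa> ` (fst \<kappa> \<inter> fst d)"
      proof clarsimp
        fix x assume "x \<in> S True"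
        then obtain p where p: "p \<in> fst c" "p \<in> U" "p \<in> fst \<kappa>" "x = snd c p" by (auto simp: S_def)
        have "\<Phi> (snd \<kappa> p) \<in> snd \<kappa> ` fst \<kappa>" using \<Phi>(2) p(3) by blast
        then have "?f p \<in> fst \<kappa>" "snd \<kappa> (?f p) = \<Phi> (snd \<kappa> p)" unfolding f1[OF p(3)] using k(4,5) by auto
        moreover have "?f p \<in> fst d" using p(2) by (simp add: U_def)
        ultimately show "\<Phi> (snd \<kappa> (chart_inv c x)) \<in> snd \<kappa> ` (fst \<kappa> \<inter> fst d)"
          using p cc(3) by (metis IntI imageI)
      qed
    qed (use oS k(8) dd(1) in auto)
    moreover have "snd d (chart_inv \<kappa> (\<Phi> (snd \<kappa> (chart_inv c x)))) = in_charts c d ?f x" if "x \<in> S True" for x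
      using that cc(3) by (auto simp: S_def in_charts_def f1)
    ultimately have 1: "Ck_on k (S True) (in_charts c d ?f)" by (rule Ck_on_eq[OF _ oS])
    have fp: "in_charts c d ?f x = snd d (chart_inv c x)" "x \<in> snd c ` (fst c \<inter> fst d)" if "x \<in> S False" for x
      using that cc(3) f2 by (auto simp: S_def in_charts_def U_def)
    have "Ck_on k (snd c ` (fst c \<inter> fst d)) (\<lambda>x. snd d (chart_inv c x))"
      using A cA dA by (auto simp: smooth_atlas_def smoothly_compatible_def smooth_on_def o_def)
    then have "Ck_on k (S False) (\<lambda>x. snd d (chart_inv c x))"
      by (rule Ck_on_subset) (use fp(2) in blast)
    then have 2: "Ck_on k (S False) (in_charts c d ?f)" by (rule Ck_on_eq[OF _ oS]) (simp add: fp(1))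
    have "Ck_on k (\<Union>b\<in>UNIV. S b) (in_charts c d ?f)"
    proof (rule Ck_on_open_UN[OF oS])
      show "Ck_on k (S b) (in_charts c d ?f)" for b using 1 2 by (cases b) auto
    qed
    then show ?thesis unfolding SU[symmetric] U_def .
  qed
  then show ?thesis using cont by (simp add: Ck_map_def)
qed

lemma chart_lift_Diff:
  fixes A :: "('a::t2_space, 'e::euclidean_space) chart set" and \<kappa> :: "('a, 'f::euclidean_space) chart"
  assumes A: "smooth_atlas A" and \<kappa>: "is_chart \<kappa>" "\<And>d. d \<in> A \<Longrightarrow> smoothly_compatible \<kappa> d"
    and \<Phi>: "cdiff k \<Phi>" "\<And>w. R < norm w \<Longrightarrow> \<Phi> w = w" and R: "cball 0 R \<subseteq> snd \<kappa> ` fst \<kappa>"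
  shows "chart_lift \<kappa> \<Phi> \<in> Diff A k"
proof -
  note k = chart_facts[OF \<kappa>(1)]
  have b: "bij \<Phi>" and ck: "Ck_on k UNIV \<Phi>" "Ck_on k UNIV (inv \<Phi>)" using \<Phi>(1) by (auto simp: cdiff_def)
  have l: "\<Phi> (inv \<Phi> w) = w" "inv \<Phi> (\<Phi> w) = w" for w
    using b by (auto simp: bij_is_surj bij_is_inj surj_f_inv_f)
  have inv: "inv \<Phi> w = w" if "R < norm w" for w using \<Phi>(2)[OF that] l(2)[of w] by simp
  \<comment> \<open>If the image of a chart point lay outside the ball it would be a fixed point,
    hence equal to its preimage by injectivity. So no point leaves the range of the chart.\<close>
  have sub: "f ` (snd \<kappa> ` fst \<kappa>) \<subseteq> snd \<kappa> ` fst \<kappa>"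
    if f: "\<And>w. R < norm w \<Longrightarrow> f w = w" "inj f" for f
  proof
    fix z assume "z \<in> f ` (snd \<kappa> ` fst \<kappa>)"
    then obtain w where w: "w \<in> snd \<kappa> ` fst \<kappa>" "z = f w" by blast
    show "z \<in> snd \<kappa> ` fst \<kappa>"
    proof (cases "norm z \<le> R")
      case True then show ?thesis using R by (auto simp: mem_cball)
    next
      case False
      then have "f z = f w" using f(1)[of z] w by simp
      then show ?thesis using f(2) w(1) by (metis injD)
    qed
  qed
  have s1: "\<Phi> ` (snd \<kappa> ` fst \<kappa>) \<subseteq> snd \<kappa> ` fst \<kappa>" by (rule sub[OF \<Phi>(2) bij_is_inj[OF b]])
  have s2: "inv \<Phi> ` (snd \<kappa> ` fst \<kappa>) \<subseteq> snd \<kappa> ` fst \<kappa>"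
    by (rule sub[OF inv bij_is_inj[OF bij_imp_bij_inv[OF b]]])
  have c: "chart_lift \<kappa> f (chart_lift \<kappa> g p) = p"
    if "\<And>w. f (g w) = w" "g ` (snd \<kappa> ` fst \<kappa>) \<subseteq> snd \<kappa> ` fst \<kappa>" for f g p
  proof (cases "p \<in> fst \<kappa>")
    case True
    then have "g (snd \<kappa> p) \<in> snd \<kappa> ` fst \<kappa>" using that(2) by blast
    then show ?thesis using True that(1) k(3,4,5) by (simp add: chart_lift_def)
  qed (simp add: chart_lift_def)
  have "chart_lift \<kappa> \<Phi> \<circ> chart_lift \<kappa> (inv \<Phi>) = id" "chart_lift \<kappa> (inv \<Phi>) \<circ> chart_lift \<kappa> \<Phi> = id"
    using c[of \<Phi> "inv \<Phi>"] c[of "inv \<Phi>" \<Phi>] l s1 s2 by (auto simp: fun_eq_iff)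
  then have "bij (chart_lift \<kappa> \<Phi>)" "inv (chart_lift \<kappa> \<Phi>) = chart_lift \<kappa> (inv \<Phi>)"
    using o_bij inv_unique_comp by blast+
  moreover have "Ck_map A k (chart_lift \<kappa> \<Phi>)"
    by (rule chart_lift_Ck_map[OF A \<kappa> ck(1) s1 compact_cball R]) (use \<Phi>(2) in auto)
  moreover have "Ck_map A k (chart_lift \<kappa> (inv \<Phi>))"
    by (rule chart_lift_Ck_map[OF A \<kappa> ck(2) s2 compact_cball R]) (use inv in auto)
  ultimately show ?thesis by (simp add: Diff_def)
qed

subsection \<open>A chart with linearly transformed coordinates\<close>

text \<open>Charts of the atlas take values in \<open>'e\<close> and may have a tiny range. An
  isomorphism onto \<open>'f\<close>, later a product space, together with a translation gives a
  compatible chart; a large scale in \<open>Lin\<close> makes room for the model.\<close>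

locale linear_chart =
  fixes A :: "('a::{t2_space,second_countable_topology}, 'e::euclidean_space) chart set"
    and G :: "'a \<Rightarrow> 'e \<Rightarrow> 'e \<Rightarrow> real" and c :: "('a, 'e) chart"
    and Lin :: "'e \<Rightarrow> 'f::euclidean_space" and Lin' :: "'f \<Rightarrow> 'e" and v0 :: 'e
  assumes M: "closed_riemannian_manifold A G" and c: "c \<in> A"
    and Lin: "linear Lin" "linear Lin'" "\<And>v. Lin' (Lin v) = v" "\<And>w. Lin (Lin' w) = w"
begin

definition \<kappa> :: "('a, 'f) chart" where
  "\<kappa> = (fst c, \<lambda>p. Lin (snd c p - v0))"

definition \<phi> :: "'a \<Rightarrow> 'f" where "\<phi> = snd \<kappa>"
definition \<psi> :: "'f \<Rightarrow> 'a" where "\<psi> = chart_inv \<kappa>"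
definition dom :: "'a set" where "dom = fst c"
definition \<Omega> :: "'f set" where "\<Omega> = \<phi> ` dom"

lemma atlas: "smooth_atlas A" and chart_c: "is_chart c" and charts: "d \<in> A \<Longrightarrow> is_chart d"
  using M c by (auto simp: closed_riemannian_manifold_def smooth_atlas_def)

lemma \<phi>_eq: "\<phi> p = Lin (snd c p - v0)" by (simp add: \<phi>_def \<kappa>_def)

lemma fst_\<kappa>: "fst \<kappa> = dom" by (simp add: \<kappa>_def dom_def)

lemma bounded_linear_Lin: "bounded_linear Lin" "bounded_linear Lin'"
  using Lin linear_conv_bounded_linear by blast+

lemma bij_Lin: "bij Lin" using Lin by (metis bij_betw_def inj_def surj_def)

lemma inj_\<phi>: "inj_on \<phi> dom"
proof (rule inj_onI)
  fix p q assume "p \<in> dom" "q \<in> dom" "\<phi> p = \<phi> q"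
  moreover from this have "snd c p - v0 = snd c q - v0" unfolding \<phi>_eq using Lin(3) by metis
  ultimately show "p = q" using chart_inv_left[OF chart_c] by (metis diff_add_cancel dom_def)
qed

lemma \<psi>_\<phi>: "p \<in> dom \<Longrightarrow> \<psi> (\<phi> p) = p"
  unfolding \<psi>_def chart_inv_def using inj_\<phi> by (simp add: fst_\<kappa> \<phi>_def[symmetric])

lemma \<psi>_mem: "y \<in> \<Omega> \<Longrightarrow> \<psi> y \<in> dom" and \<phi>_\<psi>: "y \<in> \<Omega> \<Longrightarrow> \<phi> (\<psi> y) = y"
  and \<phi>_mem: "p \<in> dom \<Longrightarrow> \<phi> p \<in> \<Omega>"
  using \<psi>_\<phi> by (auto simp: \<Omega>_def)

lemma \<psi>_eq: "y \<in> \<Omega> \<Longrightarrow> \<psi> y = chart_inv c (Lin' y + v0)"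
  using chart_inv_left[OF chart_c] \<psi>_\<phi> by (auto simp: \<Omega>_def \<phi>_eq Lin dom_def)

lemma \<Omega>_eq: "\<Omega> = (\<lambda>x. Lin (x - v0)) ` (snd c ` fst c)"
  by (auto simp: \<Omega>_def \<phi>_eq dom_def)

lemma \<Omega>_iff: "y \<in> \<Omega> \<longleftrightarrow> Lin' y + v0 \<in> snd c ` fst c"
  unfolding \<Omega>_eq by (auto simp: Lin image_iff) (metis Lin(4) add_diff_cancel_right')

lemma continuous_Lin'_shift: "continuous_on S (\<lambda>y. Lin' y + v0)"
  by (intro continuous_intros linear_continuous_on bounded_linear_Lin)

lemma open_dom: "open dom" unfolding dom_def by (rule chart_open_dom[OF chart_c])

lemma open_\<Omega>: "open \<Omega>"
proof -
  have "\<Omega> = (\<lambda>y. Lin' y + v0) -` (snd c ` fst c)" using \<Omega>_iff by auto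
  then show ?thesis using open_vimage[OF chart_open_range[OF chart_c] continuous_Lin'_shift] by simp
qed

lemma continuous_\<phi>: "continuous_on dom \<phi>"
  unfolding \<phi>_eq[abs_def] dom_def
  by (rule bounded_linear.continuous_on[OF bounded_linear_Lin(1)])
    (intro continuous_intros chart_continuous[OF chart_c])

lemma continuous_\<psi>: "continuous_on \<Omega> \<psi>"
proof -
  have "continuous_on \<Omega> (\<lambda>y. chart_inv c (Lin' y + v0))"
    by (rule continuous_on_compose2[OF chart_inv_continuous[OF chart_c] continuous_Lin'_shift])
      (auto simp: \<Omega>_iff)
  then show ?thesis by (rule continuous_on_eq) (simp add: \<psi>_eq)
qed

lemma is_chart_\<kappa>: "is_chart \<kappa>"
proof -
  have "homeomorphism dom \<Omega> \<phi> \<psi>"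
    by (rule homeomorphismI) (use continuous_\<phi> continuous_\<psi> \<psi>_mem \<psi>_\<phi> \<phi>_\<psi> in \<open>auto simp: \<Omega>_def\<close>)
  then show ?thesis
    using open_dom open_\<Omega> unfolding is_chart_def \<Omega>_def fst_\<kappa> \<phi>_def by blast
qed

lemma snd_\<kappa>_image: "snd \<kappa> ` fst \<kappa> = \<Omega>" by (simp add: \<Omega>_def fst_\<kappa> \<phi>_def)

lemma open_\<phi>_image: "open U \<Longrightarrow> open (\<phi> ` (dom \<inter> U))"
  using chart_open_image[OF is_chart_\<kappa>] by (simp add: fst_\<kappa> \<phi>_def)

lemma open_\<psi>_image: "open W \<Longrightarrow> W \<subseteq> \<Omega> \<Longrightarrow> open (\<psi> ` W)"
  using chart_inv_open_image[OF is_chart_\<kappa>] by (simp add: snd_\<kappa>_image \<psi>_def)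

lemma smoothly_compatible_\<kappa>:
  assumes "d \<in> A" shows "smoothly_compatible \<kappa> d"
proof -
  have cd: "Ck_on k (snd c ` (fst c \<inter> fst d)) (snd d \<circ> chart_inv c)"
     "Ck_on k (snd d ` (fst c \<inter> fst d)) (snd c \<circ> chart_inv d)" for k
    using atlas c assms by (auto simp: smooth_atlas_def smoothly_compatible_def smooth_on_def)
  have od: "open (fst d)" using chart_open_dom charts assms by blast
  have o1: "open (snd c ` (fst c \<inter> fst d))" by (rule chart_open_image[OF chart_c od])
  have o2: "open (snd d ` (fst c \<inter> fst d))"
    using chart_open_image[OF charts[OF assms] open_dom] by (simp add: dom_def Int_commute)
  have o3: "open (snd \<kappa> ` (fst \<kappa> \<inter> fst d))" by (rule chart_open_image[OF is_chart_\<kappa> od])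
  have "Ck_on k (snd \<kappa> ` (fst \<kappa> \<inter> fst d)) (snd d \<circ> chart_inv \<kappa>)" for k
  proof -
    have "Ck_on k (snd \<kappa> ` (fst \<kappa> \<inter> fst d)) (\<lambda>y. (snd d \<circ> chart_inv c) (Lin' y + v0))"
      by (rule Ck_on_compose[OF o3 o1 Ck_on_add[OF o3 Ck_on_linear[OF Lin(2)] Ck_on_const] cd(1)])
        (auto simp: fst_\<kappa> dom_def \<phi>_def[symmetric] \<phi>_eq Lin)
    moreover have "(snd d \<circ> chart_inv c) (Lin' y + v0) = (snd d \<circ> chart_inv \<kappa>) y"
      if "y \<in> snd \<kappa> ` (fst \<kappa> \<inter> fst d)" for y
      using that \<psi>_eq[of y] by (auto simp: \<psi>_def \<Omega>_def fst_\<kappa> \<phi>_def)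
    ultimately show ?thesis by (rule Ck_on_eq[OF _ o3])
  qed
  moreover have "Ck_on k (snd d ` (fst \<kappa> \<inter> fst d)) (snd \<kappa> \<circ> chart_inv d)" for k
  proof -
    have "Ck_on k (snd d ` (fst c \<inter> fst d)) (\<lambda>x. Lin ((snd c \<circ> chart_inv d) x - v0))"
      by (intro Ck_on_compose_linear[OF Lin(1) o2] Ck_on_diff o2 cd Ck_on_const)
    then show ?thesis by (simp add: \<kappa>_def o_def)
  qed
  ultimately show ?thesis by (simp add: smoothly_compatible_def smooth_on_def)
qed

text \<open>Tangent vectors at \<open>p\<close> are coordinates in \<open>chart_at A p\<close>,
  which may jump with \<open>p\<close>. \<open>J p\<close> converts to them from the coordinates of
  \<open>\<kappa>\<close>, in which everything is computed, and \<open>J' p\<close> converts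
  back.\<close>

definition J :: "'a \<Rightarrow> 'f \<Rightarrow> 'e" where
  "J p = frechet_derivative (snd (chart_at A p) \<circ> \<psi>) (at (\<phi> p))"

definition J' :: "'a \<Rightarrow> 'e \<Rightarrow> 'f" where
  "J' p = frechet_derivative (\<phi> \<circ> chart_inv (chart_at A p)) (at (snd (chart_at A p) p))"

lemma chart_at: "chart_at A p \<in> A" "p \<in> fst (chart_at A p)"
proof -
  have "\<exists>d. d \<in> A \<and> p \<in> fst d" using atlas unfolding smooth_atlas_def by (metis UNIV_I UN_E)
  then show "chart_at A p \<in> A" "p \<in> fst (chart_at A p)"
    unfolding chart_at_def by (metis (mono_tags, lifting) someI_ex)+
qed

lemma transition_derivative:
  assumes "d \<in> A" "p \<in> dom" "p \<in> fst d"
  shows "(snd d \<circ> \<psi> has_derivative frechet_derivative (snd d \<circ> \<psi>) (at (\<phi> p))) (at (\<phi> p))"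
    and "(\<phi> \<circ> chart_inv d has_derivative frechet_derivative (\<phi> \<circ> chart_inv d) (at (snd d p))) (at (snd d p))"
proof -
  have od: "open (fst d)" using chart_open_dom charts assms by blast
  have 1: "open (\<phi> ` (dom \<inter> fst d))" by (rule open_\<phi>_image[OF od])
  have 2: "open (snd d ` (dom \<inter> fst d))"
    using chart_open_image[OF charts[OF assms(1)] open_dom] by (simp add: Int_commute)
  have "Ck_on (Suc 0) (\<phi> ` (dom \<inter> fst d)) (snd d \<circ> \<psi>)" "Ck_on (Suc 0) (snd d ` (dom \<inter> fst d)) (\<phi> \<circ> chart_inv d)"
    using smoothly_compatible_\<kappa>[OF assms(1)]
    by (auto simp: smoothly_compatible_def smooth_on_def fst_\<kappa> \<phi>_def \<psi>_def)
  from Ck_on_SucD(1)[OF this(1) 1] Ck_on_SucD(1)[OF this(2) 2] assms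
  show "(snd d \<circ> \<psi> has_derivative frechet_derivative (snd d \<circ> \<psi>) (at (\<phi> p))) (at (\<phi> p))"
    "(\<phi> \<circ> chart_inv d has_derivative frechet_derivative (\<phi> \<circ> chart_inv d) (at (snd d p))) (at (snd d p))"
    by auto
qed

lemma has_derivative_J:
  "p \<in> dom \<Longrightarrow> (snd (chart_at A p) \<circ> \<psi> has_derivative J p) (at (\<phi> p))"
  unfolding J_def using transition_derivative chart_at by blast

lemma has_derivative_J':
  "p \<in> dom \<Longrightarrow> (\<phi> \<circ> chart_inv (chart_at A p) has_derivative J' p) (at (snd (chart_at A p) p))"
  unfolding J'_def using transition_derivative chart_at by blast

lemma linear_J: "p \<in> dom \<Longrightarrow> linear (J p)" and linear_J': "p \<in> dom \<Longrightarrow> linear (J' p)"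
  using has_derivative_J has_derivative_J' has_derivative_linear by blast+

lemma J'_J:
  assumes p: "p \<in> dom" shows "J' p (J p v) = v"
proof -
  let ?d = "chart_at A p"
  note d = chart_facts[OF charts[OF chart_at(1)[of p]]]
  have "((\<phi> \<circ> chart_inv ?d) \<circ> (snd ?d \<circ> \<psi>) has_derivative (J' p \<circ> J p)) (at (\<phi> p))"
    by (rule diff_chain_at[OF has_derivative_J[OF p]]) (use has_derivative_J'[OF p] \<psi>_\<phi>[OF p] in simp)
  then have "(id has_derivative (J' p \<circ> J p)) (at (\<phi> p))"
  proof (rule has_derivative_transform_within_open)
    show "open (\<phi> ` (dom \<inter> fst ?d))" by (rule open_\<phi>_image[OF d(1)])
    show "\<phi> p \<in> \<phi> ` (dom \<inter> fst ?d)" using p chart_at by blast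
  qed (auto simp: \<psi>_\<phi> d(3))
  moreover have "(id has_derivative id) (at (\<phi> p))" by (rule has_derivative_id)
  ultimately have "J' p \<circ> J p = id" by (rule has_derivative_unique)
  then show ?thesis by (metis comp_apply id_apply)
qed

lemma J_J':
  assumes p: "p \<in> dom" shows "J p (J' p v) = v"
proof -
  let ?d = "chart_at A p"
  note d = chart_facts[OF charts[OF chart_at(1)[of p]]]
  have "((snd ?d \<circ> \<psi>) \<circ> (\<phi> \<circ> chart_inv ?d) has_derivative (J p \<circ> J' p)) (at (snd ?d p))"
    by (rule diff_chain_at[OF has_derivative_J'[OF p]]) (use has_derivative_J[OF p] d(3) chart_at in simp)
  then have "(id has_derivative (J p \<circ> J' p)) (at (snd ?d p))"
  proof (rule has_derivative_transform_within_open)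
    show "open (snd ?d ` (fst ?d \<inter> dom))" by (rule d(8)[OF open_dom])
    show "snd ?d p \<in> snd ?d ` (fst ?d \<inter> dom)" using p chart_at by blast
  qed (auto simp: \<psi>_\<phi> d(3))
  moreover have "(id has_derivative id) (at (snd ?d p))" by (rule has_derivative_id)
  ultimately have "J p \<circ> J' p = id" by (rule has_derivative_unique)
  then show ?thesis by (metis comp_apply id_apply)
qed

text \<open>Smoothness of the metric is stated through \<open>from_chart\<close> for charts in
  \<open>A\<close>; this formula carries it over to \<open>\<kappa>\<close>, which need not belong
  to \<open>A\<close>.\<close>

lemma J_from_chart:
  assumes p: "p \<in> dom" shows "J p v = from_chart A c p (Lin' v)"
proof -
  let ?d = "chart_at A p"
  have od: "open (fst ?d)" using chart_open_dom charts chart_at by blast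
  have "Ck_on (Suc 0) (snd c ` (fst c \<inter> fst ?d)) (snd ?d \<circ> chart_inv c)"
    using atlas c chart_at(1)[of p] by (auto simp: smooth_atlas_def smoothly_compatible_def smooth_on_def)
  from Ck_on_SucD(1)[OF this chart_open_image[OF chart_c od], of "snd c p"]
  have "(snd ?d \<circ> chart_inv c has_derivative from_chart A c p) (at (snd c p))"
    unfolding from_chart_def[abs_def] using p chart_at(2)[of p] by (auto simp: dom_def)
  moreover have "((\<lambda>y. Lin' y + v0) has_derivative Lin') (at (\<phi> p))"
    using has_derivative_add[OF bounded_linear_imp_has_derivative[OF bounded_linear_Lin(2)] has_derivative_const]
    by simp
  ultimately have "((snd ?d \<circ> chart_inv c) \<circ> (\<lambda>y. Lin' y + v0) has_derivative from_chart A c p \<circ> Lin') (at (\<phi> p))"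
    by (intro diff_chain_at) (auto simp: \<phi>_eq Lin)
  then have "(snd ?d \<circ> \<psi> has_derivative from_chart A c p \<circ> Lin') (at (\<phi> p))"
    by (rule has_derivative_transform_within_open[OF _ open_\<Omega> \<phi>_mem[OF p]]) (simp add: \<psi>_eq)
  then have "J p = from_chart A c p \<circ> Lin'" using has_derivative_unique has_derivative_J[OF p] by blast
  then show ?thesis by simp
qed

text \<open>In the coordinates of \<open>\<kappa>\<close> the tangent map is the ordinary
  derivative: the charts selected at both ends cancel.\<close>

lemma tangent_map_J:
  assumes f: "continuous_on UNIV f" and p: "p \<in> dom" "f p \<in> dom"
    and D: "(\<phi> \<circ> f \<circ> \<psi> has_derivative D) (at (\<phi> p))"
  shows "tangent_map A f p (J p v) = J (f p) (D v)"
proof -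
  let ?d = "chart_at A p" and ?e = "chart_at A (f p)"
  note d = chart_facts[OF charts[OF chart_at(1)[of p]]]
  have "((\<phi> \<circ> f \<circ> \<psi>) \<circ> (\<phi> \<circ> chart_inv ?d) has_derivative D \<circ> J' p) (at (snd ?d p))"
    by (rule diff_chain_at[OF has_derivative_J'[OF p(1)]]) (use D d(3) chart_at in simp)
  then have "((snd ?e \<circ> \<psi>) \<circ> ((\<phi> \<circ> f \<circ> \<psi>) \<circ> (\<phi> \<circ> chart_inv ?d)) has_derivative J (f p) \<circ> (D \<circ> J' p)) (at (snd ?d p))"
    by (rule diff_chain_at) (use has_derivative_J[OF p(2)] d(3) chart_at \<psi>_\<phi> p in simp)
  then have "(snd ?e \<circ> f \<circ> chart_inv ?d has_derivative J (f p) \<circ> (D \<circ> J' p)) (at (snd ?d p))"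
  proof (rule has_derivative_transform_within_open)
    show "open (snd ?d ` (fst ?d \<inter> (dom \<inter> f -` dom)))"
      by (intro d(8) open_Int open_dom open_vimage f)
    show "snd ?d p \<in> snd ?d ` (fst ?d \<inter> (dom \<inter> f -` dom))" using p chart_at by blast
  qed (auto simp: \<psi>_\<phi> d(3))
  then have "tangent_map A f p = J (f p) \<circ> (D \<circ> J' p)"
    unfolding tangent_map_def[abs_def] using frechet_derivative_at by metis
  then show ?thesis by (simp add: J'_J p)
qed

end

text \<open>Displacement is at most length, for curves with finitely many corners. The indicator
  removes the corners and end points, where nothing is known about \<open>w'\<close>; an infinite
  integral makes the bound trivial.\<close>

lemma norm_diff_le_nn_integral:
  fixes w :: "real \<Rightarrow> 'b::euclidean_space"
  assumes ab: "a \<le> b" and w: "continuous_on {a..b} w" and S: "finite S"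
    and w': "\<And>t. t \<in> {a<..<b} - S \<Longrightarrow> (w has_vector_derivative w' t) (at t)"
    and cw': "continuous_on ({a<..<b} - S) w'"
  shows "ennreal (norm (w b - w a)) \<le> (\<integral>\<^sup>+ t. ennreal (norm (indicator ({a<..<b} - S) t *\<^sub>R w' t)) \<partial>lborel)"
proof (cases "(\<integral>\<^sup>+ t. ennreal (norm (indicator ({a<..<b} - S) t *\<^sub>R w' t)) \<partial>lborel) < \<infinity>")
  case True
  define F where "F t = indicator ({a<..<b} - S) t *\<^sub>R w' t" for t
  have "open ({a<..<b} - S)" using S by (simp add: open_Diff finite_imp_closed)
  then have "F \<in> borel_measurable lborel"
    unfolding F_def measurable_lborel1 using borel_measurable_continuous_on_indicator[OF _ cw'] by simp
  then have i: "integrable lborel F" using True unfolding F_def by (intro integrableI_bounded) auto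
  have "(F has_integral integral\<^sup>L lborel F) {a..b}"
  proof -
    have "(F has_integral integral\<^sup>L lborel F) UNIV" by (rule has_integral_integral_lborel[OF i])
    moreover have "(\<lambda>t. if t \<in> {a..b} then F t else 0) = F" by (rule ext) (auto simp: F_def indicator_def)
    ultimately show ?thesis using has_integral_restrict_UNIV[of "{a..b}" F] by metis
  qed
  moreover have "(F has_integral (w b - w a)) {a..b}"
  proof (rule has_integral_spike_finite[of "S \<union> {a, b}"])
    show "(w' has_integral (w b - w a)) {a..b}"
      by (rule fundamental_theorem_of_calculus_interior_strong[OF S ab w' w])
  qed (use S in \<open>auto simp: F_def\<close>)
  ultimately have "w b - w a = integral\<^sup>L lborel F" by (rule has_integral_unique[rotated])
  then show ?thesis using integral_norm_bound_ennreal[OF i] by (simp add: F_def)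
next
  case False
  then show ?thesis by (simp add: not_less top_unique)
qed

context linear_chart
begin

subsection \<open>Diffeomorphisms in the chart\<close>

lemma open_chart_domain: "continuous_on UNIV f \<Longrightarrow> open (\<phi> ` (dom \<inter> f -` dom))"
  by (intro open_\<phi>_image open_vimage open_dom)

lemma Diff_continuous: "f \<in> Diff A r \<Longrightarrow> continuous_on UNIV f"
  and Diff_inv_continuous: "f \<in> Diff A r \<Longrightarrow> continuous_on UNIV (inv f)"
  and Diff_bij: "f \<in> Diff A r \<Longrightarrow> bij f"
  and Diff_inv: "f \<in> Diff A r \<Longrightarrow> inv f \<in> Diff A r"
  by (auto simp: Diff_def Ck_map_def bij_imp_bij_inv inv_inv_eq)

lemma in_charts_\<kappa>:
  assumes "y \<in> \<Omega>" shows "(\<phi> \<circ> f \<circ> \<psi>) y = Lin (in_charts c c f (Lin' y + v0) - v0)"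
  by (simp add: in_charts_def \<phi>_eq \<psi>_eq[OF assms])

lemma Ck_in_charts:
  "f \<in> Diff A r \<Longrightarrow> Ck_on r (snd c ` (dom \<inter> f -` dom)) (in_charts c c f)"
  using c by (auto simp: Diff_def Ck_map_def dom_def)

lemma open_c_image: "f \<in> Diff A r \<Longrightarrow> open (snd c ` (dom \<inter> f -` dom))"
  unfolding dom_def using chart_open_image[OF chart_c] Diff_continuous open_dom
  by (metis dom_def open_vimage)

lemma Ck_\<kappa>:
  assumes f: "f \<in> Diff A r" shows "Ck_on r (\<phi> ` (dom \<inter> f -` dom)) (\<phi> \<circ> f \<circ> \<psi>)"
proof -
  have o: "open (\<phi> ` (dom \<inter> f -` dom))" by (rule open_chart_domain[OF Diff_continuous[OF f]])
  have "Ck_on r (\<phi> ` (dom \<inter> f -` dom)) (\<lambda>y. in_charts c c f (Lin' y + v0))"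
    by (rule Ck_on_compose[OF o open_c_image[OF f] Ck_on_add[OF o Ck_on_linear[OF Lin(2)] Ck_on_const]
          Ck_in_charts[OF f]]) (auto simp: \<phi>_eq Lin)
  then have "Ck_on r (\<phi> ` (dom \<inter> f -` dom)) (\<lambda>y. Lin (in_charts c c f (Lin' y + v0) - v0))"
    by (intro Ck_on_compose_linear[OF Lin(1) o] Ck_on_diff[OF o] Ck_on_const)
  then show ?thesis
  proof (rule Ck_on_eq[OF _ o])
    show "Lin (in_charts c c f (Lin' y + v0) - v0) = (\<phi> \<circ> f \<circ> \<psi>) y" if "y \<in> \<phi> ` (dom \<inter> f -` dom)" for y
      by (rule in_charts_\<kappa>[symmetric]) (use that \<phi>_mem in auto)
  qed
qed

definition D :: "('a \<Rightarrow> 'a) \<Rightarrow> 'a \<Rightarrow> 'f \<Rightarrow> 'f" where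
  "D f p = frechet_derivative (\<phi> \<circ> f \<circ> \<psi>) (at (\<phi> p))"

lemma has_derivative_D:
  assumes f: "f \<in> Diff A r" "r \<ge> 1" and p: "p \<in> dom" "f p \<in> dom"
  shows "(\<phi> \<circ> f \<circ> \<psi> has_derivative D f p) (at (\<phi> p))"
proof -
  have "Ck_on (Suc 0) (\<phi> ` (dom \<inter> f -` dom)) (\<phi> \<circ> f \<circ> \<psi>)"
    by (rule Ck_on_mono[OF Ck_\<kappa>[OF f(1)]]) (use f(2) in simp)
  then show ?thesis unfolding D_def
    using Ck_on_SucD(1) open_chart_domain[OF Diff_continuous[OF f(1)]] p by blast
qed

lemma D_in_charts:
  assumes f: "f \<in> Diff A r" "r \<ge> 1" and p: "p \<in> dom" "f p \<in> dom"
  shows "D f p v = Lin (frechet_derivative (in_charts c c f) (at (snd c p)) (Lin' v))"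
    and "linear (frechet_derivative (in_charts c c f) (at (snd c p)))"
proof -
  have "Ck_on (Suc 0) (snd c ` (dom \<inter> f -` dom)) (in_charts c c f)"
    by (rule Ck_on_mono[OF Ck_in_charts[OF f(1)]]) (use f(2) in simp)
  then have d: "(in_charts c c f has_derivative frechet_derivative (in_charts c c f) (at (snd c p))) (at (snd c p))"
    using Ck_on_SucD(1) open_c_image[OF f(1)] p by blast
  then show "linear (frechet_derivative (in_charts c c f) (at (snd c p)))" by (rule has_derivative_linear)
  have s: "((\<lambda>y. Lin' y + v0) has_derivative Lin') (at (\<phi> p))"
    using has_derivative_add[OF bounded_linear_imp_has_derivative[OF bounded_linear_Lin(2)] has_derivative_const]
    by simp
  have "((\<lambda>y. in_charts c c f (Lin' y + v0)) has_derivative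
      (\<lambda>v. frechet_derivative (in_charts c c f) (at (snd c p)) (Lin' v))) (at (\<phi> p))"
    by (rule has_derivative_compose[OF s]) (use d in \<open>simp add: \<phi>_eq Lin\<close>)
  then have "((\<lambda>y. in_charts c c f (Lin' y + v0) - v0) has_derivative
      (\<lambda>v. frechet_derivative (in_charts c c f) (at (snd c p)) (Lin' v) - 0)) (at (\<phi> p))"
    by (rule has_derivative_diff[OF _ has_derivative_const])
  from bounded_linear.has_derivative[OF bounded_linear_Lin(1) this]
  have "((\<lambda>y. Lin (in_charts c c f (Lin' y + v0) - v0)) has_derivative
      (\<lambda>v. Lin (frechet_derivative (in_charts c c f) (at (snd c p)) (Lin' v)))) (at (\<phi> p))" by simp
  then have "(\<phi> \<circ> f \<circ> \<psi> has_derivative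
      (\<lambda>v. Lin (frechet_derivative (in_charts c c f) (at (snd c p)) (Lin' v)))) (at (\<phi> p))"
    by (rule has_derivative_transform_within_open[OF _ open_\<Omega> \<phi>_mem[OF p(1)]])
      (rule in_charts_\<kappa>[symmetric])
  then show "D f p v = Lin (frechet_derivative (in_charts c c f) (at (snd c p)) (Lin' v))"
    using has_derivative_unique[OF has_derivative_D[OF assms]] by metis
qed

text \<open>Basic neighbourhoods control coordinate expressions in \<open>c\<close> along basis
  vectors. Passing to \<open>\<kappa>\<close> and to arbitrary vectors costs the norms of
  \<open>Lin\<close> and \<open>Lin'\<close> and the dimension, and the radius
  \<open>\<epsilon>\<close> pays for all three.\<close>

lemma Cr_neighbourhood:
  assumes f: "f \<in> Diff A r" "r \<ge> 1" and K: "compact K" "K \<subseteq> dom" "f ` K \<subseteq> dom" and e: "e > 0"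
  shows "\<exists>W. openin (Cr_topology A r) W \<and> f \<in> W \<and> (\<forall>g\<in>W. g \<in> Diff A r \<and> g ` K \<subseteq> dom \<and>
     (\<forall>p\<in>K. norm (\<phi> (f p) - \<phi> (g p)) \<le> e \<and> (\<forall>v. norm (D f p v - D g p v) \<le> e * norm v)))"
proof -
  obtain B where B: "B > 0" "\<And>v. norm (Lin v) \<le> norm v * B"
    using bounded_linear.pos_bounded[OF bounded_linear_Lin(1)] by blast
  obtain B' where B': "B' > 0" "\<And>v. norm (Lin' v) \<le> norm v * B'"
    using bounded_linear.pos_bounded[OF bounded_linear_Lin(2)] by blast
  \<comment> \<open>The summand 1 lets the same bound serve for the values as well as for the
    derivatives.\<close>
  define N where "N = 1 + real DIM('e) * B'"
  have N: "N \<ge> 1" "N > 0" "real DIM('e) * B' \<le> N" using B'(1) by (auto simp: N_def add_pos_nonneg)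
  define \<epsilon> where "\<epsilon> = e / (B * N)"
  have \<epsilon>: "\<epsilon> > 0" using e B N by (simp add: \<epsilon>_def)
  have \<epsilon>e: "\<epsilon> * B * N = e" using B N by (simp add: \<epsilon>_def)
  define W where "W = Cr_basic_nbhd A r f c c K \<epsilon>"
  have "openin (Cr_topology A r) W"
    unfolding Cr_topology_def W_def
    by (rule topology_generated_by_Basis, intro CollectI exI conjI refl)
      (use f K c \<epsilon> in \<open>auto simp: dom_def\<close>)
  moreover have "f \<in> W" unfolding W_def Cr_basic_nbhd_def using f K \<epsilon> by (auto simp: dom_def)
  moreover have "g \<in> Diff A r \<and> g ` K \<subseteq> dom \<and>
     (\<forall>p\<in>K. norm (\<phi> (f p) - \<phi> (g p)) \<le> e \<and> (\<forall>v. norm (D f p v - D g p v) \<le> e * norm v))"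
    if gW: "g \<in> W" for g
  proof -
    have g: "g \<in> Diff A r" "g ` K \<subseteq> dom"
      and cl: "\<And>p vs. p \<in> K \<Longrightarrow> set vs \<subseteq> Basis \<Longrightarrow> length vs \<le> r \<Longrightarrow>
        norm (iter_deriv (in_charts c c f) vs (snd c p) - iter_deriv (in_charts c c g) vs (snd c p)) < \<epsilon>"
      using gW by (auto simp: W_def Cr_basic_nbhd_def dom_def)
    have "norm (\<phi> (f p) - \<phi> (g p)) \<le> e" if p: "p \<in> K" for p
    proof -
      have "p \<in> fst c" using p K(2) by (auto simp: dom_def)
      then have "norm (snd c (f p) - snd c (g p)) < \<epsilon>"
        using cl[OF p, of "[]"] chart_inv_left[OF chart_c] by (simp add: in_charts_def)
      have "\<phi> (f p) - \<phi> (g p) = Lin (snd c (f p) - snd c (g p))"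
        unfolding \<phi>_eq by (simp add: linear_diff[OF Lin(1), symmetric])
      then have "norm (\<phi> (f p) - \<phi> (g p)) \<le> norm (snd c (f p) - snd c (g p)) * B" using B(2) by simp
      also have "\<dots> \<le> \<epsilon> * B" using \<open>norm (snd c (f p) - snd c (g p)) < \<epsilon>\<close> B(1) by (intro mult_right_mono) auto
      also have "\<dots> \<le> \<epsilon> * B * N" using N(1) \<epsilon> B(1) by simp
      finally show ?thesis unfolding \<epsilon>e .
    qed
    moreover have "norm (D f p v - D g p v) \<le> e * norm v" if p: "p \<in> K" for p v
    proof -
      have pd: "p \<in> dom" "f p \<in> dom" "g p \<in> dom" using p K g(2) by auto
      define df dg where "df = frechet_derivative (in_charts c c f) (at (snd c p))"
        and "dg = frechet_derivative (in_charts c c g) (at (snd c p))"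
      note Df = D_in_charts[OF f pd(1,2), folded df_def] and Dg = D_in_charts[OF g(1) f(2) pd(1,3), folded dg_def]
      define u where "u = Lin' v"
      have "norm (df b - dg b) \<le> \<epsilon>" if "b \<in> Basis" for b
        using cl[OF p, of "[b]"] that f(2) by (simp add: df_def dg_def)
      moreover have "df u - dg u = (\<Sum>b\<in>Basis. (u \<bullet> b) *\<^sub>R (df b - dg b))"
        using linear_expand_Basis[OF Df(2), of u] linear_expand_Basis[OF Dg(2), of u]
        by (simp add: scaleR_diff_right sum_subtractf)
      ultimately have "norm (df u - dg u) \<le> (\<Sum>b\<in>(Basis::'e set). norm u * \<epsilon>)"
        by (simp only:) (intro sum_norm_le, auto intro!: mult_mono Basis_le_norm)
      also have "\<dots> \<le> real DIM('e) * (norm v * B' * \<epsilon>)"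
        using B'(2)[of v] \<epsilon> by (simp add: u_def mult_left_mono mult_right_mono)
      also have "\<dots> = (real DIM('e) * B') * (norm v * \<epsilon>)" by simp
      also have "\<dots> \<le> N * (norm v * \<epsilon>)" using \<epsilon> by (intro mult_right_mono N) auto
      finally have *: "norm (df u - dg u) \<le> N * (norm v * \<epsilon>)" .
      have "D f p v - D g p v = Lin (df u - dg u)"
        unfolding Df(1) Dg(1) u_def by (simp add: linear_diff[OF Lin(1)])
      then have "norm (D f p v - D g p v) \<le> norm (df u - dg u) * B" using B(2) by simp
      also have "\<dots> \<le> N * (norm v * \<epsilon>) * B" using * B(1) by (intro mult_right_mono) auto
      also have "\<dots> = e * norm v" unfolding \<epsilon>e[symmetric] by simp
      finally show ?thesis .
    qed
    ultimately show ?thesis using g by blast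
  qed
  ultimately show ?thesis by blast
qed

subsection \<open>The Riemannian metric in the chart\<close>

definition q :: "'f \<Rightarrow> 'f \<Rightarrow> 'f \<Rightarrow> real" where
  "q y u v = G (\<psi> y) (J (\<psi> y) u) (J (\<psi> y) v)"

lemma riemannian: "riemannian_metric A G"
  using M by (simp add: closed_riemannian_manifold_def)

lemma G_bilinear: "bilinear (G p)" and G_pos: "v \<noteq> 0 \<Longrightarrow> G p v v > 0"
  using riemannian by (auto simp: riemannian_metric_def)

lemma continuous_q: "continuous_on \<Omega> (\<lambda>y. q y u v)"
proof -
  let ?h = "\<lambda>x. let p = chart_inv c x in G p (from_chart A c p (Lin' u)) (from_chart A c p (Lin' v))"
  have "smooth_on (snd c ` fst c) ?h"
    using riemannian c unfolding riemannian_metric_def by blast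
  then have "continuous_on (snd c ` fst c) ?h" unfolding smooth_on_def using Ck_on_0 by blast
  then have "continuous_on \<Omega> (\<lambda>y. ?h (Lin' y + v0))"
    by (rule continuous_on_compose2[OF _ continuous_Lin'_shift]) (auto simp: \<Omega>_iff)
  then show ?thesis
    by (rule continuous_on_eq) (simp add: q_def \<psi>_eq[symmetric] J_from_chart \<psi>_mem Let_def)
qed

lemma q_bilinear: "y \<in> \<Omega> \<Longrightarrow> bilinear (q y)"
  using G_bilinear[of "\<psi> y"] linear_J[OF \<psi>_mem]
  unfolding bilinear_def[of "q y"] q_def
  by (auto intro!: linearI simp: linear_add linear_cmul bilinear_ladd bilinear_radd bilinear_lmul bilinear_rmul)

text \<open>Reduces joint continuity in point and vector to the continuity of finitely many
  coefficients.\<close>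

lemma q_expand:
  assumes "y \<in> \<Omega>"
  shows "q y v v = (\<Sum>b\<in>Basis. \<Sum>d\<in>Basis. (v \<bullet> b) * (v \<bullet> d) * q y b d)"
proof -
  have l: "linear (\<lambda>u. q y u w)" "linear (q y w)" for w
    using q_bilinear[OF assms] by (auto simp: bilinear_def)
  have "q y v v = (\<Sum>b\<in>Basis. (v \<bullet> b) * q y b v)"
    using linear_expand_Basis[OF l(1)[of v], of v] by simp
  also have "\<dots> = (\<Sum>b\<in>Basis. (v \<bullet> b) * (\<Sum>d\<in>Basis. (v \<bullet> d) * q y b d))"
    using linear_expand_Basis[OF l(2), of _ v] by simp
  finally show ?thesis by (simp add: sum_distrib_left mult_ac)
qed

text \<open>The quadratic form attains its extrema on the compact set of points of \<open>C\<close>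
  and unit vectors; the minimum is positive because \<open>J\<close> is injective and the metric
  definite.\<close>

lemma tangent_norm_equiv:
  assumes C: "compact C" "C \<subseteq> \<Omega>"
  shows "\<exists>m>0. \<forall>y\<in>C. \<forall>v. norm v \<le> m * tangent_norm G (\<psi> y) (J (\<psi> y) v) \<and>
            tangent_norm G (\<psi> y) (J (\<psi> y) v) \<le> m * norm v"
proof (cases "C = {}")
  case False
  define S where "S = C \<times> sphere (0::'f) 1"
  obtain b :: 'f where "b \<in> Basis" using nonempty_Basis by blast
  then have S: "compact S" "S \<noteq> {}" using C False unfolding S_def by (auto simp: compact_Times intro!: exI[of _ b])
  have "continuous_on S (\<lambda>w. \<Sum>b\<in>Basis. \<Sum>d\<in>Basis. (snd w \<bullet> b) * (snd w \<bullet> d) * q (fst w) b d)"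
    by (intro continuous_intros continuous_on_compose2[OF continuous_q]) (use C in \<open>auto simp: S_def\<close>)
  then have cont: "continuous_on S (\<lambda>w. q (fst w) (snd w) (snd w))"
    by (rule continuous_on_eq) (use C in \<open>auto simp: S_def q_expand\<close>)
  obtain w1 where w1: "w1 \<in> S" "\<And>w. w \<in> S \<Longrightarrow> q (fst w1) (snd w1) (snd w1) \<le> q (fst w) (snd w) (snd w)"
    using continuous_attains_inf[OF S cont] by blast
  obtain w2 where w2: "w2 \<in> S" "\<And>w. w \<in> S \<Longrightarrow> q (fst w) (snd w) (snd w) \<le> q (fst w2) (snd w2) (snd w2)"
    using continuous_attains_sup[OF S cont] by blast
  define lo hi where "lo = q (fst w1) (snd w1) (snd w1)" and "hi = q (fst w2) (snd w2) (snd w2)"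
  have "lo > 0"
  proof -
    have "\<psi> (fst w1) \<in> dom" "snd w1 \<noteq> 0" using w1(1) C \<psi>_mem by (auto simp: S_def)
    then have "J (\<psi> (fst w1)) (snd w1) \<noteq> 0" using J'_J linear_0[OF linear_J'] by metis
    then show ?thesis unfolding lo_def q_def by (rule G_pos)
  qed
  have "hi \<ge> lo" using w1(2)[OF w2(1)] by (simp add: lo_def hi_def)
  define m where "m = 1 / sqrt lo + sqrt hi"
  have m: "m > 0" "1 / sqrt lo \<le> m" "sqrt hi \<le> m" using \<open>lo > 0\<close> \<open>hi \<ge> lo\<close> by (auto simp: m_def add_pos_nonneg)
  have "norm v \<le> m * tangent_norm G (\<psi> y) (J (\<psi> y) v) \<and> tangent_norm G (\<psi> y) (J (\<psi> y) v) \<le> m * norm v"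
    if y: "y \<in> C" for y v
  proof (cases "v = 0")
    case True
    have "q y 0 0 = 0" using q_expand[of y 0] C y by auto
    then show ?thesis using True by (simp add: tangent_norm_def q_def)
  next
    case False
    define u where "u = v /\<^sub>R norm v"
    have vu: "v = norm v *\<^sub>R u" using False by (simp add: u_def)
    have "(y, u) \<in> S" using y False by (auto simp: S_def u_def)
    then have b: "lo \<le> q y u u" "q y u u \<le> hi" using w1(2) w2(2) by (auto simp: lo_def hi_def dest: bspec)
    have "q y v v = (norm v)\<^sup>2 * q y u u"
    proof -
      have "bilinear (q y)" using q_bilinear C y by blast
      then show ?thesis by (subst (1 2) vu) (simp add: bilinear_lmul bilinear_rmul power2_eq_square)
    qed
    then have t: "tangent_norm G (\<psi> y) (J (\<psi> y) v) = norm v * sqrt (q y u u)"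
      by (simp add: tangent_norm_def q_def[symmetric] real_sqrt_mult)
    have "1 \<le> m * sqrt lo"
      using mult_right_mono[OF m(2), of "sqrt lo"] \<open>lo > 0\<close> by simp
    also have "\<dots> \<le> m * sqrt (q y u u)" using b m by simp
    finally have "norm v * 1 \<le> norm v * (m * sqrt (q y u u))" by (intro mult_left_mono) auto
    moreover have "sqrt (q y u u) \<le> m" using b m(3) by (meson order_trans real_sqrt_le_mono)
    then have "norm v * sqrt (q y u u) \<le> norm v * m" by (intro mult_left_mono) auto
    ultimately show ?thesis unfolding t by (simp add: mult_ac)
  qed
  then show ?thesis using m(1) by blast
qed (auto intro: exI[of _ 1])

subsection \<open>The Riemannian distance in the chart\<close>

text \<open>The integrand of \<open>curve_length\<close> reads the curve in a chart selected anew at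
  each time. With the time fixed the chart is fixed too, and the chain rule applies.\<close>

lemma chart_at_vector_derivative:
  assumes w: "(w has_vector_derivative u) (at t)" and "p = \<psi> (w t)" "w t \<in> \<Omega>"
    and eq: "open T" "t \<in> T" "\<And>s. s \<in> T \<Longrightarrow> \<gamma> s = \<psi> (w s)"
  shows "vector_derivative (snd (chart_at A p) \<circ> \<gamma>) (at t) = J p u"
proof -
  have "p \<in> dom" "\<phi> p = w t" using assms(2,3) \<psi>_mem \<phi>_\<psi> by auto
  from has_derivative_J[OF this(1)] have "(snd (chart_at A p) \<circ> \<psi> has_derivative J p) (at (w t))" by (simp add: \<open>\<phi> p = w t\<close>)
  from has_derivative_compose[OF w[unfolded has_vector_derivative_def] this]
  have "((\<lambda>s. (snd (chart_at A p) \<circ> \<psi>) (w s)) has_derivative (\<lambda>x. J p (x *\<^sub>R u))) (at t)" by simp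
  then have "((\<lambda>s. (snd (chart_at A p) \<circ> \<psi>) (w s)) has_vector_derivative J p u) (at t)"
    unfolding has_vector_derivative_def by (simp add: linear_cmul[OF linear_J[OF \<open>p \<in> dom\<close>]])
  then have "((snd (chart_at A p) \<circ> \<gamma>) has_vector_derivative J p u) (at t)"
    by (rule has_vector_derivative_transform_within_open[OF _ eq(1,2)]) (simp add: eq(3))
  then show ?thesis by (rule vector_derivative_at)
qed

text \<open>The image of the straight segment is an admissible curve, and its length is at most a
  constant times the Euclidean one.\<close>

lemma rdist_le:
  assumes C: "compact C" "convex C" "C \<subseteq> \<Omega>"
  shows "\<exists>L>0. \<forall>y\<in>C. \<forall>y'\<in>C. rdist A G (\<psi> y) (\<psi> y') \<le> ennreal (L * norm (y - y'))"
proof -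
  obtain m where m: "m > 0" "\<And>y v. y \<in> C \<Longrightarrow> tangent_norm G (\<psi> y) (J (\<psi> y) v) \<le> m * norm v"
    using tangent_norm_equiv[OF C(1,3)] by blast
  have "rdist A G (\<psi> y) (\<psi> y') \<le> ennreal (m * norm (y - y'))" if y: "y \<in> C" "y' \<in> C" for y y'
  proof -
    define w where "w t = y + t *\<^sub>R (y' - y)" for t
    define \<gamma> where "\<gamma> t = \<psi> (w t)" for t
    have wC: "w t \<in> C" if "t \<in> {0..1}" for t
    proof -
      have "w t = (1 - t) *\<^sub>R y + t *\<^sub>R y'" by (simp add: w_def algebra_simps)
      then show ?thesis using C(2) y that by (simp add: convex_alt)
    qed
    have dw: "(w has_vector_derivative (y' - y)) (at t)" for t
      unfolding w_def by (auto intro!: derivative_eq_intros)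
    have cw: "continuous_on S w" for S unfolding w_def by (intro continuous_intros)
    have "\<gamma> \<in> piecewise_C1_curves A (\<psi> y) (\<psi> y')"
      unfolding piecewise_C1_curves_def
    proof (intro CollectI conjI ballI allI impI)
      show "continuous_on {0..1} \<gamma>"
        unfolding \<gamma>_def by (rule continuous_on_compose2[OF continuous_\<psi> cw]) (use wC C(3) in auto)
      show "\<gamma> 0 = \<psi> y" "\<gamma> 1 = \<psi> y'" by (auto simp: \<gamma>_def w_def)
      fix d and a b :: real assume d: "d \<in> A" and ab: "0 \<le> a \<and> a \<le> b \<and> b \<le> 1 \<and> \<gamma> ` {a..b} \<subseteq> fst d"
      define O1 where "O1 = \<phi> ` (dom \<inter> fst d)"
      have oO: "open O1" unfolding O1_def by (intro open_\<phi>_image chart_open_dom charts d)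
      have wO: "w t \<in> O1" if "t \<in> {a..b}" for t
      proof -
        have "w t \<in> \<Omega>" using wC[of t] that ab C(3) by auto
        moreover have "\<psi> (w t) \<in> fst d" using ab that by (auto simp: \<gamma>_def)
        ultimately show ?thesis unfolding O1_def using \<psi>_mem \<phi>_\<psi> by (metis IntI imageI)
      qed
      have ck: "Ck_on (Suc 0) O1 (snd d \<circ> \<psi>)"
        using smoothly_compatible_\<kappa>[OF d]
        by (auto simp: smoothly_compatible_def smooth_on_def fst_\<kappa> \<phi>_def \<psi>_def O1_def)
      define X where "X t = frechet_derivative (snd d \<circ> \<psi>) (at (w t)) (y' - y)" for t
      have dX: "(snd d \<circ> \<gamma> has_vector_derivative X t) (at t)" if "t \<in> {a..b}" for t
      proof -
        note fd = Ck_on_SucD(1)[OF ck oO wO[OF that]]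
        from has_derivative_compose[OF dw[unfolded has_vector_derivative_def] fd]
        show ?thesis unfolding has_vector_derivative_def X_def \<gamma>_def
          using linear_cmul[OF has_derivative_linear[OF fd]] by (simp add: o_def)
      qed
      \<comment> \<open>The velocity in the chart \<open>d\<close>, expanded over the basis so that
        its continuity follows from that of the partial derivatives.\<close>
      have "continuous_on {a..b} (\<lambda>t. \<Sum>e\<in>Basis. ((y' - y) \<bullet> e) *\<^sub>R frechet_derivative (snd d \<circ> \<psi>) (at (w t)) e)"
        by (intro continuous_intros
            continuous_on_compose2[OF Ck_on_continuous[OF Ck_on_SucD(2)[OF ck oO]] cw]) (use wO in auto)
      then have cX: "continuous_on {a..b} X"
        by (rule continuous_on_eq)
          (simp add: X_def linear_expand_Basis[OF has_derivative_linear[OF Ck_on_SucD(1)[OF ck oO wO]], symmetric])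
      have "(snd d \<circ> \<gamma>) C1_differentiable_on {a..b}"
        unfolding C1_differentiable_on_def using dX cX by blast
      then show "(snd d \<circ> \<gamma>) piecewise_C1_differentiable_on {a..b}"
        by (rule C1_differentiable_imp_piecewise)
    qed
    then have "rdist A G (\<psi> y) (\<psi> y') \<le> curve_length A G \<gamma>"
      unfolding rdist_def by (rule INF_lower)
    also have "\<dots> \<le> (\<integral>\<^sup>+ t. ennreal (m * norm (y' - y)) * indicator {0..1::real} t \<partial>lborel)"
      unfolding curve_length_def
    proof (rule nn_integral_mono)
      fix t :: real
      have "tangent_norm G (\<gamma> t) (vector_derivative (snd (chart_at A (\<gamma> t)) \<circ> \<gamma>) (at t)) \<le> m * norm (y' - y)"
        if t: "t \<in> {0..1}"
      proof -
        have "vector_derivative (snd (chart_at A (\<gamma> t)) \<circ> \<gamma>) (at t) = J (\<gamma> t) (y' - y)"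
          by (rule chart_at_vector_derivative[OF dw _ _ open_UNIV]) (use wC[OF t] C(3) in \<open>auto simp: \<gamma>_def\<close>)
        then show ?thesis using m(2)[OF wC[OF t], of "y' - y"] by (simp add: \<gamma>_def)
      qed
      then show "ennreal (tangent_norm G (\<gamma> t) (vector_derivative (snd (chart_at A (\<gamma> t)) \<circ> \<gamma>) (at t)))
          * indicator {0..1} t \<le> ennreal (m * norm (y' - y)) * indicator {0..1} t"
        by (auto simp: indicator_def ennreal_leI)
    qed
    also have "\<dots> = ennreal (m * norm (y - y'))"
      by (simp add: nn_integral_cmult_indicator norm_minus_commute)
    finally show ?thesis .
  qed
  then show ?thesis using m(1) by blast
qed

text \<open>A curve from outside has a last time outside the ball; afterwards it runs inside the
  chart and has to cover the Euclidean distance \<rho>. The starting point is arbitrary on the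
  manifold, so a small Riemannian distance alone forces a point into the chart.\<close>

lemma rdist_ge:
  assumes \<rho>: "\<rho> > 0" "cball y0 \<rho> \<subseteq> \<Omega>"
  shows "\<exists>\<delta>>0. \<forall>p. p \<notin> \<psi> ` ball y0 \<rho> \<longrightarrow> ennreal \<delta> \<le> rdist A G p (\<psi> y0)"
proof -
  obtain m where m: "m > 0" "\<And>y v. y \<in> cball y0 \<rho> \<Longrightarrow> norm v \<le> m * tangent_norm G (\<psi> y) (J (\<psi> y) v)"
    using tangent_norm_equiv[OF compact_cball \<rho>(2)] by blast
  define N where "N = \<psi> ` ball y0 \<rho>"
  have bN: "ball y0 \<rho> \<subseteq> \<Omega>" using \<rho> by auto
  have oN: "open N" unfolding N_def by (rule open_\<psi>_image[OF open_ball bN])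
  have cP: "compact (\<psi> ` cball y0 \<rho>)"
    by (intro compact_continuous_image continuous_on_subset[OF continuous_\<psi> \<rho>(2)] compact_cball)
  have "ennreal (\<rho> / m) \<le> curve_length A G \<gamma>" if p: "p \<notin> N" and \<gamma>: "\<gamma> \<in> piecewise_C1_curves A p (\<psi> y0)" for p \<gamma>
  proof -
    have \<gamma>c: "continuous_on {0..1} \<gamma>" and \<gamma>01: "\<gamma> 0 = p" "\<gamma> 1 = \<psi> y0"
      and pc: "\<And>a b. 0 \<le> a \<Longrightarrow> a \<le> b \<Longrightarrow> b \<le> 1 \<Longrightarrow> \<gamma> ` {a..b} \<subseteq> dom \<Longrightarrow>
        (snd c \<circ> \<gamma>) piecewise_C1_differentiable_on {a..b}"
      using \<gamma> c by (auto simp: piecewise_C1_curves_def dom_def)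
    \<comment> \<open>Times at which the curve is outside \<open>N\<close>; the supremum
      \<open>t1\<close> is the last of them.\<close>
    define E where "E = {0..1} \<inter> \<gamma> -` (- N)"
    have "closed E" unfolding E_def using oN by (intro continuous_closed_preimage \<gamma>c) auto
    moreover have E0: "0 \<in> E" using p \<gamma>01 by (simp add: E_def)
    moreover have bE: "bdd_above E" unfolding E_def by auto
    ultimately have t1E: "Sup E \<in> E" using closed_contains_Sup by blast
    define t1 where "t1 = Sup E"
    have t1: "0 \<le> t1" "t1 \<le> 1" "\<gamma> t1 \<notin> N" using t1E by (auto simp: E_def t1_def)
    have "\<gamma> 1 \<in> N" using \<gamma>01 \<rho> by (simp add: N_def)
    then have "t1 < 1" using t1 by (metis le_less)
    have after: "\<gamma> t \<in> N" if "t \<in> {t1<..1}" for t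
    proof (rule ccontr)
      assume "\<gamma> t \<notin> N"
      then have "t \<in> E" using that t1 by (simp add: E_def)
      then show False using cSup_upper[OF _ bE] that by (force simp: t1_def)
    qed
    \<comment> \<open>At \<open>t1\<close> the curve is outside \<open>N\<close> but, as a limit,
      still in the image of the closed ball, so the chart is available on all of
      \<open>{t1..1}\<close>.\<close>
    have "\<gamma> ` closure {t1<..1} \<subseteq> \<psi> ` cball y0 \<rho>"
    proof (rule image_closure_subset)
      show "continuous_on (closure {t1<..1}) \<gamma>"
        using continuous_on_subset[OF \<gamma>c, of "{t1..1}"] t1 \<open>t1 < 1\<close> by simp
      show "closed (\<psi> ` cball y0 \<rho>)" by (rule compact_imp_closed[OF cP])
      show "\<gamma> ` {t1<..1} \<subseteq> \<psi> ` cball y0 \<rho>" using after ball_subset_cball unfolding N_def by blast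
    qed
    then have \<gamma>P: "\<gamma> t \<in> \<psi> ` cball y0 \<rho>" if "t \<in> {t1..1}" for t
    proof -
      have "t \<in> closure {t1<..1}" using that \<open>t1 < 1\<close> by simp
      then show ?thesis using \<open>\<gamma> ` closure {t1<..1} \<subseteq> \<psi> ` cball y0 \<rho>\<close> image_subset_iff by metis
    qed
    have "\<psi> ` cball y0 \<rho> \<subseteq> dom" using \<rho>(2) \<psi>_mem by auto
    then have \<gamma>dom: "\<gamma> t \<in> dom" if "t \<in> {t1..1}" for t using \<gamma>P[OF that] by (rule subsetD)
    define w where "w t = \<phi> (\<gamma> t)" for t
    have wb: "w t \<in> cball y0 \<rho>" if "t \<in> {t1..1}" for t
      using \<gamma>P[OF that] \<rho>(2) \<phi>_\<psi> unfolding w_def by auto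
    have \<gamma>w: "\<gamma> t = \<psi> (w t)" if "t \<in> {t1..1}" for t
      using \<psi>_\<phi>[OF \<gamma>dom[OF that]] by (simp add: w_def)
    have "w t1 \<notin> ball y0 \<rho>" using t1(3) \<gamma>w[of t1] \<open>t1 < 1\<close> unfolding N_def by (metis atLeastAtMost_iff imageI less_imp_le order_refl)
    moreover have "w 1 = y0" unfolding w_def \<gamma>01 by (rule \<phi>_\<psi>) (use \<rho> in auto)
    ultimately have wd: "\<rho> \<le> norm (w 1 - w t1)" by (simp add: dist_norm)
    have cw: "continuous_on {t1..1} w"
      unfolding w_def using \<gamma>dom t1
      by (intro continuous_on_compose2[OF continuous_\<phi> continuous_on_subset[OF \<gamma>c]]) auto
    obtain S X where S: "finite S" and X: "\<And>t. t \<in> {t1..1} - S \<Longrightarrow> (snd c \<circ> \<gamma> has_vector_derivative X t) (at t)"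
      and cX: "continuous_on ({t1..1} - S) X"
    proof -
      have "\<gamma> ` {t1..1} \<subseteq> dom" using \<gamma>dom by blast
      then have "(snd c \<circ> \<gamma>) piecewise_C1_differentiable_on {t1..1}" using pc t1 by blast
      then show ?thesis using that unfolding piecewise_C1_differentiable_on_def C1_differentiable_on_def by blast
    qed
    have dw: "(w has_vector_derivative Lin (X t)) (at t)" if "t \<in> {t1<..<1} - S" for t
    proof -
      have "(snd c \<circ> \<gamma> has_vector_derivative X t) (at t)" using X that by auto
      then have "((\<lambda>t. (snd c \<circ> \<gamma>) t - v0) has_vector_derivative X t - 0) (at t)"
        by (intro has_vector_derivative_diff has_vector_derivative_const)
      from bounded_linear.has_vector_derivative[OF bounded_linear_Lin(1) this]
      show ?thesis by (simp add: w_def[abs_def] \<phi>_eq o_def)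
    qed
    have dw': "((\<lambda>t. (1 / m) *\<^sub>R w t) has_vector_derivative (1 / m) *\<^sub>R Lin (X t)) (at t)" if "t \<in> {t1<..<1} - S" for t
      by (rule bounded_linear.has_vector_derivative[OF bounded_linear_scaleR_right dw[OF that]])
    have cX': "continuous_on ({t1<..<1} - S) (\<lambda>t. (1 / m) *\<^sub>R Lin (X t))"
      by (intro continuous_intros bounded_linear.continuous_on[OF bounded_linear_Lin(1)]
          continuous_on_subset[OF cX]) auto
    have "ennreal (\<rho> / m) \<le> ennreal (norm ((1 / m) *\<^sub>R w 1 - (1 / m) *\<^sub>R w t1))"
      using wd m(1) by (intro ennreal_leI) (simp add: scaleR_diff_right[symmetric] divide_right_mono)
    also have "\<dots> \<le> (\<integral>\<^sup>+ t. ennreal (norm (indicator ({t1<..<1} - S) t *\<^sub>R (1 / m) *\<^sub>R Lin (X t))) \<partial>lborel)"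
      by (rule norm_diff_le_nn_integral[OF t1(2) _ S dw' cX']) (intro continuous_intros cw)
    also have "\<dots> \<le> curve_length A G \<gamma>"
      unfolding curve_length_def
    proof (rule nn_integral_mono)
      fix t :: real
      show "ennreal (norm (indicator ({t1<..<1} - S) t *\<^sub>R (1 / m) *\<^sub>R Lin (X t)))
        \<le> ennreal (tangent_norm G (\<gamma> t) (vector_derivative (snd (chart_at A (\<gamma> t)) \<circ> \<gamma>) (at t))) * indicator {0..1} t"
      proof (cases "t \<in> {t1<..<1} - S")
        case True
        then have t: "t \<in> {t1..1}" "t \<in> {0..1}" using t1 by auto
        have "vector_derivative (snd (chart_at A (\<gamma> t)) \<circ> \<gamma>) (at t) = J (\<gamma> t) (Lin (X t))"
          by (rule chart_at_vector_derivative[OF dw[OF True] _ _ open_greaterThanLessThan[of t1 1]])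
            (use True \<gamma>w[OF t(1)] wb[OF t(1)] \<rho>(2) in \<open>auto intro!: \<gamma>w\<close>)
        moreover have "norm (Lin (X t)) / m \<le> tangent_norm G (\<gamma> t) (J (\<gamma> t) (Lin (X t)))"
          using m(2)[OF wb[OF t(1)], of "Lin (X t)"] m(1) by (simp add: \<gamma>w[OF t(1)] pos_divide_le_eq mult.commute)
        ultimately show ?thesis using True t(2) m(1) by (auto intro!: ennreal_leI)
      qed simp
    qed
    finally show ?thesis .
  qed
  then have "ennreal (\<rho> / m) \<le> rdist A G p (\<psi> y0)" if "p \<notin> N" for p
    unfolding rdist_def using that by (intro INF_greatest) auto
  then show ?thesis using \<rho>(1) m(1) unfolding N_def by (intro exI[of _ "\<rho> / m"]) auto
qed

end

subsection \<open>Integer iterates\<close>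

definition zpow :: "('a \<Rightarrow> 'a) \<Rightarrow> int \<Rightarrow> 'a \<Rightarrow> 'a" where
  "zpow g k = (if k \<ge> 0 then g ^^ nat k else inv g ^^ nat (- k))"

lemma zpow_of_nat: "zpow g (int n) = g ^^ n" and zpow_neg: "zpow g (- int n) = inv g ^^ n"
  by (auto simp: zpow_def)

lemma zpow_0 [simp]: "zpow g 0 p = p" by (simp add: zpow_def)

lemma zpow_step:
  assumes "bij g" shows "zpow g (k + 1) p = g (zpow g k p)"
proof -
  have g: "g (inv g x) = x" for x using assms by (simp add: bij_is_surj surj_f_inv_f)
  consider "k \<ge> 0" | "k < 0" by linarith
  then show ?thesis
  proof cases
    case 1
    then have "nat (k + 1) = Suc (nat k)" by simp
    then show ?thesis using 1 by (simp add: zpow_def)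
  next
    case 2
    then have "nat (- k) = Suc (nat (- (k + 1)))" by simp
    then have "zpow g k p = inv g ((inv g ^^ nat (- (k + 1))) p)" using 2 by (simp add: zpow_def)
    moreover have "zpow g (k + 1) p = (inv g ^^ nat (- (k + 1))) p" using 2 by (auto simp: zpow_def)
    ultimately show ?thesis by (simp add: g)
  qed
qed

lemma zpow_add:
  assumes "bij g" shows "zpow g (j + k) p = zpow g j (zpow g k p)"
proof (induction j rule: int_induct[of _ 0])
  case (step1 i)
  then show ?case using zpow_step[OF assms, of "i + k" p] zpow_step[OF assms, of i "zpow g k p"]
    by (simp add: add.commute add.left_commute)
next
  case (step2 i)
  have "g (zpow g (i - 1 + k) p) = zpow g (i + k) p" using zpow_step[OF assms, of "i - 1 + k" p] by (simp add: algebra_simps)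
  moreover have "g (zpow g (i - 1) (zpow g k p)) = zpow g i (zpow g k p)"
    using zpow_step[OF assms, of "i - 1" "zpow g k p"] by simp
  ultimately show ?case using step2 assms by (metis bij_is_inj injD)
qed simp

lemma funpow_inv_image:
  fixes g :: "'a \<Rightarrow> 'a"
  assumes "bij g" shows "p \<in> (g ^^ n) ` K \<longleftrightarrow> (inv g ^^ n) p \<in> K"
proof -
  have 1: "(inv g ^^ n) ((g ^^ n) x) = x" for x
    using zpow_add[OF assms, of "- int n" "int n" x] by (simp add: zpow_neg zpow_of_nat)
  have 2: "(g ^^ n) ((inv g ^^ n) x) = x" for x
    using zpow_add[OF assms, of "int n" "- int n" x] by (simp add: zpow_neg zpow_of_nat)
  show ?thesis using 1 2 by (metis (no_types, lifting) imageE imageI)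
qed

text \<open>Connects the two intersections by which a blender-horseshoe is defined with the orbit
  condition that defines \<open>\<Lambda>\<close> below.\<close>

lemma invariant_set_iff:
  fixes g :: "'a \<Rightarrow> 'a"
  assumes "bij g"
  shows "p \<in> (\<Inter>n. (g ^^ n) ` K) \<inter> (\<Inter>n. (inv g ^^ n) ` K) \<longleftrightarrow> (\<forall>k. zpow g k p \<in> K)"
proof -
  have "p \<in> (g ^^ n) ` K \<longleftrightarrow> zpow g (- int n) p \<in> K" for n
    by (simp add: zpow_neg funpow_inv_image[OF assms])
  moreover have "p \<in> (inv g ^^ n) ` K \<longleftrightarrow> zpow g (int n) p \<in> K" for n
    by (simp add: zpow_of_nat funpow_inv_image[OF bij_imp_bij_inv[OF assms]] inv_inv_eq[OF assms])
  ultimately have "p \<in> (\<Inter>n. (g ^^ n) ` K) \<inter> (\<Inter>n. (inv g ^^ n) ` K) \<longleftrightarrow>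
      (\<forall>n::nat. zpow g (- int n) p \<in> K \<and> zpow g (int n) p \<in> K)" by auto
  also have "\<dots> \<longleftrightarrow> (\<forall>k. zpow g k p \<in> K)" by (metis int_cases2)
  finally show ?thesis .
qed

lemma continuous_funpow: "continuous_on UNIV (f :: 'a::topological_space \<Rightarrow> 'a) \<Longrightarrow> continuous_on UNIV (f ^^ n)"
proof (induction n)
  case (Suc n)
  then show ?case using continuous_on_compose[of UNIV "f ^^ n" f] by (auto intro: continuous_on_subset)
qed (auto simp: id_def intro: continuous_intros)

subsection \<open>The horseshoe in the manifold\<close>

text \<open>\<open>D_f0\<close> speaks of two-sided derivatives, also at boundary points of the
  legs; in the model it comes from agreement with the affine map on larger open boxes.\<close>

locale manifold_horseshoe =
  linear_chart A G c Lin Lin' v0 + H: affine_horseshoe \<beta> \<alpha> B B' I Q \<eta>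
  for A :: "('a::{t2_space,second_countable_topology}, 'e::euclidean_space) chart set"
    and G :: "'a \<Rightarrow> 'e \<Rightarrow> 'e \<Rightarrow> real" and c :: "('a, 'e) chart"
    and Lin :: "'e \<Rightarrow> real \<times> 's::euclidean_space" and Lin' :: "real \<times> 's \<Rightarrow> 'e" and v0 :: 'e
    and \<beta> \<alpha> :: "bool \<Rightarrow> real" and B B' :: "bool \<Rightarrow> 's \<Rightarrow> 's"
    and I :: "bool \<Rightarrow> real set" and Q :: "'s set" and \<eta> :: real +
  fixes r :: nat and f0 :: "'a \<Rightarrow> 'a"
  assumes r: "r \<ge> 1" and f0: "f0 \<in> Diff A r"
    and V_\<Omega>: "\<And>i. H.V i \<subseteq> \<Omega>" and FV_\<Omega>: "\<And>i w. w \<in> H.V i \<Longrightarrow> H.F i w \<in> \<Omega>"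
    and f0_eq: "\<And>i w. w \<in> H.V i \<Longrightarrow> f0 (\<psi> w) = \<psi> (H.F i w)"
    and D_f0: "\<And>i w. w \<in> H.V i \<Longrightarrow> D f0 (\<psi> w) = H.F' i"
begin

definition K :: "'a set" where "K = \<psi> ` (H.V True \<union> H.V False)"

definition \<Lambda> :: "'a set" where "\<Lambda> = {p. \<forall>k. zpow f0 k p \<in> K}"

text \<open>The concrete meaning of being near \<open>f0\<close>: all persistence statements are
  proved for good maps, and \<open>good_nbhd\<close> provides an open set of them.\<close>

definition good :: "('a \<Rightarrow> 'a) \<Rightarrow> bool" where
  "good g \<longleftrightarrow> g \<in> Diff A r \<and> g ` K \<subseteq> dom \<and>
     (\<forall>p\<in>K. norm (\<phi> (f0 p) - \<phi> (g p)) \<le> \<eta> \<and> (\<forall>v. norm (D f0 p v - D g p v) \<le> \<eta> * norm v))"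

lemma V_K: "w \<in> H.V i \<Longrightarrow> \<psi> w \<in> K" unfolding K_def by (cases i) auto

lemma K_V: "p \<in> K \<Longrightarrow> \<exists>i. \<phi> p \<in> H.V i" and K_dom: "K \<subseteq> dom"
  unfolding K_def using V_\<Omega> \<phi>_\<psi> \<psi>_mem by (auto simp: subset_iff)

lemma compact_K: "compact K"
  unfolding K_def
  by (intro compact_continuous_image continuous_on_subset[OF continuous_\<psi>] compact_Un H.compact_V)
    (use V_\<Omega> in auto)

lemma f0_K: "f0 ` K \<subseteq> dom"
proof
  fix x assume "x \<in> f0 ` K"
  then obtain p i where p: "x = f0 p" "p \<in> K" "\<phi> p \<in> H.V i" using K_V by blast
  then have "x = \<psi> (H.F i (\<phi> p))" using f0_eq[OF p(3)] \<psi>_\<phi> K_dom by auto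
  then show "x \<in> dom" using FV_\<Omega>[OF p(3)] \<psi>_mem by blast
qed

lemma good_f0: "good f0"
  unfolding good_def using f0 f0_K H.\<eta> by (simp add: less_imp_le)

lemma good_nbhd: "\<exists>W. openin (Cr_topology A r) W \<and> f0 \<in> W \<and> (\<forall>g\<in>W. good g)"
  using Cr_neighbourhood[OF f0 r compact_K K_dom f0_K H.\<eta>(1)] unfolding good_def by blast

lemma good_bij: "good g \<Longrightarrow> bij g" and good_Diff: "good g \<Longrightarrow> g \<in> Diff A r"
  using Diff_bij by (auto simp: good_def)

lemma good_dom: "good g \<Longrightarrow> p \<in> K \<Longrightarrow> g p \<in> dom" by (auto simp: good_def)

lemma good_D_near:
  assumes "good g" "w \<in> H.V i" shows "norm (D g (\<psi> w) v - H.F' i v) \<le> \<eta> * norm v"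
  using assms V_K[OF assms(2)] D_f0[OF assms(2)] unfolding good_def by (metis norm_minus_commute)

lemma good_near:
  assumes g: "good g" shows "H.near (\<phi> \<circ> g \<circ> \<psi>)"
  unfolding H.near_def
proof (intro allI ballI conjI)
  fix i w assume w: "w \<in> H.V i"
  have wO: "w \<in> \<Omega>" using w V_\<Omega> by blast
  have p: "\<psi> w \<in> K" "\<psi> w \<in> dom" "\<phi> (\<psi> w) = w" "g (\<psi> w) \<in> dom"
    using V_K[OF w] K_dom wO \<phi>_\<psi> good_dom[OF g] by auto
  have d: "(\<phi> \<circ> g \<circ> \<psi> has_derivative D g (\<psi> w)) (at w)"
    using has_derivative_D[OF good_Diff[OF g] r p(2,4)] p(3) by simp
  then show "(\<phi> \<circ> g \<circ> \<psi>) differentiable (at w)" by (auto simp: differentiable_def)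
  have "frechet_derivative (\<phi> \<circ> g \<circ> \<psi>) (at w) = D g (\<psi> w)"
    using frechet_derivative_at[OF d] by simp
  then show "norm (frechet_derivative (\<phi> \<circ> g \<circ> \<psi>) (at w) v - H.F' i v) \<le> \<eta> * norm v" for v
    using good_D_near[OF g w] by simp
  have "\<phi> (f0 (\<psi> w)) = H.F i w" using f0_eq[OF w] \<phi>_\<psi>[OF FV_\<Omega>[OF w]] by simp
  then show "norm ((\<phi> \<circ> g \<circ> \<psi>) w - H.F i w) \<le> \<eta>"
    using g p(1) unfolding good_def by (metis comp_apply norm_minus_commute)
qed

section \<open>Coding by itineraries and the conjugacy\<close>

text \<open>Defined for every point. Outside \<open>\<Lambda>\<close> it is a Boolean sequence
  without meaning, but it still shifts under \<open>f0\<close>, so that \<open>h_conjugates\<close>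
  holds at every point.\<close>

definition itinerary :: "'a \<Rightarrow> int \<Rightarrow> bool" where
  "itinerary p k \<longleftrightarrow> \<phi> (zpow f0 k p) \<in> H.V True"

definition is_orbit :: "('a \<Rightarrow> 'a) \<Rightarrow> (int \<Rightarrow> bool) \<Rightarrow> (int \<Rightarrow> real \<times> 's) \<Rightarrow> bool" where
  "is_orbit g a y \<longleftrightarrow> (\<forall>k. y k \<in> H.V (a k) \<and> (\<phi> \<circ> g \<circ> \<psi>) (y k) = y (k + 1))"

definition orb :: "('a \<Rightarrow> 'a) \<Rightarrow> (int \<Rightarrow> bool) \<Rightarrow> int \<Rightarrow> real \<times> 's" where
  "orb g a = (SOME y. is_orbit g a y)"

text \<open>The point whose orbit under \<open>g\<close> visits the same legs as the orbit of
  \<open>p\<close> under \<open>f0\<close>; for good maps \<open>orbit_unique\<close> makes the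
  choice in \<open>orb\<close> unambiguous.\<close>

definition h :: "('a \<Rightarrow> 'a) \<Rightarrow> 'a \<Rightarrow> 'a" where
  "h g p = \<psi> (orb g (itinerary p) 0)"

lemma is_orbit_orb: "good g \<Longrightarrow> is_orbit g a (orb g a)"
  unfolding orb_def using H.orbit_exists[OF good_near, of g a]
  by (intro someI_ex[of "is_orbit g a"]) (auto simp: is_orbit_def)

lemma orbit_close:
  assumes g: "good g" and y: "is_orbit g a y" and y': "is_orbit g' a' y'"
    and a: "\<And>k. \<bar>k\<bar> \<le> int N \<Longrightarrow> a' k = a k"
    and \<delta>: "\<And>p. p \<in> K \<Longrightarrow> norm (\<phi> (g p) - \<phi> (g' p)) \<le> \<delta>"
    and bd: "\<And>k. norm (y k - y' k) \<le> b"
  shows "norm (y 0 - y' 0) \<le> (7/10) ^ N * b + 7 * \<delta>"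
proof (rule H.orbit_close[OF good_near[OF g], where a = a and g' = "\<phi> \<circ> g' \<circ> \<psi>"])
  show "norm ((\<phi> \<circ> g \<circ> \<psi>) w - (\<phi> \<circ> g' \<circ> \<psi>) w) \<le> \<delta>" if "w \<in> H.V i" for i w
    using \<delta>[OF V_K[OF that]] by simp
  show "y' k \<in> H.V (a k)" if "\<bar>k\<bar> \<le> int N" for k
  proof -
    have "y' k \<in> H.V (a' k)" using y' by (simp add: is_orbit_def)
    then show ?thesis by (simp add: a[OF that])
  qed
qed (use y y' bd in \<open>auto simp: is_orbit_def\<close>)

lemma V_bounded: "\<exists>b\<ge>0. \<forall>i j w w'. w \<in> H.V i \<longrightarrow> w' \<in> H.V j \<longrightarrow> norm (w - w') \<le> b"
proof -
  have "bounded (H.V True \<union> H.V False)" using H.compact_V compact_imp_bounded by blast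
  then obtain b where b: "\<And>w w'. w \<in> H.V True \<union> H.V False \<Longrightarrow> w' \<in> H.V True \<union> H.V False \<Longrightarrow> dist w w' \<le> b"
    unfolding bounded_two_points by blast
  have i: "w \<in> H.V i \<Longrightarrow> w \<in> H.V True \<union> H.V False" for w i by (cases i) auto
  have "norm (w - w') \<le> max b 0" if "w \<in> H.V i" "w' \<in> H.V j" for w w' i j
    using b[OF i[OF that(1)] i[OF that(2)]] by (simp add: dist_norm)
  then show ?thesis by (intro exI[of _ "max b 0"]) auto
qed

text \<open>The window grows to the whole orbit, and the boundary term vanishes because the legs are
  bounded.\<close>

lemma orbit_close_all:
  assumes g: "good g" and y: "is_orbit g a y" and y': "is_orbit g' a y'"
    and \<delta>: "\<And>p. p \<in> K \<Longrightarrow> norm (\<phi> (g p) - \<phi> (g' p)) \<le> \<delta>"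
  shows "norm (y 0 - y' 0) \<le> 7 * \<delta>"
proof -
  obtain b where b: "\<And>i j w w'. w \<in> H.V i \<Longrightarrow> w' \<in> H.V j \<Longrightarrow> norm (w - w') \<le> b"
    using V_bounded by blast
  have "norm (y k - y' k) \<le> b" for k using b y y' unfolding is_orbit_def by blast
  then have "norm (y 0 - y' 0) \<le> (7/10) ^ N * b + 7 * \<delta>" for N
    by (intro orbit_close[OF g y y' refl \<delta>])
  moreover have "(\<lambda>N. (7/10) ^ N * b + 7 * \<delta>) \<longlonglongrightarrow> 0 * b + 7 * \<delta>"
    by (intro tendsto_intros LIMSEQ_power_zero) auto
  ultimately have "norm (y 0 - y' 0) \<le> 0 * b + 7 * \<delta>" by (intro LIMSEQ_le_const) auto
  then show ?thesis by simp
qed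

lemma is_orbit_shift: "is_orbit g a y \<Longrightarrow> is_orbit g (\<lambda>k. a (k + j)) (\<lambda>k. y (k + j))"
  unfolding is_orbit_def by (metis add.assoc add.commute)

lemma orbit_unique:
  assumes g: "good g" and y: "is_orbit g a y" and y': "is_orbit g a y'"
  shows "y k = y' k"
proof -
  have "norm (y (0 + k) - y' (0 + k)) \<le> 7 * 0"
    by (rule orbit_close_all[OF g is_orbit_shift[OF y] is_orbit_shift[OF y']]) simp
  then show ?thesis by simp
qed

text \<open>The orbit relation is only known in the chart; it determines the point because
  \<open>g\<close> maps \<open>K\<close> into the chart domain.\<close>

lemma orbit_step:
  assumes g: "good g" and y: "is_orbit g a y" shows "g (\<psi> (y k)) = \<psi> (y (k + 1))"
proof -
  have "y k \<in> H.V (a k)" and e: "\<phi> (g (\<psi> (y k))) = y (k + 1)" using y by (auto simp: is_orbit_def)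
  then have "g (\<psi> (y k)) \<in> dom" using V_K good_dom[OF g] by blast
  then show ?thesis using \<psi>_\<phi> e by metis
qed

lemma zpow_orbit:
  assumes g: "good g" and y: "is_orbit g a y" shows "zpow g k (\<psi> (y 0)) = \<psi> (y k)"
proof (induction k rule: int_induct[of _ 0])
  case (step1 i)
  then show ?case using zpow_step[OF good_bij[OF g]] orbit_step[OF g y] by simp
next
  case (step2 i)
  have "g (zpow g (i - 1) (\<psi> (y 0))) = g (\<psi> (y (i - 1)))"
    using zpow_step[OF good_bij[OF g], of "i - 1"] orbit_step[OF g y, of "i - 1"] step2 by simp
  then show ?case using good_bij[OF g] by (metis bij_is_inj injD)
qed simp

lemma \<Lambda>_orbit:
  assumes "p \<in> \<Lambda>" shows "is_orbit f0 (itinerary p) (\<lambda>k. \<phi> (zpow f0 k p))"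
  unfolding is_orbit_def
proof (intro allI conjI)
  fix k
  have k: "zpow f0 k p \<in> K" using assms by (simp add: \<Lambda>_def)
  show "\<phi> (zpow f0 k p) \<in> H.V (itinerary p k)"
    using K_V[OF k] unfolding itinerary_def by (metis (full_types))
  show "(\<phi> \<circ> f0 \<circ> \<psi>) (\<phi> (zpow f0 k p)) = \<phi> (zpow f0 (k + 1) p)"
    using zpow_step[OF good_bij[OF good_f0]] \<psi>_\<phi> k K_dom by auto
qed

text \<open>The orbit of a point of \<open>\<Lambda>\<close> follows the itinerary of that point,
  and orbits with the same itinerary coincide.\<close>

lemma h_f0: "p \<in> \<Lambda> \<Longrightarrow> h f0 p = p"
  unfolding h_def using orbit_unique[OF good_f0 is_orbit_orb[OF good_f0] \<Lambda>_orbit, of p 0]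
    \<psi>_\<phi> K_dom by (auto simp: \<Lambda>_def) (metis zpow_0 subsetD)

lemma f0_\<Lambda>_iff: "f0 p \<in> \<Lambda> \<longleftrightarrow> p \<in> \<Lambda>"
proof -
  have "zpow f0 k (f0 p) = zpow f0 (k + 1) p" for k
    using zpow_add[OF good_bij[OF good_f0], of k 1 p] zpow_of_nat[of f0 1] by simp
  then show ?thesis unfolding \<Lambda>_def mem_Collect_eq by (metis diff_add_cancel)
qed

lemma f0_image_\<Lambda>: "f0 ` \<Lambda> = \<Lambda>"
proof (intro equalityI subsetI)
  fix p assume p: "p \<in> \<Lambda>"
  have "f0 (inv f0 p) = p" using good_bij[OF good_f0] by (simp add: bij_is_surj surj_f_inv_f)
  then show "p \<in> f0 ` \<Lambda>" using f0_\<Lambda>_iff p by (metis imageI)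
qed (use f0_\<Lambda>_iff in auto)

lemma itinerary_f0: "itinerary (f0 p) k = itinerary p (k + 1)"
proof -
  have "zpow f0 k (f0 p) = zpow f0 (k + 1) p"
    using zpow_add[OF good_bij[OF good_f0], of k 1 p] zpow_of_nat[of f0 1] by simp
  then show ?thesis by (simp add: itinerary_def)
qed

lemma h_conjugates:
  assumes g: "good g" shows "h g (f0 p) = g (h g p)"
proof -
  have "is_orbit g (itinerary (f0 p)) (\<lambda>k. orb g (itinerary p) (k + 1))"
    using is_orbit_shift[OF is_orbit_orb[OF g, of "itinerary p"], of 1] by (simp add: itinerary_f0[abs_def])
  from orbit_unique[OF g is_orbit_orb[OF g] this, of 0]
  show ?thesis unfolding h_def using orbit_step[OF g is_orbit_orb[OF g], of "itinerary p" 0] by simp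
qed

lemma h_zpow: "good g \<Longrightarrow> zpow g k (h g p) = \<psi> (orb g (itinerary p) k)"
  unfolding h_def by (rule zpow_orbit[OF _ is_orbit_orb])

lemma orb_V: "good g \<Longrightarrow> orb g a k \<in> H.V (a k)"
  using is_orbit_orb[of g a] by (simp add: is_orbit_def)

text \<open>Disjointness of the legs lets the itinerary be read off the orbit of the image, and the
  itinerary determines the point of \<open>\<Lambda>\<close> by \<open>h_f0\<close>.\<close>

lemma h_inj:
  assumes g: "good g" shows "inj_on (h g) \<Lambda>"
proof (rule inj_onI)
  fix p p' assume p: "p \<in> \<Lambda>" "p' \<in> \<Lambda>" "h g p = h g p'"
  have "itinerary p k = itinerary p' k" for k
  proof -
    have "\<psi> (orb g (itinerary p) k) = \<psi> (orb g (itinerary p') k)"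
      using h_zpow[OF g] p(3) by metis
    then have "orb g (itinerary p) k = orb g (itinerary p') k"
      using orb_V[OF g] V_\<Omega> \<phi>_\<psi> by (metis subsetD)
    then show ?thesis using orb_V[OF g] H.V_disjoint by metis
  qed
  then have "itinerary p = itinerary p'" by blast
  then show "p = p'" using h_f0 p(1,2) unfolding h_def by metis
qed

lemma continuous_zpow:
  assumes "good g" shows "continuous_on UNIV (zpow g k)"
  unfolding zpow_def
  using continuous_funpow[OF Diff_continuous[OF good_Diff[OF assms]]]
    continuous_funpow[OF Diff_inv_continuous[OF good_Diff[OF assms]]] by auto

lemma compact_\<Lambda>: "compact \<Lambda>"
proof -
  have "\<Lambda> = (\<Inter>k. zpow f0 k -` K)" by (auto simp: \<Lambda>_def)
  moreover have "closed (zpow f0 k -` K)" for k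
    by (rule closed_vimage[OF compact_imp_closed[OF compact_K] continuous_zpow[OF good_f0]])
  ultimately have "closed \<Lambda>" by auto
  moreover have "compact (UNIV :: 'a set)" using M by (simp add: closed_riemannian_manifold_def)
  ultimately show ?thesis using closed_Int_compact by fastforce
qed

text \<open>The legs are disjoint compact sets, so the leg visited at time \<open>k\<close> does not
  change under a small move of the point.\<close>

lemma eventually_itinerary:
  assumes p: "p \<in> \<Lambda>" shows "\<forall>\<^sub>F p' in at p within \<Lambda>. itinerary p' k = itinerary p k"
proof -
  let ?i = "itinerary p k"
  have cl: "closed (\<psi> ` H.V (\<not> ?i))"
    by (intro compact_imp_closed compact_continuous_image continuous_on_subset[OF continuous_\<psi> V_\<Omega>] H.compact_V)
  define T where "T = zpow f0 k -` (- (\<psi> ` H.V (\<not> ?i)))"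
  have "open T" unfolding T_def
    by (intro open_vimage continuous_zpow good_f0 open_Compl cl)
  have orb: "p' \<in> \<Lambda> \<Longrightarrow> \<phi> (zpow f0 k p') \<in> H.V (itinerary p' k) \<and> \<psi> (\<phi> (zpow f0 k p')) = zpow f0 k p'" for p'
    using \<Lambda>_orbit[of p'] \<psi>_\<phi> K_dom unfolding is_orbit_def \<Lambda>_def by blast
  have "p \<in> T"
  proof (rule ccontr)
    assume "p \<notin> T"
    then obtain w where w: "w \<in> H.V (\<not> ?i)" "zpow f0 k p = \<psi> w" by (auto simp: T_def)
    then have "\<phi> (zpow f0 k p) \<in> H.V (\<not> ?i)" using \<phi>_\<psi> V_\<Omega> by (metis subsetD)
    then show False using orb[OF p] H.V_disjoint by blast
  qed
  moreover have "itinerary p' k = ?i" if "p' \<in> T" "p' \<in> \<Lambda>" for p'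
  proof (rule ccontr)
    assume "itinerary p' k \<noteq> ?i"
    then have "itinerary p' k = (\<not> ?i)" by blast
    then have "\<phi> (zpow f0 k p') \<in> H.V (\<not> ?i)" "zpow f0 k p' = \<psi> (\<phi> (zpow f0 k p'))"
      using orb[OF that(2)] by auto
    then have "zpow f0 k p' \<in> \<psi> ` H.V (\<not> ?i)" by (rule image_eqI[rotated])
    then show False using that(1) by (simp add: T_def)
  qed
  ultimately show ?thesis using \<open>open T\<close> by (auto simp: eventually_at_topological)
qed

text \<open>Nearby points share a long window of their itineraries; \<open>orbit_close\<close> with
  equal maps then makes their images close.\<close>

lemma h_continuous:
  assumes g: "good g" shows "continuous_on \<Lambda> (h g)"
proof -
  obtain b where b: "b \<ge> 0" "\<And>i j w w'. w \<in> H.V i \<Longrightarrow> w' \<in> H.V j \<Longrightarrow> norm (w - w') \<le> b"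
    using V_bounded by blast
  have "continuous_on \<Lambda> (\<lambda>p. orb g (itinerary p) 0)"
    unfolding continuous_on_def
  proof (intro ballI tendstoI)
    fix p and e :: real assume p: "p \<in> \<Lambda>" and e: "e > 0"
    have "(\<lambda>N. (7/10::real) ^ N * b) \<longlonglongrightarrow> 0 * b" by (intro tendsto_intros LIMSEQ_power_zero) auto
    then have "\<forall>\<^sub>F N in sequentially. (7/10::real) ^ N * b < e" using e by (intro order_tendstoD) auto
    then obtain N where N: "(7/10::real) ^ N * b < e" by (auto simp: eventually_sequentially)
    have "\<forall>\<^sub>F p' in at p within \<Lambda>. \<forall>k\<in>{- int N..int N}. itinerary p' k = itinerary p k"
      by (intro eventually_ball_finite ballI eventually_itinerary p) auto
    then show "\<forall>\<^sub>F p' in at p within \<Lambda>. dist (orb g (itinerary p') 0) (orb g (itinerary p) 0) < e"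
    proof (rule eventually_mono)
      fix p' assume "\<forall>k\<in>{- int N..int N}. itinerary p' k = itinerary p k"
      then have "norm (orb g (itinerary p) 0 - orb g (itinerary p') 0) \<le> (7/10) ^ N * b + 7 * 0"
        by (intro orbit_close[OF g is_orbit_orb[OF g] is_orbit_orb[OF g]] b(2)[OF orb_V[OF g] orb_V[OF g]])
          (auto simp: abs_le_iff)
      then show "dist (orb g (itinerary p') 0) (orb g (itinerary p) 0) < e"
        using N by (simp add: dist_norm norm_minus_commute)
    qed
  qed
  then show ?thesis unfolding h_def
    by (rule continuous_on_compose2[OF continuous_\<psi>]) (use orb_V[OF g] V_\<Omega> in blast)
qed

lemma h_homeomorphism: "good g \<Longrightarrow> \<exists>k. homeomorphism \<Lambda> (h g ` \<Lambda>) (h g) k"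
  using homeomorphism_compact[OF compact_\<Lambda> h_continuous refl h_inj] by blast

text \<open>For a given itinerary the two orbits differ by at most 7\<delta> in the chart, uniformly
  over \<open>\<Lambda>\<close>; \<open>rdist_le\<close> turns this into Riemannian
  distance.\<close>

lemma h_depends_continuously:
  assumes g: "good g" and \<epsilon>: "\<epsilon> > 0"
  shows "\<exists>W. openin (Cr_topology A r) W \<and> g \<in> W \<and>
    (\<forall>g'\<in>W. good g' \<longrightarrow> (\<forall>x\<in>\<Lambda>. rdist A G (h g' x) (h g x) < ennreal \<epsilon>))"
proof -
  obtain L where L: "\<And>i. L i > 0" "\<And>i y y'. y \<in> H.V i \<Longrightarrow> y' \<in> H.V i \<Longrightarrow>
      rdist A G (\<psi> y) (\<psi> y') \<le> ennreal (L i * norm (y - y'))"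
    using rdist_le[OF H.compact_V H.convex_V V_\<Omega>] by metis
  define Lm where "Lm = L True + L False"
  have Lm: "Lm > 0" "L i \<le> Lm" for i
    using L(1)[of True] L(1)[of False] by (cases i; simp add: Lm_def)+
  \<comment> \<open>The 8 exceeds the factor 7 of \<open>orbit_close_all\<close>, which yields the
    strict inequality.\<close>
  define \<delta> where "\<delta> = \<epsilon> / (8 * Lm)"
  have \<delta>: "\<delta> > 0" using \<epsilon> Lm by (simp add: \<delta>_def)
  have gK: "g ` K \<subseteq> dom" using g by (simp add: good_def)
  obtain W where W: "openin (Cr_topology A r) W" "g \<in> W"
    "\<And>g' p. g' \<in> W \<Longrightarrow> p \<in> K \<Longrightarrow> norm (\<phi> (g p) - \<phi> (g' p)) \<le> \<delta>"
    using Cr_neighbourhood[OF good_Diff[OF g] r compact_K K_dom gK \<delta>] by blast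
  have "rdist A G (h g' x) (h g x) < ennreal \<epsilon>" if g': "g' \<in> W" "good g'" for g' x
  proof -
    let ?y = "orb g (itinerary x) 0" and ?y' = "orb g' (itinerary x) 0"
    have "norm (?y - ?y') \<le> 7 * \<delta>"
      by (rule orbit_close_all[OF g is_orbit_orb[OF g] is_orbit_orb[OF g'(2)]]) (use W(3) g' in blast)
    then have "L (itinerary x 0) * norm (?y' - ?y) \<le> Lm * (7 * \<delta>)"
      using Lm L(1) by (intro mult_mono) (auto simp: norm_minus_commute less_imp_le)
    also have "\<dots> < \<epsilon>" using Lm(1) \<epsilon> by (simp add: \<delta>_def)
    finally have "ennreal (L (itinerary x 0) * norm (?y' - ?y)) < ennreal \<epsilon>"
      using \<epsilon> by (intro ennreal_lessI) auto
    then show ?thesis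
      unfolding h_def using L(2)[OF orb_V[OF g'(2)] orb_V[OF g], of "itinerary x" 0 "itinerary x"]
      by (meson le_less_trans)
  qed
  then show ?thesis using W(1,2) by blast
qed

end

context manifold_horseshoe
begin

subsection \<open>Hyperbolicity of the continuation\<close>

definition in_K :: "('a \<Rightarrow> 'a) \<Rightarrow> 'a \<Rightarrow> bool" where
  "in_K g x \<longleftrightarrow> (\<forall>k. zpow g k x \<in> K)"

text \<open>Derivative of an integer iterate in the coordinates of \<open>\<kappa>\<close>;
  meaningful at points satisfying \<open>in_K\<close>, whose whole orbit stays in the chart
  domain.\<close>

definition Dz :: "('a \<Rightarrow> 'a) \<Rightarrow> int \<Rightarrow> 'a \<Rightarrow> real \<times> 's \<Rightarrow> real \<times> 's" where
  "Dz g k x = frechet_derivative (\<phi> \<circ> zpow g k \<circ> \<psi>) (at (\<phi> x))"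

lemma in_K_dom: "in_K g x \<Longrightarrow> zpow g k x \<in> dom" using K_dom by (auto simp: in_K_def)

lemma in_K_dom0: "in_K g x \<Longrightarrow> x \<in> dom" using in_K_dom[of g x 0] by simp

lemma in_K_zpow: "good g \<Longrightarrow> in_K g x \<Longrightarrow> in_K g (zpow g k x)"
  unfolding in_K_def using zpow_add[OF good_bij] by metis

lemma in_K_h: "good g \<Longrightarrow> in_K g (h g p)"
  unfolding in_K_def using h_zpow orb_V V_K by metis

lemma chain_in_chart:
  assumes F: "continuous_on UNIV F" and x: "x \<in> dom" "F x \<in> dom"
    and d: "(\<phi> \<circ> F \<circ> \<psi> has_derivative L) (at (\<phi> x))" "(\<phi> \<circ> F' \<circ> \<psi> has_derivative L') (at (\<phi> (F x)))"
  shows "(\<phi> \<circ> (F' \<circ> F) \<circ> \<psi> has_derivative L' \<circ> L) (at (\<phi> x))"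
proof -
  have "((\<phi> \<circ> F' \<circ> \<psi>) \<circ> (\<phi> \<circ> F \<circ> \<psi>) has_derivative L' \<circ> L) (at (\<phi> x))"
    by (rule diff_chain_at[OF d(1)]) (use d(2) \<psi>_\<phi>[OF x(1)] in simp)
  then show ?thesis
  proof (rule has_derivative_transform_within_open)
    show "open (\<phi> ` (dom \<inter> F -` dom))" by (rule open_chart_domain[OF F])
    show "\<phi> x \<in> \<phi> ` (dom \<inter> F -` dom)" using x by auto
  qed (auto simp: \<psi>_\<phi>)
qed

lemma differentiable_funpow:
  assumes f: "f \<in> Diff A r" and x: "\<And>n. (f ^^ n) x \<in> dom"
  shows "\<exists>L. (\<phi> \<circ> f ^^ n \<circ> \<psi> has_derivative L) (at (\<phi> x))"
proof (induction n)
  case 0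
  have "(\<phi> \<circ> f ^^ 0 \<circ> \<psi> has_derivative id) (at (\<phi> x))"
    by (rule has_derivative_transform_within_open[OF has_derivative_id open_\<Omega>])
      (use x[of 0] \<phi>_mem \<phi>_\<psi> in auto)
  then show ?case by blast
next
  case (Suc n)
  then obtain L where L: "(\<phi> \<circ> f ^^ n \<circ> \<psi> has_derivative L) (at (\<phi> x))" by blast
  have "(\<phi> \<circ> f \<circ> \<psi> has_derivative D f ((f ^^ n) x)) (at (\<phi> ((f ^^ n) x)))"
    by (rule has_derivative_D[OF f r]) (use x[of n] x[of "Suc n"] in auto)
  have "x \<in> dom" using x[of 0] by simp
  from chain_in_chart[OF continuous_funpow[OF Diff_continuous[OF f]] this x L
      \<open>(\<phi> \<circ> f \<circ> \<psi> has_derivative D f ((f ^^ n) x)) (at (\<phi> ((f ^^ n) x)))\<close>]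
  show ?case unfolding funpow.simps(2) by blast
qed

lemma has_derivative_Dz:
  assumes g: "good g" and x: "in_K g x"
  shows "(\<phi> \<circ> zpow g k \<circ> \<psi> has_derivative Dz g k x) (at (\<phi> x))"
proof -
  have "\<exists>L. (\<phi> \<circ> zpow g k \<circ> \<psi> has_derivative L) (at (\<phi> x))"
  proof (cases "k \<ge> 0")
    case True
    have "(g ^^ n) x \<in> dom" for n using in_K_dom[OF x, of "int n"] by (simp add: zpow_of_nat)
    from differentiable_funpow[OF good_Diff[OF g] this] True show ?thesis by (simp add: zpow_def)
  next
    case False
    have "(inv g ^^ n) x \<in> dom" for n using in_K_dom[OF x, of "- int n"] by (simp add: zpow_neg)
    from differentiable_funpow[OF Diff_inv[OF good_Diff[OF g]] this] False show ?thesis by (simp add: zpow_def)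
  qed
  then show ?thesis unfolding Dz_def using frechet_derivative_at by metis
qed

lemma linear_Dz: "good g \<Longrightarrow> in_K g x \<Longrightarrow> linear (Dz g k x)"
  using has_derivative_Dz has_derivative_linear by blast

lemma Dz_add:
  assumes g: "good g" and x: "in_K g x"
  shows "Dz g (j + k) x v = Dz g j (zpow g k x) (Dz g k x v)"
proof -
  have "(\<phi> \<circ> (zpow g j \<circ> zpow g k) \<circ> \<psi> has_derivative Dz g j (zpow g k x) \<circ> Dz g k x) (at (\<phi> x))"
    by (rule chain_in_chart[OF continuous_zpow[OF g] in_K_dom0[OF x] in_K_dom[OF x]
          has_derivative_Dz[OF g x] has_derivative_Dz[OF g in_K_zpow[OF g x]]])
  moreover have "zpow g j \<circ> zpow g k = zpow g (j + k)" using zpow_add[OF good_bij[OF g]] by (simp add: fun_eq_iff)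
  ultimately have "Dz g (j + k) x = Dz g j (zpow g k x) \<circ> Dz g k x"
    using has_derivative_Dz[OF g x] has_derivative_unique by metis
  then show ?thesis by simp
qed

lemma Dz_0:
  assumes g: "good g" and x: "in_K g x" shows "Dz g 0 x v = v"
proof -
  have "(\<phi> \<circ> zpow g 0 \<circ> \<psi> has_derivative id) (at (\<phi> x))"
    by (rule has_derivative_transform_within_open[OF has_derivative_id open_\<Omega>])
      (use in_K_dom0[OF x] \<phi>_mem \<phi>_\<psi> in auto)
  then show ?thesis using has_derivative_Dz[OF g x] has_derivative_unique by (metis id_apply)
qed

lemma zpow_1: "zpow g 1 = g" using zpow_of_nat[of g 1] by (simp add: fun_eq_iff)

lemma Dz_1: "Dz g 1 x = D g x" by (simp add: Dz_def D_def zpow_1)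

lemma Dz_step:
  assumes g: "good g" and x: "in_K g x"
  shows "Dz g (k + 1) x v = D g (zpow g k x) (Dz g k x v)"
  using Dz_add[OF g x, of 1 k v] by (simp add: Dz_1 add.commute)

lemma in_K_near:
  assumes g: "good g" and x: "in_K g x"
  shows "\<exists>i. \<forall>v. norm (D g (zpow g k x) v - H.F' i v) \<le> \<eta> * norm v"
proof -
  have "zpow g k x \<in> K" using x by (simp add: in_K_def)
  then obtain i where i: "\<phi> (zpow g k x) \<in> H.V i" using K_V by blast
  then show ?thesis using good_D_near[OF g i] \<psi>_\<phi> in_K_dom[OF x] by auto
qed

text \<open>The stable space consists of the vectors with bounded forward orbit, the unstable one
  (\<open>bwd\<close>) of those with bounded backward orbit. In this form linearity and invariance
  follow directly, and the decay comes from the cone estimates.\<close>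

definition fwd :: "('a \<Rightarrow> 'a) \<Rightarrow> 'a \<Rightarrow> (real \<times> 's) set" where
  "fwd g x = {v. \<exists>b. \<forall>k\<ge>0. norm (Dz g k x v) \<le> b}"

definition bwd :: "('a \<Rightarrow> 'a) \<Rightarrow> 'a \<Rightarrow> (real \<times> 's) set" where
  "bwd g x = {v. \<exists>b. \<forall>k\<le>0. norm (Dz g k x v) \<le> b}"

lemma subspace_bounded:
  assumes lin: "\<And>k. k \<in> S \<Longrightarrow> linear (L k)"
  shows "subspace {v. \<exists>b. \<forall>k\<in>S. norm (L k v) \<le> (b::real)}"
  unfolding subspace_def
proof (intro conjI ballI allI)
  show "0 \<in> {v. \<exists>b. \<forall>k\<in>S. norm (L k v) \<le> b}" using lin by (auto simp: linear_0 intro: exI[of _ 0])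
  fix u v c
  assume u: "u \<in> {v. \<exists>b. \<forall>k\<in>S. norm (L k v) \<le> b}"
  then obtain b where b: "\<And>k. k \<in> S \<Longrightarrow> norm (L k u) \<le> b" by blast
  have "norm (L k (c *\<^sub>R u)) \<le> \<bar>c\<bar> * b" if "k \<in> S" for k
    using b[OF that] lin[OF that] by (simp add: linear_cmul mult_left_mono)
  then show "c *\<^sub>R u \<in> {v. \<exists>b. \<forall>k\<in>S. norm (L k v) \<le> b}" by blast
  assume "v \<in> {v. \<exists>b. \<forall>k\<in>S. norm (L k v) \<le> b}"
  then obtain b' where b': "\<And>k. k \<in> S \<Longrightarrow> norm (L k v) \<le> b'" by blast
  have "norm (L k (u + v)) \<le> b + b'" if "k \<in> S" for k
    using norm_triangle_mono[OF b[OF that] b'[OF that]] lin[OF that] by (simp add: linear_add)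
  then show "u + v \<in> {v. \<exists>b. \<forall>k\<in>S. norm (L k v) \<le> b}" by blast
qed

lemma subspace_fwd: "good g \<Longrightarrow> in_K g x \<Longrightarrow> subspace (fwd g x)"
proof -
  assume "good g" "in_K g x"
  then have "subspace {v. \<exists>b. \<forall>k\<in>{0..}. norm (Dz g k x v) \<le> b}"
    by (intro subspace_bounded linear_Dz)
  then show ?thesis by (simp add: fwd_def Ball_def)
qed

lemma subspace_bwd: "good g \<Longrightarrow> in_K g x \<Longrightarrow> subspace (bwd g x)"
proof -
  assume "good g" "in_K g x"
  then have "subspace {v. \<exists>b. \<forall>k\<in>{..0}. norm (Dz g k x v) \<le> b}"
    by (intro subspace_bounded linear_Dz)
  then show ?thesis by (simp add: bwd_def Ball_def)
qed

text \<open>Passing from \<open>x\<close> to \<open>g x\<close> shifts the orbit of the vector by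
  one; the maxima in the bounds account for the single additional term.\<close>

lemma fwd_bwd_invariant:
  assumes g: "good g" and x: "in_K g x"
  shows "D g x v \<in> fwd g (g x) \<longleftrightarrow> v \<in> fwd g x" "D g x v \<in> bwd g (g x) \<longleftrightarrow> v \<in> bwd g x"
proof -
  have e: "Dz g k (g x) (D g x v) = Dz g (k + 1) x v" for k
    using Dz_add[OF g x, of k 1 v] by (simp add: Dz_1 zpow_1)
  have x0: "Dz g 0 x v = v" by (rule Dz_0[OF g x])
  show "D g x v \<in> fwd g (g x) \<longleftrightarrow> v \<in> fwd g x"
  proof
    assume "D g x v \<in> fwd g (g x)"
    then obtain b where b: "\<And>k. k \<ge> 0 \<Longrightarrow> norm (Dz g (k + 1) x v) \<le> b" by (auto simp: fwd_def e)
    have "norm (Dz g k x v) \<le> max b (norm v)" if "k \<ge> 0" for k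
      using b[of "k - 1"] that x0 by (cases "k = 0") auto
    then show "v \<in> fwd g x" unfolding fwd_def by blast
  next
    assume "v \<in> fwd g x"
    then obtain b where "\<And>k. k \<ge> 0 \<Longrightarrow> norm (Dz g k x v) \<le> b" by (auto simp: fwd_def)
    then have "\<forall>k\<ge>0. norm (Dz g (k + 1) x v) \<le> b" by simp
    then show "D g x v \<in> fwd g (g x)" unfolding fwd_def mem_Collect_eq e by blast
  qed
  show "D g x v \<in> bwd g (g x) \<longleftrightarrow> v \<in> bwd g x"
  proof
    assume "D g x v \<in> bwd g (g x)"
    then obtain b where b: "\<And>k. k \<le> 0 \<Longrightarrow> norm (Dz g (k + 1) x v) \<le> b" by (auto simp: bwd_def e)
    have "norm (Dz g k x v) \<le> b" if "k \<le> 0" for k using b[of "k - 1"] that by simp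
    then show "v \<in> bwd g x" unfolding bwd_def by blast
  next
    assume "v \<in> bwd g x"
    then obtain b where b: "\<And>k. k \<le> 0 \<Longrightarrow> norm (Dz g k x v) \<le> b" by (auto simp: bwd_def)
    have "norm (Dz g (k + 1) x v) \<le> max b (norm (Dz g 1 x v))" if "k \<le> 0" for k
      using b[of "k + 1"] that by (cases "k = 0") auto
    then have "\<forall>k\<le>0. norm (Dz g (k + 1) x v) \<le> max b (norm (Dz g 1 x v))" by blast
    then show "D g x v \<in> bwd g (g x)" unfolding bwd_def mem_Collect_eq e by blast
  qed
qed

text \<open>The derivative of the inverse at \<open>g x\<close> supplies the preimage.\<close>

lemma D_surj:
  assumes g: "good g" and x: "in_K g x"
  shows "\<exists>u. D g x u = v"
proof -
  have gx: "in_K g (g x)" using in_K_zpow[OF g x, of 1] by (simp add: zpow_1)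
  have z: "zpow g (-1) (g x) = x" using zpow_add[OF good_bij[OF g], of "-1" 1 x] by (simp add: zpow_1)
  have "Dz g (1 + (-1)) (g x) v = Dz g 1 (zpow g (-1) (g x)) (Dz g (-1) (g x) v)"
    by (rule Dz_add[OF g gx])
  then have "v = D g x (Dz g (-1) (g x) v)" using Dz_0[OF g gx, of v] by (simp add: z Dz_1)
  then show ?thesis by metis
qed

lemma fwd_decay:
  assumes g: "good g" and x: "in_K g x" and v: "v \<in> fwd g x"
  shows "norm (Dz g (int n) x v) \<le> 2 * (7/10) ^ n * norm v"
proof -
  obtain b where b: "\<And>k. k \<ge> 0 \<Longrightarrow> norm (Dz g k x v) \<le> b" using v by (auto simp: fwd_def)
  have "norm (Dz g (int n) x v) \<le> 2 * (7/10) ^ n * norm (Dz g (int 0) x v)"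
  proof (rule H.forward_bounded_decay[of "\<lambda>n. Dz g (int n) x v"])
    show "\<exists>i. norm (Dz g (int (Suc n)) x v - H.F' i (Dz g (int n) x v)) \<le> \<eta> * norm (Dz g (int n) x v)" for n
    proof -
      have "Dz g (int (Suc n)) x v = D g (zpow g (int n) x) (Dz g (int n) x v)"
        using Dz_step[OF g x, of "int n" v] by (simp add: add.commute)
      then show ?thesis using in_K_near[OF g x, of "int n"] by metis
    qed
    show "norm (Dz g (int n) x v) \<le> b" for n by (rule b) simp
  qed
  then show ?thesis by (simp add: Dz_0[OF g x])
qed

lemma bwd_decay:
  assumes g: "good g" and x: "in_K g x" and v: "v \<in> bwd g x"
  shows "norm (Dz g (- int n) x v) \<le> 2 * (7/10) ^ n * norm v"
proof -
  obtain b where b: "\<And>k. k \<le> 0 \<Longrightarrow> norm (Dz g k x v) \<le> b" using v by (auto simp: bwd_def)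
  have "norm (Dz g (- int n) x v) \<le> 2 * (7/10) ^ n * norm (Dz g (- int 0) x v)"
  proof (rule H.backward_bounded_decay[of "\<lambda>n. Dz g (- int n) x v"])
    show "\<exists>i. norm (Dz g (- int n) x v - H.F' i (Dz g (- int (Suc n)) x v)) \<le> \<eta> * norm (Dz g (- int (Suc n)) x v)" for n
    proof -
      have "Dz g (- int n) x v = D g (zpow g (- int (Suc n)) x) (Dz g (- int (Suc n)) x v)"
        using Dz_step[OF g x, of "- int (Suc n)" v] by simp
      then show ?thesis using in_K_near[OF g x, of "- int (Suc n)"] by metis
    qed
    show "norm (Dz g (- int n) x v) \<le> b" for n by (rule b) simp
  qed
  then show ?thesis by (simp add: Dz_0[OF g x])
qed

lemma fwd_bwd_zero:
  assumes g: "good g" and x: "in_K g x" and v: "v \<in> fwd g x" "v \<in> bwd g x"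
  shows "v = 0"
proof -
  obtain b b' where b: "\<And>k. k \<ge> 0 \<Longrightarrow> norm (Dz g k x v) \<le> b" "\<And>k. k \<le> 0 \<Longrightarrow> norm (Dz g k x v) \<le> b'"
    using v by (auto simp: fwd_def bwd_def)
  have "Dz g 0 x v = 0"
  proof (rule H.bounded_orbit_zero[of "\<lambda>k. Dz g k x v"])
    show "\<exists>i. norm (Dz g (k + 1) x v - H.F' i (Dz g k x v)) \<le> \<eta> * norm (Dz g k x v)" for k
      using in_K_near[OF g x, of k] Dz_step[OF g x, of k v] by metis
    show "norm (Dz g k x v) \<le> max b b'" for k using b[of k] by (cases "k \<ge> 0") auto
  qed
  then show ?thesis by (simp add: Dz_0[OF g x])
qed

text \<open>A bounded solution with impulse \<open>w\<close> on arrival at time 0 satisfies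
  \<open>y 0 = z + w\<close>, where \<open>z\<close> continues the past and \<open>y 0\<close>
  begins the future. Hence \<open>y 0\<close> has a bounded forward orbit, \<open>z\<close> a
  bounded backward one, and \<open>w = y 0 + (- z)\<close>.\<close>

lemma fwd_bwd_sum:
  assumes g: "good g" and x: "in_K g x"
  shows "\<exists>u\<in>fwd g x. \<exists>v\<in>bwd g x. w = u + v"
proof -
  define L where "L k = D g (zpow g k x)" for k
  have L1: "L k = Dz g 1 (zpow g k x)" for k by (simp add: L_def Dz_1)
  have lin: "linear (L k)" for k unfolding L1 by (rule linear_Dz[OF g in_K_zpow[OF g x]])
  obtain a where a: "\<And>k v. norm (L k v - H.F' (a k) v) \<le> \<eta> * norm v"
    using in_K_near[OF g x] unfolding L_def by metis
  obtain y b where y: "\<And>k. norm (y k) \<le> b" "\<And>k. y (k + 1) = L k (y k) + (if k = -1 then w else 0)"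
    using H.dichotomy_split[where L = L and a = a and v = w, OF lin a] by blast
  have st: "Dz g (k + 1) x u = L k (Dz g k x u)" for k u unfolding L_def by (rule Dz_step[OF g x])
  have f: "Dz g (int n) x (y 0) = y (int n)" for n
  proof (induction n)
    case (Suc n)
    have "Dz g (int n + 1) x (y 0) = L (int n) (Dz g (int n) x (y 0))" by (rule st)
    then show ?case using Suc y(2)[of "int n"] by (simp add: add.commute)
  qed (simp add: Dz_0[OF g x])
  have "norm (Dz g k x (y 0)) \<le> b" if "k \<ge> 0" for k
    using f[of "nat k"] y(1)[of k] that by simp
  then have u: "y 0 \<in> fwd g x" unfolding fwd_def by blast
  define z where "z = L (-1) (y (-1))"
  have zw: "y 0 = z + w" using y(2)[of "-1"] by (simp add: z_def)
  \<comment> \<open>The solution is only known to satisfy forward steps; injectivity of each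
    \<open>L k\<close> allows going back in time.\<close>
  have bk: "Dz g (- int (Suc n)) x z = y (- int (Suc n))" for n
  proof (induction n)
    case 0
    have "Dz g (-1 + 1) (zpow g (-1) x) (y (-1)) = Dz g (-1) (zpow g 1 (zpow g (-1) x)) (Dz g 1 (zpow g (-1) x) (y (-1)))"
      by (rule Dz_add[OF g in_K_zpow[OF g x]])
    moreover have "zpow g 1 (zpow g (-1) x) = x" using zpow_add[OF good_bij[OF g], of 1 "-1" x] by simp
    ultimately show ?case using Dz_0[OF g in_K_zpow[OF g x]] by (simp add: z_def L1)
  next
    case (Suc n)
    let ?k = "- int (Suc (Suc n))"
    have inj: "inj (L ?k)"
    proof (rule injI)
      fix u v assume "L ?k u = L ?k v"
      then have "Dz g (-1) (zpow g 1 (zpow g ?k x)) (Dz g 1 (zpow g ?k x) u)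
          = Dz g (-1) (zpow g 1 (zpow g ?k x)) (Dz g 1 (zpow g ?k x) v)" by (simp only: L1)
      then show "u = v"
        unfolding Dz_add[OF g in_K_zpow[OF g x], symmetric] by (simp add: Dz_0[OF g in_K_zpow[OF g x]])
    qed
    have "L ?k (Dz g ?k x z) = Dz g (?k + 1) x z" by (rule st[symmetric])
    also have "\<dots> = y (?k + 1)" using Suc by simp
    also have "\<dots> = L ?k (y ?k)" using y(2)[of ?k] by simp
    finally show ?case using inj by (rule injD[rotated])
  qed
  have "norm (Dz g k x z) \<le> max b (norm z)" if "k \<le> 0" for k
  proof (cases "k = 0")
    case False
    then have "- int (Suc (nat (- k) - 1)) = k" using that by simp
    then show ?thesis using bk[of "nat (- k) - 1"] y(1)[of k] by simp
  qed (simp add: Dz_0[OF g x])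
  then have "z \<in> bwd g x" unfolding bwd_def by blast
  then have "- z \<in> bwd g x" by (rule subspace_neg[OF subspace_bwd[OF g x]])
  then show ?thesis using u zw by (intro bexI[of _ "y 0"] bexI[of _ "- z"]) auto
qed

text \<open>The rate is 7/10. In the constant \<open>2 * m^2\<close> the 2 comes from the decay
  lemmas, and one factor \<open>m\<close> each from comparing Riemannian and Euclidean norms at the
  start and at the end.\<close>

lemma hyperbolic_h:
  assumes g: "good g"
  shows "hyperbolic_set A G g (h g ` \<Lambda>)"
proof -
  have cV: "compact (H.V True \<union> H.V False)" "H.V True \<union> H.V False \<subseteq> \<Omega>"
    using H.compact_V V_\<Omega> by auto
  obtain m where m: "m > 0" "\<And>y v. y \<in> H.V True \<union> H.V False \<Longrightarrow>
      norm v \<le> m * tangent_norm G (\<psi> y) (J (\<psi> y) v) \<and> tangent_norm G (\<psi> y) (J (\<psi> y) v) \<le> m * norm v"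
    using tangent_norm_equiv[OF cV] by blast
  have mK: "norm v \<le> m * tangent_norm G p (J p v)" "tangent_norm G p (J p v) \<le> m * norm v" if "p \<in> K" for p v
    using m(2) that unfolding K_def by blast+
  define Es Eu where "Es x = J x ` fwd g x" and "Eu x = J x ` bwd g x" for x
  have tm: "tangent_map A (zpow g k) x (J x v) = J (zpow g k x) (Dz g k x v)" if x: "in_K g x" for k x v
    by (rule tangent_map_J[OF continuous_zpow[OF g] in_K_dom0[OF x] in_K_dom[OF x] has_derivative_Dz[OF g x]])
  have tm1: "tangent_map A g x (J x v) = J (g x) (D g x v)" if "in_K g x" for x v
    using tm[OF that, of 1 v] by (simp add: zpow_1 Dz_1)
  have decay: "tangent_norm G (zpow g k x) (tangent_map A (zpow g k) x (J x u)) \<le> 2 * m\<^sup>2 * (7/10) ^ n * tangent_norm G x (J x u)"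
    if x: "in_K g x" and le: "norm (Dz g k x u) \<le> 2 * (7/10) ^ n * norm u" for x k u n
  proof -
    have "x \<in> K" "zpow g k x \<in> K" using x unfolding in_K_def by (metis zpow_0, blast)
    then have "tangent_norm G (zpow g k x) (tangent_map A (zpow g k) x (J x u)) \<le> m * norm (Dz g k x u)"
      unfolding tm[OF x] using mK(2) by blast
    also have "\<dots> \<le> m * (2 * (7/10) ^ n * norm u)" using m(1) le by (intro mult_left_mono) auto
    also have "\<dots> \<le> m * (2 * (7/10) ^ n * (m * tangent_norm G x (J x u)))"
      using m(1) mK(1)[OF \<open>x \<in> K\<close>] by (intro mult_left_mono) auto
    finally show ?thesis by (simp add: power2_eq_square mult_ac)
  qed
  have hyp: "subspace (Es x) \<and> subspace (Eu x) \<and>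
          Es x \<inter> Eu x = {0} \<and> {u + v | u v. u \<in> Es x \<and> v \<in> Eu x} = UNIV \<and>
          tangent_map A g x ` Es x = Es (g x) \<and> tangent_map A g x ` Eu x = Eu (g x) \<and>
          (\<forall>n. \<forall>v\<in>Es x.
             tangent_norm G ((g ^^ n) x) (tangent_map A (g ^^ n) x v)
               \<le> 2 * m\<^sup>2 * (7/10) ^ n * tangent_norm G x v) \<and>
          (\<forall>n. \<forall>v\<in>Eu x.
             tangent_norm G ((inv g ^^ n) x) (tangent_map A (inv g ^^ n) x v)
               \<le> 2 * m\<^sup>2 * (7/10) ^ n * tangent_norm G x v)" if "x \<in> h g ` \<Lambda>" for x
  proof (intro conjI allI ballI)
    have x: "in_K g x" using that in_K_h[OF g] by blast
    note xd = in_K_dom0[OF x]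
    have lJ: "linear (J x)" by (rule linear_J[OF xd])
    have sub: "subspace (fwd g x)" "subspace (bwd g x)" using subspace_fwd subspace_bwd g x by auto
    show s: "subspace (Es x)" "subspace (Eu x)"
      unfolding Es_def Eu_def by (intro linear_subspace_image lJ sub)+
    have "v = 0" if "v \<in> Es x" "v \<in> Eu x" for v
    proof -
      obtain u w where "u \<in> fwd g x" "v = J x u" "w \<in> bwd g x" "v = J x w"
        using \<open>v \<in> Es x\<close> \<open>v \<in> Eu x\<close> by (auto simp: Es_def Eu_def)
      moreover from this have "u = w" using J'_J[OF xd] by metis
      ultimately show ?thesis using fwd_bwd_zero[OF g x, of u] linear_0[OF lJ] by simp
    qed
    then show "Es x \<inter> Eu x = {0}" using subspace_0[OF s(1)] subspace_0[OF s(2)] by blast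
    have "\<exists>u\<in>Es x. \<exists>w\<in>Eu x. v = u + w" for v
    proof -
      obtain u w where uw: "u \<in> fwd g x" "w \<in> bwd g x" "J' x v = u + w"
        using fwd_bwd_sum[OF g x, of "J' x v"] by blast
      then have "v = J x u + J x w" using J_J'[OF xd, of v] linear_add[OF lJ] by metis
      then show ?thesis using uw by (auto simp: Es_def Eu_def)
    qed
    then show "{u + v | u v. u \<in> Es x \<and> v \<in> Eu x} = UNIV" by blast
    show "tangent_map A g x ` Es x = Es (g x)"
      unfolding Es_def image_image tm1[OF x]
    proof (intro equalityI subsetI)
      fix y assume "y \<in> J (g x) ` fwd g (g x)"
      then obtain v where v: "v \<in> fwd g (g x)" "y = J (g x) v" by blast
      obtain u where "D g x u = v" using D_surj[OF g x] by blast
      then show "y \<in> (\<lambda>v. J (g x) (D g x v)) ` fwd g x" using v fwd_bwd_invariant(1)[OF g x, of u] by blast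
    qed (use fwd_bwd_invariant(1)[OF g x] in blast)
    show "tangent_map A g x ` Eu x = Eu (g x)"
      unfolding Eu_def image_image tm1[OF x]
    proof (intro equalityI subsetI)
      fix y assume "y \<in> J (g x) ` bwd g (g x)"
      then obtain v where v: "v \<in> bwd g (g x)" "y = J (g x) v" by blast
      obtain u where "D g x u = v" using D_surj[OF g x] by blast
      then show "y \<in> (\<lambda>v. J (g x) (D g x v)) ` bwd g x" using v fwd_bwd_invariant(2)[OF g x, of u] by blast
    qed (use fwd_bwd_invariant(2)[OF g x] in blast)
    fix n v
    show "tangent_norm G ((g ^^ n) x) (tangent_map A (g ^^ n) x v) \<le> 2 * m\<^sup>2 * (7/10) ^ n * tangent_norm G x v"
      if v: "v \<in> Es x"
    proof -
      obtain u where u: "u \<in> fwd g x" "v = J x u" using v unfolding Es_def by blast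
      show ?thesis using decay[OF x fwd_decay[OF g x u(1)], of n] by (simp add: u(2) zpow_of_nat)
    qed
    show "tangent_norm G ((inv g ^^ n) x) (tangent_map A (inv g ^^ n) x v) \<le> 2 * m\<^sup>2 * (7/10) ^ n * tangent_norm G x v"
      if v: "v \<in> Eu x"
    proof -
      obtain u where u: "u \<in> bwd g x" "v = J x u" using v unfolding Eu_def by blast
      show ?thesis using decay[OF x bwd_decay[OF g x u(1)], of n] by (simp add: u(2) zpow_neg)
    qed
  qed
  have 1: "compact (h g ` \<Lambda>)" by (rule compact_continuous_image[OF h_continuous[OF g] compact_\<Lambda>])
  have 2: "g ` h g ` \<Lambda> = h g ` \<Lambda>"
  proof -
    have "g ` h g ` \<Lambda> = h g ` f0 ` \<Lambda>" unfolding image_image using h_conjugates[OF g] by simp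
    then show ?thesis by (simp add: f0_image_\<Lambda>)
  qed
  have 3: "2 * m\<^sup>2 > 0" "0 < (7/10::real)" "(7/10::real) < 1" using m(1) by auto
  show ?thesis
    unfolding hyperbolic_set_def
    by (intro conjI 1 2, rule exI[of _ Es], rule exI[of _ Eu], rule exI[of _ "2 * m\<^sup>2"],
      rule exI[of _ "7/10"], intro conjI 3, rule ballI, rule hyp, assumption)
qed

theorem hyperbolic_continuation_h:
  assumes W: "openin (Cr_topology A r) W" "f0 \<in> W" "\<And>g. g \<in> W \<Longrightarrow> good g"
  shows "hyperbolic_continuation A G r f0 \<Lambda> W h"
  unfolding hyperbolic_continuation_def
proof (intro conjI ballI allI impI)
  fix g assume g: "g \<in> W"
  show "hyperbolic_set A G g (h g ` \<Lambda>)" by (rule hyperbolic_h[OF W(3)[OF g]])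
  show "\<exists>k. homeomorphism \<Lambda> (h g ` \<Lambda>) (h g) k" by (rule h_homeomorphism[OF W(3)[OF g]])
  show "h g (f0 x) = g (h g x)" for x by (rule h_conjugates[OF W(3)[OF g]])
  fix \<epsilon> :: real assume "\<epsilon> > 0"
  from h_depends_continuously[OF W(3)[OF g] this]
  show "\<exists>W'. openin (Cr_topology A r) W' \<and> g \<in> W' \<and>
      (\<forall>g'\<in>W' \<inter> W. \<forall>x\<in>\<Lambda>. rdist A G (h g' x) (h g x) < ennreal \<epsilon>)"
    using W(3) by (metis IntD1 IntD2)
qed (use W h_f0 in auto)

end

subsection \<open>Lebesgue measure under locally Lipschitz maps\<close>

lemma measure_cball_scaled:
  assumes "DIM('a) = DIM('b)" "K \<ge> 0" "r \<ge> 0"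
  shows "measure lebesgue (cball (y::'b::euclidean_space) (K * r))
    = K ^ DIM('a) * measure lebesgue (cball (x::'a::euclidean_space) r)"
  using assms by (simp add: content_cball power_mult_distrib)

lemma continuous_on_locally_lipschitz:
  fixes T :: "'a::real_normed_vector \<Rightarrow> 'b::real_normed_vector"
  assumes "K \<ge> 0" and lip: "\<And>x. x \<in> S \<Longrightarrow> \<exists>d>0. \<forall>y\<in>S. norm (y - x) < d \<longrightarrow> norm (T y - T x) \<le> K * norm (y - x)"
  shows "continuous_on S T"
  unfolding continuous_on_iff
proof (intro ballI allI impI)
  fix x and e :: real assume x: "x \<in> S" and e: "e > 0"
  obtain d where d: "d > 0" "\<And>y. y \<in> S \<Longrightarrow> norm (y - x) < d \<Longrightarrow> norm (T y - T x) \<le> K * norm (y - x)"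
    using lip[OF x] by blast
  define d' where "d' = min d (e / (K + 1))"
  have "d' > 0" using d(1) e assms(1) by (simp add: d'_def)
  moreover have "dist (T y) (T x) < e" if y: "y \<in> S" "dist y x < d'" for y
  proof -
    have n: "norm (y - x) < d" "norm (y - x) < e / (K + 1)" using y(2) by (auto simp: d'_def dist_norm)
    have "norm (T y - T x) \<le> K * norm (y - x)" by (rule d(2)[OF y(1) n(1)])
    also have "\<dots> \<le> (K + 1) * norm (y - x)" by (intro mult_right_mono) auto
    also have "\<dots> < e" using n(2) assms(1) by (simp add: pos_less_divide_eq mult.commute)
    finally show ?thesis by (simp add: dist_norm)
  qed
  ultimately show "\<exists>d>0. \<forall>y\<in>S. dist y x < d \<longrightarrow> dist (T y) (T x) < e" by blast
qed

text \<open>Vitali covering: almost all of \<open>S\<close> lies in disjoint small balls inside an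
  open set of nearly the same measure. The part of \<open>S\<close> in a ball maps into a ball
  \<open>K\<close> times as large, so no constant is lost beyond \<open>K ^ n\<close>; the uncovered
  null set has a null image.\<close>

lemma measure_locally_lipschitz_image:
  fixes T :: "'a::euclidean_space \<Rightarrow> 'b::euclidean_space"
  assumes dim: "DIM('a) = DIM('b)" and S: "compact S" and K: "K \<ge> 0"
    and lip: "\<And>x. x \<in> S \<Longrightarrow> \<exists>d>0. \<forall>y\<in>S. norm (y - x) < d \<longrightarrow> norm (T y - T x) \<le> K * norm (y - x)"
  shows "measure lebesgue (T ` S) \<le> K ^ DIM('a) * measure lebesgue S"
proof (rule field_le_epsilon)
  fix e0 :: real assume e0: "e0 > 0"
  define n where "n = DIM('a)"
  define e where "e = e0 / (K ^ n + 1)"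
  have Kn: "K ^ n \<ge> 0" using K by simp
  have e: "e > 0" "K ^ n * e \<le> e0" using e0 Kn by (auto simp: e_def add_nonneg_pos field_simps)
  have cT: "compact (T ` S)"
    by (intro compact_continuous_image S continuous_on_locally_lipschitz[OF K lip])
  obtain O' where O': "open O'" "S \<subseteq> O'" "O' - S \<in> lmeasurable" "emeasure lebesgue (O' - S) < ennreal e"
    using sets_lebesgue_outer_open[OF _ e(1), of S] S by (metis fmeasurableD lmeasurable_compact)
  have Sm: "S \<in> lmeasurable" by (rule lmeasurable_compact[OF S])
  have Oeq: "O' = (O' - S) \<union> S" using O'(2) by blast
  then have Om: "O' \<in> lmeasurable" using O'(3) Sm by (metis fmeasurable.Un)
  have "measure lebesgue O' \<le> measure lebesgue (O' - S) + measure lebesgue S"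
    using measure_Un_le[of "O' - S" lebesgue S] O'(3) Sm Oeq by auto
  moreover have "measure lebesgue (O' - S) \<le> e"
    using O'(4) e(1) unfolding measure_def by (intro enn2real_leI less_imp_le)
  ultimately have mO: "measure lebesgue O' \<le> measure lebesgue S + e" by linarith
  define I where "I = {i. fst i \<in> S \<and> 0 < snd i \<and> cball (fst i) (snd i) \<subseteq> O' \<and>
      (\<forall>y\<in>S \<inter> cball (fst i) (snd i). norm (T y - T (fst i)) \<le> K * norm (y - fst i))}"
  have vit: "\<exists>i. i \<in> I \<and> x \<in> cball (fst i) (snd i) \<and> snd i < d" if x: "x \<in> S" and d: "0 < d" for x d
  proof -
    obtain d1 where d1: "d1 > 0" "\<And>y. y \<in> S \<Longrightarrow> norm (y - x) < d1 \<Longrightarrow> norm (T y - T x) \<le> K * norm (y - x)"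
      using lip[OF x] by blast
    obtain d2 where d2: "d2 > 0" "cball x d2 \<subseteq> O'" using O'(1,2) x open_contains_cball by blast
    define s where "s = min (min (d1 / 2) d2) (d / 2)"
    have s: "0 < s" "s < d1" "s \<le> d2" "s < d" using d1(1) d2(1) d by (auto simp: s_def)
    then have "(x, s) \<in> I" using x d1(2) d2(2) by (auto simp: I_def dist_norm norm_minus_commute)
    then show ?thesis using s by (intro exI[of _ "(x, s)"]) auto
  qed
  obtain C where C: "countable C" "C \<subseteq> I"
     "pairwise (\<lambda>i j. disjnt (cball (fst i) (snd i)) (cball (fst j) (snd j))) C"
     "negligible (S - (\<Union>i\<in>C. cball (fst i) (snd i)))"
    by (rule Vitali_covering_theorem_cballs[of I snd S fst]) (use vit in \<open>auto simp: I_def\<close>)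
  let ?B = "\<lambda>i. cball (T (fst i)) (K * snd i)"
  have neg: "negligible (T ` (S - (\<Union>i\<in>C. cball (fst i) (snd i))))"
  proof (rule negligible_locally_Lipschitz_image[OF _ C(4)])
    fix x assume "x \<in> S - (\<Union>i\<in>C. cball (fst i) (snd i))"
    then obtain d where "d > 0" "\<forall>y\<in>S. norm (y - x) < d \<longrightarrow> norm (T y - T x) \<le> K * norm (y - x)"
      using lip by blast
    then show "\<exists>U B. open U \<and> x \<in> U \<and>
        (\<forall>y\<in>(S - (\<Union>i\<in>C. cball (fst i) (snd i))) \<inter> U. norm (T y - T x) \<le> B * norm (y - x))"
      by (intro exI[of _ "ball x d"] exI[of _ K]) (auto simp: dist_norm norm_minus_commute)
  qed (use dim in simp)
  have Bm: "?B i \<in> lmeasurable" for i by simp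
  \<comment> \<open>The bound is uniform over finite subfamilies, so the countable union has finite
    measure with the same bound.\<close>
  have bound: "measure lebesgue (\<Union>i\<in>I'. ?B i) \<le> K ^ n * measure lebesgue O'" if I': "I' \<subseteq> C" "finite I'" for I'
  proof -
    have "measure lebesgue (\<Union>i\<in>I'. ?B i) \<le> (\<Sum>i\<in>I'. measure lebesgue (?B i))"
      by (intro measure_UNION_le I'(2)) auto
    also have "\<dots> = (\<Sum>i\<in>I'. K ^ n * measure lebesgue (cball (fst i) (snd i)))"
    proof (rule sum.cong[OF refl])
      fix i assume "i \<in> I'"
      then have "snd i \<ge> 0" using I' C(2) by (force simp: I_def)
      then show "measure lebesgue (?B i) = K ^ n * measure lebesgue (cball (fst i) (snd i))"
        unfolding n_def by (rule measure_cball_scaled[OF dim K])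
    qed
    also have "\<dots> = K ^ n * (\<Sum>i\<in>I'. measure lebesgue (cball (fst i) (snd i)))"
      by (simp add: sum_distrib_left)
    also have "(\<Sum>i\<in>I'. measure lebesgue (cball (fst i) (snd i)))
        = measure lebesgue (\<Union>i\<in>I'. cball (fst i) (snd i))"
    proof (rule measure_finite_Union[symmetric, OF I'(2)])
      show "disjoint_family_on (\<lambda>i. cball (fst i) (snd i)) I'"
        using C(3) I'(1) unfolding disjoint_family_on_def pairwise_def disjnt_def by blast
      show "emeasure lebesgue (cball (fst i) (snd i)) \<noteq> \<infinity>" for i :: "'a \<times> real"
        using emeasure_lborel_cball_finite[of "fst i" "snd i"] by auto
    qed auto
    also have "\<dots> \<le> measure lebesgue O'"
      using I' C(2) by (intro measure_mono_fmeasurable Om) (auto simp: I_def)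
    finally show ?thesis using Kn by (simp add: mult_left_mono)
  qed
  have Um: "(\<Union>i\<in>C. ?B i) \<in> lmeasurable" by (rule fmeasurable_UN_bound[OF C(1) Bm bound])
  have Ub: "measure lebesgue (\<Union>i\<in>C. ?B i) \<le> K ^ n * measure lebesgue O'"
    by (rule measure_UN_bound[OF C(1) Bm bound])
  let ?N = "T ` (S - (\<Union>i\<in>C. cball (fst i) (snd i)))"
  have sub: "T ` S \<subseteq> ?N \<union> (\<Union>i\<in>C. ?B i)"
  proof
    fix z assume "z \<in> T ` S"
    then obtain x where x: "x \<in> S" "z = T x" by blast
    show "z \<in> ?N \<union> (\<Union>i\<in>C. ?B i)"
    proof (cases "\<exists>i\<in>C. x \<in> cball (fst i) (snd i)")
      case True
      then obtain i where i: "i \<in> C" "x \<in> cball (fst i) (snd i)" by blast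
      then have "norm (T x - T (fst i)) \<le> K * norm (x - fst i)" using C(2) x by (force simp: I_def)
      also have "\<dots> \<le> K * snd i" using i(2) K by (intro mult_left_mono) (auto simp: dist_norm norm_minus_commute)
      finally have "z \<in> ?B i" using x(2) by (simp add: dist_norm norm_minus_commute)
      then show ?thesis using i(1) by blast
    qed (use x in blast)
  qed
  have Nm: "?N \<in> lmeasurable" using neg by (rule negligible_imp_measurable)
  have "measure lebesgue (T ` S) \<le> measure lebesgue (?N \<union> (\<Union>i\<in>C. ?B i))"
    by (rule measure_mono_fmeasurable[OF sub _ fmeasurable.Un[OF Nm Um]])
      (use lmeasurable_compact[OF cT] in auto)
  also have "\<dots> \<le> measure lebesgue ?N + measure lebesgue (\<Union>i\<in>C. ?B i)"
    by (rule measure_Un_le) (use Nm Um in auto)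
  also have "measure lebesgue ?N = 0" using neg by (rule negligible_imp_measure0)
  also have "0 + measure lebesgue (\<Union>i\<in>C. ?B i) \<le> K ^ n * (measure lebesgue S + e)"
    using Ub mult_left_mono[OF mO Kn] by linarith
  also have "\<dots> \<le> K ^ DIM('a) * measure lebesgue S + e0"
    using e(2) by (simp add: distrib_left n_def)
  finally show "measure lebesgue (T ` S) \<le> K ^ DIM('a) * measure lebesgue S + e0" .
qed

text \<open>On a compact set the derivative is bounded by \<open>K - 1\<close>; the additional 1
  absorbs the error of the linear approximation near each point.\<close>

lemma measure_C1_image_le:
  fixes T :: "'a::euclidean_space \<Rightarrow> 'b::euclidean_space"
  assumes dim: "DIM('a) = DIM('b)" and T: "Ck_on (Suc 0) U T" "open U" and Q: "compact Q" "Q \<subseteq> U"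
  shows "\<exists>C\<ge>0. \<forall>S. compact S \<and> S \<subseteq> Q \<longrightarrow> measure lebesgue (T ` S) \<le> C * measure lebesgue S"
proof -
  note d = Ck_on_SucD[OF T]
  define D where "D x = frechet_derivative T (at x)" for x
  have "\<exists>B. \<forall>x\<in>Q. norm (D x b) \<le> B" if "b \<in> Basis" for b
  proof -
    have "continuous_on Q (\<lambda>x. D x b)"
      unfolding D_def using continuous_on_subset[OF Ck_on_continuous[OF d(2)[OF that]] Q(2)] .
    then have "bounded ((\<lambda>x. D x b) ` Q)" using Q(1) compact_continuous_image compact_imp_bounded by blast
    then show ?thesis by (auto simp: bounded_iff)
  qed
  then obtain B where B: "\<And>b x. b \<in> Basis \<Longrightarrow> x \<in> Q \<Longrightarrow> norm (D x b) \<le> B b" by metis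
  define K where "K = (\<Sum>b\<in>Basis. \<bar>B b\<bar>) + 1"
  have K: "K \<ge> 0" unfolding K_def by (simp add: sum_nonneg)
  have DK: "norm (D x v) \<le> (K - 1) * norm v" if x: "x \<in> Q" for x v
  proof -
    have l: "linear (D x)" unfolding D_def using d(1) x Q(2) has_derivative_linear by blast
    have "norm (D x v) \<le> (\<Sum>b\<in>Basis. norm ((v \<bullet> b) *\<^sub>R D x b))"
      unfolding linear_expand_Basis[OF l, of v] by (rule norm_sum)
    also have "\<dots> \<le> (\<Sum>b\<in>Basis. norm v * \<bar>B b\<bar>)"
      by (intro sum_mono) (auto intro!: mult_mono Basis_le_norm order_trans[OF B[OF _ x] abs_ge_self])
    finally show ?thesis by (simp add: K_def sum_distrib_left mult.commute)
  qed
  have "measure lebesgue (T ` S) \<le> K ^ DIM('a) * measure lebesgue S" if S: "compact S" "S \<subseteq> Q" for S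
  proof (rule measure_locally_lipschitz_image[OF dim S(1) K])
    fix x assume x: "x \<in> S"
    then have "(T has_derivative D x) (at x)" unfolding D_def using d(1) S Q by blast
    then obtain e where e: "e > 0" "\<And>y. norm (y - x) < e \<Longrightarrow> norm (T y - T x - D x (y - x)) \<le> 1 * norm (y - x)"
      unfolding has_derivative_at_alt by (metis zero_less_one)
    have "norm (T y - T x) \<le> K * norm (y - x)" if "norm (y - x) < e" for y
    proof -
      have "norm (T y - T x) \<le> norm (D x (y - x)) + norm (T y - T x - D x (y - x))" by (rule norm_triangle_sub)
      also have "\<dots> \<le> (K - 1) * norm (y - x) + 1 * norm (y - x)"
        using DK[of x "y - x"] e(2)[OF that] x S by (intro add_mono) auto
      finally show ?thesis by (simp add: algebra_simps)
    qed
    then show "\<exists>d>0. \<forall>y\<in>S. norm (y - x) < d \<longrightarrow> norm (T y - T x) \<le> K * norm (y - x)" using e(1) by blast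
  qed
  then show ?thesis using K by (intro exI[of _ "K ^ DIM('a)"]) auto
qed

text \<open>Serves both for two charts on the same set (\<open>u\<close> the identity) and for one
  step of a diffeomorphism. Compactness of \<open>P\<close> and \<open>R\<close> gives a compact
  \<open>Q\<close> on which the derivative is bounded.\<close>

lemma chart_measure_compare:
  fixes a :: "('m::t2_space, 'e::euclidean_space) chart" and b :: "('m, 'f::euclidean_space) chart"
  assumes dim: "DIM('e) = DIM('f)" and ab: "is_chart a" "is_chart b"
    and u: "continuous_on UNIV u" "Ck_on (Suc 0) (snd a ` (fst a \<inter> u -` fst b)) (snd b \<circ> u \<circ> chart_inv a)"
    and P: "compact P" "P \<subseteq> fst a" and R: "compact R" "R \<subseteq> fst b"
  shows "\<exists>C\<ge>0. \<forall>S. compact S \<and> S \<subseteq> P \<and> u ` S \<subseteq> R \<longrightarrow>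
     measure lebesgue (snd b ` u ` S) \<le> C * measure lebesgue (snd a ` S)"
proof -
  note ca = chart_facts[OF ab(1)] and cb = chart_facts[OF ab(2)]
  define Q where "Q = snd a ` (P \<inter> u -` R)"
  have "compact (P \<inter> u -` R)"
    by (intro compact_Int_closed P closed_vimage compact_imp_closed R u)
  then have Q: "compact Q" unfolding Q_def
    by (intro compact_continuous_image continuous_on_subset[OF ca(6)]) (use P in auto)
  have QU: "Q \<subseteq> snd a ` (fst a \<inter> u -` fst b)" unfolding Q_def using P R by blast
  have oU: "open (snd a ` (fst a \<inter> u -` fst b))" by (intro ca(8) open_vimage cb(1) u(1))
  obtain C where C: "C \<ge> 0" "\<And>S. compact S \<Longrightarrow> S \<subseteq> Q \<Longrightarrow>
      measure lebesgue ((snd b \<circ> u \<circ> chart_inv a) ` S) \<le> C * measure lebesgue S"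
    using measure_C1_image_le[OF dim u(2) oU Q QU] by blast
  have "measure lebesgue (snd b ` u ` S) \<le> C * measure lebesgue (snd a ` S)"
    if S: "compact S" "S \<subseteq> P" "u ` S \<subseteq> R" for S
  proof -
    have "compact (snd a ` S)"
      by (intro compact_continuous_image continuous_on_subset[OF ca(6)] S) (use S P in auto)
    moreover have "snd a ` S \<subseteq> Q" unfolding Q_def using S by blast
    moreover have "(snd b \<circ> u \<circ> chart_inv a) ` (snd a ` S) = snd b ` u ` S"
      unfolding image_image using ca(3) S P by (intro image_cong) auto
    ultimately show ?thesis using C(2)[of "snd a ` S"] by simp
  qed
  then show ?thesis using C(1) by blast
qed

section \<open>Doubling against rare losses\<close>

text \<open>A step that begins and ends with \<open>P\<close> doubles; any other loses at most the
  factor \<open>C\<close>. Hence \<open>a 0 * 2 ^ n \<le> a n * (2 * C) ^ t n\<close>, where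
  \<open>t n\<close> counts the other steps. As \<open>t n\<close> grows more slowly than any
  multiple of \<open>n\<close>, the doubling violates the bound \<open>B\<close>.\<close>

lemma geometric_growth_contradiction:
  fixes a :: "nat \<Rightarrow> real"
  assumes a0: "a 0 > 0" and bd: "\<And>n. a n \<le> B" and C: "C \<ge> 1"
    and step: "\<And>i. a i \<le> C * a (Suc i)" "\<And>i. P i \<Longrightarrow> P (Suc i) \<Longrightarrow> 2 * a i \<le> a (Suc i)"
    and sparse: "\<And>\<gamma>. \<gamma> > 0 \<Longrightarrow> \<forall>\<^sub>F n in sequentially. real (card {i. i < n \<and> \<not> P i}) \<le> \<gamma> * real n"
  shows False
proof -
  define t where "t n = card {i. i < n \<and> \<not> (P i \<and> P (Suc i))}" for n
  define b where "b n = card {i. i < n \<and> \<not> P i}" for n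
  have apos: "a n > 0" for n
  proof (induction n)
    case (Suc n)
    then have "0 < C * a (Suc n)" using step(1)[of n] by linarith
    then show ?case using C by (simp add: zero_less_mult_iff)
  qed (rule a0)
  have grow: "a 0 * 2 ^ n \<le> a n * (2 * C) ^ t n" for n
  proof (induction n)
    case 0 show ?case by (simp add: t_def)
  next
    case (Suc n)
    show ?case
    proof (cases "P n \<and> P (Suc n)")
      case True
      then have "{i. i < Suc n \<and> \<not> (P i \<and> P (Suc i))} = {i. i < n \<and> \<not> (P i \<and> P (Suc i))}"
        by (auto simp: less_Suc_eq)
      then have t: "t (Suc n) = t n" by (simp add: t_def)
      have "a 0 * 2 ^ Suc n \<le> (2 * a n) * (2 * C) ^ t n" using Suc by simp
      also have "\<dots> \<le> a (Suc n) * (2 * C) ^ t n" using step(2)[of n] True C by (intro mult_right_mono) auto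
      finally show ?thesis by (simp add: t)
    next
      case False
      then have "{i. i < Suc n \<and> \<not> (P i \<and> P (Suc i))} = insert n {i. i < n \<and> \<not> (P i \<and> P (Suc i))}"
        by (auto simp: less_Suc_eq)
      then have t: "t (Suc n) = Suc (t n)" by (simp add: t_def)
      have "a 0 * 2 ^ Suc n \<le> 2 * (a n * (2 * C) ^ t n)" using Suc by simp
      also have "\<dots> \<le> 2 * ((C * a (Suc n)) * (2 * C) ^ t n)"
        using step(1)[of n] C by (intro mult_left_mono mult_right_mono) auto
      finally show ?thesis by (simp add: t mult_ac)
    qed
  qed
  \<comment> \<open>A bad time spoils at most the two steps that touch it; the last step ends at
    time \<open>n\<close>, hence \<open>Suc n\<close>.\<close>
  have tb: "t n \<le> 2 * b (Suc n)" for n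
  proof -
    have f: "finite {i. i < n \<and> \<not> P i}" "finite {i. i < n \<and> \<not> P (Suc i)}" for n by auto
    have "{i. i < n \<and> \<not> (P i \<and> P (Suc i))} \<subseteq> {i. i < n \<and> \<not> P i} \<union> {i. i < n \<and> \<not> P (Suc i)}" by auto
    then have "t n \<le> card ({i. i < n \<and> \<not> P i} \<union> {i. i < n \<and> \<not> P (Suc i)})"
      unfolding t_def by (intro card_mono) auto
    also have "\<dots> \<le> card {i. i < n \<and> \<not> P i} + card {i. i < n \<and> \<not> P (Suc i)}" by (rule card_Un_le)
    also have "card {i. i < n \<and> \<not> P i} \<le> b (Suc n)" unfolding b_def by (intro card_mono) auto
    also have "card {i. i < n \<and> \<not> P (Suc i)} = card (Suc ` {i. i < n \<and> \<not> P (Suc i)})"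
      by (simp add: card_image)
    also have "\<dots> \<le> b (Suc n)" unfolding b_def by (intro card_mono) auto
    finally show ?thesis by simp
  qed
  \<comment> \<open>The power \<open>2 ^ p\<close> beats the loss \<open>2 * C\<close>. With bad
    times of density at most \<open>1 / (8 * p)\<close> the exponent \<open>p * t n\<close> is at
    most \<open>n / 2\<close>, so half of the doubling survives.\<close>
  obtain p :: nat where p: "2 * C < 2 ^ p" using real_arch_pow[of 2 "2 * C"] by auto
  have p1: "p \<ge> 1" using p C by (cases p) auto
  have "\<forall>\<^sub>F n in sequentially. real (b n) \<le> 1 / (8 * real p) * real n"
    unfolding b_def by (rule sparse) (use p1 in simp)
  then obtain n0 where n0: "\<And>n. n \<ge> n0 \<Longrightarrow> real (b n) \<le> 1 / (8 * real p) * real n"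
    by (auto simp: eventually_sequentially)
  obtain n1 :: nat where n1: "2 * B / a 0 < real n1" using reals_Archimedean2 by blast
  define n where "n = max (max n0 n1) 1"
  have n: "n \<ge> n0" "n \<ge> n1" "n \<ge> 1" by (auto simp: n_def)
  have "real (b (Suc n)) \<le> 1 / (8 * real p) * real (Suc n)" using n0[of "Suc n"] n by simp
  then have "8 * real p * real (b (Suc n)) \<le> real (Suc n)" using p1 by (simp add: field_simps)
  then have "8 * p * b (Suc n) \<le> Suc n" by (metis (mono_tags) of_nat_le_iff of_nat_mult of_nat_numeral)
  moreover have "2 * (p * t n) \<le> 4 * (p * b (Suc n))"
    using mult_le_mono2[OF tb[of n], of p] by simp
  ultimately have pt: "2 * (p * t n) \<le> n" using n(3) by linarith
  have "a 0 * 2 ^ n \<le> a n * (2 ^ p) ^ t n"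
    using grow[of n] apos[of n] power_mono[of "2 * C" "2 ^ p" "t n"] p C
    by (meson less_imp_le mult_left_mono order_trans mult_nonneg_nonneg zero_le_numeral zero_le_one)
  also have "(2 ^ p) ^ t n = (2::real) ^ (p * t n)" by (simp add: power_mult)
  finally have 1: "a 0 * 2 ^ n \<le> a n * 2 ^ (p * t n)" .
  have "(2::real) ^ n = 2 ^ (n - p * t n) * 2 ^ (p * t n)" using pt by (simp add: power_add[symmetric])
  with 1 have "a 0 * 2 ^ (n - p * t n) \<le> a n" by (simp add: mult.assoc[symmetric])
  then have 2: "a 0 * 2 ^ (n - p * t n) \<le> B" using bd[of n] by linarith
  have "n - p * t n < 2 ^ (n - p * t n)" by (rule less_exp)
  then have "real (n - p * t n) \<le> 2 ^ (n - p * t n)" by (metis less_imp_le of_nat_le_iff of_nat_numeral of_nat_power)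
  moreover have "real n / 2 \<le> real (n - p * t n)"
  proof -
    have "real (2 * (p * t n)) \<le> real n" using pt by (rule of_nat_mono)
    then show ?thesis using pt by (simp add: of_nat_diff)
  qed
  ultimately have "real n / 2 \<le> 2 ^ (n - p * t n)" by linarith
  then have "a 0 * (real n / 2) \<le> B" using 2 a0 by (meson less_imp_le mult_left_mono order_trans)
  then have "real n \<le> 2 * B / a 0" using a0 by (simp add: field_simps)
  then show False using n1 n(2) by linarith
qed

text \<open>Markov's inequality: every bad time contributes at least \<delta> to the sum.\<close>

lemma average_to_zero_sparse:
  fixes s :: "nat \<Rightarrow> ennreal"
  assumes lim: "(\<lambda>n. (\<Sum>i<n. s i) / of_nat n) \<longlonglongrightarrow> 0"
    and \<delta>: "\<delta> > 0" "\<And>i. \<not> P i \<Longrightarrow> ennreal \<delta> \<le> s i" and \<gamma>: "\<gamma> > 0"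
  shows "\<forall>\<^sub>F n in sequentially. real (card {i. i < n \<and> \<not> P i}) \<le> \<gamma> * real n"
proof -
  have "\<forall>\<^sub>F n in sequentially. (\<Sum>i<n. s i) / of_nat n < ennreal (\<delta> * \<gamma>)"
    using lim \<delta>(1) \<gamma> by (intro order_tendstoD(2)) auto
  then show ?thesis
  proof (rule eventually_rev_mp[OF _ eventually_mono[OF eventually_gt_at_top[of 0]]], intro impI)
    fix n :: nat assume n: "0 < n" and lt: "(\<Sum>i<n. s i) / of_nat n < ennreal (\<delta> * \<gamma>)"
    let ?b = "card {i. i < n \<and> \<not> P i}"
    have "of_nat ?b * ennreal \<delta> = (\<Sum>i\<in>{i. i < n \<and> \<not> P i}. ennreal \<delta>)" by simp
    also have "\<dots> \<le> (\<Sum>i\<in>{i. i < n \<and> \<not> P i}. s i)" by (intro sum_mono \<delta>(2)) auto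
    also have "\<dots> \<le> (\<Sum>i<n. s i)" by (intro sum_mono2) auto
    finally have "of_nat ?b * ennreal \<delta> / of_nat n < ennreal (\<delta> * \<gamma>)"
      using lt by (meson divide_right_mono_ennreal le_less_trans)
    moreover have "of_nat ?b * ennreal \<delta> / of_nat n = ennreal (real ?b * \<delta> / real n)"
      using n \<delta>(1) by (simp add: ennreal_of_nat_eq_real_of_nat ennreal_mult[symmetric] divide_ennreal)
    ultimately have "real ?b * \<delta> / real n < \<delta> * \<gamma>" using \<delta>(1) \<gamma> by (simp add: ennreal_less_iff)
    then have "real ?b * \<delta> < \<gamma> * real n * \<delta>" using n by (simp add: pos_divide_less_eq mult_ac)
    then show "real ?b \<le> \<gamma> * real n" using \<delta>(1) by simp
  qed
qed

context linear_chart
begin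

subsection \<open>A finite measure on the manifold\<close>

lemma DIM_eq: "DIM('e) = DIM('f)"
proof -
  have "dim (Lin ` UNIV) = dim (UNIV :: 'e set)"
    by (rule dim_image_eq[OF Lin(1)]) (metis Lin(3) inj_on_inverseI)
  moreover have "Lin ` UNIV = UNIV" using bij_Lin by (simp add: bij_is_surj)
  ultimately show ?thesis by simp
qed

lemma compact_UNIV: "compact (UNIV :: 'a set)"
  using M by (simp add: closed_riemannian_manifold_def)

lemma finite_chart_cover:
  "\<exists>F. finite F \<and> (\<forall>x\<in>F. fst x \<in> A \<and> compact (snd x) \<and> snd x \<subseteq> fst (fst x)) \<and> (\<Union>x\<in>F. snd x) = (UNIV :: 'a set)"
proof -
  have "\<exists>P U. compact P \<and> P \<subseteq> fst (chart_at A p) \<and> open U \<and> p \<in> U \<and> U \<subseteq> P" for p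
  proof -
    let ?d = "chart_at A p"
    note d = chart_facts[OF charts[OF chart_at(1)[of p]]]
    obtain e where e: "e > 0" "cball (snd ?d p) e \<subseteq> snd ?d ` fst ?d"
      using d(2) chart_at(2)[of p] open_contains_cball by blast
    have b: "ball (snd ?d p) e \<subseteq> snd ?d ` fst ?d" using e(2) ball_subset_cball by blast
    have "compact (chart_inv ?d ` cball (snd ?d p) e)"
      by (intro compact_continuous_image continuous_on_subset[OF d(7) e(2)] compact_cball)
    moreover have "chart_inv ?d ` cball (snd ?d p) e \<subseteq> fst ?d" using e(2) d(4) by blast
    moreover have "open (chart_inv ?d ` ball (snd ?d p) e)" by (rule d(9)[OF open_ball b])
    moreover have "p \<in> chart_inv ?d ` ball (snd ?d p) e"
      using d(3)[OF chart_at(2)] e(1) by (metis centre_in_ball imageI)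
    moreover have "chart_inv ?d ` ball (snd ?d p) e \<subseteq> chart_inv ?d ` cball (snd ?d p) e" by auto
    ultimately show ?thesis by blast
  qed
  then obtain P U where PU: "\<And>p. compact (P p)" "\<And>p. P p \<subseteq> fst (chart_at A p)" "\<And>p. open (U p)"
    "\<And>p. p \<in> U p" "\<And>p. U p \<subseteq> P p" by metis
  obtain F where F: "finite F" "UNIV \<subseteq> (\<Union>p\<in>F. U p)"
    using compactE_image[OF compact_UNIV, of UNIV U] PU by (metis UNIV_I UN_I subsetI)
  have "(\<Union>x\<in>(\<lambda>p. (chart_at A p, P p)) ` F. snd x) = UNIV" using F(2) PU(5) by force
  then show ?thesis
    using F(1) PU(1,2) chart_at(1) by (intro exI[of _ "(\<lambda>p. (chart_at A p, P p)) ` F"]) auto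
qed

definition cover :: "(('a, 'e) chart \<times> 'a set) set" where
  "cover = (SOME F. finite F \<and> (\<forall>x\<in>F. fst x \<in> A \<and> compact (snd x) \<and> snd x \<subseteq> fst (fst x)) \<and>
     (\<Union>x\<in>F. snd x) = UNIV)"

lemma cover: "finite cover" "x \<in> cover \<Longrightarrow> fst x \<in> A" "x \<in> cover \<Longrightarrow> compact (snd x)"
  "x \<in> cover \<Longrightarrow> snd x \<subseteq> fst (fst x)" "(\<Union>x\<in>cover. snd x) = UNIV"
proof -
  note * = someI_ex[OF finite_chart_cover, folded cover_def]
  show "finite cover" using * by (rule conjunct1)
  have 2: "\<forall>x\<in>cover. fst x \<in> A \<and> compact (snd x) \<and> snd x \<subseteq> fst (fst x)" using * by (elim conjE)
  show "(\<Union>x\<in>cover. snd x) = UNIV" using * by (elim conjE)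
  assume "x \<in> cover"
  with 2 have "fst x \<in> A \<and> compact (snd x) \<and> snd x \<subseteq> fst (fst x)" by (rule bspec)
  then show "fst x \<in> A" "compact (snd x)" "snd x \<subseteq> fst (fst x)" by auto
qed

text \<open>A stand-in for a Riemannian volume, in which overlaps of the cover count several times.
  It is monotone and bounded on compact sets and comparable with Lebesgue measure in charts.\<close>

definition \<mu> :: "'a set \<Rightarrow> real" where
  "\<mu> S = (\<Sum>x\<in>cover. measure lebesgue (snd (fst x) ` (S \<inter> snd x)))"

lemma compact_chart_image:
  "is_chart b \<Longrightarrow> compact S \<Longrightarrow> S \<subseteq> fst b \<Longrightarrow> compact (snd b ` S)"
  by (intro compact_continuous_image continuous_on_subset[OF chart_continuous])

lemma compact_cover_piece:
  assumes "compact S" "x \<in> cover" shows "compact (snd (fst x) ` (S \<inter> snd x))"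
  using assms cover(2-4)[OF assms(2)]
  by (intro compact_chart_image charts compact_Int) auto

lemma \<mu>_nonneg: "\<mu> S \<ge> 0" unfolding \<mu>_def by (simp add: sum_nonneg)

lemma \<mu>_mono:
  assumes "compact S" "compact S'" "S \<subseteq> S'" shows "\<mu> S \<le> \<mu> S'"
  unfolding \<mu>_def
  by (intro sum_mono measure_mono_fmeasurable)
    (use assms in \<open>auto intro!: lmeasurable_compact compact_cover_piece fmeasurableD\<close>)

lemma \<mu>_bounded: "compact S \<Longrightarrow> \<mu> S \<le> \<mu> UNIV"
  by (rule \<mu>_mono) (auto simp: compact_UNIV)

text \<open>Stated for a pair \<open>u\<close>, \<open>v\<close> with two instances: the identity
  compares a chart with \<open>\<mu>\<close>, while \<open>u = inv g\<close> and
  \<open>v = g\<close> bound the loss of volume in one step.\<close>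

lemma measure_le_\<mu>:
  fixes b :: "('a, 'g::euclidean_space) chart"
  assumes dim: "DIM('e) = DIM('g)" and b: "is_chart b"
    and u: "continuous_on UNIV u" "continuous_on UNIV v" "\<And>p. u (v p) = p"
    and ck: "\<And>d. d \<in> A \<Longrightarrow> Ck_on (Suc 0) (snd d ` (fst d \<inter> u -` fst b)) (snd b \<circ> u \<circ> chart_inv d)"
    and R: "compact R" "R \<subseteq> fst b"
  shows "\<exists>C\<ge>0. \<forall>S. compact S \<and> S \<subseteq> R \<longrightarrow> measure lebesgue (snd b ` S) \<le> C * \<mu> (v ` S)"
proof -
  have "\<exists>C\<ge>0. \<forall>S. compact S \<and> S \<subseteq> snd x \<and> u ` S \<subseteq> R \<longrightarrow>
     measure lebesgue (snd b ` u ` S) \<le> C * measure lebesgue (snd (fst x) ` S)" if "x \<in> cover" for x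
    by (rule chart_measure_compare[OF dim charts[OF cover(2)[OF that]] b u(1) ck[OF cover(2)[OF that]]
          cover(3,4)[OF that] R])
  then obtain C where C: "\<And>x. x \<in> cover \<Longrightarrow> C x \<ge> 0"
    "\<And>x S. x \<in> cover \<Longrightarrow> compact S \<Longrightarrow> S \<subseteq> snd x \<Longrightarrow> u ` S \<subseteq> R \<Longrightarrow>
      measure lebesgue (snd b ` u ` S) \<le> C x * measure lebesgue (snd (fst x) ` S)" by metis
  have Csum: "C x \<le> sum C cover" if "x \<in> cover" for x
    using member_le_sum[OF that _ cover(1), of C] C(1) by auto
  have "measure lebesgue (snd b ` S) \<le> sum C cover * \<mu> (v ` S)" if S: "compact S" "S \<subseteq> R" for S
  proof -
    define X where "X x = v ` S \<inter> snd x" for x :: "('a, 'e) chart \<times> 'a set"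
    have cvS: "compact (v ` S)" by (intro compact_continuous_image continuous_on_subset[OF u(2)] S) auto
    have X: "compact (X x)" "X x \<subseteq> snd x" "u ` X x \<subseteq> R" if "x \<in> cover" for x
      unfolding X_def using cvS cover(3)[OF that] S(2) u(3) by (auto intro: compact_Int)
    have "S = (\<Union>x\<in>cover. u ` X x)"
    proof (intro equalityI subsetI)
      fix s assume s: "s \<in> S"
      obtain x where x: "x \<in> cover" "v s \<in> snd x" using cover(5) by (metis UNIV_I UN_E)
      then have "v s \<in> X x" "s = u (v s)" using s u(3) by (auto simp: X_def)
      then show "s \<in> (\<Union>x\<in>cover. u ` X x)" using x(1) by blast
    qed (auto simp: X_def u(3))
    then have "snd b ` S = (\<Union>x\<in>cover. snd b ` u ` X x)" by (metis image_UN)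
    then have "measure lebesgue (snd b ` S) = measure lebesgue (\<Union>x\<in>cover. snd b ` u ` X x)" by simp
    also have "\<dots> \<le> (\<Sum>x\<in>cover. measure lebesgue (snd b ` u ` X x))"
    proof (rule measure_UNION_le[OF cover(1)])
      fix x assume x: "x \<in> cover"
      have "compact (u ` X x)" by (intro compact_continuous_image continuous_on_subset[OF u(1)] X x) auto
      then have "compact (snd b ` u ` X x)" using compact_chart_image[OF b] X(3)[OF x] R(2) by blast
      then show "snd b ` u ` X x \<in> sets lebesgue" using lmeasurable_compact fmeasurableD by blast
    qed
    also have "\<dots> \<le> (\<Sum>x\<in>cover. C x * measure lebesgue (snd (fst x) ` X x))"
      by (intro sum_mono C X)
    also have "\<dots> \<le> (\<Sum>x\<in>cover. sum C cover * measure lebesgue (snd (fst x) ` X x))"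
      by (intro sum_mono mult_right_mono Csum) auto
    also have "\<dots> = sum C cover * \<mu> (v ` S)" by (simp add: \<mu>_def X_def sum_distrib_left)
    finally show ?thesis .
  qed
  moreover have "sum C cover \<ge> 0" using C(1) by (simp add: sum_nonneg)
  ultimately show ?thesis by blast
qed

lemma \<mu>_le_measure:
  fixes b :: "('a, 'g::euclidean_space) chart"
  assumes dim: "DIM('g) = DIM('e)" and b: "is_chart b" "\<And>d. d \<in> A \<Longrightarrow> smoothly_compatible b d"
    and R: "compact R" "R \<subseteq> fst b"
  shows "\<exists>C\<ge>0. \<forall>S. compact S \<and> S \<subseteq> R \<longrightarrow> \<mu> S \<le> C * measure lebesgue (snd b ` S)"
proof -
  have "\<exists>C\<ge>0. \<forall>S. compact S \<and> S \<subseteq> R \<and> id ` S \<subseteq> snd x \<longrightarrow>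
     measure lebesgue (snd (fst x) ` id ` S) \<le> C * measure lebesgue (snd b ` S)" if "x \<in> cover" for x
  proof (rule chart_measure_compare[OF dim b(1) charts[OF cover(2)[OF that]] continuous_on_id' _ R cover(3,4)[OF that]])
    show "Ck_on (Suc 0) (snd b ` (fst b \<inter> id -` fst (fst x))) (snd (fst x) \<circ> id \<circ> chart_inv b)"
      using b(2)[OF cover(2)[OF that]] by (simp add: smoothly_compatible_def smooth_on_def)
  qed
  then obtain C where C: "\<And>x. x \<in> cover \<Longrightarrow> C x \<ge> 0"
    "\<And>x S. x \<in> cover \<Longrightarrow> compact S \<Longrightarrow> S \<subseteq> R \<Longrightarrow> S \<subseteq> snd x \<Longrightarrow>
      measure lebesgue (snd (fst x) ` S) \<le> C x * measure lebesgue (snd b ` S)" by (simp, metis)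
  have "\<mu> S \<le> sum C cover * measure lebesgue (snd b ` S)" if S: "compact S" "S \<subseteq> R" for S
  proof -
    have cb: "compact (snd b ` S')" if "compact S'" "S' \<subseteq> S" for S'
      using compact_chart_image[OF b(1) that(1)] that S R by blast
    have "\<mu> S \<le> (\<Sum>x\<in>cover. C x * measure lebesgue (snd b ` S))"
      unfolding \<mu>_def
    proof (rule sum_mono)
      fix x assume x: "x \<in> cover"
      have k: "compact (S \<inter> snd x)" using S(1) cover(3)[OF x] by (rule compact_Int)
      have "measure lebesgue (snd (fst x) ` (S \<inter> snd x)) \<le> C x * measure lebesgue (snd b ` (S \<inter> snd x))"
        by (rule C(2)[OF x k]) (use S in auto)
      also have "\<dots> \<le> C x * measure lebesgue (snd b ` S)"
      proof (intro mult_left_mono C(1)[OF x] measure_mono_fmeasurable)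
        show "snd b ` (S \<inter> snd x) \<in> sets lebesgue" using lmeasurable_compact[OF cb[OF k]] fmeasurableD by blast
        show "snd b ` S \<in> lmeasurable" using lmeasurable_compact[OF cb[OF S(1)]] by simp
      qed auto
      finally show "measure lebesgue (snd (fst x) ` (S \<inter> snd x)) \<le> C x * measure lebesgue (snd b ` S)" .
    qed
    then show ?thesis by (simp add: sum_distrib_right)
  qed
  moreover have "sum C cover \<ge> 0" using C(1) by (simp add: sum_nonneg)
  ultimately show ?thesis by blast
qed

text \<open>The inverse of \<open>g\<close> has bounded derivatives on the compact pieces of the
  cover, so a single step shrinks volume at most by a constant factor.\<close>

lemma \<mu>_step:
  assumes g: "g \<in> Diff A r" "r \<ge> 1"
  shows "\<exists>C\<ge>0. \<forall>S. compact S \<longrightarrow> \<mu> S \<le> C * \<mu> (g ` S)"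
proof -
  have i: "inv g (g p) = p" for p using Diff_bij[OF g(1)] by (simp add: bij_is_inj)
  have "\<exists>C\<ge>0. \<forall>S. compact S \<and> S \<subseteq> snd x \<longrightarrow> measure lebesgue (snd (fst x) ` S) \<le> C * \<mu> (g ` S)"
    if x: "x \<in> cover" for x
  proof (rule measure_le_\<mu>[OF refl charts[OF cover(2)[OF x]] Diff_inv_continuous[OF g(1)]
        Diff_continuous[OF g(1)] i _ cover(3,4)[OF x]])
    fix d assume "d \<in> A"
    then have "Ck_on r (snd d ` (fst d \<inter> inv g -` fst (fst x))) (in_charts d (fst x) (inv g))"
      using Diff_inv[OF g(1)] cover(2)[OF x] by (auto simp: Diff_def Ck_map_def)
    then show "Ck_on (Suc 0) (snd d ` (fst d \<inter> inv g -` fst (fst x))) (snd (fst x) \<circ> inv g \<circ> chart_inv d)"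
      unfolding in_charts_def by (rule Ck_on_mono) (use g(2) in simp)
  qed
  then obtain C where C: "\<And>x. x \<in> cover \<Longrightarrow> C x \<ge> 0"
    "\<And>x S. x \<in> cover \<Longrightarrow> compact S \<Longrightarrow> S \<subseteq> snd x \<Longrightarrow> measure lebesgue (snd (fst x) ` S) \<le> C x * \<mu> (g ` S)"
    by metis
  have cg: "compact S \<Longrightarrow> compact (g ` S)" for S
    by (intro compact_continuous_image continuous_on_subset[OF Diff_continuous[OF g(1)]]) auto
  have "\<mu> S \<le> sum C cover * \<mu> (g ` S)" if S: "compact S" for S
  proof -
    have "\<mu> S \<le> (\<Sum>x\<in>cover. C x * \<mu> (g ` S))"
      unfolding \<mu>_def[of S]
    proof (rule sum_mono)
      fix x assume x: "x \<in> cover"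
      have k: "compact (S \<inter> snd x)" using S cover(3)[OF x] by (rule compact_Int)
      have "measure lebesgue (snd (fst x) ` (S \<inter> snd x)) \<le> C x * \<mu> (g ` (S \<inter> snd x))"
        by (rule C(2)[OF x k]) simp
      also have "\<dots> \<le> C x * \<mu> (g ` S)" by (intro mult_left_mono C(1)[OF x] \<mu>_mono cg k S) auto
      finally show "measure lebesgue (snd (fst x) ` (S \<inter> snd x)) \<le> C x * \<mu> (g ` S)" .
    qed
    then show ?thesis by (simp add: sum_distrib_right)
  qed
  moreover have "sum C cover \<ge> 0" using C(1) by (simp add: sum_nonneg)
  ultimately show ?thesis by blast
qed

lemma measure_chart_le_\<mu>:
  fixes b :: "('a, 'g::euclidean_space) chart"
  assumes dim: "DIM('e) = DIM('g)" and b: "is_chart b" "\<And>d. d \<in> A \<Longrightarrow> smoothly_compatible b d"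
    and R: "compact R" "R \<subseteq> fst b"
  shows "\<exists>C\<ge>0. \<forall>S. compact S \<and> S \<subseteq> R \<longrightarrow> measure lebesgue (snd b ` S) \<le> C * \<mu> S"
proof -
  have "\<exists>C\<ge>0. \<forall>S. compact S \<and> S \<subseteq> R \<longrightarrow> measure lebesgue (snd b ` S) \<le> C * \<mu> (id ` S)"
  proof (rule measure_le_\<mu>[OF dim b(1) continuous_on_id' continuous_on_id' _ _ R])
    fix d assume "d \<in> A"
    then show "Ck_on (Suc 0) (snd d ` (fst d \<inter> id -` fst b)) (snd b \<circ> id \<circ> chart_inv d)"
      using b(2) by (simp add: smoothly_compatible_def smooth_on_def Int_commute)
  qed simp
  then show ?thesis by simp
qed

text \<open>Inner regularity in a chart. Passing to a compact subset ensures that all its images are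
  compact, hence measurable.\<close>

lemma lebesgue_positive_compact:
  assumes "lebesgue_positive A E"
  shows "\<exists>S. compact S \<and> S \<subseteq> E \<and> \<mu> S > 0"
proof -
  obtain d where d: "d \<in> A" "snd d ` (E \<inter> fst d) \<in> sets lebesgue" "emeasure lebesgue (snd d ` (E \<inter> fst d)) > 0"
    using assms by (auto simp: lebesgue_positive_def)
  note cd = chart_facts[OF charts[OF d(1)]]
  define X where "X = snd d ` (E \<inter> fst d)"
  have "\<not> negligible X" using d(2,3) by (simp add: X_def negligible_iff_emeasure0)
  \<comment> \<open>If all compact subsets were null, closed inner approximations within balls would
    make \<open>X\<close> null.\<close>
  moreover have "negligible X" if cneg: "\<And>T. compact T \<Longrightarrow> T \<subseteq> X \<Longrightarrow> negligible T"
  proof -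
    have "X \<inter> cball 0 (real n) \<in> null_sets lebesgue" for n
    proof -
      have Xm: "X \<inter> cball 0 (real n) \<in> sets lebesgue" using d(2) by (auto simp: X_def)
      have small: "emeasure lebesgue (X \<inter> cball 0 (real n)) \<le> 0 + ennreal e" if e: "e > 0" for e
      proof -
        obtain T where T: "closed T" "T \<subseteq> X \<inter> cball 0 (real n)" "X \<inter> cball 0 (real n) - T \<in> lmeasurable"
          "emeasure lebesgue (X \<inter> cball 0 (real n) - T) < ennreal e"
          using sets_lebesgue_inner_closed[OF Xm e] by blast
        have "bounded T" using T(2) bounded_subset[OF bounded_cball] by blast
        then have "compact T" using T(1) compact_eq_bounded_closed by blast
        then have "negligible T" using T(2) by (intro cneg) auto
        then have nT: "T \<in> null_sets lebesgue" by (simp add: negligible_iff_null_sets)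
        have "emeasure lebesgue (X \<inter> cball 0 (real n)) = emeasure lebesgue (X \<inter> cball 0 (real n) - T)"
          by (rule emeasure_Diff_null_set[OF nT Xm, symmetric])
        then show ?thesis using T(4) by simp
      qed
      have "emeasure lebesgue (X \<inter> cball 0 (real n)) \<le> 0" by (rule ennreal_le_epsilon[OF small])
      then show ?thesis using Xm by (intro null_setsI) auto
    qed
    then have "(\<Union>n. X \<inter> cball 0 (real n)) \<in> null_sets lebesgue" by (intro null_sets_UN) auto
    moreover have "(\<Union>n. X \<inter> cball 0 (real n)) = X"
      using real_arch_simple by (auto simp: mem_cball)
    ultimately show ?thesis by (simp add: negligible_iff_null_sets)
  qed
  ultimately obtain T where T: "compact T" "T \<subseteq> X" "\<not> negligible T" by blast
  define S where "S = chart_inv d ` T"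
  have TX: "T \<subseteq> snd d ` fst d" using T(2) by (auto simp: X_def)
  have S: "compact S" unfolding S_def
    by (intro compact_continuous_image continuous_on_subset[OF cd(7) TX] T(1))
  have Sd: "S \<subseteq> E \<inter> fst d" unfolding S_def using T(2) cd(3) by (auto simp: X_def)
  have "snd d ` S = T" unfolding S_def image_image using TX cd(5) by force
  then have "measure lebesgue (snd d ` S) > 0"
    using T(3) lmeasurable_compact[OF T(1)] by (metis measure_nonneg negligible_iff_measure0 order_le_less zero_less_measure_iff)
  moreover obtain C where "C \<ge> 0" "measure lebesgue (snd d ` S) \<le> C * \<mu> S"
  proof -
    have comp: "smoothly_compatible d e" if "e \<in> A" for e using atlas d(1) that by (auto simp: smooth_atlas_def)
    have "S \<subseteq> fst d" using Sd by blast
    from measure_chart_le_\<mu>[OF refl charts[OF d(1)] comp S this] S that show ?thesis by blast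
  qed
  ultimately have "\<mu> S > 0" using \<mu>_nonneg[of S] by (cases "\<mu> S = 0") auto
  then show ?thesis using S Sd by blast
qed

end

subsection \<open>Volume expansion excludes strong pluripotency\<close>

text \<open>\<open>i0\<close> is the leg with the expanding fixed point \<open>wf\<close>,
  \<open>P\<close> inverts its linear part, and \<open>jac\<close> bounds the volume factor of
  \<open>P\<close>. The radius \<open>8 * \<eta>\<close> allows the fixed point of a nearby map to
  move by \<open>7 * \<eta>\<close> and still have a ball of radius \<eta> in the leg.\<close>

locale expanding_horseshoe =
  manifold_horseshoe A G c Lin Lin' v0 \<beta> \<alpha> B B' I Q \<eta> r f0
  for A :: "('a::{t2_space,second_countable_topology}, 'e::euclidean_space) chart set"
    and G :: "'a \<Rightarrow> 'e \<Rightarrow> 'e \<Rightarrow> real" and c :: "('a, 'e) chart"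
    and Lin :: "'e \<Rightarrow> real \<times> 's::euclidean_space" and Lin' :: "real \<times> 's \<Rightarrow> 'e" and v0 :: 'e
    and \<beta> \<alpha> :: "bool \<Rightarrow> real" and B B' :: "bool \<Rightarrow> 's \<Rightarrow> 's"
    and I :: "bool \<Rightarrow> real set" and Q :: "'s set" and \<eta> :: real
    and r :: nat and f0 :: "'a \<Rightarrow> 'a" +
  fixes i0 :: bool and wf :: "real \<times> 's" and P :: "real \<times> 's \<Rightarrow> real \<times> 's" and b jac :: real
  assumes wf: "H.F i0 wf = wf" "cball wf (8 * \<eta>) \<subseteq> H.V i0"
    and P: "linear P" "\<And>v. P (H.F' i0 v) = v" "\<And>v. norm (P v) \<le> b * norm v" "b \<ge> 0" "b * \<eta> \<le> 1/2"
    and jac: "\<And>X. compact X \<Longrightarrow> measure lebesgue (P ` X) \<le> jac * measure lebesgue X"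
      "2 ^ DIM(real \<times> 's) * jac \<le> 1/2"
begin

text \<open>Undoing the linear part gives \<open>T1\<close>, which differs from a translation by a
  map with Lipschitz constant \<open>b * \<eta>\<close>, at most 1/2. So the inverse of
  \<open>T1\<close> is 2-Lipschitz and costs at most \<open>2 ^ DIM\<close> in volume, which the
  factor \<open>jac\<close> outweighs.\<close>

lemma volume_growth:
  assumes g: "good g" and S: "compact S" "S \<subseteq> H.V i0"
  shows "2 * measure lebesgue S \<le> measure lebesgue ((\<phi> \<circ> g \<circ> \<psi>) ` S)"
proof -
  let ?T = "\<phi> \<circ> g \<circ> \<psi>"
  define T1 where "T1 w = P (?T w)" for w
  define e where "e w = ?T w - H.F i0 w" for w
  have expand: "norm (x - y) \<le> 2 * norm (T1 x - T1 y)" if xy: "x \<in> H.V i0" "y \<in> H.V i0" for x y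
  proof -
    have "?T x - ?T y = H.F' i0 (x - y) + (e x - e y)"
      by (simp add: e_def H.F_diff[symmetric])
    then have "T1 x - T1 y = (x - y) + P (e x - e y)"
      unfolding T1_def by (simp only: linear_diff[OF P(1), symmetric] linear_add[OF P(1)] P(2))
    moreover have "norm (P (e x - e y)) \<le> 1/2 * norm (x - y)"
    proof -
      have "norm (P (e x - e y)) \<le> b * (\<eta> * norm (x - y))"
        using P(3)[of "e x - e y"] mult_left_mono[OF H.near_lipschitz[OF good_near[OF g] xy] P(4)]
        unfolding e_def by linarith
      also have "\<dots> = (b * \<eta>) * norm (x - y)" by simp
      also have "\<dots> \<le> 1/2 * norm (x - y)" by (intro mult_right_mono P(5)) auto
      finally show ?thesis .
    qed
    ultimately show ?thesis
      using norm_triangle_sub[of "x - y" "- P (e x - e y)"] by simp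
  qed
  have cT: "continuous_on (H.V i0) ?T"
    using good_near[OF g] differentiable_imp_continuous_within
    unfolding H.near_def continuous_on_eq_continuous_within
    by (metis continuous_at_imp_continuous_within)
  have kT: "compact (?T ` S)" by (intro compact_continuous_image continuous_on_subset[OF cT] S)
  have T1S: "T1 ` S = P ` ?T ` S" by (simp add: T1_def image_image)
  have "continuous_on (?T ` S) P" using P(1) by (simp add: linear_continuous_on linear_conv_bounded_linear)
  then have kT1: "compact (T1 ` S)" unfolding T1S using kT compact_continuous_image by blast
  define U where "U = inv_into S T1"
  have "inj_on T1 S"
  proof (rule inj_onI)
    fix x y assume "x \<in> S" "y \<in> S" "T1 x = T1 y"
    then show "x = y" using expand[of x y] S(2) by auto
  qed
  then have US: "U (T1 x) = x" if "x \<in> S" for x using that by (simp add: U_def)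
  then have "U ` T1 ` S = S" by (force simp: image_iff)
  moreover have "measure lebesgue (U ` T1 ` S) \<le> 2 ^ DIM(real \<times> 's) * measure lebesgue (T1 ` S)"
  proof (rule measure_locally_lipschitz_image[OF refl kT1])
    fix z assume "z \<in> T1 ` S"
    then obtain x where x: "x \<in> S" "z = T1 x" by blast
    have "norm (U y - U z) \<le> 2 * norm (y - z)" if "y \<in> T1 ` S" for y
    proof -
      obtain x' where x': "x' \<in> S" "y = T1 x'" using \<open>y \<in> T1 ` S\<close> by blast
      show ?thesis unfolding x(2) x'(2) US[OF x(1)] US[OF x'(1)]
        by (rule expand) (use x x' S(2) in auto)
    qed
    then show "\<exists>d>0. \<forall>y\<in>T1 ` S. norm (y - z) < d \<longrightarrow> norm (U y - U z) \<le> 2 * norm (y - z)"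
      by (intro exI[of _ 1]) auto
  qed simp
  ultimately have "measure lebesgue S \<le> 2 ^ DIM(real \<times> 's) * measure lebesgue (T1 ` S)" by simp
  also have "\<dots> \<le> 2 ^ DIM(real \<times> 's) * (jac * measure lebesgue (?T ` S))"
    unfolding T1S by (intro mult_left_mono jac(1) kT) auto
  also have "\<dots> \<le> 1/2 * measure lebesgue (?T ` S)"
    using mult_right_mono[OF jac(2) measure_nonneg[of lebesgue "?T ` S"]] by (simp add: mult.assoc)
  finally show ?thesis by simp
qed

text \<open>Applies to any fixed point with an \<eta>-ball in the leg, whatever continuation it
  comes from.\<close>

lemma no_average_shadowing:
  assumes g: "good g" and y: "g (\<psi> y) = \<psi> y" "cball y \<eta> \<subseteq> H.V i0"
    and E: "lebesgue_positive A E"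
    and lim: "(\<lambda>n. (\<Sum>i<n. SUP p\<in>E. rdist A G ((g ^^ i) p) ((g ^^ i) (\<psi> y))) / of_nat n) \<longlonglongrightarrow> 0"
  shows False
proof -
  note gD = good_Diff[OF g]
  define N where "N = \<psi> ` cball y \<eta>"
  have y\<Omega>: "cball y \<eta> \<subseteq> \<Omega>" using y(2) V_\<Omega> by blast
  have kN: "compact N" unfolding N_def
    by (intro compact_continuous_image continuous_on_subset[OF continuous_\<psi> y\<Omega>] compact_cball)
  have Nd: "N \<subseteq> dom" using y\<Omega> \<psi>_mem by (auto simp: N_def)
  have \<phi>N: "\<phi> p \<in> cball y \<eta>" if "p \<in> N" for p using that y\<Omega> \<phi>_\<psi> by (auto simp: N_def subset_iff)
  obtain \<delta> where \<delta>: "\<delta> > 0" "\<And>p. p \<notin> \<psi> ` ball y \<eta> \<Longrightarrow> ennreal \<delta> \<le> rdist A G p (\<psi> y)"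
    using rdist_ge[OF H.\<eta>(1) y\<Omega>] by blast
  have \<delta>N: "ennreal \<delta> \<le> rdist A G p (\<psi> y)" if "p \<notin> N" for p
  proof (rule \<delta>(2))
    show "p \<notin> \<psi> ` ball y \<eta>" using that ball_subset_cball unfolding N_def by blast
  qed
  obtain E' where E': "compact E'" "E' \<subseteq> E" "\<mu> E' > 0" using lebesgue_positive_compact[OF E] by blast
  define S where "S n = (g ^^ n) ` E'" for n
  have kS: "compact (S n)" for n
    unfolding S_def
    by (intro compact_continuous_image E' continuous_on_subset[OF continuous_funpow[OF Diff_continuous[OF gD]]]) auto
  have S_Suc: "S (Suc n) = g ` S n" for n by (simp add: S_def image_image)
  have fixp: "(g ^^ n) (\<psi> y) = \<psi> y" for n by (induction n) (auto simp: y)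
  \<comment> \<open>A supremum below \<delta> forces the whole image into \<open>N\<close>, so the
    volume estimate applies to the set as a whole.\<close>
  have sub: "S n \<subseteq> N" if n: "\<not> ennreal \<delta> \<le> (SUP p\<in>E. rdist A G ((g ^^ n) p) ((g ^^ n) (\<psi> y)))" for n
  proof (rule ccontr)
    assume "\<not> S n \<subseteq> N"
    then obtain p where p: "p \<in> E'" "(g ^^ n) p \<notin> N" by (auto simp: S_def)
    have "ennreal \<delta> \<le> rdist A G ((g ^^ n) p) (\<psi> y)" by (rule \<delta>N[OF p(2)])
    also have "\<dots> \<le> (SUP p\<in>E. rdist A G ((g ^^ n) p) (\<psi> y))" using p(1) E'(2) by (intro SUP_upper) auto
    finally show False using n by (simp add: fixp)
  qed
  have comp: "smoothly_compatible \<kappa> d" if "d \<in> A" for d by (rule smoothly_compatible_\<kappa>[OF that])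
  have N\<kappa>: "N \<subseteq> fst \<kappa>" using Nd by (simp add: fst_\<kappa>)
  obtain C1 where C1: "C1 \<ge> 0" "\<And>S. compact S \<Longrightarrow> \<mu> S \<le> C1 * \<mu> (g ` S)" using \<mu>_step[OF gD r] by blast
  obtain C2 where C2: "C2 \<ge> 0" "\<And>S. compact S \<Longrightarrow> S \<subseteq> N \<Longrightarrow> \<mu> S \<le> C2 * measure lebesgue (\<phi> ` S)"
    using \<mu>_le_measure[OF DIM_eq[symmetric] is_chart_\<kappa> comp kN N\<kappa>] unfolding \<phi>_def by blast
  obtain C3 where C3: "C3 \<ge> 0" "\<And>S. compact S \<Longrightarrow> S \<subseteq> N \<Longrightarrow> measure lebesgue (\<phi> ` S) \<le> C3 * \<mu> S"
    using measure_chart_le_\<mu>[OF DIM_eq is_chart_\<kappa> comp kN N\<kappa>] unfolding \<phi>_def by blast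
  \<comment> \<open>\<open>\<mu>\<close> is only defined up to a bounded density, so exact growth near the fixed point is
    measured in the chart \<open>\<kappa>\<close> instead.\<close>
  define c' where "c' X = (if X \<subseteq> N then measure lebesgue (\<phi> ` X) else \<mu> X)" for X
  have c1: "c' X \<le> (C3 + 1) * \<mu> X" and c2: "\<mu> X \<le> (C2 + 1) * c' X" if X: "compact X" for X
    unfolding c'_def using C3 C2 X \<mu>_nonneg[of X] measure_nonneg[of lebesgue "\<phi> ` X"]
    by (auto simp: distrib_right intro: add_increasing2 add_increasing)
  have c0: "c' X \<ge> 0" for X unfolding c'_def using \<mu>_nonneg by simp
  \<comment> \<open>The price of passing from \<open>c'\<close> to \<open>\<mu>\<close>, taking a
    step, and returning to \<open>c'\<close>; the final 1 makes it at least 1.\<close>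
  define C where "C = (C3 + 1) * (C1 * (C2 + 1)) + 1"
  have C: "C \<ge> 1" unfolding C_def using C1 C2 C3 by simp
  show False
  proof (rule geometric_growth_contradiction[of "\<lambda>n. c' (S n)" "(C3 + 1) * \<mu> UNIV" C "\<lambda>n. S n \<subseteq> N"])
    have "0 < (C2 + 1) * c' (S 0)" using c2[OF kS[of 0]] E'(3) by (simp add: S_def)
    then show "c' (S 0) > 0" using C2(1) by (simp add: zero_less_mult_iff)
    show "c' (S n) \<le> (C3 + 1) * \<mu> UNIV" for n
      using c1[OF kS[of n]] mult_left_mono[OF \<mu>_bounded[OF kS[of n]], of "C3 + 1"] C3(1) by linarith
    show "C \<ge> 1" by (rule C)
    show "c' (S n) \<le> C * c' (S (Suc n))" for n
    proof -
      have "c' (S n) \<le> (C3 + 1) * \<mu> (S n)" by (rule c1[OF kS])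
      also have "\<dots> \<le> (C3 + 1) * (C1 * \<mu> (S (Suc n)))"
        unfolding S_Suc using C1(2)[OF kS] C3(1) by (intro mult_left_mono) auto
      also have "\<dots> \<le> (C3 + 1) * (C1 * ((C2 + 1) * c' (S (Suc n))))"
        using c2[OF kS, of "Suc n"] C3(1) C1(1) by (intro mult_left_mono) auto
      also have "\<dots> \<le> C * c' (S (Suc n))"
        using c0[of "S (Suc n)"] unfolding C_def by (simp add: distrib_right mult.assoc)
      finally show ?thesis .
    qed
    show "2 * c' (S n) \<le> c' (S (Suc n))" if n: "S n \<subseteq> N" "S (Suc n) \<subseteq> N" for n
    proof -
      have "\<phi> ` S n \<subseteq> H.V i0" using n(1) \<phi>N y(2) by blast
      moreover have "compact (\<phi> ` S n)"
        by (intro compact_continuous_image continuous_on_subset[OF continuous_\<phi>] kS) (use n(1) Nd in blast)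
      ultimately have "2 * measure lebesgue (\<phi> ` S n) \<le> measure lebesgue ((\<phi> \<circ> g \<circ> \<psi>) ` \<phi> ` S n)"
        by (intro volume_growth g)
      moreover have "(\<phi> \<circ> g \<circ> \<psi>) ` \<phi> ` S n = \<phi> ` S (Suc n)"
        unfolding S_Suc image_image using n(1) Nd by (intro image_cong) (auto simp: \<psi>_\<phi> subset_iff)
      ultimately show ?thesis using n by (simp add: c'_def)
    qed
    show "\<forall>\<^sub>F n in sequentially. real (card {i. i < n \<and> \<not> S i \<subseteq> N}) \<le> \<gamma> * real n" if "\<gamma> > 0" for \<gamma>
      by (rule average_to_zero_sparse[OF lim \<delta>(1) _ that]) (use sub in blast)
  qed
qed

text \<open>Constant sequences are orbits of \<open>g\<close> and of \<open>f0\<close> with the same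
  constant itinerary, and a good map is \<eta>-close to \<open>f0\<close> on
  \<open>K\<close>.\<close>

lemma fixed_point_near:
  assumes g: "good g" and y: "y \<in> H.V i0" "g (\<psi> y) = \<psi> y"
  shows "norm (y - wf) \<le> 7 * \<eta>"
proof -
  have wfV: "wf \<in> H.V i0" using wf(2) H.\<eta>(1) by auto
  have "is_orbit g (\<lambda>k. i0) (\<lambda>k. y)"
    unfolding is_orbit_def using y \<phi>_\<psi>[OF subsetD[OF V_\<Omega> y(1)]] by simp
  moreover have "is_orbit f0 (\<lambda>k. i0) (\<lambda>k. wf)"
    unfolding is_orbit_def using wfV f0_eq[OF wfV] wf(1) \<phi>_\<psi>[OF subsetD[OF V_\<Omega> wfV]] by simp
  ultimately have "norm ((\<lambda>k::int. y) 0 - (\<lambda>k::int. wf) 0) \<le> 7 * \<eta>"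
  proof (rule orbit_close_all[OF g])
    show "norm (\<phi> (g p) - \<phi> (f0 p)) \<le> \<eta>" if "p \<in> K" for p
      using g that unfolding good_def by (metis norm_minus_commute)
  qed
  then show ?thesis by simp
qed

text \<open>The continuation \<open>h'\<close> in the definition is arbitrary. Its value at the
  fixed point \<open>x\<close> is fixed by \<open>g\<close> through the conjugacy and close to
  \<open>x\<close> by continuity at \<open>f\<close>; \<open>rdist_ge\<close> brings it into the
  leg, where \<open>fixed_point_near\<close> places it within \<open>7 * \<eta>\<close> of
  \<open>wf\<close>.\<close>

theorem not_strongly_pluripotent:
  assumes W: "openin (Cr_topology A r) W" "\<And>g. g \<in> W \<Longrightarrow> good g" and f: "f \<in> W"
  shows "\<not> strongly_pluripotent A G r f (h f ` \<Lambda>) (h f ` \<Lambda>)"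
proof
  assume "strongly_pluripotent A G r f (h f ` \<Lambda>) (h f ` \<Lambda>)"
  then obtain V h' where V: "hyperbolic_continuation A G r f (h f ` \<Lambda>) V h' \<and>
      (\<forall>x\<in>h f ` \<Lambda>. \<forall>W. openin (Cr_topology A r) W \<and> f \<in> W \<longrightarrow>
        (\<exists>g\<in>W \<inter> V. \<exists>D. lebesgue_positive A D \<and>
             (\<lambda>n. (\<Sum>i<n. SUP y\<in>D. rdist A G ((g ^^ i) y) ((g ^^ i) (h' g x))) / of_nat n) \<longlonglongrightarrow> 0))"
    unfolding strongly_pluripotent_def by (elim exE)
  note hc = conjunct1[OF V] and sp = conjunct2[OF V, rule_format, OF _ conjI]
  note gf = W(2)[OF f]
  have wfV: "wf \<in> H.V i0" using wf(2) H.\<eta>(1) by auto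
  define p0 where "p0 = \<psi> wf"
  have fp: "f0 p0 = p0" unfolding p0_def using f0_eq[OF wfV] wf(1) by simp
  have z: "zpow f0 k p0 = p0" for k
  proof (induction k rule: int_induct[of _ 0])
    case (step1 i)
    then show ?case using zpow_step[OF good_bij[OF good_f0]] fp by simp
  next
    case (step2 i)
    have "f0 (zpow f0 (i - 1) p0) = f0 p0"
      using zpow_step[OF good_bij[OF good_f0], of "i - 1" p0] step2 fp by simp
    then show ?case using good_bij[OF good_f0] by (metis bij_is_inj injD)
  qed simp
  have p0\<Lambda>: "p0 \<in> \<Lambda>" using V_K[OF wfV] z by (simp add: \<Lambda>_def p0_def)
  have "\<phi> p0 = wf" unfolding p0_def by (rule \<phi>_\<psi>) (use wfV V_\<Omega> in blast)
  then have "wf \<in> H.V (itinerary p0 0)" using \<Lambda>_orbit[OF p0\<Lambda>] unfolding is_orbit_def z by simp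
  then have it: "itinerary p0 0 = i0" using wfV H.V_disjoint by blast
  define x where "x = h f p0"
  have x\<Lambda>: "x \<in> h f ` \<Lambda>" using p0\<Lambda> by (simp add: x_def)
  have fx: "f x = x" unfolding x_def using h_conjugates[OF gf, of p0] fp by simp
  define yx where "yx = orb f (itinerary p0) 0"
  have yx: "x = \<psi> yx" "yx \<in> H.V i0" unfolding x_def yx_def h_def using orb_V[OF gf, of "itinerary p0" 0] it by auto
  have nx: "norm (yx - wf) \<le> 7 * \<eta>" using fixed_point_near[OF gf yx(2)] fx yx(1) by simp
  \<comment> \<open>7\<eta> + \<eta>/2 stays below 8\<eta>.\<close>
  have "cball yx (\<eta> / 2) \<subseteq> cball wf (8 * \<eta>)"
    unfolding cball_subset_cball_iff using nx H.\<eta>(1) by (simp add: dist_norm)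
  then have cb: "cball yx (\<eta> / 2) \<subseteq> H.V i0" using wf(2) by blast
  obtain \<delta> where \<delta>: "\<delta> > 0" "\<And>p. p \<notin> \<psi> ` ball yx (\<eta> / 2) \<Longrightarrow> ennreal \<delta> \<le> rdist A G p (\<psi> yx)"
    using rdist_ge[of "\<eta> / 2" yx] H.\<eta>(1) cb V_\<Omega> by (metis half_gt_zero order_trans)
  have hx: "h' f x = x" "f \<in> V" using hc x\<Lambda> by (auto simp: hyperbolic_continuation_def)
  obtain W' where W': "openin (Cr_topology A r) W'" "f \<in> W'"
    "\<And>g'. g' \<in> W' \<Longrightarrow> g' \<in> V \<Longrightarrow> rdist A G (h' g' x) (h' f x) < ennreal \<delta>"
    using hc hx(2) \<delta>(1) x\<Lambda> unfolding hyperbolic_continuation_def by (metis IntI)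
  \<comment> \<open>The neighbourhood combines goodness of \<open>g\<close> (from \<open>W\<close>)
    with closeness of the continuation at \<open>x\<close> (from \<open>W'\<close>).\<close>
  obtain g D' where g: "g \<in> W \<inter> W'" "g \<in> V" and D': "lebesgue_positive A D'"
     "(\<lambda>n. (\<Sum>i<n. SUP y\<in>D'. rdist A G ((g ^^ i) y) ((g ^^ i) (h' g x))) / of_nat n) \<longlonglongrightarrow> 0"
    using sp[OF x\<Lambda> openin_Int[OF W(1) W'(1)]] f W'(2) by blast
  have gg: "good g" using W(2) g by blast
  have "rdist A G (h' g x) (\<psi> yx) < ennreal \<delta>" using W'(3)[of g] g hx yx by simp
  then have "h' g x \<in> \<psi> ` ball yx (\<eta> / 2)" using \<delta>(2) by (meson not_le)
  then obtain y where y: "h' g x = \<psi> y" "y \<in> ball yx (\<eta> / 2)" by blast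
  have yV: "y \<in> H.V i0" using y(2) cb by auto
  have "h' g (f x) = g (h' g x)" using hc g(2) x\<Lambda> by (auto simp: hyperbolic_continuation_def)
  then have gy: "g (\<psi> y) = \<psi> y" using fx y(1) by simp
  have "norm (y - wf) \<le> 7 * \<eta>" by (rule fixed_point_near[OF gg yV gy])
  then have "cball y \<eta> \<subseteq> cball wf (8 * \<eta>)"
    unfolding cball_subset_cball_iff by (simp add: dist_norm)
  then have "cball y \<eta> \<subseteq> H.V i0" using wf(2) by blast
  from no_average_shadowing[OF gg gy this D'(1)] D'(2) y(1) show False by simp
qed

end

subsection \<open>The model horseshoe\<close>

text \<open>Throughout the model, True is the leg V1, where the base map is
  \<open>lam * (1 - x)\<close> with slope \<open>- lam\<close> and shift \<open>lam\<close>.\<close>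

definition model_slope :: "real \<Rightarrow> bool \<Rightarrow> real" where
  "model_slope lam b = (if b then - lam else lam)"

definition model_shift :: "real \<Rightarrow> bool \<Rightarrow> real" where
  "model_shift lam b = (if b then lam else 0)"

definition model_interval :: "real \<Rightarrow> bool \<Rightarrow> real set" where
  "model_interval lam b = (if b then {1 - 1 / lam - 1/100..1 + 1/100} else {- (1/100)..1 / lam + 1/100})"

text \<open>For one fibre dimension these are the prescribed maps \<open>y / 4\<close> and
  \<open>1 - y / 4\<close>. In higher dimension reversing the single coordinate \<open>i0\<close>
  separates the two images.\<close>

definition model_Y :: "'m::finite \<Rightarrow> bool \<Rightarrow> real ^ 'm \<Rightarrow> real ^ 'm" where
  "model_Y i0 b y = (\<chi> j. if b \<and> j = i0 then 1 - 1/4 * y $ j else 1/4 * y $ j)"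

definition model_Y' :: "'m::finite \<Rightarrow> bool \<Rightarrow> real ^ 'm \<Rightarrow> real ^ 'm" where
  "model_Y' i0 b y = (\<chi> j. if b \<and> j = i0 then - (1/4 * y $ j) else 1/4 * y $ j)"

definition model_fibre :: "'m::finite \<Rightarrow> bool \<Rightarrow> (real ^ 'm) \<times> real \<Rightarrow> (real ^ 'm) \<times> real" where
  "model_fibre i0 b s = (model_Y i0 b (fst s), 2/3 * snd s + (if b then 1/3 else 0))"

definition model_fibre' :: "'m::finite \<Rightarrow> bool \<Rightarrow> (real ^ 'm) \<times> real \<Rightarrow> (real ^ 'm) \<times> real" where
  "model_fibre' i0 b s = (model_Y' i0 b (fst s), 2/3 * snd s)"

definition model_Q :: "((real ^ 'm::finite) \<times> real) set" where
  "model_Q = I_eps_cube (1/100) \<times> I_eps (1/100)"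

lemma linear_model_Y': "linear (model_Y' i0 b)"
  by (auto intro!: linearI simp: model_Y'_def vec_eq_iff algebra_simps)

lemma model_Y_eq: "model_Y i0 b y = model_Y' i0 b y + (\<chi> j. if b \<and> j = i0 then 1 else 0)"
  by (auto simp: model_Y_def model_Y'_def vec_eq_iff)

lemma norm_model_Y': "norm (model_Y' i0 b y) = 1/4 * norm y"
proof -
  have "norm (model_Y' i0 b y) = norm ((1/4) *\<^sub>R y)"
    unfolding norm_vec_def by (intro L2_set_cong refl) (auto simp: model_Y'_def)
  then show ?thesis by simp
qed

lemma norm_model_fibre': "norm (model_fibre' i0 b s) \<le> 2/3 * norm s"
proof -
  have "(1/4 * p)\<^sup>2 + (2/3 * q)\<^sup>2 \<le> (2/3)\<^sup>2 * (p\<^sup>2 + q\<^sup>2)" for p q :: real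
    using zero_le_power2[of p] unfolding power_mult_distrib by (simp add: power_divide field_simps)
  from this[of "norm (fst s)" "norm (snd s)"]
  have "sqrt ((1/4 * norm (fst s))\<^sup>2 + (2/3 * norm (snd s))\<^sup>2) \<le> sqrt ((2/3)\<^sup>2 * ((norm (fst s))\<^sup>2 + (norm (snd s))\<^sup>2))"
    by (rule real_sqrt_le_mono)
  also have "\<dots> = 2/3 * norm s" by (simp add: real_sqrt_mult norm_prod_def)
  finally show ?thesis by (simp add: norm_prod_def model_fibre'_def norm_model_Y' abs_mult)
qed

lemma I_eps_cube_cbox: "I_eps_cube \<epsilon> = cbox (\<chi> i. - \<epsilon>) (\<chi> i. 1 + \<epsilon>)"
  by (auto simp: I_eps_cube_def I_eps_def cbox_def Basis_vec_def inner_axis)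

lemma model_Q: "compact (model_Q :: ((real ^ 'm::finite) \<times> real) set)" "convex (model_Q :: ((real ^ 'm) \<times> real) set)"
  "(0, 0) \<in> (model_Q :: ((real ^ 'm) \<times> real) set)"
proof -
  show "compact (model_Q :: ((real ^ 'm::finite) \<times> real) set)"
    unfolding model_Q_def I_eps_cube_cbox I_eps_def by (rule compact_Times[OF compact_cbox compact_Icc])
  show "convex (model_Q :: ((real ^ 'm) \<times> real) set)"
    unfolding model_Q_def I_eps_cube_cbox I_eps_def
    by (rule convex_Times[OF convex_box(1) convex_real_interval(5)])
  show "(0, 0) \<in> (model_Q :: ((real ^ 'm) \<times> real) set)"
    by (simp add: model_Q_def I_eps_cube_def I_eps_def)
qed

text \<open>The tightest place is the central direction, where the rate 2/3 pulls the border 1/100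
  in by 1/300; the margin 1/1000 fits into this gap.\<close>

lemma model_horseshoe:
  fixes i0 :: "'m::finite"
  assumes lam: "lam \<ge> 100"
  shows "affine_horseshoe (model_slope lam) (model_shift lam) (model_fibre i0) (model_fibre' i0)
     (model_interval lam) model_Q (1/1000)"
proof (rule affine_horseshoe.intro)
  show "100 \<le> \<bar>model_slope lam i\<bar>" for i using lam by (auto simp: model_slope_def)
  show "linear (model_fibre' i0 i)" for i
    using linear_model_Y'[of i0 i]
    by (auto intro!: linearI simp: model_fibre'_def linear_add linear_cmul algebra_simps)
  show "norm (model_fibre' i0 i s) \<le> 2/3 * norm s" for i s by (rule norm_model_fibre')
  show "model_fibre i0 i s - model_fibre i0 i t = model_fibre' i0 i (s - t)" for i s t
    by (simp add: model_fibre_def model_fibre'_def model_Y_eq linear_diff[OF linear_model_Y'])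
  have l: "1 / lam > 0" "1 / lam \<le> 1/100" using lam by (auto simp: field_simps)
  have "1 - 1 / lam - 1/100 \<le> 1 + 1/100" "- (1/100) \<le> 1 / lam + 1/100" using l by linarith+
  then have "1 + 1/100 \<in> model_interval lam True" "- (1/100) \<in> model_interval lam False"
    by (simp_all only: model_interval_def if_True if_False atLeastAtMost_iff order_refl simp_thms)
  then show "model_interval lam i \<noteq> {}" for i by (cases i) auto
  show "compact (model_interval lam i)" "convex (model_interval lam i)" for i
    by (auto simp: model_interval_def)
  have "1 / lam + 1/100 < 1 - 1 / lam - 1/100" using l by linarith
  then show "model_interval lam True \<inter> model_interval lam False = {}"
    unfolding model_interval_def if_True if_False disjoint_iff atLeastAtMost_iff by (meson not_le order_trans)
  show "compact (model_Q :: ((real ^ 'm) \<times> real) set)" "convex (model_Q :: ((real ^ 'm) \<times> real) set)"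
    "model_Q \<noteq> ({} :: ((real ^ 'm) \<times> real) set)" using model_Q by auto
  show "(u - model_shift lam i - e) / model_slope lam i \<in> model_interval lam i"
    if u: "u \<in> model_interval lam j" and e: "\<bar>e\<bar> \<le> 1/1000" for u i j e
  proof -
    have "- (1/100) \<le> u \<and> u \<le> 1 + 1/100" if "u \<in> model_interval lam True"
      using that l unfolding model_interval_def if_True atLeastAtMost_iff by linarith
    moreover have "- (1/100) \<le> u \<and> u \<le> 1 + 1/100" if "u \<in> model_interval lam False"
      using that l unfolding model_interval_def if_False atLeastAtMost_iff by linarith
    ultimately have "- (1/100) \<le> u \<and> u \<le> 1 + 1/100" using u by (cases j) auto
    \<comment> \<open>11/1000 is the border 1/100 plus the perturbation 1/1000.\<close>
    then have b: "- (11/1000) \<le> u - e" "u - e \<le> 1 + 11/1000" using e by auto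
    have lp: "lam > 0" using lam by simp
    have lo: "- (1/100) \<le> (u - e) / lam"
      using b(1) lam lp by (simp add: pos_le_divide_eq) 
    have "u - e \<le> 1 + (1/100) * lam" using b(2) lam by simp
    then have "(u - e) / lam \<le> (1 + (1/100) * lam) / lam" using lp by (intro divide_right_mono) auto
    then have hi: "(u - e) / lam \<le> 1 / lam + 1/100" using lp by (simp add: add_divide_distrib)
    have "(u - lam - e) / (- lam) = 1 - (u - e) / lam" using lp by (simp add: field_simps)
    moreover have "1 - (u - e) / lam \<in> model_interval lam True"
      unfolding model_interval_def if_True atLeastAtMost_iff using lo hi by linarith
    moreover have "(u - e) / lam \<in> model_interval lam False"
      unfolding model_interval_def if_False atLeastAtMost_iff using lo hi by linarith
    ultimately show ?thesis by (cases i) (simp_all only: model_slope_def model_shift_def if_True if_False diff_0_right)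
  qed
  show "model_fibre i0 i s + e \<in> model_Q" if s: "s \<in> model_Q" and e: "norm e \<le> 1/1000" for s e i
  proof -
    have e1: "\<bar>fst e $ j\<bar> \<le> 1/1000" for j
      using component_le_norm_cart[of "fst e" j] norm_fst_le[of "fst e" "snd e"] e by simp
    have e2: "\<bar>snd e\<bar> \<le> 1/1000" using norm_snd_le[of "snd e" "fst e"] e by simp
    have sy: "- (1/100) \<le> fst s $ j" "fst s $ j \<le> 1 + 1/100" for j
      using s by (auto simp: model_Q_def I_eps_cube_def I_eps_def)
    have sz: "- (1/100) \<le> snd s" "snd s \<le> 1 + 1/100" using s by (auto simp: model_Q_def I_eps_def)
    have "(model_Y i0 i (fst s) + fst e) $ j \<in> {- (1/100)..1 + 1/100}" for j
      using e1[of j] sy[of j] by (auto simp: model_Y_def abs_le_iff)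
    moreover have "2/3 * snd s + (if i then 1/3 else 0) + snd e \<in> {- (1/100)..1 + 1/100}"
      using e2 sz by (auto simp: abs_le_iff)
    ultimately show ?thesis
      unfolding model_Q_def I_eps_cube_def I_eps_def model_fibre_def by (auto simp: mem_Times_iff)
  qed
qed auto

lemma blender_V_model:
  "model_interval lam False \<times> model_Q = blender_V0 lam (1/100)"
  "model_interval lam True \<times> model_Q = blender_V1 lam (1/100)"
  by (auto simp: model_interval_def model_Q_def blender_V0_def blender_V1_def)

text \<open>Inverts the linear part of the model in the leg False; it becomes \<open>P\<close> in
  the locale \<open>expanding_horseshoe\<close>.\<close>

definition model_inverse :: "real \<Rightarrow> real \<times> (real ^ 'm::finite) \<times> real \<Rightarrow> real \<times> (real ^ 'm) \<times> real" where
  "model_inverse lam w = (fst w / lam, 4 *\<^sub>R fst (snd w), 3/2 * snd (snd w))"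

text \<open>7 is a round bound for 1 + 4 + 3/2.\<close>

lemma norm_model_inverse:
  assumes "lam \<ge> 1" shows "norm (model_inverse lam w) \<le> 7 * norm w"
proof -
  obtain x y z where w: "w = (x, y, z)" by (metis prod.collapse)
  have n: "\<bar>x\<bar> \<le> norm w" "norm y \<le> norm w" "\<bar>z\<bar> \<le> norm w"
    using norm_fst_le[of x "(y, z)"] norm_snd_le[of "(y, z)" x] norm_fst_le[of y z] norm_snd_le[of z y]
    unfolding w by auto
  have "norm (model_inverse lam w) \<le> \<bar>x / lam\<bar> + (norm (4 *\<^sub>R y) + \<bar>3/2 * z\<bar>)"
    unfolding model_inverse_def w fst_conv snd_conv
    using norm_Pair_le[of "x / lam" "(4 *\<^sub>R y, 3/2 * z)"] norm_Pair_le[of "4 *\<^sub>R y" "3/2 * z"] by simp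
  also have "\<bar>x / lam\<bar> \<le> \<bar>x\<bar>" using assms by (simp add: abs_divide divide_le_eq mult_le_cancel_left1)
  finally show ?thesis using n by (simp add: abs_mult)
qed

lemma prod_Basis_prod:
  fixes f :: "'a::euclidean_space \<times> 'b::euclidean_space \<Rightarrow> real"
  shows "(\<Prod>j\<in>Basis. f j) = (\<Prod>u\<in>Basis. f (u, 0)) * (\<Prod>v\<in>Basis. f (0, v))"
  unfolding Basis_prod_def
  by (subst prod.union_disjoint) (auto simp: prod.reindex inj_on_def)

text \<open>The map is diagonal in the standard basis, so its volume factor is the product of the
  diagonal entries: one \<open>1 / lam\<close>, a 4 for each fibre coordinate and one 3/2.\<close>

lemma model_inverse_measure:
  fixes X :: "(real \<times> (real ^ 'm::finite) \<times> real) set"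
  assumes lam: "lam > 0" and X: "compact X"
  shows "measure lebesgue (model_inverse lam ` X) \<le> (1 / lam * 4 ^ CARD('m) * (3/2)) * measure lebesgue X"
proof -
  \<comment> \<open>The diagonal entry of a basis vector is read off its nonzero component.\<close>
  define cf :: "real \<times> (real ^ 'm) \<times> real \<Rightarrow> real" where
    "cf j = (if fst j \<noteq> 0 then 1 / lam else if snd (snd j) \<noteq> 0 then 3/2 else 4)" for j
  let ?P = "model_inverse lam :: real \<times> (real ^ 'm) \<times> real \<Rightarrow> _"
  have lin: "linear ?P"
    by (auto intro!: linearI simp: model_inverse_def add_divide_distrib algebra_simps)
  have Pj: "?P j = cf j *\<^sub>R j" if "j \<in> Basis" for j
    using that by (auto simp: model_inverse_def cf_def Basis_prod_def zero_prod_def)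
  have P: "?P = (\<lambda>w. 0 + (\<Sum>j\<in>Basis. (cf j * (w \<bullet> j)) *\<^sub>R j))"
  proof
    fix w
    have "?P w = (\<Sum>j\<in>Basis. (w \<bullet> j) *\<^sub>R ?P j)" by (rule linear_expand_Basis[OF lin])
    also have "\<dots> = (\<Sum>j\<in>Basis. (cf j * (w \<bullet> j)) *\<^sub>R j)" by (intro sum.cong refl) (simp add: Pj mult.commute)
    finally show "?P w = 0 + (\<Sum>j\<in>Basis. (cf j * (w \<bullet> j)) *\<^sub>R j)" by simp
  qed
  have cf0: "cf j \<noteq> 0" for j using lam by (simp add: cf_def)
  define k where "k = (\<Prod>j\<in>Basis. \<bar>cf j\<bar>)"
  have k: "k = 1 / lam * 4 ^ CARD('m) * (3/2)"
  proof -
    have "(\<Prod>y\<in>(Basis :: (real ^ 'm) set). \<bar>cf (0, y, 0)\<bar>) = 4 ^ CARD('m)"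
      by (simp add: cf_def)
    then show ?thesis unfolding k_def prod_Basis_prod using lam by (simp add: cf_def zero_prod_def)
  qed
  have kp: "k \<ge> 0" unfolding k_def by (simp add: prod_nonneg)
  have cP: "continuous_on S ?P" for S
    using lin by (simp add: linear_continuous_on linear_conv_bounded_linear)
  have PX: "compact (?P ` X)" by (intro compact_continuous_image cP X)
  have inj: "inj ?P" by (rule injI) (use lam in \<open>auto simp: model_inverse_def prod_eq_iff\<close>)
  have Pm: "?P \<in> borel_measurable borel" using cP by (rule borel_measurable_continuous_onI)
  have "emeasure lborel (?P ` X) = emeasure (density (distr lborel borel ?P) (\<lambda>_. k)) (?P ` X)"
    using lborel_affine_euclidean[of cf 0] cf0 unfolding P[symmetric] k_def[symmetric] by metis
  also have "\<dots> = ennreal k * emeasure (distr lborel borel ?P) (?P ` X)"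
    using PX by (subst emeasure_density) (auto simp: nn_integral_cmult_indicator compact_imp_closed)
  also have "emeasure (distr lborel borel ?P) (?P ` X) = emeasure lborel X"
    using PX Pm inj by (subst emeasure_distr) (auto simp: compact_imp_closed inj_vimage_image_eq)
  finally have "emeasure lborel (?P ` X) = ennreal k * emeasure lborel X" .
  then have "measure lborel (?P ` X) = k * measure lborel X"
    using kp by (simp add: measure_def enn2real_mult)
  moreover have "measure lebesgue (?P ` X) = measure lborel (?P ` X)" "measure lebesgue X = measure lborel X"
    using PX X by (auto intro!: measure_completion borel_compact)
  ultimately show ?thesis unfolding k by simp
qed

text \<open>In several fibre dimensions the coordinate \<open>i0\<close> separates the images: at
  most 101/400 in one, at least 299/400 in the other.\<close>

lemma model_fibre_maps:
  fixes i0 :: "'m::finite"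
  shows "blender_fibre_maps (1/4) (1/100) (model_Y i0 False) (model_Y i0 True)"
proof (cases "CARD('m) = 1")
  case True
  then have "j = i0" for j by (metis (full_types) UNIV_I card_1_singletonE singletonD)
  then show ?thesis
    using True by (auto simp: blender_fibre_maps_def model_Y_def fun_eq_iff vec_eq_iff)
next
  case False
  have ac: "affine_contraction (1/4) (model_Y i0 b)" for b
    unfolding affine_contraction_def
  proof (intro exI conjI)
    show "linear (model_Y' i0 b)" by (rule linear_model_Y')
    \<comment> \<open>The linear part is a quarter of an involution, so 16 times itself is its
      inverse.\<close>
    have "model_Y' i0 b (4 *\<^sub>R model_Y' i0 b (4 *\<^sub>R y)) = y" "4 *\<^sub>R model_Y' i0 b (4 *\<^sub>R model_Y' i0 b y) = y" for y
      by (auto simp: model_Y'_def vec_eq_iff)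
    then show "bij (model_Y' i0 b)"
      by (intro bijI' ) (metis, metis)
    show "onorm (model_Y' i0 b) \<le> 1/4" by (rule onorm_le) (simp add: norm_model_Y')
    show "model_Y i0 b = (\<lambda>y. model_Y' i0 b y + (\<chi> j. if b \<and> j = i0 then 1 else 0))"
      by (rule ext) (rule model_Y_eq)
  qed
  have int: "model_Y i0 b ` I_eps_cube (1/100) \<subseteq> interior (I_eps_cube (1/100))" for b
  proof -
    have "model_Y i0 b ` I_eps_cube (1/100) \<subseteq> box (\<chi> i. - (1/100)) (\<chi> i. 1 + 1/100)"
    proof
      fix z assume "z \<in> model_Y i0 b ` I_eps_cube (1/100)"
      then obtain y where y: "\<And>j. - (1/100) \<le> y $ j \<and> y $ j \<le> 1 + 1/100" "z = model_Y i0 b y"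
        by (auto simp: I_eps_cube_def I_eps_def)
      have "- (1/100) < z $ j \<and> z $ j < 1 + 1/100" for j
        using y(1)[of j] unfolding y(2) model_Y_def by auto
      then show "z \<in> box (\<chi> i. - (1/100)) (\<chi> i. 1 + 1/100)" by (simp add: mem_box_cart)
    qed
    then show ?thesis unfolding I_eps_cube_cbox interior_cbox .
  qed
  have "model_Y i0 False ` I_eps_cube (1/100) \<inter> model_Y i0 True ` I_eps_cube (1/100) = {}"
  proof -
    have "False" if y: "y \<in> I_eps_cube (1/100)" "y' \<in> I_eps_cube (1/100)" "model_Y i0 False y = model_Y i0 True y'"
      for y y' :: "real ^ 'm"
    proof -
      have "model_Y i0 False y $ i0 = model_Y i0 True y' $ i0" using y(3) by simp
      then have "1/4 * y $ i0 = 1 - 1/4 * y' $ i0" by (simp add: model_Y_def)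
      moreover have "y $ i0 \<le> 1 + 1/100" "y' $ i0 \<le> 1 + 1/100" using y by (auto simp: I_eps_cube_def I_eps_def)
      ultimately show False by simp
    qed
    then show ?thesis by blast
  qed
  then show ?thesis using False ac int by (simp add: blender_fibre_maps_def)
qed

subsection \<open>The diffeomorphism with a blender-horseshoe\<close>

lemma model_horseshoe_simps:
  assumes "lam \<ge> 100"
  shows "affine_horseshoe.F (model_slope lam) (model_shift lam) (model_fibre i0) b (x, y, z)
    = (if b then lam * (1 - x) else lam * x, model_Y i0 b y, 2/3 * z + (if b then 1/3 else 0))"
    "affine_horseshoe.F' (model_slope lam) (model_fibre' i0) b (x, y, z)
    = (if b then - (lam * x) else lam * x, model_Y' i0 b y, 2/3 * z)"
    "affine_horseshoe.V (model_interval lam) (model_Q :: ((real ^ 'm::finite) \<times> real) set) b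
    = model_interval lam b \<times> model_Q"
proof -
  interpret H: affine_horseshoe "model_slope lam" "model_shift lam" "model_fibre i0" "model_fibre' i0"
    "model_interval lam" model_Q "1/1000" by (rule model_horseshoe[OF assms])
  show "H.F b (x, y, z) = (if b then lam * (1 - x) else lam * x, model_Y i0 b y, 2/3 * z + (if b then 1/3 else 0))"
    by (auto simp: H.F_def model_slope_def model_shift_def model_fibre_def algebra_simps)
  show "H.F' b (x, y, z) = (if b then - (lam * x) else lam * x, model_Y' i0 b y, 2/3 * z)"
    by (auto simp: H.F'_def model_slope_def model_fibre'_def)
  interpret H': affine_horseshoe "model_slope lam" "model_shift lam" "model_fibre (SOME i::'m. True)" "model_fibre' (SOME i::'m. True)"
    "model_interval lam" "model_Q :: ((real ^ 'm) \<times> real) set" "1/1000" by (rule model_horseshoe[OF assms])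
  show "H'.V b = model_interval lam b \<times> model_Q" by (rule H'.V_def)
qed

text \<open>Open boxes around the legs on which the diffeomorphism is still exactly affine; openness
  yields the derivative at boundary points of the legs.\<close>

definition wide_box :: "bool \<Rightarrow> (real \<times> (real ^ 'm::finite) \<times> real) set" where
  "wide_box b = (if b then {3/5<..<11/10} else {-1/10<..<2/5}) \<times>
     box (\<chi> i. -1/10) (\<chi> i. 11/10) \<times> {-1/10<..<11/10}"

lemma open_wide_box: "open (wide_box b)"
  by (auto simp: wide_box_def intro!: open_Times)

lemma V_wide_box:
  assumes "lam \<ge> 100"
  shows "model_interval lam b \<times> (model_Q :: ((real ^ 'm::finite) \<times> real) set) \<subseteq> wide_box b"
proof -
  have l: "1 / lam > 0" "1 / lam \<le> 1/100" using assms by (auto simp: field_simps)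
  have "x \<in> {3/5<..<11/10}" if "x \<in> model_interval lam True" for x
    using that l unfolding model_interval_def if_True atLeastAtMost_iff greaterThanLessThan_iff by linarith
  moreover have "x \<in> {-1/10<..<2/5}" if "x \<in> model_interval lam False" for x
    using that l unfolding model_interval_def if_False atLeastAtMost_iff greaterThanLessThan_iff by linarith
  ultimately have "model_interval lam b \<subseteq> (if b then {3/5<..<11/10} else {-1/10<..<2/5})"
    by (cases b) auto
  moreover have "y $ i > -1/10 \<and> y $ i < 11/10" if "y \<in> I_eps_cube (1/100)" for y :: "real ^ 'm" and i
  proof -
    have "- (1/100) \<le> y $ i" "y $ i \<le> 1 + 1/100" using that by (auto simp: I_eps_cube_def I_eps_def)
    then show ?thesis by simp
  qed
  ultimately show ?thesis
    unfolding wide_box_def model_Q_def by (auto simp: mem_box_cart I_eps_def)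
qed

lemma norm_triple_le:
  fixes x z :: real and y :: "real ^ 'm::finite"
  assumes "\<bar>x\<bar> \<le> a" "\<And>i. \<bar>y $ i\<bar> \<le> 2" "\<bar>z\<bar> \<le> 2"
  shows "norm (x, y, z) \<le> a + 2 * real CARD('m) + 2"
proof -
  have "norm y \<le> (\<Sum>i\<in>UNIV. \<bar>y $ i\<bar>)" by (rule norm_le_l1_cart)
  also have "\<dots> \<le> (\<Sum>i\<in>(UNIV::'m set). 2)" using assms by (intro sum_mono) auto
  finally have "norm y \<le> 2 * real CARD('m)" by simp
  moreover have "norm (x, y, z) \<le> \<bar>x\<bar> + (norm y + \<bar>z\<bar>)"
    using norm_Pair_le[of x "(y, z)"] norm_Pair_le[of y z] by simp
  ultimately show ?thesis using assms by linarith
qed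

theorem theorem1:
  fixes A :: "('a::{t2_space,second_countable_topology}, 'e::euclidean_space) chart set"
    and G :: "'a \<Rightarrow> 'e \<Rightarrow> 'e \<Rightarrow> real"
    and r :: nat
  assumes "closed_riemannian_manifold A G"
    and "DIM('e) > 2"
    and "CARD('m::finite) = DIM('e) - 2"
    and "r \<ge> 1"
  shows "\<exists>f0 \<in> Diff A r. \<exists>\<Lambda> U h.
           affine_blender_horseshoe TYPE('m) A f0 \<Lambda> \<and>
           hyperbolic_continuation A G r f0 \<Lambda> U h \<and>
           (\<forall>f\<in>U. \<not> strongly_pluripotent A G r f (h f ` \<Lambda>) (h f ` \<Lambda>))"
proof -
  note M = assms(1) and dim = assms(2,3) and r = assms(4)
  define i0 :: 'm where "i0 = (SOME i. True)"
  \<comment> \<open>The Jacobian is \<open>lam * (1/4) ^ m * (2/3)\<close>; it has to beat the factor \<open>2 ^ (m + 2)\<close> lost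
    in \<open>volume_growth\<close> to the nonlinear part.\<close>
  define lam :: real where "lam = 100 * 8 ^ CARD('m)"
  have lam: "lam \<ge> 100" by (simp add: lam_def)
  obtain k where k: "r = Suc k" using r by (cases r) auto
  obtain \<Phi> :: "real \<times> (real ^ 'm) \<times> real \<Rightarrow> real \<times> (real ^ 'm) \<times> real" where \<Phi>: "cdiff r \<Phi>"
    "\<And>x y z. x \<in> {-1/10..2/5} \<Longrightarrow> (\<forall>i. y $ i \<in> {-1/10..11/10}) \<Longrightarrow> z \<in> {-1/10..11/10} \<Longrightarrow>
       \<Phi> (x, y, z) = (lam * x, (1/4) *\<^sub>R y, 2/3 * z)"
    "\<And>x y z. x \<in> {3/5..11/10} \<Longrightarrow> (\<forall>i. y $ i \<in> {-1/10..11/10}) \<Longrightarrow> z \<in> {-1/10..11/10} \<Longrightarrow>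
       \<Phi> (x, y, z) = (lam * (1 - x), \<chi> i. if i = i0 then 1 - 1/4 * y $ i else 1/4 * y $ i, 2/3 * z + 1/3)"
    using blender_diffeo_exists[of lam k i0] lam k by auto
  interpret H: affine_horseshoe "model_slope lam" "model_shift lam" "model_fibre i0" "model_fibre' i0"
    "model_interval lam" "model_Q :: ((real ^ 'm) \<times> real) set" "1/1000" by (rule model_horseshoe[OF lam])
  note HF = model_horseshoe_simps(1)[OF lam, of i0] and HF' = model_horseshoe_simps(2)[OF lam, of i0] and HV = model_horseshoe_simps(3)[OF lam, where 'm = 'm]
  have \<Phi>F: "\<Phi> w = H.F b w" if "w \<in> wide_box b" for w b
  proof -
    obtain x y z where w: "w = (x, y, z)" by (metis prod.collapse)
    have yz: "\<forall>i. y $ i \<in> {-1/10..11/10}" "z \<in> {-1/10..11/10}"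
      using that by (auto simp: w wide_box_def mem_box_cart less_imp_le)
    show ?thesis
    proof (cases b)
      case True
      then have "x \<in> {3/5..11/10}" using that by (auto simp: w wide_box_def)
      from \<Phi>(3)[OF this yz] show ?thesis using True by (simp add: w HF model_Y_def)
    next
      case False
      then have "x \<in> {-1/10..2/5}" using that by (auto simp: w wide_box_def)
      from \<Phi>(2)[OF this yz] show ?thesis using False by (simp add: w HF model_Y_def vec_eq_iff)
    qed
  qed
  obtain R1 where R1: "\<And>w. R1 < norm w \<Longrightarrow> \<Phi> w = w" using \<Phi>(1) by (auto simp: cdiff_def)
  \<comment> \<open>A ball of this radius contains the support of \<Phi>, the wide boxes and their
    affine images, which are longest in the expanded direction.\<close>
  define R where "R = max R1 (2 * lam + 2 * real CARD('m) + 2)"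
  have R: "R > 0" "R1 \<le> R" using lam by (auto simp: R_def less_max_iff_disj)
  have wide_R: "norm w \<le> R" "norm (H.F b w) \<le> R" if "w \<in> wide_box b" for w b
  proof -
    obtain x y z where w: "w = (x, y, z)" by (metis prod.collapse)
    have x: "-1/10 < x" "x < 11/10" using that by (auto simp: w wide_box_def split: if_splits)
    have yz: "-1/10 < y $ i" "y $ i < 11/10" "-1/10 < z" "z < 11/10" for i
      using that by (auto simp: w wide_box_def mem_box_cart)
    have ya: "\<bar>y $ i\<bar> \<le> 2" for i using yz(1,2)[of i] by (simp add: abs_le_iff)
    have "norm w \<le> 2 + 2 * real CARD('m) + 2"
      unfolding w by (rule norm_triple_le[OF _ ya]) (use x yz(3,4) in \<open>auto simp: abs_le_iff\<close>)
    then show "norm w \<le> R" using lam by (simp add: R_def)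
    have x1: "\<bar>x\<bar> \<le> 2" "\<bar>1 - x\<bar> \<le> 2" using x by (auto simp: abs_le_iff)
    have xl: "\<bar>if b then lam * (1 - x) else lam * x\<bar> \<le> 2 * lam"
      using mult_left_mono[OF x1(1), of lam] mult_left_mono[OF x1(2), of lam] lam by (auto simp: abs_mult)
    have yl: "\<bar>model_Y i0 b y $ i\<bar> \<le> 2" for i
      using yz(1,2)[of i] by (auto simp: model_Y_def abs_le_iff)
    have zl: "\<bar>2/3 * z + (if b then 1/3 else 0)\<bar> \<le> 2" using yz(3,4) by (auto simp: abs_le_iff)
    have "norm (H.F b w) \<le> 2 * lam + 2 * real CARD('m) + 2"
      unfolding w HF by (rule norm_triple_le[OF xl yl zl])
    then show "norm (H.F b w) \<le> R" by (simp add: R_def)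
  qed
  obtain c :: "('a, 'e) chart" and p0 where c: "c \<in> A" "p0 \<in> fst c"
    using M unfolding closed_riemannian_manifold_def smooth_atlas_def by (metis UNIV_I UN_E)
  have ch: "is_chart c" using M c by (auto simp: closed_riemannian_manifold_def smooth_atlas_def)
  define v0 where "v0 = snd c p0"
  obtain e where e: "e > 0" "cball v0 e \<subseteq> snd c ` fst c"
    using chart_open_range[OF ch] c(2) open_contains_cball unfolding v0_def by (metis imageI)
  have "DIM('e) = DIM(real \<times> (real ^ 'm) \<times> real)" using dim by simp
  then obtain f :: "'e \<Rightarrow> real \<times> (real ^ 'm) \<times> real" and f' where f: "linear f" "linear f'"
    "\<And>x. norm (f x) = norm x" "\<And>y. norm (f' y) = norm y" "\<And>x. f' (f x) = x" "\<And>y. f (f' y) = y"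
    by (rule isomorphisms_UNIV_UNIV) (rule that)
  \<comment> \<open>The scale magnifies the coordinate ball of radius \<open>e\<close> to radius
    \<open>R\<close>, so that the model fits into one chart of any manifold.\<close>
  define s where "s = R / e"
  have s: "s > 0" using R e by (simp add: s_def)
  define Lin where "Lin v = s *\<^sub>R f v" for v
  define Lin' where "Lin' w = (1 / s) *\<^sub>R f' w" for w
  interpret L: linear_chart A G c Lin Lin' v0
  proof (rule linear_chart.intro[OF M c(1)])
    show "linear Lin" "linear Lin'" unfolding Lin_def Lin'_def using f by (auto intro: linear_compose_scale_right)
    show "Lin' (Lin v) = v" for v using s f by (simp add: Lin_def Lin'_def linear_cmul)
    show "Lin (Lin' w) = w" for w using s f by (simp add: Lin_def Lin'_def linear_cmul)
  qed
  have R\<Omega>: "cball 0 R \<subseteq> L.\<Omega>"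
  proof
    fix w :: "real \<times> (real ^ 'm) \<times> real" assume "w \<in> cball 0 R"
    then have "norm (Lin' w) \<le> R / s" using s by (simp add: Lin'_def f divide_right_mono)
    then have "Lin' w + v0 \<in> cball v0 e" using R e by (simp add: s_def dist_norm)
    then show "w \<in> L.\<Omega>" unfolding L.\<Omega>_iff using e(2) by blast
  qed
  define f0 where "f0 = chart_lift L.\<kappa> \<Phi>"
  have f0D: "f0 \<in> Diff A r"
    unfolding f0_def
    by (rule chart_lift_Diff[OF L.atlas L.is_chart_\<kappa> L.smoothly_compatible_\<kappa> \<Phi>(1), of R])
      (use R1 R R\<Omega> L.snd_\<kappa>_image in auto)
  have f0\<psi>: "f0 (L.\<psi> w) = L.\<psi> (\<Phi> w)" if "w \<in> L.\<Omega>" for w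
    using L.\<psi>_mem[OF that] L.\<phi>_\<psi>[OF that] by (simp add: f0_def chart_lift_def L.fst_\<kappa> L.\<phi>_def[symmetric] L.\<psi>_def[symmetric])
  have wide\<Omega>: "w \<in> L.\<Omega>" "H.F b w \<in> L.\<Omega>" if "w \<in> wide_box b" for w b
    using wide_R[OF that] R\<Omega> by auto
  have Vw: "H.V b \<subseteq> wide_box b" for b unfolding HV by (rule V_wide_box[OF lam])
  have f0F: "f0 (L.\<psi> w) = L.\<psi> (H.F b w)" if "w \<in> wide_box b" for w b
    using f0\<psi>[OF wide\<Omega>(1)[OF that]] \<Phi>F[OF that] by simp
  have DF: "L.D f0 (L.\<psi> w) = H.F' b" if "w \<in> H.V b" for w b
  proof -
    have w: "w \<in> wide_box b" using that Vw by blast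
    have "(L.\<phi> \<circ> f0 \<circ> L.\<psi> has_derivative H.F' b) (at w)"
      by (rule has_derivative_transform_within_open[OF H.has_derivative_F open_wide_box w])
        (simp add: f0F L.\<phi>_\<psi> wide\<Omega>)
    then show ?thesis
      unfolding L.D_def L.\<phi>_\<psi>[OF wide\<Omega>(1)[OF w]] using frechet_derivative_at by metis
  qed
  \<comment> \<open>The fixed point is the origin in the leg False. With 7 as norm bound for
    \<open>model_inverse\<close> and \<eta> = 1/1000 the product is far below 1/2.\<close>
  interpret X: expanding_horseshoe A G c Lin Lin' v0 "model_slope lam" "model_shift lam" "model_fibre i0"
    "model_fibre' i0" "model_interval lam" model_Q "1/1000" r f0 False "(0, 0, 0)" "model_inverse lam" 7
    "1 / lam * 4 ^ CARD('m) * (3/2)"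
  proof (intro expanding_horseshoe.intro manifold_horseshoe.intro manifold_horseshoe_axioms.intro
      expanding_horseshoe_axioms.intro L.linear_chart_axioms H.affine_horseshoe_axioms r f0D)
    show "H.V b \<subseteq> L.\<Omega>" for b using Vw wide\<Omega> by blast
    show "H.F b w \<in> L.\<Omega>" "f0 (L.\<psi> w) = L.\<psi> (H.F b w)" if "w \<in> H.V b" for b w
      using that Vw wide\<Omega> f0F by blast+
    show "L.D f0 (L.\<psi> w) = H.F' b" if "w \<in> H.V b" for b w by (rule DF[OF that])
    show "H.F False (0, 0, 0) = (0, 0, 0)" by (simp add: HF model_Y_def vec_eq_iff)
    show "cball (0, 0, 0) (8 * (1/1000)) \<subseteq> H.V False"
    proof
      fix w :: "real \<times> (real ^ 'm) \<times> real" assume "w \<in> cball (0, 0, 0) (8 * (1/1000))"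
      then have n: "norm w \<le> 8/1000" by (simp add: dist_norm zero_prod_def[symmetric])
      obtain x y z where w: "w = (x, y, z)" by (metis prod.collapse)
      have xyz: "\<bar>x\<bar> \<le> 8/1000" "norm y \<le> 8/1000" "\<bar>z\<bar> \<le> 8/1000"
        using norm_fst_le[of x "(y, z)"] norm_snd_le[of "(y, z)" x] norm_fst_le[of y z] norm_snd_le[of z y] n
        unfolding w by auto
      have "1 / lam > 0" using lam by simp
      then have "x \<in> {- (1/100)..1 / lam + 1/100}"
        using xyz(1) unfolding atLeastAtMost_iff by linarith
      moreover have "y $ i \<in> {- (1/100)..1 + 1/100}" for i
        using component_le_norm_cart[of y i] xyz(2) unfolding atLeastAtMost_iff by linarith
      moreover have "z \<in> {- (1/100)..1 + 1/100}"
        using xyz(3) unfolding atLeastAtMost_iff by linarith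
      ultimately have "x \<in> {- (1/100)..1 / lam + 1/100}" "\<And>i. y $ i \<in> {- (1/100)..1 + 1/100}" "z \<in> {- (1/100)..1 + 1/100}"
        by blast+
      then show "w \<in> H.V False" unfolding HV w by (simp add: model_interval_def model_Q_def I_eps_cube_def I_eps_def)
    qed
    show "linear (model_inverse lam :: real \<times> (real ^ 'm) \<times> real \<Rightarrow> _)"
      by (auto intro!: linearI simp: model_inverse_def add_divide_distrib algebra_simps)
    show "model_inverse lam (H.F' False v) = v" for v
    proof -
      obtain x y z where v: "v = (x, y, z)" by (metis prod.collapse)
      show ?thesis using lam by (simp add: v HF' model_inverse_def model_Y'_def vec_eq_iff)
    qed
    show "norm (model_inverse lam v) \<le> 7 * norm v" for v :: "real \<times> (real ^ 'm) \<times> real"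
      by (rule norm_model_inverse) (use lam in simp)
    show "measure lebesgue (model_inverse lam ` X) \<le> 1 / lam * 4 ^ CARD('m) * (3/2) * measure lebesgue X"
      if "compact X" for X :: "(real \<times> (real ^ 'm) \<times> real) set"
      by (rule model_inverse_measure[OF _ that]) (use lam in simp)
    \<comment> \<open>With \<open>lam = 100 * 8 ^ m\<close> the product of
      \<open>2 ^ (m + 2)\<close> and \<open>4 ^ m * (3/2) / lam\<close> is 6/100.\<close>
    have "(2::real) ^ CARD('m) * 4 ^ CARD('m) = 8 ^ CARD('m)" by (simp add: power_mult_distrib[symmetric])
    then show "2 ^ DIM(real \<times> (real ^ 'm) \<times> real) * (1 / lam * 4 ^ CARD('m) * (3/2)) \<le> 1/2"
      by (simp add: lam_def power_add field_simps)
  qed auto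
  obtain W where W: "openin (Cr_topology A r) W" "f0 \<in> W" "\<And>g. g \<in> W \<Longrightarrow> X.good g"
    using X.good_nbhd by blast
  have "affine_blender_horseshoe TYPE('m) A f0 X.\<Lambda>"
  proof -
    let ?F0 = "\<lambda>(x, y, z). (lam * x, model_Y i0 False y, 2/3 * z)"
    let ?F1 = "\<lambda>(x, y, z). (lam * (1 - x), model_Y i0 True y, 2/3 * z + 1 - 2/3)"
    have V: "H.V False = blender_V0 lam (1/100)" "H.V True = blender_V1 lam (1/100)"
      unfolding HV by (rule blender_V_model)+
    have F: "H.F False = ?F0" "H.F True = ?F1" by (auto simp: fun_eq_iff HF)
    have K: "X.K = chart_inv L.\<kappa> ` (blender_V0 lam (1/100) \<union> blender_V1 lam (1/100))"
      unfolding X.K_def V L.\<psi>_def by (simp add: Un_commute)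
    have \<Lambda>: "X.\<Lambda> = (\<Inter>n. (f0 ^^ n) ` X.K) \<inter> (\<Inter>n. (inv f0 ^^ n) ` X.K)"
      by (rule set_eqI) (unfold invariant_set_iff[OF L.Diff_bij[OF f0D]], simp add: X.\<Lambda>_def)
    have cube: "blender_cube (1/100) \<subseteq> L.\<Omega>"
    proof
      fix w :: "real \<times> (real ^ 'm) \<times> real" assume "w \<in> blender_cube (1/100)"
      then obtain x y z where w: "w = (x, y, z)" "x \<in> I_eps (1/100)" "y \<in> I_eps_cube (1/100)" "z \<in> I_eps (1/100)"
        by (auto simp: blender_cube_def)
      have y: "- (1/100) \<le> y $ i \<and> y $ i \<le> 1 + 1/100" for i using w(3) by (auto simp: I_eps_cube_def I_eps_def)
      have "norm w \<le> 2 + 2 * real CARD('m) + 2"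
        unfolding w(1)
      proof (rule norm_triple_le)
        show "\<bar>x\<bar> \<le> 2" "\<bar>z\<bar> \<le> 2" using w by (auto simp: I_eps_def abs_le_iff)
        show "\<bar>y $ i\<bar> \<le> 2" for i using y[of i] by (simp add: abs_le_iff)
      qed
      then show "w \<in> L.\<Omega>" using R\<Omega> lam by (auto simp: R_def)
    qed
    have img: "?F0 ` blender_V0 lam (1/100) \<subseteq> L.\<Omega>" "?F1 ` blender_V1 lam (1/100) \<subseteq> L.\<Omega>"
      unfolding V[symmetric] F[symmetric] using X.FV_\<Omega> by blast+
    have eq: "\<forall>w\<in>blender_V0 lam (1/100). f0 (chart_inv L.\<kappa> w) = chart_inv L.\<kappa> (?F0 w)"
      "\<forall>w\<in>blender_V1 lam (1/100). f0 (chart_inv L.\<kappa> w) = chart_inv L.\<kappa> (?F1 w)"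
      unfolding V[symmetric] F[symmetric] L.\<psi>_def[symmetric] using X.f0_eq by blast+
    have num: "1 / lam + 1/100 < 1/2" using lam by (simp add: field_simps)
    \<comment> \<open>The parameters: \<open>lam_ss\<close> is 1/4, both central rates are 2/3, so
      that their sum exceeds 1, and \<epsilon> is 1/100.\<close>
    show ?thesis
      unfolding affine_blender_horseshoe_def Let_def
      by (rule exI[of _ "1/4"], rule exI[of _ "2/3"], rule exI[of _ "2/3"], rule exI[of _ lam],
          rule exI[of _ "1/100"], rule exI[of _ "model_Y i0 False"], rule exI[of _ "model_Y i0 True"],
          rule exI[of _ L.\<kappa>])
        (use lam num model_fibre_maps[of i0] L.is_chart_\<kappa> L.smoothly_compatible_\<kappa> cube img eq
          \<Lambda>[unfolded K] in \<open>simp add: L.snd_\<kappa>_image\<close>)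
  qed
  moreover have "hyperbolic_continuation A G r f0 X.\<Lambda> W X.h"
    by (rule X.hyperbolic_continuation_h[OF W])
  moreover have "\<forall>f\<in>W. \<not> strongly_pluripotent A G r f (X.h f ` X.\<Lambda>) (X.h f ` X.\<Lambda>)"
    using X.not_strongly_pluripotent[OF W(1,3)] by blast
  ultimately show ?thesis using f0D by blast
qed

end
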